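(* Let $\mathcal S$ be one of the five genus-zero sets of steps $\mathcal S_1,\dots,\mathcal S_5$ (listed in the context), with step weights $d_{i,j}>0$ for $(i,j)\in\mathcal S$ and Boltzmann weights $a,b>0$, and let $Q(x,y)$ be the generating function of weighted quadrant walks with interacting boundaries. Then $Q(x,y)$ has the following nature in the variables $x$ and $y$: \begin{enumerate} \item If $\mathcal S\in\{\mathcal S_1,\mathcal S_2\}$ and $a+b=ab$, then $Q(x,y)$ is rational, and \[ Q(x,0)=\frac{1}{1-x\,\dfrac{a d_{1,0}t+ab\,d_{1,-1}d_{0,1}t^2}{1-ab\,d_{1,-1}d_{-1,1}t^2}},\qquad Q(0,y)=\frac{1}{1-y\,\dfrac{b d_{0,1}t+ab\,d_{-1,1}d_{1,0}t^2}{1-ab\,d_{1,-1}d_{-1,1}t^2}}. \] \item If $\mathcal S=\mathcal S_3$ and $a=b=2$, then $Q(x,y)$ is algebraic of degree $4$, and \[ Q(x,0)=\frac{1}{\sqrt{1-x^2\dfrac{4d_{1,1}d_{1,-1}t^2}{1-4d_{1,-1}d_{-1,1}t^2}}},\qquad Q(0,y)=\frac{1}{\sqrt{1-y^2\dfrac{4d_{1,1}d_{-1,1}t^2}{1-4d_{1,-1}d_{-1,1}t^2}}}. \] \item In all other cases, $Q(x,y)$ is neither $x$-D-algebraic nor $y$-D-algebraic. \end{enumerate}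
   Context: The five genus-zero sets of steps are $\mathcal S_1=\{(1,-1),(-1,1),(0,1)\}$, $\mathcal S_2=\{(1,-1),(-1,1),(1,0),(0,1)\}$, $\mathcal S_3=\{(1,-1),(-1,1),(1,1)\}$, $\mathcal S_4=\{(1,-1),(-1,1),(0,1),(1,1)\}$, $\mathcal S_5=\{(1,-1),(-1,1),(1,0),(0,1),(1,1)\}$. A weighting consists of real numbers $d_{i,j}>0$ for $(i,j)\in\mathcal S$ (with the convention $d_{i,j}=0$ for $(i,j)\in\{(1,0),(0,1),(1,1)\}\setminus\mathcal S$) and Boltzmann weights $a,b>0$. A quadrant walk of length $n$ is a sequence $v_1,\dots,v_n$ of steps of $\mathcal S$ such that every partial sum $v_1+\dots+v_k$ ($k\le n$) has nonnegative coordinates; $(i,j)$ denotes its endpoint, $n_v$ the number of occurrences of the step $v$, $n_x$ the number of indices $k\ge1$ such that $v_1+\dots+v_k$ lies on the $x$-axis (second coordinate $0$) and $n_y$ the number of indices $k\ge 1$ such that it lies on the $y$-axis. Its weight is $\prod_{v\in\mathcal S}d_v^{n_v}\,a^{n_x}b^{n_y}$, and $Q(x,y)=\sum_{w}\mathrm{weight}(w)x^iy^jt^n$, the sum over all quadrant walks; it is a formal power series in $t$ with polynomial coefficients in $x,y$, and $Q(x,0)$, $Q(0,y)$ are its specializations. The nature refers to $Q$ as a function of $x$ and $y$ (the variable $t$ being a fixed sufficiently small positive real number transcendental over $\mathbb Q((d_{i,j}),a,b)$). A series is $x$-D-algebraic (resp. $y$-D-algebraic) if it satisfies a nontrivial polynomial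 differential equation with respect to $x$ (resp. $y$) with coefficients in $\mathbb C(x,y,t)$; it is rational if it lies in $\mathbb C(x,y,t)$, algebraic if it is algebraic over $\mathbb C(x,y,t)$. *)

theory Defs
  imports "HOL-Analysis.Analysis" "HOL-Library.Poly_Mapping"
begin

definition S1 :: "(int \<times> int) set" where "S1 = {(1,-1),(-1,1),(0,1)}"
definition S2 :: "(int \<times> int) set" where "S2 = {(1,-1),(-1,1),(1,0),(0,1)}"
definition S3 :: "(int \<times> int) set" where "S3 = {(1,-1),(-1,1),(1,1)}"
definition S4 :: "(int \<times> int) set" where "S4 = {(1,-1),(-1,1),(0,1),(1,1)}"
definition S5 :: "(int \<times> int) set" where "S5 = {(1,-1),(-1,1),(1,0),(0,1),(1,1)}"

definition px :: "(int \<times> int) list \<Rightarrow> nat \<Rightarrow> int" where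
  "px w k = sum_list (map fst (take k w))"
definition py :: "(int \<times> int) list \<Rightarrow> nat \<Rightarrow> int" where
  "py w k = sum_list (map snd (take k w))"

definition walks :: "(int \<times> int) set \<Rightarrow> nat \<Rightarrow> (int \<times> int) list set" where
  "walks S n = {w. length w = n \<and> set w \<subseteq> S \<and>
      (\<forall>k\<in>{1..n}. 0 \<le> px w k \<and> 0 \<le> py w k)}"

definition nx :: "(int \<times> int) list \<Rightarrow> nat" where
  "nx w = card {k\<in>{1..length w}. py w k = 0}"
definition ny :: "(int \<times> int) list \<Rightarrow> nat" where
  "ny w = card {k\<in>{1..length w}. px w k = 0}"

definition weight :: "(int \<times> int) set \<Rightarrow> (int \<times> int \<Rightarrow> real) \<Rightarrow> real \<Rightarrow> real
    \<Rightarrow> (int \<times> int) list \<Rightarrow> real" where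
  "weight S d a b w = (\<Prod>v\<in>S. d v ^ count_list w v) * a ^ nx w * b ^ ny w"

definition Qgf :: "(int \<times> int) set \<Rightarrow> (int \<times> int \<Rightarrow> real) \<Rightarrow> real \<Rightarrow> real \<Rightarrow> real
    \<Rightarrow> complex \<Rightarrow> complex \<Rightarrow> complex" where
  "Qgf S d a b t x y = suminf (\<lambda>n. complex_of_real (t ^ n) *
      (\<Sum>w\<in>walks S n. complex_of_real (weight S d a b w) *
          x ^ nat (px w n) * y ^ nat (py w n)))"

definition moneval :: "(nat \<Rightarrow>\<^sub>0 nat) \<Rightarrow> (nat \<Rightarrow> 'a::comm_ring_1) \<Rightarrow> 'a" where
  "moneval m v = (\<Prod>i\<in>Poly_Mapping.keys m. v i ^ Poly_Mapping.lookup m i)"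

definition mpeval :: "((nat \<Rightarrow>\<^sub>0 nat) \<Rightarrow>\<^sub>0 'a::comm_ring_1) \<Rightarrow> (nat \<Rightarrow> 'a) \<Rightarrow> 'a" where
  "mpeval p v = (\<Sum>m\<in>Poly_Mapping.keys p. Poly_Mapping.lookup p m * moneval m v)"

definition deg_in :: "nat \<Rightarrow> ((nat \<Rightarrow>\<^sub>0 nat) \<Rightarrow>\<^sub>0 'a::zero) \<Rightarrow> nat" where
  "deg_in i p = Max (insert 0 ((\<lambda>m. Poly_Mapping.lookup m i) ` Poly_Mapping.keys p))"

definition vars_in :: "nat set \<Rightarrow> ((nat \<Rightarrow>\<^sub>0 nat) \<Rightarrow>\<^sub>0 'a::zero) \<Rightarrow> bool" where
  "vars_in V p \<longleftrightarrow> (\<forall>m\<in>Poly_Mapping.keys p. Poly_Mapping.keys m \<subseteq> V)"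

definition transcendental_over :: "real list \<Rightarrow> real \<Rightarrow> bool" where
  "transcendental_over ps t \<longleftrightarrow>
     (\<forall>P :: (nat \<Rightarrow>\<^sub>0 nat) \<Rightarrow>\<^sub>0 real. (\<forall>m. Poly_Mapping.lookup P m \<in> \<rat>) \<longrightarrow>
        mpeval P (\<lambda>i. if i < length ps then ps ! i else t) = 0 \<longrightarrow>
        (\<forall>z. mpeval P (\<lambda>i. if i < length ps then ps ! i else z) = 0))"

definition is_rational2 :: "(complex \<Rightarrow> complex \<Rightarrow> complex) \<Rightarrow> bool" where
  "is_rational2 F \<longleftrightarrow> (\<exists>P R. vars_in {0,1} P \<and> vars_in {0,1} R \<and> R \<noteq> 0 \<and>
     (\<exists>r>0. \<forall>x y. norm x < r \<and> norm y < r \<longrightarrow>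
        F x y * mpeval R (\<lambda>i. if i = 0 then x else y) = mpeval P (\<lambda>i. if i = 0 then x else y)))"

definition alg_annihilates :: "(complex \<Rightarrow> complex \<Rightarrow> complex) \<Rightarrow> ((nat \<Rightarrow>\<^sub>0 nat) \<Rightarrow>\<^sub>0 complex) \<Rightarrow> bool" where
  "alg_annihilates F P \<longleftrightarrow> P \<noteq> 0 \<and> vars_in {0,1,2} P \<and>
     (\<exists>r>0. \<forall>x y. norm x < r \<and> norm y < r \<longrightarrow>
        mpeval P (\<lambda>i. if i = 0 then x else if i = 1 then y else F x y) = 0)"

definition algebraic_deg2 :: "(complex \<Rightarrow> complex \<Rightarrow> complex) \<Rightarrow> nat \<Rightarrow> bool" where
  "algebraic_deg2 F n \<longleftrightarrow> (\<exists>P. alg_annihilates F P \<and> deg_in 2 P = n) \<and>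
     (\<forall>P. alg_annihilates F P \<longrightarrow> n \<le> deg_in 2 P)"

definition x_D_algebraic :: "(complex \<Rightarrow> complex \<Rightarrow> complex) \<Rightarrow> bool" where
  "x_D_algebraic F \<longleftrightarrow> (\<exists>P :: (nat \<Rightarrow>\<^sub>0 nat) \<Rightarrow>\<^sub>0 complex. P \<noteq> 0 \<and>
     (\<exists>r>0. \<forall>x y. norm x < r \<and> norm y < r \<longrightarrow>
        mpeval P (\<lambda>i. if i = 0 then x else if i = 1 then y
                       else (deriv ^^ (i - 2)) (\<lambda>u. F u y) x) = 0))"

definition y_D_algebraic :: "(complex \<Rightarrow> complex \<Rightarrow> complex) \<Rightarrow> bool" where
  "y_D_algebraic F \<longleftrightarrow> (\<exists>P :: (nat \<Rightarrow>\<^sub>0 nat) \<Rightarrow>\<^sub>0 complex. P \<noteq> 0 \<and>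
     (\<exists>r>0. \<forall>x y. norm x < r \<and> norm y < r \<longrightarrow>
        mpeval P (\<lambda>i. if i = 0 then x else if i = 1 then y
                       else (deriv ^^ (i - 2)) (\<lambda>u. F x u) y) = 0))"

end

theory Submission
  imports Defs "HOL-Complex_Analysis.Complex_Analysis" "HOL-Computational_Algebra.Fundamental_Theorem_Algebra"
begin

text \<open>For small \<open>t\<close> the kernel of the functional equation of \<open>Q\<close> vanishes on a rational curve
\<open>1/x = X(s)\<close>, \<open>1/y = Y(s)\<close> with \<open>X(1/s) = X(s)\<close> and \<open>Y(1/s) = Y(qs)\<close>. On this curve the functional equation
becomes a linear first-order \<open>q\<close>-difference equation with rational coefficients for the Laurent series of \<open>Q(0,y)\<close>.
If the logarithmic derivative of its coefficient does not telescope, an argument of Kolchin-Ostrowski type shows that a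
differentially algebraic solution forces a rational one; if the coefficient is essentially constant, an isolated pole
of the inhomogeneous term on its \<open>q\<close>-orbit excludes differentially algebraic solutions. For small \<open>t\<close> the sizes of the
roots of the two quadratic polynomials \<open>n\<^sub>A\<close>, \<open>n\<^sub>B\<close> in the equation separate their \<open>q\<close>-orbits and rule out
all rational solutions outside the two exceptional cases. In these cases the equation is homogeneous, its solution is
unique up to a constant, and it can be written down.\<close>

section \<open>Polynomials in countably many variables\<close>

abbreviation lookup where "lookup \<equiv> Poly_Mapping.lookup"
abbreviation keys where "keys \<equiv> Poly_Mapping.keys"
abbreviation single where "single \<equiv> Poly_Mapping.single"
abbreviation var_exp :: "nat \<Rightarrow> nat \<Rightarrow>\<^sub>0 nat" where "var_exp i \<equiv> single i 1"
abbreviation cr where "cr \<equiv> complex_of_real"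

declare One_nat_def [simp del]

type_synonym 'a mpoly = "(nat \<Rightarrow>\<^sub>0 nat) \<Rightarrow>\<^sub>0 'a"

lemma moneval_superset:
  assumes "finite A" "keys m \<subseteq> A"
  shows "moneval m v = (\<Prod>i\<in>A. v i^lookup m i)"
  unfolding moneval_def using assms
  by (intro prod.mono_neutral_left) (auto simp: in_keys_iff)

lemma mpeval_superset:
  assumes "finite A" "keys p \<subseteq> A"
  shows "mpeval p v = (\<Sum>m\<in>A. lookup p m * moneval m v)"
  unfolding mpeval_def using assms
  by (intro sum.mono_neutral_left) (auto simp: in_keys_iff)

lemma moneval_0 [simp]: "moneval 0 v = 1"
  by (simp add: moneval_def)

lemma moneval_add: "moneval (m + n) v = moneval m v * moneval n v"
proof -
  let ?A = "keys m \<union> keys n"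
  have "moneval (m + n) v = (\<Prod>i\<in>?A. v i^lookup (m + n) i)"
    using Poly_Mapping.keys_add[of m n] by (intro moneval_superset) auto
  also have "... = (\<Prod>i\<in>?A. v i^lookup m i) * (\<Prod>i\<in>?A. v i^lookup n i)"
    by (simp add: lookup_add power_add prod.distrib)
  also have "... = moneval m v * moneval n v"
    by (simp add: moneval_superset[of ?A m] moneval_superset[of ?A n])
  finally show ?thesis .
qed

lemma moneval_single [simp]: "moneval (single i k) v = v i^k"
  by (cases "k = 0") (auto simp: moneval_def)

lemma mpeval_add: "mpeval (p + r) v = mpeval p v + mpeval r v"
proof -
  let ?A = "keys p \<union> keys r"
  have "mpeval (p + r) v = (\<Sum>m\<in>?A. lookup (p + r) m * moneval m v)"
    using Poly_Mapping.keys_add[of p r] by (intro mpeval_superset) auto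
  thus ?thesis
    by (simp add: lookup_add distrib_right sum.distrib mpeval_superset[of ?A p] mpeval_superset[of ?A r])
qed

lemma mpeval_0 [simp]: "mpeval 0 v = 0"
  by (simp add: mpeval_def)

lemma mpeval_single [simp]: "mpeval (single m c) v = c * moneval m v"
  by (cases "c = 0") (auto simp: mpeval_def)

lemma mpeval_1 [simp]: "mpeval 1 v = 1"
  using mpeval_single[of 0 1 v] by (simp del: mpeval_single)

lemma mpeval_uminus [simp]: "mpeval (-p) v = - mpeval p v"
  using mpeval_add[of p "- p" v] by (simp add: eq_neg_iff_add_eq_0 add.commute)

lemma mpeval_diff: "mpeval (p - r) v = mpeval p v - mpeval r v"
  using mpeval_add[of p "- r" v] by simp

lemma mpeval_sum: "mpeval (sum f A) v = (\<Sum>x\<in>A. mpeval (f x) v)"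
  by (induction A rule: infinite_finite_induct) (auto simp: mpeval_add)

lemma sum_singles:
  fixes p :: "'b \<Rightarrow>\<^sub>0 'a :: comm_monoid_add"
  shows "p = (\<Sum>m\<in>keys p. single m (lookup p m))"
proof (rule poly_mapping_eqI)
  fix k
  show "lookup p k = lookup (\<Sum>m\<in>keys p. single m (lookup p m)) k"
    by (cases "k \<in> keys p")
        (auto simp: lookup_sum lookup_single when_def in_keys_iff sum.delta)
qed

lemma mult_sum_singles:
  fixes p r :: "'a :: comm_ring_1 mpoly"
  shows "p * r = (\<Sum>m\<in>keys p. \<Sum>n\<in>keys r. single (m + n) (lookup p m * lookup r n))"
proof -
  have "p * r = (\<Sum>m\<in>keys p. single m (lookup p m)) * (\<Sum>n\<in>keys r. single n (lookup r n))"
    by (simp flip: sum_singles)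
  thus ?thesis by (simp add: sum_product mult_single)
qed

lemma mpeval_mult: "mpeval (p * r) v = mpeval p v * mpeval r v"
proof -
  have "mpeval (p * r) v = (\<Sum>m\<in>keys p. \<Sum>n\<in>keys r.
      (lookup p m * moneval m v) * (lookup r n * moneval n v))"
    by (simp add: mult_sum_singles mpeval_sum moneval_add mult_ac)
  thus ?thesis by (simp add: mpeval_def sum_product)
qed

lemma mpeval_power: "mpeval (p^n) v = mpeval p v^n"
  by (induction n) (auto simp: mpeval_mult)

lemma mpeval_prod: "mpeval (prod f A) v = (\<Prod>x\<in>A. mpeval (f x) v)"
  by (induction A rule: infinite_finite_induct) (auto simp: mpeval_mult)

definition poly_subst :: "('a \<Rightarrow> 'a) \<Rightarrow> 'a::comm_ring_1 mpoly \<Rightarrow> (nat \<Rightarrow> 'a mpoly) \<Rightarrow> 'a mpoly" where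
  "poly_subst \<sigma> P w = (\<Sum>m\<in>keys P. single 0 (\<sigma> (lookup P m)) * moneval m w)"

lemma mpeval_moneval: "mpeval (moneval m w) v = moneval m (\<lambda>i. mpeval (w i) v)"
  by (simp add: moneval_def mpeval_prod mpeval_power)

lemma mpeval_poly_subst:
  "mpeval (poly_subst \<sigma> P w) v = (\<Sum>m\<in>keys P. \<sigma> (lookup P m) * moneval m (\<lambda>i. mpeval (w i) v))"
  by (simp add: poly_subst_def mpeval_sum mpeval_mult mpeval_moneval)

lemma poly_subst_superset:
  assumes "finite A" "keys P \<subseteq> A" "\<sigma> 0 = 0"
  shows "poly_subst \<sigma> P w = (\<Sum>m\<in>A. single 0 (\<sigma> (lookup P m)) * moneval m w)"
  unfolding poly_subst_def using assms
  by (intro sum.mono_neutral_left) (auto simp: in_keys_iff)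

lemma poly_subst_0 [simp]: "poly_subst \<sigma> 0 w = 0"
  by (simp add: poly_subst_def)

lemma poly_subst_add:
  assumes "\<And>x y. \<sigma> (x + y) = \<sigma> x + \<sigma> y" "\<sigma> 0 = 0"
  shows "poly_subst \<sigma> (P + R) w = poly_subst \<sigma> P w + poly_subst \<sigma> R w"
proof -
  let ?A = "keys P \<union> keys R"
  have "poly_subst \<sigma> S w = (\<Sum>m\<in>?A. single 0 (\<sigma> (lookup S m)) * moneval m w)" if "keys S \<subseteq> ?A" for S
    using that assms(2) by (intro poly_subst_superset) auto
  from this[of P] this[of R] this[OF Poly_Mapping.keys_add] show ?thesis
    by (simp add: lookup_add assms(1) single_add distrib_right sum.distrib)
qed

lemma poly_subst_single:
  "\<sigma> 0 = 0 \<Longrightarrow> poly_subst \<sigma> (single m c) w = single 0 (\<sigma> c) * moneval m w"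
  by (cases "c = 0") (auto simp: poly_subst_def)

lemma poly_subst_sum:
  assumes "\<And>x y. \<sigma> (x + y) = \<sigma> x + \<sigma> y" "\<sigma> 0 = 0"
  shows "poly_subst \<sigma> (sum f A) w = (\<Sum>x\<in>A. poly_subst \<sigma> (f x) w)"
  by (induction A rule: infinite_finite_induct) (auto simp: poly_subst_add assms)

lemma lookup_const_mult: "lookup (single 0 c * p) N = c * lookup p N"
  for p :: "'a :: comm_ring_1 mpoly"
proof -
  have "single 0 c * p = Poly_Mapping.map ((*) c) p"
    by (simp add: mult_map_scale_conv_mult)
  thus ?thesis by (simp add: map.rep_eq when_def)
qed

lemma monomial_split: "lookup m k > 0 \<Longrightarrow> m = (m - var_exp k) + var_exp k"
  by (rule poly_mapping_eqI) (auto simp: lookup_add lookup_minus lookup_single when_def)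

lemma lookup_var_mult:
  fixes p :: "'a :: comm_ring_1 mpoly"
  shows "lookup (single (var_exp k) c * p) N =
    (if lookup N k > 0 then c * lookup p (N - var_exp k) else 0)"
proof -
  have "single (var_exp k) c * p = (\<Sum>m\<in>keys p. single (var_exp k + m) (c * lookup p m))"
    by (subst sum_singles[of p]) (simp add: sum_distrib_left mult_single)
  hence eq: "lookup (single (var_exp k) c * p) N =
      (\<Sum>m\<in>keys p. if var_exp k + m = N then c * lookup p m else 0)"
    by (simp add: lookup_sum lookup_single when_def)
  show ?thesis
  proof (cases "lookup N k > 0")
    case True
    have "var_exp k + m = N \<longleftrightarrow> m = N - var_exp k" for m
      using monomial_split[OF True] by (metis add.commute add_diff_cancel_left')
    thus ?thesis using True eq by (auto simp: sum.delta in_keys_iff)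
  next
    case False
    hence "var_exp k + m \<noteq> N" for m by (auto simp: lookup_add)
    thus ?thesis using False eq by simp
  qed
qed

lemma keys_addE:
  assumes "k \<in> keys (p + r)"
  obtains "k \<in> keys p" | "k \<in> keys r"
  using subsetD[OF Poly_Mapping.keys_add assms] by auto

lemma keys_multE:
  assumes "k \<in> keys (p * r)"
  obtains a b where "k = a + b" "a \<in> keys p" "b \<in> keys r"
  using subsetD[OF Poly_Mapping.keys_mult assms] that by auto

lemma keys_sum_subset: "keys (sum f A) \<subseteq> (\<Union>x\<in>A. keys (f x))"
proof (induction A rule: infinite_finite_induct)
  case (insert x A)
  thus ?case using Poly_Mapping.keys_add[of "f x" "sum f A"] by auto
qed auto

subsection \<open>Coefficients in a subfield\<close>

definition coeffs_in :: "'a set \<Rightarrow> 'a::zero mpoly \<Rightarrow> bool" where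
  "coeffs_in K p \<longleftrightarrow> (\<forall>m. lookup p m \<in> K)"

locale subfield =
  fixes K :: "'a :: field set"
  assumes zero_in [simp]: "0 \<in> K" and one_in [simp]: "1 \<in> K"
    and add_in: "x \<in> K \<Longrightarrow> y \<in> K \<Longrightarrow> x + y \<in> K"
    and uminus_in: "x \<in> K \<Longrightarrow> - x \<in> K"
    and mult_in: "x \<in> K \<Longrightarrow> y \<in> K \<Longrightarrow> x * y \<in> K"
    and inverse_in: "x \<in> K \<Longrightarrow> inverse x \<in> K"
begin

lemma diff_in: "x \<in> K \<Longrightarrow> y \<in> K \<Longrightarrow> x - y \<in> K"
  using add_in[of x "- y"] uminus_in[of y] by simp

lemma divide_in: "x \<in> K \<Longrightarrow> y \<in> K \<Longrightarrow> x / y \<in> K"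
  using mult_in[of x "inverse y"] inverse_in[of y] by (simp add: divide_inverse)

lemma power_in: "x \<in> K \<Longrightarrow> x^n \<in> K"
  by (induction n) (auto intro: mult_in)

lemma sum_in: "(\<And>x. x \<in> A \<Longrightarrow> f x \<in> K) \<Longrightarrow> sum f A \<in> K"
  by (induction A rule: infinite_finite_induct) (auto intro: add_in)

lemma of_nat_in: "of_nat n \<in> K"
  by (induction n) (auto intro: add_in)

lemma coeffs_in_single: "c \<in> K \<Longrightarrow> coeffs_in K (single m c)"
  by (auto simp: coeffs_in_def lookup_single when_def)

lemma coeffs_in_0: "coeffs_in K 0"
  by (simp add: coeffs_in_def)

lemma coeffs_in_1: "coeffs_in K 1"
  using coeffs_in_single[of 1 0] by simp

lemma coeffs_in_add: "coeffs_in K p \<Longrightarrow> coeffs_in K r \<Longrightarrow> coeffs_in K (p + r)"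
  by (auto simp: coeffs_in_def lookup_add intro: add_in)

lemma coeffs_in_diff: "coeffs_in K p \<Longrightarrow> coeffs_in K r \<Longrightarrow> coeffs_in K (p - r)"
  by (auto simp: coeffs_in_def lookup_minus intro: diff_in)

lemma coeffs_in_sum: "(\<And>x. x \<in> A \<Longrightarrow> coeffs_in K (f x)) \<Longrightarrow> coeffs_in K (sum f A)"
  by (induction A rule: infinite_finite_induct) (auto intro: coeffs_in_add coeffs_in_0)

lemma coeffs_in_mult: "coeffs_in K p \<Longrightarrow> coeffs_in K r \<Longrightarrow> coeffs_in K (p * r)"
  unfolding mult_sum_singles
  by (intro coeffs_in_sum coeffs_in_single mult_in) (auto simp: coeffs_in_def)

lemma coeffs_in_power: "coeffs_in K p \<Longrightarrow> coeffs_in K (p^n)"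
  by (induction n) (auto intro: coeffs_in_mult coeffs_in_1)

lemma coeffs_in_moneval:
  assumes "\<And>i. coeffs_in K (w i)"
  shows "coeffs_in K (moneval m w)"
proof -
  have "finite A \<Longrightarrow> coeffs_in K (\<Prod>i\<in>A. w i^lookup m i)" for A
    by (induction A rule: finite_induct)
       (auto intro: coeffs_in_mult coeffs_in_1 coeffs_in_power assms)
  thus ?thesis by (simp add: moneval_def)
qed

lemma coeffs_in_poly_subst:
  assumes "coeffs_in K P" "\<And>i. coeffs_in K (w i)" "\<And>x. x \<in> K \<Longrightarrow> \<sigma> x \<in> K"
  shows "coeffs_in K (poly_subst \<sigma> P w)"
  unfolding poly_subst_def using assms
  by (intro coeffs_in_sum coeffs_in_mult coeffs_in_single coeffs_in_moneval) (auto simp: coeffs_in_def)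

definition alg_dep :: "(nat \<Rightarrow> 'a) \<Rightarrow> bool" where
  "alg_dep v \<longleftrightarrow> (\<exists>P. P \<noteq> 0 \<and> coeffs_in K P \<and> mpeval P v = 0)"

end

subsection \<open>Weighted degrees and leading forms\<close>

definition wdeg :: "(nat \<Rightarrow> nat) \<Rightarrow> (nat \<Rightarrow>\<^sub>0 nat) \<Rightarrow> nat" where
  "wdeg \<omega> m = (\<Sum>i\<in>keys m. lookup m i * \<omega> i)"

abbreviation tdeg :: "(nat \<Rightarrow>\<^sub>0 nat) \<Rightarrow> nat" where "tdeg \<equiv> wdeg (\<lambda>_. 1)"

lemma wdeg_superset:
  assumes "finite A" "keys m \<subseteq> A"
  shows "wdeg \<omega> m = (\<Sum>i\<in>A. lookup m i * \<omega> i)"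
  unfolding wdeg_def using assms
  by (intro sum.mono_neutral_left) (auto simp: in_keys_iff)

lemma wdeg_0 [simp]: "wdeg \<omega> 0 = 0"
  by (simp add: wdeg_def)

lemma wdeg_add: "wdeg \<omega> (m + n) = wdeg \<omega> m + wdeg \<omega> n"
proof -
  let ?A = "keys m \<union> keys n"
  have "wdeg \<omega> (m + n) = (\<Sum>i\<in>?A. lookup (m + n) i * \<omega> i)"
    using Poly_Mapping.keys_add[of m n] by (intro wdeg_superset) auto
  thus ?thesis
    by (simp add: lookup_add distrib_right sum.distrib wdeg_superset[of ?A m] wdeg_superset[of ?A n])
qed

lemma wdeg_single [simp]: "wdeg \<omega> (single i k) = k * \<omega> i"
  by (cases "k = 0") (auto simp: wdeg_def)

lemma wdeg_shift: "wdeg (\<lambda>i. B + i) m = B * tdeg m + wdeg (\<lambda>i. i) m"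
  by (simp add: wdeg_def sum_distrib_left algebra_simps sum.distrib)

lemma tdeg_eq_0_iff: "tdeg m = 0 \<longleftrightarrow> m = 0"
  by (auto simp: wdeg_def in_keys_iff intro!: poly_mapping_eqI)

lemma nonzero_monomialE:
  assumes "m \<noteq> 0"
  obtains i n where "m = n + var_exp i"
proof -
  obtain i where "lookup m i > 0" using assms by (metis gr0I lookup_zero poly_mapping_eqI)
  from that[OF monomial_split[OF this]] show ?thesis .
qed

lemma tdeg_eq_1E:
  assumes "tdeg m = 1"
  obtains i where "m = var_exp i"
proof -
  have "m \<noteq> 0" using assms by auto
  then obtain i n where m: "m = n + var_exp i" by (rule nonzero_monomialE)
  hence "n = 0" using assms by (simp add: wdeg_add tdeg_eq_0_iff)
  thus ?thesis using that m by simp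
qed

lemma moneval_const: "moneval m (\<lambda>_. c) = c^tdeg m"
  by (simp add: moneval_def wdeg_def power_sum)

lemma ex_max_wdeg:
  assumes "P \<noteq> 0"
  obtains N where "N \<in> keys P" "\<And>m. m \<in> keys P \<Longrightarrow> wdeg \<omega> m \<le> wdeg \<omega> N"
proof -
  have "Max (wdeg \<omega> ` keys P) \<in> wdeg \<omega> ` keys P" using assms by (intro Max_in) auto
  then obtain N where "N \<in> keys P" "wdeg \<omega> N = Max (wdeg \<omega> ` keys P)" by auto
  thus ?thesis using that[of N] by simp
qed

definition leading_form :: "(nat \<Rightarrow> nat) \<Rightarrow> nat \<Rightarrow> 'a::comm_ring_1 mpoly \<Rightarrow> 'a mpoly \<Rightarrow> bool" where
  "leading_form \<omega> n p r \<longleftrightarrow> (\<forall>k\<in>keys r. wdeg \<omega> k = n) \<and> (\<forall>k\<in>keys (p - r). wdeg \<omega> k < n)"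

lemma leading_form_mult:
  assumes "leading_form \<omega> n p r" "leading_form \<omega> n' p' r'"
  shows "leading_form \<omega> (n + n') (p * p') (r * r')"
proof -
  have deg: "\<And>k. k \<in> keys r \<Longrightarrow> wdeg \<omega> k = n" "\<And>k. k \<in> keys r' \<Longrightarrow> wdeg \<omega> k = n'"
    "\<And>k. k \<in> keys (p - r) \<Longrightarrow> wdeg \<omega> k < n" "\<And>k. k \<in> keys (p' - r') \<Longrightarrow> wdeg \<omega> k < n'"
    using assms by (auto simp: leading_form_def)
  let ?low = "(p - r) * (p' - r') + ((p - r) * r' + r * (p' - r'))"
  have "wdeg \<omega> k < n + n'" if "k \<in> keys ?low" for k
    using that by (elim keys_addE keys_multE) (auto simp: wdeg_add dest!: deg)
  moreover have "wdeg \<omega> k = n + n'" if "k \<in> keys (r * r')" for k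
    using that by (elim keys_multE) (simp add: wdeg_add deg)
  moreover have "p * p' - r * r' = ?low" by (simp add: algebra_simps)
  ultimately show ?thesis unfolding leading_form_def by auto
qed

lemma leading_form_1: "leading_form \<omega> 0 1 1"
  by (simp add: leading_form_def)

lemma leading_form_power: "leading_form \<omega> n p r \<Longrightarrow> leading_form \<omega> (k * n) (p^k) (r^k)"
  by (induction k) (auto intro: leading_form_1 leading_form_mult)

lemma leading_form_moneval:
  assumes "\<And>i. leading_form \<omega> (\<omega> i) (w i) (w' i)"
  shows "leading_form \<omega> (wdeg \<omega> m) (moneval m w) (moneval m w')"
proof -
  have "finite A \<Longrightarrow> leading_form \<omega> (\<Sum>i\<in>A. lookup m i * \<omega> i)
      (\<Prod>i\<in>A. w i^lookup m i) (\<Prod>i\<in>A. w' i^lookup m i)" for A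
    by (induction A rule: finite_induct)
       (auto intro!: leading_form_1 leading_form_mult leading_form_power assms)
  thus ?thesis by (simp add: moneval_def wdeg_def)
qed

lemma leading_form_single_add:
  "(\<And>m. m \<in> keys f \<Longrightarrow> wdeg \<omega> m < \<omega> i) \<Longrightarrow> leading_form \<omega> (\<omega> i) (single (var_exp i) c + f) (single (var_exp i) c)"
  by (auto simp: leading_form_def)

lemma moneval_single_vars:
  "moneval m (\<lambda>i. single (var_exp i) (c i)) = single m (moneval m c)" for c :: "nat \<Rightarrow> 'a::comm_ring_1"
proof -
  have power: "single (var_exp i) x^n = single (single i n) (x^n)" for i n and x :: 'a
  proof (induction n)
    case (Suc n)
    have "var_exp i + single i n = single i (Suc n)"
      unfolding single_add[symmetric] by (simp only: plus_1_eq_Suc)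
    thus ?case by (simp add: Suc mult_single)
  qed simp
  have "(\<Prod>i\<in>A. single (single i (lookup m i)) (c i^lookup m i)) =
      single (\<Sum>i\<in>A. single i (lookup m i)) (\<Prod>i\<in>A. c i^lookup m i)" for A
    by (induction A rule: infinite_finite_induct) (simp_all add: mult_single)
  thus ?thesis by (simp add: moneval_def power flip: sum_singles)
qed

definition homog_part :: "(nat \<Rightarrow> nat) \<Rightarrow> nat \<Rightarrow> 'a::comm_ring_1 mpoly \<Rightarrow> 'a mpoly" where
  "homog_part \<omega> D p = (\<Sum>m\<in>{m\<in>keys p. wdeg \<omega> m = D}. single m (lookup p m))"

lemma lookup_homog_part: "lookup (homog_part \<omega> D p) N = (if wdeg \<omega> N = D then lookup p N else 0)"
proof -
  have "lookup (homog_part \<omega> D p) N =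
      (\<Sum>m\<in>{m\<in>keys p. wdeg \<omega> m = D}. if m = N then lookup p m else 0)"
    by (simp add: homog_part_def lookup_sum lookup_single when_def)
  also have "... = (if wdeg \<omega> N = D then lookup p N else 0)"
    by (subst sum.delta) (auto simp: in_keys_iff)
  finally show ?thesis .
qed

lemma keys_homog_part: "keys (homog_part \<omega> D p) = {m\<in>keys p. wdeg \<omega> m = D}"
  by (auto simp: in_keys_iff lookup_homog_part split: if_splits)

lemma homog_part_const_mult: "homog_part \<omega> D (single 0 c * p) = single 0 c * homog_part \<omega> D p"
  by (rule poly_mapping_eqI) (simp add: lookup_homog_part lookup_const_mult)

lemma homog_part_poly_subst:
  assumes w: "\<And>i. leading_form \<omega> (\<omega> i) (w i) (w' i)" and top: "\<And>m. m \<in> keys P \<Longrightarrow> wdeg \<omega> m \<le> D"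
  shows "homog_part \<omega> D (poly_subst \<sigma> P w) = poly_subst \<sigma> (homog_part \<omega> D P) w'"
proof (rule poly_mapping_eqI)
  fix N
  have lf: "leading_form \<omega> (wdeg \<omega> m) (moneval m w) (moneval m w')" for m
    by (rule leading_form_moneval[OF w])
  have hom: "lookup (moneval m w') N = 0" if "wdeg \<omega> m \<noteq> wdeg \<omega> N" for m
  proof -
    have "N \<notin> keys (moneval m w')" using lf[of m] that by (auto simp: leading_form_def)
    thus ?thesis by (simp add: in_keys_iff)
  qed
  have low: "lookup (moneval m w) N = lookup (moneval m w') N" if "wdeg \<omega> m \<le> wdeg \<omega> N" for m
  proof -
    have "N \<notin> keys (moneval m w - moneval m w')" using lf[of m] that by (auto simp: leading_form_def)
    thus ?thesis by (simp add: in_keys_iff lookup_minus)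
  qed
  have rhs: "lookup (poly_subst \<sigma> (homog_part \<omega> D P) w') N =
      (\<Sum>m\<in>{m\<in>keys P. wdeg \<omega> m = D}. \<sigma> (lookup P m) * lookup (moneval m w') N)"
    unfolding poly_subst_def lookup_sum lookup_const_mult keys_homog_part
    by (intro sum.cong refl) (auto simp: lookup_homog_part)
  show "lookup (homog_part \<omega> D (poly_subst \<sigma> P w)) N = lookup (poly_subst \<sigma> (homog_part \<omega> D P) w') N"
  proof (cases "wdeg \<omega> N = D")
    case True
    have "lookup (poly_subst \<sigma> P w) N = (\<Sum>m\<in>keys P. \<sigma> (lookup P m) * lookup (moneval m w') N)"
      unfolding poly_subst_def lookup_sum lookup_const_mult
      using low top True by (intro sum.cong refl) auto
    also have "... = (\<Sum>m\<in>{m\<in>keys P. wdeg \<omega> m = D}. \<sigma> (lookup P m) * lookup (moneval m w') N)"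
      using True by (intro sum.mono_neutral_right) (auto simp: hom)
    finally show ?thesis using True by (simp add: lookup_homog_part rhs)
  next
    case False
    hence "lookup (poly_subst \<sigma> (homog_part \<omega> D P) w') N = 0"
      unfolding rhs by (intro sum.neutral) (auto simp: hom)
    thus ?thesis using False by (simp add: lookup_homog_part)
  qed
qed

lemma lookup_poly_subst_top:
  assumes w: "\<And>i. leading_form \<omega> (\<omega> i) (w i) (single (var_exp i) (c i))"
    and top: "\<And>m. m \<in> keys P \<Longrightarrow> wdeg \<omega> m \<le> wdeg \<omega> N" and "\<sigma> 0 = 0"
  shows "lookup (poly_subst \<sigma> P w) N = \<sigma> (lookup P N) * moneval N c"
proof -
  let ?H = "homog_part \<omega> (wdeg \<omega> N) P"
  have "lookup (poly_subst \<sigma> P w) N = lookup (poly_subst \<sigma> ?H (\<lambda>i. single (var_exp i) (c i))) N"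
    using homog_part_poly_subst[OF w top, where \<sigma> = \<sigma>] by (metis lookup_homog_part)
  also have "... = (\<Sum>m\<in>keys ?H. if m = N then \<sigma> (lookup ?H m) * moneval m c else 0)"
    unfolding poly_subst_def lookup_sum lookup_const_mult moneval_single_vars lookup_single
    by (intro sum.cong refl) (simp add: when_def)
  also have "... = \<sigma> (lookup P N) * moneval N c"
    using \<open>\<sigma> 0 = 0\<close> by (auto simp: if_distrib sum.delta in_keys_iff lookup_homog_part cong: if_cong)
  finally show ?thesis .
qed

definition drop_vars :: "nat \<Rightarrow> (nat \<Rightarrow>\<^sub>0 nat) \<Rightarrow> (nat \<Rightarrow>\<^sub>0 nat)" where
  "drop_vars k m = Poly_Mapping.map_key (\<lambda>j. j + k) m"

lemma lookup_drop_vars: "lookup (drop_vars k m) j = lookup m (j + k)"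
  unfolding drop_vars_def by (subst Poly_Mapping.map_key.rep_eq) (auto simp: inj_def)

lemma keys_subset_drop_vars: "keys m \<subseteq> {..<k} \<union> (\<lambda>j. j + k) ` keys (drop_vars k m)"
proof
  fix i assume "i \<in> keys m"
  thus "i \<in> {..<k} \<union> (\<lambda>j. j + k) ` keys (drop_vars k m)"
    by (cases "i < k") (auto simp: in_keys_iff lookup_drop_vars image_iff intro!: bexI[of _ "i - k"])
qed

lemma moneval_drop_vars:
  "moneval m v = (\<Prod>i<k. v i^lookup m i) * moneval (drop_vars k m) (\<lambda>j. v (j + k))"
proof -
  have "moneval m v = (\<Prod>i\<in>{..<k} \<union> (\<lambda>j. j + k) ` keys (drop_vars k m). v i^lookup m i)"
    using keys_subset_drop_vars by (intro moneval_superset) auto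
  also have "... = (\<Prod>i<k. v i^lookup m i) * (\<Prod>i\<in>(\<lambda>j. j + k) ` keys (drop_vars k m). v i^lookup m i)"
    by (rule prod.union_disjoint) auto
  finally show ?thesis by (simp add: prod.reindex moneval_def lookup_drop_vars)
qed

lemma tdeg_drop_vars: "tdeg m = (\<Sum>i<k. lookup m i) + tdeg (drop_vars k m)"
proof -
  have "tdeg m = (\<Sum>i\<in>{..<k} \<union> (\<lambda>j. j + k) ` keys (drop_vars k m). lookup m i * 1)"
    using keys_subset_drop_vars by (intro wdeg_superset) auto
  also have "... = (\<Sum>i<k. lookup m i * 1) + (\<Sum>i\<in>(\<lambda>j. j + k) ` keys (drop_vars k m). lookup m i * 1)"
    by (rule sum.union_disjoint) auto
  finally show ?thesis by (simp add: sum.reindex wdeg_def lookup_drop_vars)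
qed

subsection \<open>Triangular substitutions preserve algebraic dependence\<close>

fun dominating_weight :: "(nat \<Rightarrow> (nat \<Rightarrow>\<^sub>0 nat) set) \<Rightarrow> nat \<Rightarrow> nat" where
  "dominating_weight M i = Suc (\<Sum>m\<in>M i. \<Sum>j<i. lookup m j * dominating_weight M j)"

declare dominating_weight.simps [simp del]

lemma wdeg_dominating_weight:
  assumes "finite (M i)" "m \<in> M i" "keys m \<subseteq> {..<i}"
  shows "wdeg (dominating_weight M) m < dominating_weight M i"
proof -
  have "wdeg (dominating_weight M) m = (\<Sum>j<i. lookup m j * dominating_weight M j)"
    using assms(3) by (rule wdeg_superset[OF finite_lessThan])
  also have "... \<le> (\<Sum>m\<in>M i. \<Sum>j<i. lookup m j * dominating_weight M j)"
    using assms(1,2) by (intro member_le_sum) auto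
  finally show ?thesis by (simp add: dominating_weight.simps[of M i])
qed

context subfield
begin

lemma alg_dep_triangular:
  assumes dep: "alg_dep w"
    and c: "\<And>i. c i \<in> K" "\<And>i. c i \<noteq> 0"
    and f: "\<And>i. coeffs_in K (f i)" "\<And>i m. m \<in> keys (f i) \<Longrightarrow> keys m \<subseteq> {..<i}"
    and w: "\<And>i. w i = c i * v i + mpeval (f i) v"
  shows "alg_dep v"
proof -
  obtain P where P: "P \<noteq> 0" "coeffs_in K P" "mpeval P w = 0"
    using dep by (auto simp: alg_dep_def)
  define \<omega> where "\<omega> = dominating_weight (\<lambda>i. keys (f i))"
  define g where "g i = single (var_exp i) (c i) + f i" for i
  have lead: "leading_form \<omega> (\<omega> i) (g i) (single (var_exp i) (c i))" for i
    unfolding g_def \<omega>_def by (intro leading_form_single_add wdeg_dominating_weight f) auto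
  define Q where "Q = poly_subst (\<lambda>x. x) P g"
  have "coeffs_in K Q" unfolding Q_def g_def
    by (intro coeffs_in_poly_subst coeffs_in_add coeffs_in_single P c f)
  moreover have "(\<lambda>i. mpeval (g i) v) = w"
    by (auto simp: g_def mpeval_add w)
  hence "mpeval Q v = 0" using P(3) by (simp add: Q_def mpeval_poly_subst mpeval_def[of P])
  moreover have "Q \<noteq> 0"
  proof -
    obtain N where N: "N \<in> keys P" "\<And>m. m \<in> keys P \<Longrightarrow> wdeg \<omega> m \<le> wdeg \<omega> N"
      using ex_max_wdeg[OF P(1), of \<omega>] by blast
    have "lookup Q N = lookup P N * moneval N c" unfolding Q_def
      using lookup_poly_subst_top[OF lead N(2)] by simp
    also have "... \<noteq> 0" using c(2) N(1) by (simp add: moneval_def in_keys_iff)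
    finally show ?thesis by auto
  qed
  ultimately show ?thesis by (auto simp: alg_dep_def)
qed

lemma ex_minimal_relation:
  assumes "alg_dep v"
  obtains P M where "coeffs_in K P" "mpeval P v = 0" "lookup P M = 1"
    "\<And>m. m \<in> keys P \<Longrightarrow> wdeg \<omega> m \<le> wdeg \<omega> M"
    "\<And>Q. coeffs_in K Q \<Longrightarrow> mpeval Q v = 0 \<Longrightarrow> (\<And>m. m \<in> keys Q \<Longrightarrow> wdeg \<omega> m \<le> wdeg \<omega> M) \<Longrightarrow>
      {m\<in>keys Q. wdeg \<omega> m = wdeg \<omega> M} \<subset> {m\<in>keys P. wdeg \<omega> m = wdeg \<omega> M} \<Longrightarrow> Q = 0"
proof -
  define rel where "rel P \<longleftrightarrow> P \<noteq> 0 \<and> coeffs_in K P \<and> mpeval P v = 0" for P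
  define top where "top P = Max (wdeg \<omega> ` keys P)" for P :: "'a mpoly"
  define size where "size P = (top P, card {m\<in>keys P. wdeg \<omega> m = top P})" for P :: "'a mpoly"
  obtain P' where "rel P'" using assms by (auto simp: alg_dep_def rel_def)
  then obtain P where P: "rel P" and min: "\<And>Q. (size Q, size P) \<in> less_than <*lex*> less_than \<Longrightarrow> \<not> rel Q"
    using wfE_min'[of "inv_image (less_than <*lex*> less_than) size" "Collect rel"] by auto
  obtain M where M: "M \<in> keys P" "\<And>m. m \<in> keys P \<Longrightarrow> wdeg \<omega> m \<le> wdeg \<omega> M"
    using ex_max_wdeg[of P \<omega>] P unfolding rel_def by blast
  have top_P: "top P = wdeg \<omega> M" unfolding top_def using M by (intro Max_eqI) auto
  define a where "a = lookup P M"
  have a: "a \<noteq> 0" "a \<in> K" using M P by (auto simp: a_def rel_def coeffs_in_def in_keys_iff)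
  define P1 where "P1 = single 0 (inverse a) * P"
  have lookup_P1: "lookup P1 m = inverse a * lookup P m" for m
    by (simp add: P1_def lookup_const_mult)
  hence keys_P1: "keys P1 = keys P" using a by (auto simp: in_keys_iff)
  show thesis
  proof (rule that[of P1 M])
    show "coeffs_in K P1" "mpeval P1 v = 0" unfolding P1_def
      using P a by (auto simp: rel_def mpeval_mult intro: coeffs_in_mult coeffs_in_single inverse_in)
    show "lookup P1 M = 1" using a by (simp add: lookup_P1 a_def)
    show "wdeg \<omega> m \<le> wdeg \<omega> M" if "m \<in> keys P1" for m using M(2) that by (simp add: keys_P1)
    fix Q assume Q: "coeffs_in K Q" "mpeval Q v = 0" "\<And>m. m \<in> keys Q \<Longrightarrow> wdeg \<omega> m \<le> wdeg \<omega> M"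
      "{m\<in>keys Q. wdeg \<omega> m = wdeg \<omega> M} \<subset> {m\<in>keys P1. wdeg \<omega> m = wdeg \<omega> M}"
    show "Q = 0"
    proof (rule ccontr)
      assume "Q \<noteq> 0"
      hence "top Q \<le> wdeg \<omega> M" unfolding top_def using Q(3) by auto
      moreover have "card {m\<in>keys Q. wdeg \<omega> m = wdeg \<omega> M} < card {m\<in>keys P. wdeg \<omega> m = wdeg \<omega> M}"
        using Q(4) unfolding keys_P1 by (intro psubset_card_mono) auto
      ultimately have "(size Q, size P) \<in> less_than <*lex*> less_than"
        by (auto simp: size_def top_P)
      thus False using min Q(1,2) \<open>Q \<noteq> 0\<close> by (auto simp: rel_def)
    qed
  qed
qed

end

locale difference_field = subfield K for K :: "'a :: field set" +
  fixes \<sigma> :: "'a \<Rightarrow> 'a"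
  assumes \<sigma>_add: "\<sigma> (x + y) = \<sigma> x + \<sigma> y" and \<sigma>_mult: "\<sigma> (x * y) = \<sigma> x * \<sigma> y"
    and \<sigma>_1 [simp]: "\<sigma> 1 = 1" and \<sigma>_in: "x \<in> K \<Longrightarrow> \<sigma> x \<in> K"
    and char0: "of_nat (Suc n) \<noteq> (0 :: 'a)"
begin

lemma \<sigma>_0 [simp]: "\<sigma> 0 = 0"
  using \<sigma>_add[of 0 0] by (metis add_0 add_cancel_right_left)

lemma \<sigma>_uminus: "\<sigma> (-x) = - \<sigma> x"
  using \<sigma>_add[of x "- x"] by (simp add: eq_neg_iff_add_eq_0 add.commute)

lemma \<sigma>_diff: "\<sigma> (x - y) = \<sigma> x - \<sigma> y"
  using \<sigma>_add[of x "- y"] by (simp add: \<sigma>_uminus)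

lemma \<sigma>_power: "\<sigma> (x^n) = \<sigma> x^n"
  by (induction n) (auto simp: \<sigma>_mult)

lemma \<sigma>_sum: "\<sigma> (sum f A) = (\<Sum>x\<in>A. \<sigma> (f x))"
  by (induction A rule: infinite_finite_induct) (auto simp: \<sigma>_add)

lemma \<sigma>_prod: "\<sigma> (prod f A) = (\<Prod>x\<in>A. \<sigma> (f x))"
  by (induction A rule: infinite_finite_induct) (auto simp: \<sigma>_mult)

lemma \<sigma>_of_nat: "\<sigma> (of_nat n) = of_nat n"
  by (induction n) (auto simp: \<sigma>_add)

lemma \<sigma>_inverse: "\<sigma> (inverse x) = inverse (\<sigma> x)"
proof (cases "x = 0")
  case False
  hence "\<sigma> x * \<sigma> (inverse x) = 1" by (simp flip: \<sigma>_mult)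
  thus ?thesis by (metis inverse_unique)
qed simp

lemma \<sigma>_eq_0_iff [simp]: "\<sigma> x = 0 \<longleftrightarrow> x = 0"
  by (metis \<sigma>_0 \<sigma>_1 \<sigma>_inverse \<sigma>_mult inverse_zero mult_zero_left right_inverse zero_neq_one)

lemma \<sigma>_divide: "\<sigma> (x / y) = \<sigma> x / \<sigma> y"
  by (simp add: divide_inverse \<sigma>_mult \<sigma>_inverse)

lemma \<sigma>_mpeval: "\<sigma> (mpeval P v) = (\<Sum>m\<in>keys P. \<sigma> (lookup P m) * moneval m (\<lambda>i. \<sigma> (v i)))"
  by (simp add: mpeval_def \<sigma>_sum \<sigma>_mult moneval_def \<sigma>_prod \<sigma>_power)

text \<open>The shift of a minimal relation, suitably normalised, has the same leading monomial; the
  difference of the two would be a smaller relation.\<close>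

lemma ex_semi_invariant_relation:
  assumes dep: "alg_dep v" and \<gamma>: "\<gamma> \<in> K"
    and w: "\<And>i. coeffs_in K (w i)" "\<And>i. mpeval (w i) v = \<sigma> (v i)"
      "\<And>i. leading_form \<omega> (\<omega> i) (w i) (single (var_exp i) \<gamma>)"
  obtains P M where "coeffs_in K P" "mpeval P v = 0" "lookup P M = 1"
    "\<And>m. m \<in> keys P \<Longrightarrow> wdeg \<omega> m \<le> wdeg \<omega> M"
    "poly_subst \<sigma> P w = single 0 (\<gamma>^tdeg M) * P"
proof -
  obtain P M where P: "coeffs_in K P" "mpeval P v = 0" "lookup P M = 1"
      "\<And>m. m \<in> keys P \<Longrightarrow> wdeg \<omega> m \<le> wdeg \<omega> M"
    and min: "\<And>Q. coeffs_in K Q \<Longrightarrow> mpeval Q v = 0 \<Longrightarrow> (\<And>m. m \<in> keys Q \<Longrightarrow> wdeg \<omega> m \<le> wdeg \<omega> M) \<Longrightarrow>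
      {m\<in>keys Q. wdeg \<omega> m = wdeg \<omega> M} \<subset> {m\<in>keys P. wdeg \<omega> m = wdeg \<omega> M} \<Longrightarrow> Q = 0"
    by (rule ex_minimal_relation[OF dep, of \<omega>]) (rule that; blast)
  define Q where "Q = poly_subst \<sigma> P w - single 0 (\<gamma>^tdeg M) * P"
  have lookup_Q: "lookup Q N = \<sigma> (lookup P N) * \<gamma>^tdeg N - \<gamma>^tdeg M * lookup P N"
    if "wdeg \<omega> M \<le> wdeg \<omega> N" for N
    using lookup_poly_subst_top[OF w(3), of P N \<sigma>] P(4) that order_trans
    by (fastforce simp: Q_def lookup_minus lookup_const_mult moneval_const)
  have "Q = 0"
  proof (rule min)
    show "coeffs_in K Q" unfolding Q_def
      by (intro coeffs_in_diff coeffs_in_poly_subst coeffs_in_mult coeffs_in_single power_in P w \<gamma> \<sigma>_in)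
    have "mpeval Q v = \<sigma> (mpeval P v) - \<gamma>^tdeg M * mpeval P v"
      by (simp add: Q_def mpeval_diff mpeval_mult mpeval_poly_subst w \<sigma>_mpeval)
    thus "mpeval Q v = 0" using P(2) by simp
    show "wdeg \<omega> m \<le> wdeg \<omega> M" if "m \<in> keys Q" for m
      using lookup_Q[of m] P(4)[of m] that by (fastforce simp: in_keys_iff)
    have "m \<in> keys P" if "m \<in> keys Q" "wdeg \<omega> m = wdeg \<omega> M" for m
      using lookup_Q[of m] that by (auto simp: in_keys_iff)
    moreover have "M \<notin> keys Q" "M \<in> keys P" using lookup_Q[of M] P(3) by (simp_all add: in_keys_iff)
    ultimately show "{m\<in>keys Q. wdeg \<omega> m = wdeg \<omega> M} \<subset> {m\<in>keys P. wdeg \<omega> m = wdeg \<omega> M}" by blast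
  qed
  thus ?thesis using that[OF P] by (simp add: Q_def)
qed

end

subsection \<open>Partial derivatives and the Kolchin--Ostrowski theorem\<close>

definition partial_deriv :: "nat \<Rightarrow> 'a::comm_ring_1 mpoly \<Rightarrow> 'a mpoly" where
  "partial_deriv i p = (\<Sum>m\<in>keys p. single (m - var_exp i) (of_nat (lookup m i) * lookup p m))"

lemma lookup_partial_deriv:
  "lookup (partial_deriv i p) m = of_nat (Suc (lookup m i)) * lookup p (m + var_exp i)"
proof -
  have iff: "n - var_exp i = m \<and> lookup n i > 0 \<longleftrightarrow> n = m + var_exp i" for n
    using monomial_split[of n i] by (metis add_diff_cancel_right' add_gr_0 lookup_add lookup_single_eq zero_less_one)
  have "lookup (partial_deriv i p) m =
      (\<Sum>n\<in>keys p. if n - var_exp i = m \<and> lookup n i > 0 then of_nat (lookup n i) * lookup p n else 0)"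
    by (auto simp: partial_deriv_def lookup_sum lookup_single when_def intro!: sum.cong)
  also have "... = of_nat (Suc (lookup m i)) * lookup p (m + var_exp i)"
    unfolding iff by (auto simp: sum.delta in_keys_iff lookup_add add.commute)
  finally show ?thesis .
qed

lemma partial_deriv_add: "partial_deriv i (p + r) = partial_deriv i p + partial_deriv i r"
  by (rule poly_mapping_eqI) (simp add: lookup_partial_deriv lookup_add distrib_left)

lemma partial_deriv_0 [simp]: "partial_deriv i 0 = 0"
  by (simp add: partial_deriv_def)

lemma partial_deriv_sum: "partial_deriv i (sum f A) = (\<Sum>x\<in>A. partial_deriv i (f x))"
  by (induction A rule: infinite_finite_induct) (auto simp: partial_deriv_add)

lemma partial_deriv_single:
  "partial_deriv i (single m c) = single (m - var_exp i) (of_nat (lookup m i) * c)"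
  by (cases "c = 0") (auto simp: partial_deriv_def)

lemma partial_deriv_const_mult: "partial_deriv i (single 0 c * p) = single 0 c * partial_deriv i p"
  by (rule poly_mapping_eqI) (simp add: lookup_partial_deriv lookup_const_mult mult.left_commute)

lemma partial_deriv_var_mult:
  "partial_deriv i (single (var_exp j) c * p) =
    single (var_exp j) c * partial_deriv i p + (if i = j then single 0 c * p else 0)"
proof (rule poly_mapping_eqI)
  fix m
  have "m + var_exp i - var_exp j = m - var_exp j + var_exp i" if "lookup m j > 0"
    by (rule poly_mapping_eqI) (use that in \<open>auto simp: lookup_add lookup_minus lookup_single when_def\<close>)
  moreover have "m - var_exp i + var_exp i = m" if "lookup m i > 0"
    using monomial_split[OF that] by simp
  ultimately show "lookup (partial_deriv i (single (var_exp j) c * p)) m =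
      lookup (single (var_exp j) c * partial_deriv i p + (if i = j then single 0 c * p else 0)) m"
    by (auto simp: lookup_partial_deriv lookup_var_mult lookup_add lookup_const_mult lookup_minus
        lookup_single when_def) (simp_all add: algebra_simps)
qed

lemma partial_deriv_moneval_affine:
  fixes \<gamma> :: "'a::comm_ring_1" and \<delta> :: "nat \<Rightarrow> 'a"
  defines "w \<equiv> \<lambda>i. single (var_exp i) \<gamma> + single 0 (\<delta> i)"
  shows "partial_deriv i (moneval m w) = single 0 (of_nat (lookup m i) * \<gamma>) * moneval (m - var_exp i) w"
proof (induction "tdeg m" arbitrary: m rule: less_induct)
  case less
  show ?case
  proof (cases "m = 0")
    case True
    thus ?thesis by (simp add: partial_deriv_single flip: single_one)
  next
    case False
    then obtain k n where m: "m = n + var_exp k" by (rule nonzero_monomialE)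
    have IH: "partial_deriv i (moneval n w) = single 0 (of_nat (lookup n i) * \<gamma>) * moneval (n - var_exp i) w"
      by (rule less) (simp add: m wdeg_add)
    have mon: "moneval (n - var_exp i) w * w k = moneval (m - var_exp i) w" if "i \<noteq> k \<or> lookup n i > 0"
    proof -
      have "m - var_exp i = n - var_exp i + var_exp k"
        by (rule poly_mapping_eqI) (use that in \<open>auto simp: m lookup_add lookup_minus lookup_single when_def\<close>)
      thus ?thesis by (simp add: moneval_add)
    qed
    have "moneval m w = single (var_exp k) \<gamma> * moneval n w + single 0 (\<delta> k) * moneval n w"
      by (simp add: m moneval_add w_def algebra_simps)
    hence "partial_deriv i (moneval m w) = single 0 (of_nat (lookup n i) * \<gamma>) * (moneval (n - var_exp i) w * w k)
        + (if i = k then single 0 \<gamma> * moneval n w else 0)"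
      by (simp only: partial_deriv_add partial_deriv_var_mult partial_deriv_const_mult IH)
         (simp add: w_def algebra_simps)
    also have "... = single 0 (of_nat (lookup m i) * \<gamma>) * moneval (m - var_exp i) w"
    proof (cases "i = k")
      case True
      have "moneval (n - var_exp k) w * w k = moneval n w" if "lookup n k > 0"
        using mon[unfolded True] that by (simp add: m)
      thus ?thesis using True
        by (cases "lookup n k > 0") (simp_all add: m lookup_add algebra_simps single_add mult_single)
    next
      case False
      thus ?thesis using mon by (simp add: m lookup_add lookup_single when_def)
    qed
    finally show ?thesis .
  qed
qed

context difference_field
begin

lemma partial_deriv_poly_subst:
  fixes \<gamma> :: 'a and \<delta> :: "nat \<Rightarrow> 'a"
  defines "w \<equiv> \<lambda>i. single (var_exp i) \<gamma> + single 0 (\<delta> i)"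
  shows "partial_deriv i (poly_subst \<sigma> P w) = single 0 \<gamma> * poly_subst \<sigma> (partial_deriv i P) w"
proof -
  have mono: "partial_deriv i (poly_subst \<sigma> (single m c) w) =
      single 0 \<gamma> * poly_subst \<sigma> (partial_deriv i (single m c)) w" for m c
    unfolding partial_deriv_single poly_subst_single[of \<sigma>, OF \<sigma>_0] partial_deriv_const_mult w_def
      partial_deriv_moneval_affine
    by (simp add: mult_single \<sigma>_mult \<sigma>_of_nat mult_ac flip: mult.assoc)
  show ?thesis
    by (subst (1 2) sum_singles[of P])
       (simp add: poly_subst_sum[of \<sigma>, OF \<sigma>_add \<sigma>_0] partial_deriv_sum mono sum_distrib_left)
qed

text \<open>Partial derivatives preserve semi-invariance and lower the degree, hence a relation of
  degree \<open>D\<close> yields an affine one.\<close>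

lemma ex_affine_semi_invariant:
  fixes \<gamma> :: 'a and \<delta> :: "nat \<Rightarrow> 'a"
  defines "w \<equiv> \<lambda>i. single (var_exp i) \<gamma> + single 0 (\<delta> i)"
  assumes "coeffs_in K P" "M \<in> keys P" "tdeg M = Suc n" "\<And>m. m \<in> keys P \<Longrightarrow> tdeg m \<le> Suc n"
    and "poly_subst \<sigma> P w = single 0 (\<gamma>^Suc n) * P" "\<gamma> \<noteq> 0"
  shows "\<exists>R i. coeffs_in K R \<and> var_exp i \<in> keys R \<and> (\<forall>m\<in>keys R. tdeg m \<le> 1) \<and>
    poly_subst \<sigma> R w = single 0 \<gamma> * R"
  using assms(2-6)
proof (induction n arbitrary: P M)
  case 0
  have "tdeg M = 1" using 0(3) by (simp add: One_nat_def)
  then obtain i where "M = var_exp i" by (rule tdeg_eq_1E)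
  thus ?case using 0 by (intro exI[of _ P] exI[of _ i]) (auto simp: One_nat_def)
next
  case (Suc n)
  have "M \<noteq> 0" using Suc.prems(3) by auto
  then obtain i N where M: "M = N + var_exp i" by (rule nonzero_monomialE)
  show ?case
  proof (rule Suc.IH)
    show "coeffs_in K (partial_deriv i P)"
      using Suc.prems(1) unfolding coeffs_in_def lookup_partial_deriv by (blast intro: mult_in of_nat_in)
    show "N \<in> keys (partial_deriv i P)"
      using Suc.prems(2) char0[of "lookup N i"] by (simp add: M in_keys_iff lookup_partial_deriv del: of_nat_Suc)
    show "tdeg N = Suc n" using Suc.prems(3) by (simp add: M wdeg_add)
    show "tdeg m \<le> Suc n" if "m \<in> keys (partial_deriv i P)" for m
      using that Suc.prems(4)[of "m + var_exp i"] by (auto simp: in_keys_iff lookup_partial_deriv wdeg_add)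
    have "single 0 \<gamma> * poly_subst \<sigma> (partial_deriv i P) w = single 0 \<gamma> * (single 0 (\<gamma>^Suc n) * partial_deriv i P)"
      unfolding w_def partial_deriv_poly_subst[symmetric] Suc.prems(5)[unfolded w_def] partial_deriv_const_mult
      by (simp add: mult_single flip: mult.assoc)
    moreover have "lookup (single 0 \<gamma> * p) m = lookup (single 0 \<gamma> * r) m \<Longrightarrow> lookup p m = lookup r m"
      for p r :: "'a mpoly" and m
      using \<open>\<gamma> \<noteq> 0\<close> by (simp add: lookup_const_mult)
    ultimately show "poly_subst \<sigma> (partial_deriv i P) w = single 0 (\<gamma>^Suc n) * partial_deriv i P"
      by (metis poly_mapping_eqI)
  qed
qed

lemma affine_semi_invariant_coboundary:
  assumes \<gamma>: "\<gamma> \<in> K" "\<gamma> \<noteq> 0" and \<delta>: "\<And>i. \<delta> i \<in> K"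
    and R: "coeffs_in K R" "var_exp i0 \<in> keys R" "\<And>m. m \<in> keys R \<Longrightarrow> tdeg m \<le> 1"
      "poly_subst \<sigma> R (\<lambda>i. single (var_exp i) \<gamma> + single 0 (\<delta> i)) = single 0 \<gamma> * R"
  obtains I c p where "finite I" "\<forall>i. c i \<in> K \<and> \<sigma> (c i) = c i" "\<exists>i\<in>I. c i \<noteq> 0" "p \<in> K"
    "(\<Sum>i\<in>I. c i * \<delta> i) = \<gamma> * p - \<sigma> p"
proof -
  define w where "w = (\<lambda>i. single (var_exp i) \<gamma> + single 0 (\<delta> i))"
  have lead: "leading_form (\<lambda>_. 1) 1 (w i) (single (var_exp i) \<gamma>)" for i
    unfolding w_def by (rule leading_form_single_add[where \<omega> = "\<lambda>_. 1"]) (auto split: if_splits)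
  note R = R(1-3) R(4)[folded w_def]
  define c where "c i = lookup R (var_exp i)" for i
  define p where "p = lookup R 0"
  define I where "I = {i. var_exp i \<in> keys R}"
  have "inj var_exp" by (rule injI) (metis lookup_single_eq lookup_single_not_eq zero_neq_one)
  hence "finite I" unfolding I_def using finite_vimageI[of "keys R" var_exp] by (simp add: vimage_def)
  have \<sigma>_c: "\<sigma> (c i) = c i" for i
  proof -
    have "lookup (poly_subst \<sigma> R w) (var_exp i) = \<sigma> (c i) * \<gamma>"
      using lookup_poly_subst_top[OF lead, of R "var_exp i" \<sigma>] R(3) by (simp add: moneval_const c_def)
    thus ?thesis using \<gamma>(2) by (simp add: R(4) lookup_const_mult c_def)
  qed
  have "m = 0 \<or> m \<in> var_exp ` I" if m: "m \<in> keys R" for m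
  proof (cases "m = 0")
    case False
    hence "tdeg m \<noteq> 0" by (simp add: tdeg_eq_0_iff)
    hence "tdeg m = 1" using R(3)[OF m] by linarith
    then obtain i where "m = var_exp i" by (rule tdeg_eq_1E)
    thus ?thesis using m by (simp add: I_def)
  qed simp
  hence keys: "keys R \<subseteq> insert 0 (var_exp ` I)" by blast
  have "0 \<notin> var_exp ` I" by (auto dest!: arg_cong[where f = tdeg])
  hence "lookup (poly_subst \<sigma> R w) 0 = \<sigma> p + (\<Sum>i\<in>I. \<sigma> (c i) * \<delta> i)"
    using \<open>finite I\<close> \<open>inj var_exp\<close> keys
    by (subst poly_subst_superset[of "insert 0 (var_exp ` I)"])
       (auto simp: lookup_add lookup_sum lookup_const_mult sum.reindex inj_on_def c_def p_def w_def
         lookup_single when_def dest: injD intro!: sum.cong)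
  hence "(\<Sum>i\<in>I. c i * \<delta> i) = \<gamma> * p - \<sigma> p"
    by (simp add: R(4) lookup_const_mult p_def \<sigma>_c)
  moreover have "c i \<in> K" "p \<in> K" for i using R(1) by (simp_all add: c_def p_def coeffs_in_def)
  moreover have "i0 \<in> I" "c i0 \<noteq> 0" using R(2) by (simp_all add: I_def c_def in_keys_iff)
  ultimately show ?thesis using that[of I c p] \<open>finite I\<close> \<sigma>_c by blast
qed

theorem kolchin_ostrowski:
  assumes dep: "alg_dep v" and \<gamma>: "\<gamma> \<in> K" "\<gamma> \<noteq> 0" and \<delta>: "\<And>i. \<delta> i \<in> K"
    and v: "\<And>i. \<sigma> (v i) = \<gamma> * v i + \<delta> i"
  obtains I c p where "finite I" "\<forall>i. c i \<in> K \<and> \<sigma> (c i) = c i" "\<exists>i\<in>I. c i \<noteq> 0" "p \<in> K"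
    "(\<Sum>i\<in>I. c i * \<delta> i) = \<gamma> * p - \<sigma> p"
proof -
  define w where "w = (\<lambda>i. single (var_exp i) \<gamma> + single 0 (\<delta> i))"
  have w: "coeffs_in K (w i)" "mpeval (w i) v = \<sigma> (v i)" for i
    unfolding w_def using v \<gamma> \<delta> by (auto intro!: coeffs_in_add coeffs_in_single simp: mpeval_add)
  have lead: "leading_form (\<lambda>_. 1) 1 (w i) (single (var_exp i) \<gamma>)" for i
    unfolding w_def by (rule leading_form_single_add[where \<omega> = "\<lambda>_. 1"]) (auto split: if_splits)
  obtain P M where P: "coeffs_in K P" "mpeval P v = 0" "lookup P M = 1" "\<And>m. m \<in> keys P \<Longrightarrow> tdeg m \<le> tdeg M"
    "poly_subst \<sigma> P w = single 0 (\<gamma>^tdeg M) * P"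
    by (rule ex_semi_invariant_relation[OF dep \<gamma>(1) w lead]) (rule that; blast)
  have "tdeg M \<noteq> 0"
  proof
    assume "tdeg M = 0"
    moreover from this have "lookup P m = 0" if "m \<noteq> 0" for m
      using P(4)[of m] that by (auto simp: in_keys_iff tdeg_eq_0_iff)
    ultimately have "P = single 0 1"
      using P(3) by (intro poly_mapping_eqI) (auto simp: lookup_single lookup_one when_def tdeg_eq_0_iff)
    thus False using P(2) by simp
  qed
  then obtain n where n: "tdeg M = Suc n" using not0_implies_Suc by blast
  have "M \<in> keys P" using P(3) by (simp add: in_keys_iff)
  then obtain R i0 where "coeffs_in K R" "var_exp i0 \<in> keys R" "\<And>m. m \<in> keys R \<Longrightarrow> tdeg m \<le> 1"
    "poly_subst \<sigma> R w = single 0 \<gamma> * R"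
    using ex_affine_semi_invariant[of P M n \<gamma> \<delta>] P(1,4,5) n \<gamma> unfolding w_def by auto
  thus ?thesis unfolding w_def using that by (elim affine_semi_invariant_coboundary[OF \<gamma> \<delta>]) blast
qed

end

section \<open>Formal Laurent series and rational functions\<close>

definition toR :: "complex poly \<Rightarrow> complex fls" where
  "toR p = fps_to_fls (fps_of_poly p)"

lemma toR_add: "toR (p + r) = toR p + toR r"
  by (simp add: toR_def fps_of_poly_add)

lemma toR_mult: "toR (p * r) = toR p * toR r"
  by (simp add: toR_def fps_of_poly_mult fls_times_fps_to_fls)

lemma toR_0 [simp]: "toR 0 = 0" by (simp add: toR_def)
lemma toR_1 [simp]: "toR 1 = 1" by (simp add: toR_def)

lemma toR_uminus: "toR (-p) = - toR p"
  by (simp add: toR_def fps_of_poly_uminus)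

lemma toR_diff: "toR (p - r) = toR p - toR r"
  by (simp add: toR_def fps_of_poly_diff)

lemma toR_power: "toR (p^n) = toR p^n"
  by (induction n) (auto simp: toR_mult)

lemma toR_eq_iff [simp]: "toR p = toR r \<longleftrightarrow> p = r"
  by (simp add: toR_def)

lemma toR_eq_0_iff [simp]: "toR p = 0 \<longleftrightarrow> p = 0"
  using toR_eq_iff[of p 0] by (simp del: toR_eq_iff)

lemma toR_const: "toR [:c:] = fls_const c"
  by (simp add: toR_def fps_of_poly_const)

lemma toR_pCons: "toR (pCons c p) = fls_const c + fls_X * toR p"
  by (simp add: toR_def fps_of_poly_pCons fls_times_fps_to_fls mult.commute)

lemma toR_smult: "toR (smult c p) = fls_const c * toR p"
  using toR_mult[of "[:c:]" p] by (simp add: toR_const)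

definition ratfun :: "complex fls set" where
  "ratfun = {f. \<exists>N D. D \<noteq> 0 \<and> f * toR D = toR N}"

lemma ratfunI: "D \<noteq> 0 \<Longrightarrow> f * toR D = toR N \<Longrightarrow> f \<in> ratfun"
  by (auto simp: ratfun_def)

lemma ratfun_toR: "toR p \<in> ratfun"
  by (rule ratfunI[of 1 _ p]) auto

interpretation rat: subfield ratfun
proof
  show "0 \<in> ratfun" "1 \<in> ratfun" using ratfun_toR[of 0] ratfun_toR[of 1] by auto
next
  fix x y assume "x \<in> ratfun" "y \<in> ratfun"
  then obtain N D N' D' where *: "D \<noteq> 0" "x * toR D = toR N" "D' \<noteq> 0" "y * toR D' = toR N'"
    by (auto simp: ratfun_def)
  have "(x + y) * toR (D * D') = (x * toR D) * toR D' + (y * toR D') * toR D"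
    by (simp add: toR_mult algebra_simps)
  thus "x + y \<in> ratfun" using*by (intro ratfunI[of "D * D'" _ "N * D' + N' * D"]) (auto simp: toR_mult toR_add)
  have "(x * y) * toR (D * D') = (x * toR D) * (y * toR D')"
    by (simp add: toR_mult algebra_simps)
  thus "x * y \<in> ratfun" using*by (intro ratfunI[of "D * D'" _ "N * N'"]) (auto simp: toR_mult)
next
  fix x assume "x \<in> ratfun"
  then obtain N D where *: "D \<noteq> 0" "x * toR D = toR N" by (auto simp: ratfun_def)
  thus "- x \<in> ratfun" by (intro ratfunI[of D _ "- N"]) (auto simp: toR_uminus)
  show "inverse x \<in> ratfun"
  proof (cases "x = 0")
    case True
    thus ?thesis using ratfun_toR[of 0] by simp
  next
    case False
    hence "toR N \<noteq> 0" using*by (metis mult_eq_0_iff toR_eq_0_iff)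
    moreover have "inverse x * toR N = toR D" using*False by (simp add: field_simps)
    ultimately show ?thesis by (intro ratfunI[of N _ D]) auto
  qed
qed

lemma ratfun_const: "fls_const c \<in> ratfun"
  using ratfun_toR[of "[:c:]"] by (simp add: toR_const)

lemma ratfun_X: "fls_X \<in> ratfun"
  using ratfun_toR[of "[:0,1:]"] by (simp add: toR_pCons)

definition theta :: "complex fls \<Rightarrow> complex fls" where
  "theta f = fls_X * fls_deriv f"

lemma theta_nth: "fls_nth (theta f) n = of_int n * fls_nth f n"
  by (simp add: theta_def fls_X_times_conv_shift)

lemma theta_add: "theta (f + g) = theta f + theta g"
  by (simp add: theta_def algebra_simps)
lemma theta_mult: "theta (f * g) = theta f * g + f * theta g"
  by (simp add: theta_def algebra_simps)
lemma theta_0 [simp]: "theta 0 = 0" by (simp add: theta_def)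
lemma theta_1 [simp]: "theta 1 = 0" by (simp add: theta_def)
lemma theta_const [simp]: "theta (fls_const c) = 0" by (simp add: theta_def)
lemma theta_diff: "theta (f - g) = theta f - theta g" by (simp add: theta_def algebra_simps)
lemma theta_X [simp]: "theta fls_X = fls_X" by (simp add: theta_def)
lemma theta_sum: "theta (sum f A) = (\<Sum>x\<in>A. theta (f x))"
  by (induction A rule: infinite_finite_induct) (auto simp: theta_add)

lemma theta_inverse: "theta (inverse f) = - theta f * inverse f^2"
proof (cases "f = 0")
  case False
  have "theta (f * inverse f) = 0" using False by simp
  hence "f * theta (inverse f) = - (theta f * inverse f)"
    by (simp add: theta_mult eq_neg_iff_add_eq_0 add.commute)
  thus ?thesis using False by (simp add: power2_eq_square field_simps)
qed simp

lemma theta_toR: "theta (toR p) = toR ([:0,1:] * pderiv p)"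
  by (simp add: theta_def toR_def fps_of_poly_pderiv fls_deriv_fps_to_fls fps_of_poly_mult
      fls_times_fps_to_fls fps_of_poly_pCons)

lemma theta_ratfun: "f \<in> ratfun \<Longrightarrow> theta f \<in> ratfun"
proof -
  assume "f \<in> ratfun"
  then obtain N D where *: "D \<noteq> 0" "f * toR D = toR N" by (auto simp: ratfun_def)
  hence f: "f = toR N * inverse (toR D)" by (simp add: field_simps)
  show ?thesis unfolding f theta_mult theta_inverse theta_toR
    by (intro rat.add_in rat.mult_in rat.uminus_in rat.power_in rat.inverse_in ratfun_toR)
qed

lemma theta_pow_ratfun: "f \<in> ratfun \<Longrightarrow> (theta ^^ n) f \<in> ratfun"
  by (induction n) (auto intro: theta_ratfun)

lemma theta_pow_add: "(theta ^^ n) (f + g) = (theta ^^ n) f + (theta ^^ n) g"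
  by (induction n) (auto simp: theta_add)
lemma theta_pow_diff: "(theta ^^ n) (f - g) = (theta ^^ n) f - (theta ^^ n) g"
  by (induction n) (auto simp: theta_diff)

lemma theta_of_nat [simp]: "theta (of_nat m) = 0"
  by (induction m) (auto simp: theta_add)

lemma sum_choose_Suc:
  fixes F G :: "nat \<Rightarrow> 'a::comm_semiring_1"
  shows "(\<Sum>j\<le>n. of_nat (n choose j) * F (Suc j) * G (n - j)) + (\<Sum>j\<le>n. of_nat (n choose j) * F j * G (Suc (n - j)))
    = (\<Sum>j\<le>Suc n. of_nat (Suc n choose j) * F j * G (Suc n - j))"
proof -
  have "(\<Sum>j\<le>n. of_nat (n choose j) * F j * G (Suc (n - j))) =
      (\<Sum>j\<le>Suc n. of_nat (n choose j) * F j * G (Suc n - j))"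
    by (simp add: Suc_diff_le binomial_eq_0)
  also have "... = F 0 * G (Suc n) + (\<Sum>j\<le>n. of_nat (n choose Suc j) * F (Suc j) * G (n - j))"
    by (subst sum.atMost_Suc_shift) simp
  also have "(\<Sum>j\<le>n. of_nat (n choose j) * F (Suc j) * G (n - j)) + ... =
      F 0 * G (Suc n) + (\<Sum>j\<le>n. of_nat (Suc n choose Suc j) * F (Suc j) * G (n - j))"
    by (simp add: sum.distrib distrib_right add_ac)
  also have "... = (\<Sum>j\<le>Suc n. of_nat (Suc n choose j) * F j * G (Suc n - j))"
    by (subst sum.atMost_Suc_shift) simp
  finally show ?thesis .
qed

lemma theta_pow_mult:
  "(theta ^^ n) (f * g) = (\<Sum>j\<le>n. of_nat (n choose j) * (theta ^^ j) f * (theta ^^ (n - j)) g)"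
proof (induction n)
  case (Suc n)
  let ?F = "\<lambda>j. (theta ^^ j) f" and ?G = "\<lambda>j. (theta ^^ j) g"
  have "(theta ^^ Suc n) (f * g) = (\<Sum>j\<le>n. of_nat (n choose j) * ?F (Suc j) * ?G (n - j))
      + (\<Sum>j\<le>n. of_nat (n choose j) * ?F j * ?G (Suc (n - j)))"
    by (simp add: Suc theta_sum theta_mult sum.distrib)
  also have "... = (\<Sum>j\<le>Suc n. of_nat (Suc n choose j) * ?F j * ?G (Suc n - j))" by (rule sum_choose_Suc)
  finally show ?case .
qed simp

locale q_dilation =
  fixes q :: complex
  assumes q_gt1: "norm q > 1"
begin

lemma q_nz [simp]: "q \<noteq> 0" using q_gt1 by auto

lemma q_powi_eq_1_iff: "q powi n = 1 \<longleftrightarrow> n = 0"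
proof
  assume "q powi n = 1"
  hence "norm q powi n = 1" by (metis norm_one norm_power_int)
  moreover have "norm q powi n > 1" if "n > 0" using q_gt1 that by (simp add: one_less_power_int)
  moreover have "norm q powi n < 1" if "n < 0"
  proof -
    have "norm q powi (-n) > 1" using q_gt1 that by (simp add: one_less_power_int)
    thus ?thesis by (simp add: power_int_minus field_simps)
  qed
  ultimately show "n = 0" by (metis less_irrefl linorder_neqE_linordered_idom)
qed simp

definition dil :: "complex fls \<Rightarrow> complex fls" where
  "dil f = fls_compose_fps f (fps_const q * fps_X)"

lemma dil_nth: "fls_nth (dil f) n = fls_nth f n * q powi n"
  by (simp add: dil_def fls_nth_fls_compose_fps_linear)

lemma dil_add: "dil (f + g) = dil f + dil g"
  by (intro fls_eqI) (simp add: dil_nth algebra_simps)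

lemma dil_mult: "dil (f * g) = dil f * dil g"
  by (simp add: dil_def fls_compose_fps_mult)

lemma dil_1 [simp]: "dil 1 = 1" by (simp add: dil_def)
lemma dil_const [simp]: "dil (fls_const c) = fls_const c" by (simp add: dil_def)
lemma dil_X [simp]: "dil fls_X = fls_const q * fls_X"
  by (simp add: dil_def fls_times_fps_to_fls)

lemma dil_theta: "dil (theta f) = theta (dil f)"
  by (intro fls_eqI) (simp add: dil_nth theta_nth)

lemma dil_theta_pow: "dil ((theta ^^ n) f) = (theta ^^ n) (dil f)"
  by (induction n) (auto simp: dil_theta)

lemma dil_toR: "dil (toR p) = toR (pcompose p [:0,q:])"
proof (induction p)
  case 0
  show ?case by (simp add: dil_def)
next
  case (pCons c p)
  show ?case
    by (simp add: toR_pCons dil_add dil_mult pCons pcompose_pCons toR_add toR_mult toR_const toR_smult mult_ac)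
qed

lemma pcompose_lin_nz: "p \<noteq> 0 \<Longrightarrow> pcompose p [:0,q:] \<noteq> 0"
  using pcompose_eq_0[of p "[:0,q:]"] by auto

lemma dil_ratfun: "f \<in> ratfun \<Longrightarrow> dil f \<in> ratfun"
proof -
  assume "f \<in> ratfun"
  then obtain N D where *: "D \<noteq> 0" "f * toR D = toR N" by (auto simp: ratfun_def)
  have "dil f * toR (pcompose D [:0,q:]) = toR (pcompose N [:0,q:])"
    using arg_cong[OF *(2), of dil] by (simp add: dil_mult dil_toR)
  thus ?thesis using pcompose_lin_nz[OF *(1)] by (intro ratfunI)
qed

sublocale difference_field ratfun dil
proof
  fix n show "of_nat (Suc n) \<noteq> (0 :: complex fls)"
    by (metis fls_const_nonzero fls_of_nat of_nat_neq_0)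
qed (auto simp: dil_add dil_mult dil_ratfun)

lemma dil_fixed:
  assumes "dil f = f"
  shows "f = fls_const (fls_nth f 0)"
proof (rule fls_eqI)
  fix n
  have "fls_nth f n * q powi n = fls_nth f n" using arg_cong[OF assms, of "\<lambda>f. fls_nth f n"] by (simp add: dil_nth)
  thus "fls_nth f n = fls_nth (fls_const (fls_nth f 0)) n" using q_powi_eq_1_iff[of n] by (cases "n = 0") auto
qed

end

section \<open>Poles of rational functions along an orbit of the dilation\<close>

definition lin :: "complex \<Rightarrow> complex fls" where "lin z = toR [:-z, 1:]"

lemma lin_eq: "lin z = fls_X - fls_const z"
  by (simp add: lin_def toR_pCons flip: fls_const_uminus)

lemma lin_nz [simp]: "lin z \<noteq> 0" by (simp add: lin_def)
lemma lin_ratfun: "lin z \<in> ratfun" unfolding lin_def by (rule ratfun_toR)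
lemma theta_lin: "theta (lin z) = fls_X" by (simp add: lin_eq theta_diff)

definition has_value :: "complex \<Rightarrow> complex fls \<Rightarrow> complex \<Rightarrow> bool" where
  "has_value z f v \<longleftrightarrow> (\<exists>N D. poly D z \<noteq> 0 \<and> f * toR D = toR N \<and> poly N z = v * poly D z)"

lemma has_value_toR: "has_value z (toR p) (poly p z)"
  unfolding has_value_def by (rule exI[of _ p], rule exI[of _ 1]) simp

lemma has_value_const: "has_value z (fls_const c) c"
  using has_value_toR[of z "[:c:]"] by (simp add: toR_const)

lemma fls_const_minus_1: "fls_const (-1) = (-1 :: complex fls)"
  by (intro fls_eqI) simp

lemma has_value_X: "has_value z fls_X z"
  using has_value_toR[of z "[:0, 1:]"] by (simp add: toR_pCons)

lemma has_value_lin: "has_value z (lin u) (z - u)"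
  using has_value_toR[of z "[:-u, 1:]"] by (simp add: lin_def)

lemma has_value_unique:
  assumes "has_value z f v" "has_value z f w" shows "v = w"
proof -
  obtain N D N' D' where *: "poly D z \<noteq> 0" "f * toR D = toR N" "poly N z = v * poly D z"
    "poly D' z \<noteq> 0" "f * toR D' = toR N'" "poly N' z = w * poly D' z"
    using assms unfolding has_value_def by blast
  have "toR (N * D') = (f * toR D) * toR D'" by (simp add: toR_mult *)
  also have "... = toR (N' * D)" by (simp add: toR_mult flip: *(5))
  finally have "poly (N * D') z = poly (N' * D) z" by simp
  thus ?thesis using * by simp
qed

lemma has_value_add:
  assumes "has_value z f v" "has_value z g w" shows "has_value z (f + g) (v + w)"
proof -
  obtain N D N' D' where *: "poly D z \<noteq> 0" "f * toR D = toR N" "poly N z = v * poly D z"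
    "poly D' z \<noteq> 0" "g * toR D' = toR N'" "poly N' z = w * poly D' z"
    using assms unfolding has_value_def by blast
  have "(f + g) * toR (D * D') = (f * toR D) * toR D' + (g * toR D') * toR D"
    by (simp add: toR_mult algebra_simps)
  thus ?thesis unfolding has_value_def using *
    by (intro exI[of _ "N * D' + N' * D"] exI[of _ "D * D'"]) (simp add: toR_mult toR_add algebra_simps)
qed

lemma has_value_mult:
  assumes "has_value z f v" "has_value z g w" shows "has_value z (f * g) (v * w)"
proof -
  obtain N D N' D' where *: "poly D z \<noteq> 0" "f * toR D = toR N" "poly N z = v * poly D z"
    "poly D' z \<noteq> 0" "g * toR D' = toR N'" "poly N' z = w * poly D' z"
    using assms unfolding has_value_def by blast
  have "(f * g) * toR (D * D') = (f * toR D) * (g * toR D')"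
    by (simp add: toR_mult mult_ac)
  thus ?thesis unfolding has_value_def using *
    by (intro exI[of _ "N * N'"] exI[of _ "D * D'"]) (simp add: toR_mult mult_ac)
qed

lemma has_value_diff: "has_value z f v \<Longrightarrow> has_value z g w \<Longrightarrow> has_value z (f - g) (v - w)"
  using has_value_add[OF _ has_value_mult[OF has_value_const[of z "-1"]], of f v g w]
  by (simp add: fls_const_minus_1)

lemma has_value_power: "has_value z f v \<Longrightarrow> has_value z (f^n) (v^n)"
  using has_value_toR[of z 1] by (induction n) (auto intro: has_value_mult)

lemma has_value_inverse:
  assumes "has_value z f v" "v \<noteq> 0" shows "has_value z (inverse f) (inverse v)"
proof -
  obtain N D where *: "poly D z \<noteq> 0" "f * toR D = toR N" "poly N z = v * poly D z"
    using assms(1) unfolding has_value_def by blast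
  hence "poly N z \<noteq> 0" using assms(2) by simp
  hence "f \<noteq> 0" using *(2) by auto
  thus ?thesis unfolding has_value_def using * assms(2)
    by (intro exI[of _ D] exI[of _ N]) (simp add: field_simps flip: *(2))
qed

lemma has_value_theta:
  assumes "has_value z f v" shows "\<exists>w. has_value z (theta f) w"
proof -
  obtain N D where *: "poly D z \<noteq> 0" "f * toR D = toR N" using assms unfolding has_value_def by blast
  have "theta (toR N) * toR D = theta f * toR (D * D) + theta (toR D) * (f * toR D)"
    unfolding *(2)[symmetric] by (simp add: theta_mult toR_mult algebra_simps)
  hence "theta f * toR (D * D) = toR ([:0, 1:] * pderiv N * D - [:0, 1:] * pderiv D * N)"
    unfolding *(2) theta_toR toR_mult toR_diff by (simp only: algebra_simps)
  thus ?thesis unfolding has_value_def using *(1)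
    by (intro exI[of _ "_ / poly (D * D) z"] exI[of _ "D * D"] exI conjI) auto
qed

lemma has_value_cancel_lin:
  assumes "has_value z (f * lin z) 0" shows "\<exists>v. has_value z f v"
proof -
  obtain N D where *: "poly D z \<noteq> 0" "f * lin z * toR D = toR N" "poly N z = 0"
    using assms unfolding has_value_def by auto
  then obtain N' where N': "N = [:-z, 1:] * N'" by (metis poly_eq_0_iff_dvd dvdE)
  have "lin z * (f * toR D) = lin z * toR N'" using *(2) by (simp only: N' toR_mult lin_def mult_ac)
  hence "f * toR D = toR N'" by (simp only: mult_cancel_left lin_nz simp_thms)
  thus ?thesis unfolding has_value_def using *(1)
    by (intro exI[of _ "poly N' z / poly D z"] exI[of _ N'] exI[of _ D]) simp
qed

definition pole_le :: "complex \<Rightarrow> nat \<Rightarrow> complex fls \<Rightarrow> bool" where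
  "pole_le z k f \<longleftrightarrow> (\<exists>v. has_value z (f * lin z^k) v)"

definition pole_eq :: "complex \<Rightarrow> nat \<Rightarrow> complex fls \<Rightarrow> bool" where
  "pole_eq z k f \<longleftrightarrow> (\<exists>v. v \<noteq> 0 \<and> has_value z (f * lin z^k) v)"

lemma pole_le_0_iff: "pole_le z 0 f \<longleftrightarrow> (\<exists>v. has_value z f v)"
  by (simp add: pole_le_def)

lemma pole_eq_imp_le: "pole_eq z k f \<Longrightarrow> pole_le z k f"
  unfolding pole_eq_def pole_le_def by blast

lemma has_value_lin_power: "has_value z (lin z^n) (0^n)"
  using has_value_power[OF has_value_lin[of z z]] by simp

lemma has_value_raise:
  assumes "has_value z (f * lin z^j) v" "j \<le> k"
  shows "has_value z (f * lin z^k) (v * 0^(k - j))"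
proof -
  have "f * lin z^k = f * lin z^j * lin z^(k - j)" using assms(2) by (simp add: mult.assoc flip: power_add)
  thus ?thesis using has_value_mult[OF assms(1) has_value_lin_power] by (simp only:)
qed

lemma pole_le_mono: "pole_le z j f \<Longrightarrow> j \<le> k \<Longrightarrow> pole_le z k f"
  unfolding pole_le_def using has_value_raise by blast

lemma pole_eq_not_le:
  assumes "pole_eq z k f" "pole_le z j f" "j < k" shows False
proof -
  obtain v w where v: "v \<noteq> 0" "has_value z (f * lin z^k) v" and w: "has_value z (f * lin z^j) w"
    using assms(1,2) unfolding pole_eq_def pole_le_def by blast
  from has_value_raise[OF w, of k] assms(3) have "has_value z (f * lin z^k) 0"
    by (simp add: power_0_left)
  thus False using has_value_unique[OF v(2)] v(1) by blast
qed

lemma pole_le_add: "pole_le z k f \<Longrightarrow> pole_le z k g \<Longrightarrow> pole_le z k (f + g)"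
  unfolding pole_le_def distrib_right using has_value_add by blast

lemma pole_eq_add:
  assumes "pole_eq z k f" "pole_le z j g" "j < k" shows "pole_eq z k (f + g)"
proof -
  obtain v w where v: "v \<noteq> 0" "has_value z (f * lin z^k) v" and w: "has_value z (g * lin z^j) w"
    using assms(1,2) unfolding pole_eq_def pole_le_def by blast
  have "has_value z ((f + g) * lin z^k) (v + w * 0^(k - j))"
    using has_value_add[OF v(2) has_value_raise[OF w]] assms(3) by (simp add: distrib_right)
  thus ?thesis unfolding pole_eq_def using v(1) assms(3) by (intro exI[of _ v]) (simp add: power_0_left)
qed

lemma pole_le_mult:
  assumes "pole_le z k f" "pole_le z j g" shows "pole_le z (k + j) (f * g)"
proof -
  obtain v w where "has_value z (f * lin z^k) v" "has_value z (g * lin z^j) w"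
    using assms unfolding pole_le_def by blast
  from has_value_mult[OF this] show ?thesis unfolding pole_le_def by (auto simp: power_add mult_ac)
qed

lemma pole_eq_mult:
  assumes "pole_eq z k f" "pole_eq z j g" shows "pole_eq z (k + j) (f * g)"
proof -
  obtain v w where *: "v \<noteq> 0" "w \<noteq> 0" "has_value z (f * lin z^k) v" "has_value z (g * lin z^j) w"
    using assms unfolding pole_eq_def by blast
  show ?thesis unfolding pole_eq_def
    using has_value_mult[OF *(3,4)] *(1,2) by (intro exI[of _ "v * w"]) (simp add: power_add mult_ac)
qed

lemma pole_le_toR: "pole_le z 0 (toR p)"
  using has_value_toR by (auto simp: pole_le_0_iff)

lemma pole_eq_0I: "has_value z f v \<Longrightarrow> v \<noteq> 0 \<Longrightarrow> pole_eq z 0 f"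
  by (auto simp: pole_eq_def)

lemma pole_le_cmult: "pole_le z k f \<Longrightarrow> pole_le z k (fls_const c * f)"
  using pole_le_mult[of z 0 "fls_const c" k f] has_value_const by (auto simp: pole_le_0_iff)

lemma pole_eq_cmult: "pole_eq z k f \<Longrightarrow> c \<noteq> 0 \<Longrightarrow> pole_eq z k (fls_const c * f)"
  using pole_eq_mult[OF pole_eq_0I[OF has_value_const]] by fastforce

lemma pole_le_0: "pole_le z k 0"
  using has_value_const[of z 0] by (auto simp: pole_le_def)

lemma pole_le_sum: "(\<And>i. i \<in> I \<Longrightarrow> pole_le z k (f i)) \<Longrightarrow> pole_le z k (sum f I)"
  by (induction I rule: infinite_finite_induct) (auto intro: pole_le_add pole_le_0)

lemma pole_le_uminus: "pole_le z k f \<Longrightarrow> pole_le z k (-f)"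
  using pole_le_cmult[of z k f "- 1"] by (simp add: fls_const_minus_1)

lemma pole_eq_uminus: "pole_eq z k f \<Longrightarrow> pole_eq z k (-f)"
  using pole_eq_cmult[of z k f "- 1"] by (simp add: fls_const_minus_1)

lemma pole_le_diff: "pole_le z k f \<Longrightarrow> pole_le z k g \<Longrightarrow> pole_le z k (f - g)"
  using pole_le_add[of z k f "- g"] pole_le_uminus[of z k g] by simp

lemma theta_power: "f * theta (f^k) = of_nat k * theta f * f^k"
proof (induction k)
  case (Suc k)
  have "f * theta (f^Suc k) = theta f * f^Suc k + f * (f * theta (f^k))"
    by (simp add: theta_mult algebra_simps)
  thus ?case unfolding Suc by (simp add: algebra_simps)
qed simp

lemma has_value_theta_pole:
  assumes "has_value z (f * lin z^k) v"
  shows "has_value z (theta f * lin z^Suc k) (- of_nat k * z * v)"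
proof -
  obtain w where w: "has_value z (theta (f * lin z^k)) w" using has_value_theta[OF assms] by blast
  have "lin z * theta (f * lin z^k) = theta f * lin z^Suc k + f * (lin z * theta (lin z^k))"
    by (simp add: theta_mult algebra_simps)
  hence "theta f * lin z^Suc k = lin z * theta (f * lin z^k) - of_nat k * fls_X * (f * lin z^k)"
    unfolding theta_power theta_lin by (simp add: algebra_simps)
  moreover have "has_value z (lin z * theta (f * lin z^k) - of_nat k * fls_X * (f * lin z^k))
      ((z - z) * w - of_nat k * z * v)"
    unfolding fls_of_nat
    by (intro has_value_diff has_value_mult has_value_lin has_value_const has_value_X w assms)
  ultimately show ?thesis by simp
qed

lemma pole_le_theta: "pole_le z k f \<Longrightarrow> pole_le z (Suc k) (theta f)"
  unfolding pole_le_def using has_value_theta_pole by blast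

lemma pole_eq_theta: "pole_eq z k f \<Longrightarrow> k \<ge> 1 \<Longrightarrow> z \<noteq> 0 \<Longrightarrow> pole_eq z (Suc k) (theta f)"
  unfolding pole_eq_def by (elim exE conjE, rule exI, rule conjI[rotated], erule has_value_theta_pole) simp

lemma pole_le_theta_pow: "pole_le z k f \<Longrightarrow> pole_le z (k + i) ((theta ^^ i) f)"
  by (induction i) (auto intro: pole_le_theta)

lemma pole_eq_theta_pow: "pole_eq z k f \<Longrightarrow> k \<ge> 1 \<Longrightarrow> z \<noteq> 0 \<Longrightarrow> pole_eq z (k + i) ((theta ^^ i) f)"
  by (induction i) (auto intro: pole_eq_theta)

lemma has_value_order:
  assumes "D \<noteq> 0" "f * toR D = toR N"
  shows "\<exists>v. has_value z (f * lin z ^ order z D) v \<and> (v = 0 \<longleftrightarrow> poly N z = 0)"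
proof -
  obtain D' where D': "D = [:-z, 1:] ^ order z D * D'" "\<not> [:-z, 1:] dvd D'"
    using order_decomp[OF assms(1)] by blast
  have "f * lin z ^ order z D * toR D' = f * toR D"
    by (subst (2) D'(1)) (simp add: toR_mult toR_power lin_def mult_ac)
  moreover have "poly D' z \<noteq> 0" using D'(2) by (simp add: poly_eq_0_iff_dvd)
  ultimately show ?thesis unfolding has_value_def assms(2)
    by (intro exI[of _ "poly N z / poly D' z"] conjI exI[of _ N] exI[of _ D']) auto
qed

lemma ratfun_finite_poles:
  assumes "f \<in> ratfun" shows "finite {z. \<not> pole_le z 0 f}"
proof -
  obtain N D where *: "D \<noteq> 0" "f * toR D = toR N" using assms by (auto simp: ratfun_def)
  have "pole_le z 0 f" if "poly D z \<noteq> 0" for z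
    using has_value_order[OF *, of z] that by (auto simp: pole_le_def order_0I)
  hence "{z. \<not> pole_le z 0 f} \<subseteq> {z. poly D z = 0}" by auto
  thus ?thesis using poly_roots_finite[OF *(1)] finite_subset by blast
qed

definition pole_order :: "complex \<Rightarrow> complex fls \<Rightarrow> nat" where
  "pole_order z f = (LEAST k. pole_le z k f)"

lemma pole_order_le:
  assumes "f \<in> ratfun" shows "pole_le z (pole_order z f) f"
proof -
  obtain N D where "D \<noteq> 0" "f * toR D = toR N" using assms by (auto simp: ratfun_def)
  hence "\<exists>k. pole_le z k f" unfolding pole_le_def using has_value_order by blast
  thus ?thesis unfolding pole_order_def by (rule LeastI_ex)
qed

lemma pole_order_eq:
  assumes "f \<in> ratfun" "pole_order z f \<ge> 1"
  shows "pole_eq z (pole_order z f) f"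
proof -
  obtain j where j: "pole_order z f = Suc j" using assms(2) by (cases "pole_order z f") auto
  obtain v where v: "has_value z (f * lin z ^ Suc j) v"
    using pole_order_le[OF assms(1), of z] by (auto simp: j pole_le_def)
  have "\<not> pole_le z j f" using not_less_Least[of j "\<lambda>k. pole_le z k f"] j by (auto simp: pole_order_def)
  hence "v \<noteq> 0" using has_value_cancel_lin[of z "f * lin z^j"] v
    by (auto simp: pole_le_def mult_ac)
  thus ?thesis unfolding j pole_eq_def using v by blast
qed

lemma pole_order_0D: "f \<in> ratfun \<Longrightarrow> pole_order z f = 0 \<Longrightarrow> pole_le z 0 f"
  using pole_order_le by metis

lemma pole_order_0I: "pole_le z 0 f \<Longrightarrow> pole_order z f = 0"
  unfolding pole_order_def by (metis Least_le le_zero_eq)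

lemma interval_of_large_values:
  fixes P :: "int \<Rightarrow> nat"
  assumes "finite {n. P n \<noteq> 0}" "1 \<le> K" "K \<le> P m"
  obtains n0 n1 where "n0 \<le> n1" "K \<le> P n0" "P (n0 - 1) < K" "K \<le> P n1" "P (n1 + 1) < K"
proof -
  define B where "B = {n. K \<le> P n}"
  have B: "finite B" "B \<noteq> {}"
    using assms by (auto simp: B_def intro: finite_subset[OF _ assms(1)])
  show thesis
  proof (rule that[of "Min B" "Max B"])
    have "Min B \<in> B" "Max B \<in> B" using B by simp_all
    thus "Min B \<le> Max B" "K \<le> P (Min B)" "K \<le> P (Max B)" using B by (simp_all add: B_def)
    have "Min B - 1 \<notin> B" "Max B + 1 \<notin> B" using Min_le[OF B(1)] Max_ge[OF B(1)] by fastforce+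
    thus "P (Min B - 1) < K" "P (Max B + 1) < K" by (simp_all add: B_def)
  qed
qed

context q_dilation
begin

lemma has_value_dil:
  assumes "has_value (q * z) f v" shows "has_value z (dil f) v"
proof -
  obtain N D where *: "poly D (q * z) \<noteq> 0" "f * toR D = toR N" "poly N (q * z) = v * poly D (q * z)"
    using assms unfolding has_value_def by blast
  have "dil f * toR (pcompose D [:0, q:]) = toR (pcompose N [:0, q:])"
    using arg_cong[OF *(2), of dil] by (simp add: dil_mult dil_toR)
  thus ?thesis unfolding has_value_def using *
    by (intro exI[of _ "pcompose N [:0, q:]"] exI[of _ "pcompose D [:0, q:]"])
       (simp add: poly_pcompose mult.commute)
qed

lemma has_value_dil_pole:
  assumes "has_value (q * z) (f * lin (q * z)^k) v"
  shows "has_value z (dil f * lin z^k) (inverse (q^k) * v)"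
proof -
  have "dil (lin (q * z)) = fls_const q * lin z"
    by (simp add: lin_eq \<sigma>_diff right_diff_distrib)
  hence "fls_const (inverse (q^k)) * dil (f * lin (q * z)^k) =
      (fls_const (inverse (q^k)) * fls_const q^k) * (dil f * lin z^k)"
    by (simp add: dil_mult \<sigma>_power power_mult_distrib mult_ac)
  also have "fls_const (inverse (q^k)) * fls_const q^k = 1"
    by (simp flip: fls_const_power)
  finally have "dil f * lin z^k = fls_const (inverse (q^k)) * dil (f * lin (q * z)^k)" by simp
  thus ?thesis using has_value_mult[OF has_value_const has_value_dil[OF assms]] by simp
qed

lemma pole_le_dil: "pole_le (q * z) k f \<Longrightarrow> pole_le z k (dil f)"
  unfolding pole_le_def using has_value_dil_pole by blast

lemma pole_eq_dil: "pole_eq (q * z) k f \<Longrightarrow> pole_eq z k (dil f)"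
  unfolding pole_eq_def by (elim exE conjE, rule exI, rule conjI[rotated], erule has_value_dil_pole) simp

lemma q_powi_inj: "z \<noteq> 0 \<Longrightarrow> z * q powi m = z * q powi n \<Longrightarrow> m = n"
  using q_powi_eq_1_iff[of "m - n"] by (simp add: power_int_diff)

lemma orbit_neq: "z \<noteq> 0 \<Longrightarrow> n \<noteq> 0 \<Longrightarrow> z * q powi n \<noteq> z"
  using q_powi_inj[of z n 0] by auto

lemma q_mult_orbit: "q * (z * q powi n) = z * q powi (n + 1)"
  by (simp add: power_int_add mult_ac)

lemma finite_orbit_poles:
  assumes "f \<in> ratfun" "z \<noteq> 0"
  shows "finite {n. pole_order (z * q powi n) f \<noteq> 0}"
proof -
  have "(\<lambda>n. z * q powi n) ` {n. pole_order (z * q powi n) f \<noteq> 0} \<subseteq> {z. \<not> pole_le z 0 f}"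
    using pole_order_0I by auto
  hence "finite ((\<lambda>n. z * q powi n) ` {n. pole_order (z * q powi n) f \<noteq> 0})"
    using ratfun_finite_poles[OF assms(1)] finite_subset by blast
  thus ?thesis by (rule finite_imageD) (auto intro!: inj_onI dest: q_powi_inj[OF assms(2)])
qed

lemma pole_order_orbit:
  fixes z f defines "P \<equiv> \<lambda>n. pole_order (z * q powi n) f"
  assumes "f \<in> ratfun"
  shows "pole_le (z * q powi n) (P n) f" "pole_le (z * q powi n) (P (n + 1)) (dil f)"
    "P n \<ge> 1 \<Longrightarrow> pole_eq (z * q powi n) (P n) f"
    "P (n + 1) \<ge> 1 \<Longrightarrow> pole_eq (z * q powi n) (P (n + 1)) (dil f)"
  using pole_order_le[OF assms(2)] pole_order_eq[OF assms(2)]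
  by (auto simp: P_def q_mult_orbit intro: pole_le_dil pole_eq_dil)

text \<open>The rightmost and the leftmost pole of maximal order of \<open>p\<close> on the orbit
  produce two different poles of that order of \<open>\<mu> p - \<sigma> p\<close>.\<close>

lemma no_telescoper:
  assumes z0: "z0 \<noteq> 0" and k: "k \<ge> 1" and g: "pole_eq z0 k g"
    and others: "\<And>n. n \<noteq> 0 \<Longrightarrow> pole_le (z0 * q powi n) (k - 1) g"
    and p: "p \<in> ratfun" and \<mu>: "\<mu> \<noteq> 0" and eq: "g = fls_const \<mu> * p - dil p"
  shows False
proof -
  define P where "P n = pole_order (z0 * q powi n) p" for n
  note orbit = pole_order_orbit[where z = z0, OF p, folded P_def]
  have fin: "finite {n. P n \<noteq> 0}" unfolding P_def by (rule finite_orbit_poles[OF p z0])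
  define K where "K = Max (insert k (P ` {n. P n \<noteq> 0}))"
  have P_le: "P n \<le> K" for n using fin by (cases "P n = 0") (auto simp: K_def)
  have "K \<ge> k" using fin by (simp add: K_def)
  have "\<exists>m. K \<le> P m"
  proof (cases "k \<le> P 0 \<or> k \<le> P 1")
    case True
    have "K \<in> insert k (P ` {n. P n \<noteq> 0})" unfolding K_def using fin by (intro Max_in) auto
    thus ?thesis using True by auto
  next
    case False
    hence "pole_le z0 (k - 1) p" "pole_le z0 (k - 1) (dil p)"
      using pole_le_mono[OF orbit(1)[of 0]] pole_le_mono[OF orbit(2)[of 0]] by auto
    hence "pole_le z0 (k - 1) g" unfolding eq by (intro pole_le_diff pole_le_cmult)
    thus ?thesis using pole_eq_not_le[OF g, of "k - 1"] k by simp
  qed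
  then obtain n0 n1 where n: "n0 \<le> n1" "P n0 = K" "P (n0 - 1) < K" "P n1 = K" "P (n1 + 1) < K"
    using interval_of_large_values[OF fin, of K] k \<open>K \<ge> k\<close> P_le by (metis le_antisym le_trans)
  have "K \<ge> 1" using k \<open>K \<ge> k\<close> by simp
  have "pole_eq (z0 * q powi n1) K (fls_const \<mu> * p)"
    using orbit(3)[of n1] n(4) \<open>K \<ge> 1\<close> \<mu> by (intro pole_eq_cmult) auto
  from pole_eq_add[OF this pole_le_uminus[OF orbit(2)] n(5)]
  have right: "pole_eq (z0 * q powi n1) K g" by (simp add: eq)
  have "pole_eq (z0 * q powi (n0 - 1)) K (- dil p)"
    using orbit(4)[of "n0 - 1"] n(2) \<open>K \<ge> 1\<close> by (intro pole_eq_uminus) auto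
  from pole_eq_add[OF this pole_le_cmult[OF orbit(1)] n(3), of \<mu>]
  have left: "pole_eq (z0 * q powi (n0 - 1)) K g" by (simp add: eq)
  have "n = 0" if "pole_eq (z0 * q powi n) K g" for n
    using pole_eq_not_le[OF that others] \<open>K \<ge> k\<close> k by fastforce
  from this[OF right] this[OF left] n(1) show False by simp
qed

definition isolated_pole :: "complex \<Rightarrow> nat \<Rightarrow> complex fls \<Rightarrow> bool" where
  "isolated_pole z0 k f \<longleftrightarrow> z0 \<noteq> 0 \<and> k \<ge> 1 \<and> pole_eq z0 k f \<and>
    (\<forall>n. n \<noteq> 0 \<longrightarrow> pole_le (z0 * q powi n) (k - 1) f)"

lemma isolated_pole_combination:
  assumes iso: "isolated_pole z0 k f" and I: "finite I" "i0 \<in> I" "c i0 \<noteq> 0"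
  shows "\<exists>j. isolated_pole z0 (k + j) (\<Sum>i\<in>I. fls_const (c i) * (theta ^^ i) f)"
proof -
  define J where "J = Max {i\<in>I. c i \<noteq> 0}"
  have J: "J \<in> I" "c J \<noteq> 0" using Max_in[of "{i\<in>I. c i \<noteq> 0}"] I unfolding J_def by auto
  have J_max: "i \<le> J" if "i \<in> I" "c i \<noteq> 0" for i
    using that I unfolding J_def by (intro Max_ge) auto
  have f: "z0 \<noteq> 0" "k \<ge> 1" "pole_eq z0 k f" "\<And>n. n \<noteq> 0 \<Longrightarrow> pole_le (z0 * q powi n) (k - 1) f"
    using iso by (auto simp: isolated_pole_def)
  have bound: "pole_le z l (fls_const (c i) * (theta ^^ i) f)"
    if "pole_le z m f" "c i \<noteq> 0 \<Longrightarrow> m + i \<le> l" for z l m i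
    using that pole_le_0 by (cases "c i = 0")
      (auto intro!: pole_le_cmult pole_le_mono[OF pole_le_theta_pow[OF that(1)]])
  have "pole_eq z0 (k + J) (fls_const (c J) * (theta ^^ J) f)"
    by (intro pole_eq_cmult pole_eq_theta_pow f J)
  moreover have "pole_le z0 (k + J - 1) (\<Sum>i\<in>I - {J}. fls_const (c i) * (theta ^^ i) f)"
    using J_max f(2) by (intro pole_le_sum bound[OF pole_eq_imp_le[OF f(3)]]) force
  ultimately have "pole_eq z0 (k + J) (\<Sum>i\<in>I. fls_const (c i) * (theta ^^ i) f)"
    unfolding sum.remove[OF I(1) J(1)] using f(2) by (intro pole_eq_add) auto
  moreover have "pole_le (z0 * q powi n) (k + J - 1) (\<Sum>i\<in>I. fls_const (c i) * (theta ^^ i) f)" if "n \<noteq> 0" for n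
    using J_max f(2) by (intro pole_le_sum bound[OF f(4)[OF that]]) force
  ultimately have "isolated_pole z0 (k + J) (\<Sum>i\<in>I. fls_const (c i) * (theta ^^ i) f)"
    using f(1,2) by (simp add: isolated_pole_def)
  thus ?thesis by blast
qed

lemma isolated_pole_not_coboundary:
  assumes "isolated_pole z0 k f" "finite I" "i0 \<in> I" "c i0 \<noteq> 0" "p \<in> ratfun" "\<mu> \<noteq> 0"
  shows "(\<Sum>i\<in>I. fls_const (c i) * (theta ^^ i) f) \<noteq> fls_const \<mu> * p - dil p"
proof -
  obtain j where "isolated_pole z0 (k + j) (\<Sum>i\<in>I. fls_const (c i) * (theta ^^ i) f)"
    using isolated_pole_combination[OF assms(1,2), of i0 c] assms(3,4) by blast
  thus ?thesis using no_telescoper[OF _ _ _ _ assms(5,6)] unfolding isolated_pole_def by blast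
qed

end


section \<open>Differential transcendence\<close>

definition diff_alg :: "complex fls \<Rightarrow> bool" where
  "diff_alg f \<longleftrightarrow> rat.alg_dep (\<lambda>i. (theta ^^ i) f)"

definition affine_form :: "(nat \<Rightarrow> 'a) \<Rightarrow> 'a \<Rightarrow> nat \<Rightarrow> 'a::comm_ring_1 mpoly" where
  "affine_form a b i = (\<Sum>j<i. single (var_exp j) (a j)) + single 0 b"

lemma keys_linear_form: "m \<in> keys (\<Sum>j\<in>J. single (var_exp j) (a j)) \<Longrightarrow> \<exists>j\<in>J. m = var_exp j"
  using keys_sum_subset[of "\<lambda>j. single (var_exp j) (a j)" J] by (fastforce split: if_splits)

lemma keys_affine_form: "m \<in> keys (affine_form a b i) \<Longrightarrow> m = 0 \<or> (\<exists>j<i. m = var_exp j)"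
  unfolding affine_form_def by (elim keys_addE) (auto dest: keys_linear_form split: if_splits)

lemma mpeval_affine_form: "mpeval (affine_form a b i) v = (\<Sum>j<i. a j * v j) + b"
  by (simp add: affine_form_def mpeval_add mpeval_sum)

lemma (in subfield) alg_dep_affine:
  assumes "alg_dep w" and c: "\<And>i. c i \<in> K" "\<And>i. c i \<noteq> 0"
    and a: "\<And>i j. a i j \<in> K" and b: "\<And>i. b i \<in> K"
    and w: "\<And>i. w i = c i * v i + ((\<Sum>j<i. a i j * v j) + b i)"
  shows "alg_dep v"
proof (rule alg_dep_triangular[OF assms(1) c, where f = "\<lambda>i. affine_form (a i) (b i) i"])
  show "coeffs_in K (affine_form (a i) (b i) i)" for i
    unfolding affine_form_def by (intro coeffs_in_add coeffs_in_sum coeffs_in_single a b)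
  show "m \<in> keys (affine_form (a i) (b i) i) \<Longrightarrow> keys m \<subseteq> {..<i}" for i m
    by (drule keys_affine_form) auto
  show "w i = c i * v i + mpeval (affine_form (a i) (b i) i) v" for i
    unfolding mpeval_affine_form by (rule w)
qed

lemma diff_alg_affine:
  assumes "diff_alg f" "f = w * g + w0" "w \<in> ratfun" "w0 \<in> ratfun" "w \<noteq> 0"
  shows "diff_alg g"
  unfolding diff_alg_def
proof (rule rat.alg_dep_affine)
  show "rat.alg_dep (\<lambda>i. (theta ^^ i) f)" using assms(1) by (simp add: diff_alg_def)
  have "(theta ^^ i) (w * g) = w * (theta ^^ i) g + (\<Sum>j<i. of_nat (i choose j) * (theta ^^ (i - j)) w * (theta ^^ j) g)" for i
    using theta_pow_mult[of i g w] unfolding lessThan_Suc_atMost[symmetric] sum.lessThan_Suc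
    by (simp add: mult_ac)
  thus "(theta ^^ i) f = w * (theta ^^ i) g +
      ((\<Sum>j<i. (of_nat (i choose j) * (theta ^^ (i - j)) w) * (theta ^^ j) g) + (theta ^^ i) w0)" for i
    by (simp add: assms(2) theta_pow_add)
qed (use assms in \<open>auto intro!: theta_pow_ratfun rat.mult_in rat.of_nat_in\<close>)

context q_dilation
begin

lemma dil_fixed_coeffs:
  assumes "\<And>i. dil (c i) = c i"
  obtains c' where "c = (\<lambda>i. fls_const (c' i))"
  using that[of "\<lambda>i. fls_nth (c i) 0"] dil_fixed[OF assms] by (simp add: fun_eq_iff)

theorem isolated_pole_not_diff_alg:
  assumes f: "dil f = fls_const \<mu> * f + \<delta>" and \<mu>: "\<mu> \<noteq> 0" and \<delta>: "\<delta> \<in> ratfun"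
    and iso: "isolated_pole z0 k \<delta>"
  shows "\<not> diff_alg f"
proof
  assume "diff_alg f"
  hence dep: "rat.alg_dep (\<lambda>i. (theta ^^ i) f)" by (simp add: diff_alg_def)
  have "(theta ^^ i) (fls_const \<mu> * f) = fls_const \<mu> * (theta ^^ i) f" for i
    by (induction i) (auto simp: theta_mult)
  hence shift: "dil ((theta ^^ i) f) = fls_const \<mu> * (theta ^^ i) f + (theta ^^ i) \<delta>" for i
    by (simp add: dil_theta_pow f theta_pow_add)
  have "fls_const \<mu> \<noteq> 0" using \<mu> by simp
  then obtain I c p where I: "finite I" "\<forall>i. c i \<in> ratfun \<and> dil (c i) = c i" "\<exists>i\<in>I. c i \<noteq> 0"
    "p \<in> ratfun" "(\<Sum>i\<in>I. c i * (theta ^^ i) \<delta>) = fls_const \<mu> * p - dil p"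
    by (rule kolchin_ostrowski[OF dep ratfun_const _ theta_pow_ratfun[OF \<delta>] shift]) (erule (4) that)
  obtain c' where "c = (\<lambda>i. fls_const (c' i))" using I(2) dil_fixed_coeffs[of c] by blast
  thus False using isolated_pole_not_coboundary[OF iso I(1) _ _ I(4) \<mu>, of _ c'] I(3,5) by auto
qed

definition non_telescoping :: "complex fls \<Rightarrow> bool" where
  "non_telescoping g \<longleftrightarrow> (\<forall>I c p. finite I \<longrightarrow> p \<in> ratfun \<longrightarrow>
    (\<Sum>i\<in>I. fls_const (c i) * (theta ^^ i) g) = p - dil p \<longrightarrow> (\<forall>i\<in>I. c i = 0))"

lemma isolated_pole_non_telescoping:
  assumes "isolated_pole z0 k g" shows "non_telescoping g"
  unfolding non_telescoping_def
proof (intro allI impI ballI, rule ccontr)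
  fix I :: "nat set" and c p i
  assume "finite I" "p \<in> ratfun" "(\<Sum>i\<in>I. fls_const (c i) * (theta ^^ i) g) = p - dil p" "i \<in> I" "c i \<noteq> 0"
  thus False using isolated_pole_not_coboundary[OF assms, of I i c p 1] by simp
qed

lemma non_telescoping_coboundary:
  assumes "non_telescoping g1" "g = g1 + (dil h - h)" "h \<in> ratfun"
  shows "non_telescoping g"
  unfolding non_telescoping_def
proof (intro allI impI)
  fix I :: "nat set" and c p
  assume *: "finite I" "p \<in> ratfun" "(\<Sum>i\<in>I. fls_const (c i) * (theta ^^ i) g) = p - dil p"
  define h' where "h' = (\<Sum>i\<in>I. fls_const (c i) * (theta ^^ i) h)"
  have "(\<Sum>i\<in>I. fls_const (c i) * (theta ^^ i) g) =
      (\<Sum>i\<in>I. fls_const (c i) * (theta ^^ i) g1) + (dil h' - h')"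
    unfolding assms(2) h'_def \<sigma>_sum dil_mult dil_const dil_theta_pow
      theta_pow_add theta_pow_diff sum_subtractf[symmetric] sum.distrib[symmetric]
    by (intro sum.cong refl) (simp only: right_diff_distrib distrib_left)
  hence "(\<Sum>i\<in>I. fls_const (c i) * (theta ^^ i) g1) = (p + h') - dil (p + h')"
    unfolding *(3) dil_add by (simp add: algebra_simps)
  moreover have "p + h' \<in> ratfun" unfolding h'_def
    by (intro rat.add_in *(2) rat.sum_in rat.mult_in ratfun_const theta_pow_ratfun assms)
  ultimately show "\<forall>i\<in>I. c i = 0" using assms(1) *(1) unfolding non_telescoping_def by blast
qed

lemma non_telescoping_power:
  assumes nt: "non_telescoping (theta \<gamma> / \<gamma>)" and \<gamma>: "\<gamma> \<noteq> 0" and p: "p \<in> ratfun" "p \<noteq> 0" and j: "j \<ge> 1"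
  shows "dil p \<noteq> \<gamma>^j * p"
proof
  assume eq: "dil p = \<gamma>^j * p"
  define l where "l = theta p / p"
  have "\<gamma> * theta (dil p) = of_nat j * theta \<gamma> * \<gamma>^j * p + \<gamma>^j * (\<gamma> * theta p)"
    unfolding eq theta_mult by (simp add: distrib_left mult.assoc[symmetric] theta_power)
  hence "theta (dil p) = (of_nat j * theta \<gamma> * \<gamma>^j * p + \<gamma>^j * (\<gamma> * theta p)) / \<gamma>"
    using \<gamma> by (simp add: eq_divide_eq mult.commute)
  hence "dil l = of_nat j * (theta \<gamma> / \<gamma>) + l"
    using \<gamma> p by (simp add: l_def \<sigma>_divide dil_theta eq divide_simps) (simp add: algebra_simps)
  hence "(\<Sum>i\<in>{0}. fls_const (of_nat j) * (theta ^^ i) (theta \<gamma> / \<gamma>)) = (-l) - dil (-l)"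
    by (simp add: \<sigma>_uminus fls_of_nat)
  moreover have "- l \<in> ratfun" unfolding l_def by (intro rat.uminus_in rat.divide_in theta_ratfun p)
  ultimately have "of_nat j = (0::complex)"
    using nt[unfolded non_telescoping_def, rule_format, of "{0}" "- l" "\<lambda>_. of_nat j" 0] by simp
  thus False using j by simp
qed

lemma non_telescoping_degree:
  assumes nt: "non_telescoping (theta \<gamma> / \<gamma>)" and \<gamma>: "\<gamma> \<noteq> 0" and p: "p \<in> ratfun" "p \<noteq> 0"
    and eq: "dil p * \<gamma>^m = \<gamma>^n * p"
  shows "m = n"
proof (rule ccontr)
  assume "m \<noteq> n"
  then consider "m < n" | "n < m" by linarith
  thus False
  proof cases
    case 1
    hence "\<gamma>^n = \<gamma>^m * \<gamma>^(n - m)" by (simp flip: power_add)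
    hence "dil p = \<gamma>^(n - m) * p" using eq \<gamma> by simp
    thus False using non_telescoping_power[OF nt \<gamma> p, of "n - m"] 1 by simp
  next
    case 2
    hence "\<gamma>^m = \<gamma>^n * \<gamma>^(m - n)" by (simp flip: power_add)
    hence "dil p * \<gamma>^(m - n) = p" using eq \<gamma> by simp
    moreover have "dil p \<noteq> 0" using p(2) by (simp add: \<sigma>_eq_0_iff)
    ultimately have "inverse (dil p) = \<gamma>^(m - n) * inverse p" using p(2) by (simp add: field_simps)
    hence "dil (inverse p) = \<gamma>^(m - n) * inverse p" by (simp only: \<sigma>_inverse)
    thus False using non_telescoping_power[OF nt \<gamma> rat.inverse_in[OF p(1)], of "m - n"] 2 p(2) by simp
  qed
qed

end

subsection \<open>Logarithmic jets\<close>

text \<open>The formal value of \<open>\<theta>\<^sup>i h / h\<close> for a solution \<open>h\<close> of \<open>\<theta> h = U h\<close>.\<close>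

primrec log_jet :: "complex fls \<Rightarrow> nat \<Rightarrow> complex fls" where
  "log_jet U 0 = 1"
| "log_jet U (Suc i) = theta (log_jet U i) + U * log_jet U i"

definition leibniz :: "complex fls \<Rightarrow> complex fls \<Rightarrow> nat \<Rightarrow> complex fls" where
  "leibniz U f i = (\<Sum>j\<le>i. of_nat (i choose j) * (theta ^^ j) f * log_jet U (i - j))"

lemma leibniz_Suc: "leibniz U f (Suc i) = theta (leibniz U f i) + U * leibniz U f i"
proof -
  let ?F = "\<lambda>j. (theta ^^ j) f" and ?G = "log_jet U"
  have "theta (leibniz U f i) + U * leibniz U f i =
      (\<Sum>j\<le>i. of_nat (i choose j) * ?F (Suc j) * ?G (i - j)) + (\<Sum>j\<le>i. of_nat (i choose j) * ?F j * ?G (Suc (i - j)))"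
    unfolding leibniz_def theta_sum theta_mult sum_distrib_left sum.distrib[symmetric] theta_of_nat
    by (intro sum.cong refl) (simp add: algebra_simps)
  also have "... = leibniz U f (Suc i)"
    unfolding leibniz_def by (rule sum_choose_Suc[where F = ?F and G = ?G])
  finally show ?thesis by simp
qed

lemma log_jet_Suc_leibniz: "log_jet U (Suc i) = leibniz U U i"
proof (induction i)
  case (Suc i)
  show ?case unfolding leibniz_Suc Suc[symmetric] by simp
qed (simp add: leibniz_def)

fun log_jet_mpoly :: "nat \<Rightarrow> complex fls mpoly" where
  "log_jet_mpoly 0 = 1"
| "log_jet_mpoly (Suc i) = (\<Sum>j\<le>i. single (var_exp j) (of_nat (i choose j)) * log_jet_mpoly (i - j))"

lemma coeffs_log_jet_mpoly: "coeffs_in ratfun (log_jet_mpoly i)"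
  by (induction i rule: log_jet_mpoly.induct)
     (auto intro!: rat.coeffs_in_1 rat.coeffs_in_sum rat.coeffs_in_mult rat.coeffs_in_single rat.of_nat_in)

lemma mpeval_log_jet_mpoly: "mpeval (log_jet_mpoly i) (\<lambda>j. (theta ^^ j) U) = log_jet U i"
proof (induction i rule: log_jet_mpoly.induct)
  case (2 i)
  thus ?case unfolding log_jet_Suc_leibniz leibniz_def
    by (simp add: mpeval_sum mpeval_mult del: log_jet.simps)
qed simp

lemma keys_var_mult_sum:
  assumes "m \<in> keys (\<Sum>j\<in>J. single (var_exp j) (c j) * p j)"
    and "\<And>j k. j \<in> J \<Longrightarrow> k \<in> keys (p j) \<Longrightarrow> j < i \<and> keys k \<subseteq> {..<i}"
  shows "keys m \<subseteq> {..<i}"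
proof -
  obtain j where j: "j \<in> J" "m \<in> keys (single (var_exp j) (c j) * p j)"
    using subsetD[OF keys_sum_subset assms(1)] by blast
  from j(2) obtain a b where "m = a + b" "a \<in> keys (single (var_exp j) (c j))" "b \<in> keys (p j)"
    by (rule keys_multE)
  thus ?thesis using Poly_Mapping.keys_add[of a b] assms(2)[OF j(1)] by (auto split: if_splits)
qed

lemma keys_log_jet_mpoly: "m \<in> keys (log_jet_mpoly i) \<Longrightarrow> keys m \<subseteq> {..<i}"
proof (induction i arbitrary: m rule: log_jet_mpoly.induct)
  case (2 i)
  show ?case
  proof (rule keys_var_mult_sum[OF "2.prems"[unfolded log_jet_mpoly.simps]])
    fix j k assume "j \<in> {..i}" "k \<in> keys (log_jet_mpoly (i - j))"
    thus "j < Suc i \<and> keys k \<subseteq> {..<Suc i}" using "2.IH"[of j k] by auto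
  qed
qed simp

context q_dilation
begin

lemma log_jet_indep:
  assumes nt: "non_telescoping g" "g \<in> ratfun" and U: "dil U = U + g"
  shows "\<not> rat.alg_dep (\<lambda>i. log_jet U (Suc i))"
proof
  assume dep: "rat.alg_dep (\<lambda>i. log_jet U (Suc i))"
  define Z where "Z i = (\<Sum>j<i. single (var_exp j) (of_nat (i choose j)) * log_jet_mpoly (i - j))" for i
  have dep': "rat.alg_dep (\<lambda>i. (theta ^^ i) U)"
  proof (rule rat.alg_dep_triangular[OF dep, where c = "\<lambda>_. 1" and f = Z])
    show "coeffs_in ratfun (Z i)" for i unfolding Z_def
      by (intro rat.coeffs_in_sum rat.coeffs_in_mult rat.coeffs_in_single rat.of_nat_in coeffs_log_jet_mpoly)
    show "keys m \<subseteq> {..<i}" if "m \<in> keys (Z i)" for i m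
      using that[unfolded Z_def] by (rule keys_var_mult_sum) (use keys_log_jet_mpoly in fastforce)
    show "log_jet U (Suc i) = 1 * (theta ^^ i) U + mpeval (Z i) (\<lambda>j. (theta ^^ j) U)" for i
      unfolding log_jet_Suc_leibniz leibniz_def lessThan_Suc_atMost[symmetric] sum.lessThan_Suc Z_def
        mpeval_sum mpeval_mult mpeval_log_jet_mpoly by (simp add: mult_ac)
  qed auto
  have "dil ((theta ^^ i) U) = 1 * (theta ^^ i) U + (theta ^^ i) g" for i
    by (simp add: dil_theta_pow U theta_pow_add)
  then obtain I c p where I: "finite I" "\<forall>i. c i \<in> ratfun \<and> dil (c i) = c i" "\<exists>i\<in>I. c i \<noteq> 0"
    "p \<in> ratfun" "(\<Sum>i\<in>I. c i * (theta ^^ i) g) = 1 * p - dil p"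
    by (rule kolchin_ostrowski[OF dep' rat.one_in one_neq_zero theta_pow_ratfun[OF nt(2)]]) (erule (4) that)
  obtain c' where "c = (\<lambda>i. fls_const (c' i))" using I(2) dil_fixed_coeffs[of c] by blast
  thus False using nt(1)[unfolded non_telescoping_def, rule_format, of I p c'] I by auto
qed

lemma ex_log_solution:
  assumes "\<And>n. n \<le> 0 \<Longrightarrow> fls_nth g n = 0"
  obtains U where "dil U = U + g"
proof
  let ?U = "fps_to_fls (Abs_fps (\<lambda>n. fls_nth g (int n) / (q^n - 1)))"
  show "dil ?U = ?U + g"
  proof (rule fls_eqI)
    fix n :: int
    show "fls_nth (dil ?U) n = fls_nth (?U + g) n"
    proof (cases "n \<le> 0")
      case True
      thus ?thesis using assms[of n] by (cases "n = 0") (simp_all add: dil_nth)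
    next
      case False
      then obtain m where m: "n = int m" "m > 0"
        by (metis int_eq_iff not_le_imp_less of_nat_0_less_iff zero_le_imp_eq_int less_imp_le)
      have "q^m \<noteq> 1" using q_powi_eq_1_iff[of n] m by simp
      thus ?thesis by (simp add: dil_nth m field_simps)
    qed
  qed
qed

lemma dil_log_jet:
  assumes U: "dil U = U + theta \<gamma> / \<gamma>" and \<gamma>: "\<gamma> \<noteq> 0"
  shows "\<gamma> * dil (log_jet U i) = leibniz U \<gamma> i"
proof (induction i)
  case (Suc i)
  define T where "T = leibniz U \<gamma> i"
  have "dil (log_jet U i) = T / \<gamma>" using Suc \<gamma> by (simp add: T_def field_simps)
  hence "\<gamma> * dil (log_jet U (Suc i)) = \<gamma> * (theta (T / \<gamma>) + (U + theta \<gamma> / \<gamma>) * (T / \<gamma>))"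
    by (simp add: dil_add dil_mult dil_theta U)
  also have "theta (T / \<gamma>) = theta T / \<gamma> - T * theta \<gamma> / \<gamma>^2"
    using \<gamma> by (simp add: divide_inverse theta_mult theta_inverse mult_ac power_inverse)
  also have "\<gamma> * (theta T / \<gamma> - T * theta \<gamma> / \<gamma>^2 + (U + theta \<gamma> / \<gamma>) * (T / \<gamma>)) = theta T + U * T"
    using \<gamma> by (simp add: field_simps power2_eq_square)
  finally show ?case by (simp add: leibniz_Suc T_def)
qed (simp add: leibniz_def)

end

lemma homog_relation_zero:
  assumes indep: "\<not> rat.alg_dep (\<lambda>i. x (Suc i))" and x0: "x 0 = 1"
    and Q: "coeffs_in ratfun Q" "\<And>m. m \<in> keys Q \<Longrightarrow> tdeg m = D" "mpeval Q x = 0"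
  shows "Q = 0"
proof (rule ccontr)
  assume "Q \<noteq> 0"
  have inj: "m = n" if "m \<in> keys Q" "n \<in> keys Q" "drop_vars 1 m = drop_vars 1 n" for m n
  proof (rule poly_mapping_eqI)
    fix i
    have "lookup m 0 = lookup n 0"
      using tdeg_drop_vars[of m 1] tdeg_drop_vars[of n 1] Q(2)[OF that(1)] Q(2)[OF that(2)] that(3)
      by (simp add: lessThan_Suc One_nat_def)
    moreover have "lookup m (j + 1) = lookup n (j + 1)" for j
      using that(3) by (metis lookup_drop_vars)
    ultimately show "lookup m i = lookup n i" by (cases i) (simp_all add: One_nat_def)
  qed
  define Q' where "Q' = (\<Sum>m\<in>keys Q. single (drop_vars 1 m) (lookup Q m))"
  have "coeffs_in ratfun Q'" unfolding Q'_def
    using Q(1) by (intro rat.coeffs_in_sum rat.coeffs_in_single) (auto simp: coeffs_in_def)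
  moreover have "mpeval Q' (\<lambda>i. x (Suc i)) = 0"
    using Q(3) by (simp add: Q'_def mpeval_sum mpeval_def[of Q] moneval_drop_vars[of _ x 1] x0 Suc_eq_plus1)
  moreover have "Q' \<noteq> 0"
  proof -
    obtain N where N: "N \<in> keys Q" using \<open>Q \<noteq> 0\<close> by (metis all_not_in_conv keys_eq_empty)
    have "lookup Q' (drop_vars 1 N) = (\<Sum>m\<in>keys Q. if m = N then lookup Q m else 0)"
      unfolding Q'_def lookup_sum lookup_single when_def
      by (intro sum.cong refl) (use inj N in auto)
    also have "... \<noteq> 0" using N by (simp add: sum.delta in_keys_iff)
    finally show ?thesis by auto
  qed
  ultimately show False using indep unfolding rat.alg_dep_def by blast
qed

subsection \<open>First order equations with non-telescoping coefficient\<close>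

definition jet_form :: "complex fls \<Rightarrow> nat \<Rightarrow> complex fls mpoly" where
  "jet_form \<gamma> i = (\<Sum>j\<le>i. single (var_exp j) (of_nat (i choose j) * (theta ^^ (i - j)) \<gamma>))"

lemma jet_form_eq:
  "jet_form \<gamma> i = single (var_exp i) \<gamma> +
    (\<Sum>j<i. single (var_exp j) (of_nat (i choose j) * (theta ^^ (i - j)) \<gamma>))"
  unfolding jet_form_def lessThan_Suc_atMost[symmetric] sum.lessThan_Suc by simp

lemma coeffs_jet_form: "\<gamma> \<in> ratfun \<Longrightarrow> coeffs_in ratfun (jet_form \<gamma> i)"
  unfolding jet_form_def
  by (intro rat.coeffs_in_sum rat.coeffs_in_single rat.mult_in rat.of_nat_in theta_pow_ratfun)

lemma mpeval_jet_form: "mpeval (jet_form \<gamma> i) (\<lambda>i. (theta ^^ i) g) = (theta ^^ i) (\<gamma> * g)"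
  unfolding mult.commute[of \<gamma>] theta_pow_mult
  by (simp add: jet_form_def mpeval_sum mult_ac)

lemma leading_form_jet_form_weighted:
  assumes "B \<ge> 1"
  shows "leading_form (\<lambda>i. B + i) (B + i) (jet_form \<gamma> i + single 0 d) (single (var_exp i) \<gamma>)"
  unfolding jet_form_eq add.assoc using assms
  by (intro leading_form_single_add[where \<omega> = "\<lambda>i. B + i"])
     (auto elim!: keys_addE dest: keys_linear_form split: if_splits)

lemma leading_form_jet_form: "leading_form (\<lambda>_. 1) 1 (jet_form \<gamma> i + single 0 d) (jet_form \<gamma> i)"
  unfolding leading_form_def jet_form_def by (auto dest: keys_linear_form split: if_splits)

lemma power_single: "single m c^n = single (of_nat n * m) (c^n)" for c :: "'a::comm_ring_1"
  by (induction n) (simp_all add: mult_single algebra_simps)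

lemma of_nat_mult_var_exp [simp]: "of_nat n * var_exp i = single i n"
  by (induction n) (simp_all add: algebra_simps One_nat_def flip: single_add)

lemma affine_var_power:
  "(single (var_exp i) \<gamma> + single 0 \<delta>)^n =
    (\<Sum>k\<le>n. single (single i k) (of_nat (n choose k) * \<gamma>^k * \<delta>^(n - k)))" for \<gamma> :: "'a::comm_ring_1"
  by (simp add: binomial_ring power_single mult_single mult_ac flip: single_of_nat)

lemma lookup_affine_var_power:
  fixes \<gamma> \<delta> :: "'a :: comm_ring_1"
  assumes "tdeg N = n"
  shows "lookup ((single (var_exp 0) \<gamma> + single 0 \<delta>)^Suc n) N =
    (if N = single 0 n then of_nat (Suc n) * \<gamma>^n * \<delta> else 0)"
proof -
  have N: "single 0 k = N \<longleftrightarrow> k = n \<and> N = single 0 n" for k using assms by auto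
  have "lookup ((single (var_exp 0) \<gamma> + single 0 \<delta>)^Suc n) N =
      (\<Sum>k\<le>Suc n. if single 0 k = N then of_nat (Suc n choose k) * \<gamma>^k * \<delta>^(Suc n - k) else 0)"
    by (simp only: affine_var_power lookup_sum lookup_single when_def)
  also have "... = (\<Sum>k\<le>Suc n. if k = n then if N = single 0 n then of_nat (Suc n) * \<gamma>^n * \<delta> else 0 else 0)"
    unfolding N by (intro sum.cong refl) auto
  finally show ?thesis by simp
qed

text \<open>In the rest of this section \<open>\<theta> \<gamma> / \<gamma>\<close> is not telescoping, so no \<open>\<gamma>\<^sup>m\<close> with \<open>m \<noteq> 0\<close> is of the form
  \<open>\<sigma> p / p\<close>; this separates the degrees of a semi-invariant relation.\<close>

context q_dilation
begin

lemma mpeval_jet_form_log_jet: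
  assumes "dil U = U + theta \<gamma> / \<gamma>" "\<gamma> \<noteq> 0"
  shows "mpeval (jet_form \<gamma> i) (log_jet U) = \<gamma> * dil (log_jet U i)"
proof -
  have "leibniz U \<gamma> i = (\<Sum>j\<le>i. of_nat (i choose j) * (theta ^^ (i - j)) \<gamma> * log_jet U j)"
    unfolding leibniz_def
    by (rule sum.reindex_bij_witness[of _ "\<lambda>j. i - j" "\<lambda>j. i - j"]) (auto simp: binomial_symmetric[symmetric])
  thus ?thesis unfolding dil_log_jet[OF assms] by (simp add: jet_form_def mpeval_sum)
qed

context
  fixes \<gamma> :: "complex fls"
  assumes \<gamma>: "\<gamma> \<in> ratfun" "\<gamma> \<noteq> 0" and nt: "non_telescoping (theta \<gamma> / \<gamma>)"
    and reg: "\<And>n. n \<le> 0 \<Longrightarrow> fls_nth (theta \<gamma> / \<gamma>) n = 0"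
begin

lemma tdeg_leading_semi_invariant:
  assumes P: "coeffs_in ratfun P" "poly_subst dil P (\<lambda>i. jet_form \<gamma> i + single 0 (d i)) = single 0 (\<gamma>^D) * P"
    and N: "N \<in> keys P" "\<And>m. m \<in> keys P \<Longrightarrow> wdeg (\<lambda>i. B + i) m \<le> wdeg (\<lambda>i. B + i) N" and "B \<ge> 1"
  shows "tdeg N = D"
proof (rule non_telescoping_degree[OF nt \<gamma>(2)])
  show "lookup P N \<in> ratfun" "lookup P N \<noteq> 0" using P(1) N(1) by (auto simp: coeffs_in_def in_keys_iff)
  show "dil (lookup P N) * \<gamma>^tdeg N = \<gamma>^D * lookup P N"
    using lookup_poly_subst_top[OF leading_form_jet_form_weighted[OF \<open>B \<ge> 1\<close>] N(2), of P dil "\<lambda>_. \<gamma>" d]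
    by (simp add: lookup_const_mult moneval_const P(2))
qed

lemma tdeg_semi_invariant_le:
  assumes P: "coeffs_in ratfun P" "poly_subst dil P (\<lambda>i. jet_form \<gamma> i + single 0 (d i)) = single 0 (\<gamma>^D) * P"
    and m: "m \<in> keys P"
  shows "tdeg m \<le> D"
proof -
  define B where "B = Suc (\<Sum>m\<in>keys P. wdeg (\<lambda>i. i) m)"
  have B: "wdeg (\<lambda>i. i) m < B" if "m \<in> keys P" for m
    using member_le_sum[of m "keys P" "wdeg (\<lambda>i. i)"] that by (simp add: B_def)
  have "P \<noteq> 0" using m by auto
  then obtain N where N: "N \<in> keys P" "\<And>m. m \<in> keys P \<Longrightarrow> wdeg (\<lambda>i. B + i) m \<le> wdeg (\<lambda>i. B + i) N"
    using ex_max_wdeg[of P "\<lambda>i. B + i"] by blast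
  have "B \<ge> 1" unfolding B_def by linarith
  with P N have "tdeg N = D" by (rule tdeg_leading_semi_invariant)
  hence "B * tdeg m < B * Suc D" using N(2)[OF m] B[OF N(1)] by (simp add: wdeg_shift)
  thus ?thesis by (simp only: mult_less_cancel1 less_Suc_eq_le)
qed

lemma homog_semi_invariant:
  assumes H: "coeffs_in ratfun H" "\<And>m. m \<in> keys H \<Longrightarrow> tdeg m = D"
    "poly_subst dil H (jet_form \<gamma>) = single 0 (\<gamma>^D) * H"
  obtains c where "H = single (single 0 D) (fls_const c)"
proof -
  obtain U where U: "dil U = U + theta \<gamma> / \<gamma>" using ex_log_solution[OF reg] by blast
  let ?x = "log_jet U"
  have mono: "moneval m (\<lambda>i. \<gamma> * dil (?x i)) = \<gamma>^D * moneval m (\<lambda>i. dil (?x i))" if "m \<in> keys H" for m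
    using moneval_const[of m \<gamma>] H(2)[OF that] by (simp add: moneval_def power_mult_distrib prod.distrib)
  have "\<gamma>^D * mpeval H ?x = (\<Sum>m\<in>keys H. dil (lookup H m) * moneval m (\<lambda>i. \<gamma> * dil (?x i)))"
    using arg_cong[OF H(3), of "\<lambda>p. mpeval p ?x"]
    by (simp add: mpeval_poly_subst mpeval_jet_form_log_jet[OF U \<gamma>(2)] mpeval_mult)
  also have "... = \<gamma>^D * dil (mpeval H ?x)"
    unfolding \<sigma>_mpeval sum_distrib_left by (intro sum.cong refl) (simp add: mono mult_ac)
  finally have "dil (mpeval H ?x) = mpeval H ?x" using \<gamma>(2) by simp
  then obtain c where c: "mpeval H ?x = fls_const c" using dil_fixed by blast
  have "H - single (single 0 D) (fls_const c) = 0"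
  proof (rule homog_relation_zero)
    show "\<not> rat.alg_dep (\<lambda>i. ?x (Suc i))"
      by (rule log_jet_indep[OF nt _ U]) (intro rat.divide_in theta_ratfun \<gamma>)
    show "coeffs_in ratfun (H - single (single 0 D) (fls_const c))"
      by (intro rat.coeffs_in_diff rat.coeffs_in_single ratfun_const H)
    show "tdeg m = D" if "m \<in> keys (H - single (single 0 D) (fls_const c))" for m
      using subsetD[OF Poly_Mapping.keys_diff that] H(2) by (auto split: if_splits)
  qed (simp_all add: mpeval_diff c)
  thus thesis using that[of c] by simp
qed

lemma ex_monic_semi_invariant:
  assumes \<delta>: "\<delta> \<in> ratfun" and G: "dil G = \<gamma> * G + \<delta>" "diff_alg G"
  defines "w \<equiv> \<lambda>i. jet_form \<gamma> i + single 0 ((theta ^^ i) \<delta>)"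
  obtains D R where "D > 0" "coeffs_in ratfun R" "\<forall>m\<in>keys R. tdeg m < D"
    "G^D + mpeval R (\<lambda>i. (theta ^^ i) G) = 0"
    "poly_subst dil R w + w 0^D = single 0 (\<gamma>^D) * R + single (single 0 D) (\<gamma>^D)"
proof -
  let ?v = "\<lambda>i. (theta ^^ i) G"
  have w: "coeffs_in ratfun (w i)" "mpeval (w i) ?v = dil (?v i)" for i
    unfolding w_def
    by (auto intro!: rat.coeffs_in_add coeffs_jet_form rat.coeffs_in_single theta_pow_ratfun \<gamma> \<delta>
        simp: mpeval_add mpeval_jet_form dil_theta_pow G theta_pow_add)
  have lead: "leading_form (\<lambda>i. 1 + i) (1 + i) (w i) (single (var_exp i) \<gamma>)" for i
    unfolding w_def by (rule leading_form_jet_form_weighted) simp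
  obtain P M where P: "coeffs_in ratfun P" "mpeval P ?v = 0" "lookup P M = 1"
      "poly_subst dil P w = single 0 (\<gamma>^tdeg M) * P"
    by (rule ex_semi_invariant_relation[OF G(2)[unfolded diff_alg_def] \<gamma>(1) w lead]) (rule that; blast)
  define D where "D = tdeg M"
  have le: "tdeg m \<le> D" if "m \<in> keys P" for m
    using tdeg_semi_invariant_le[OF P(1) P(4)[unfolded w_def] that] by (simp add: D_def)
  let ?H = "homog_part (\<lambda>_. 1) D P"
  have "poly_subst dil ?H (jet_form \<gamma>) = homog_part (\<lambda>_. 1) D (poly_subst dil P w)"
    using le unfolding w_def by (intro homog_part_poly_subst[symmetric] leading_form_jet_form)
  also have "... = single 0 (\<gamma>^D) * ?H" unfolding P(4) D_def by (rule homog_part_const_mult)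
  finally obtain c where c: "?H = single (single 0 D) (fls_const c)"
    using P(1) by (elim homog_semi_invariant[rotated 2]) (auto simp: coeffs_in_def lookup_homog_part keys_homog_part)
  have "lookup ?H M = 1" using P(3) by (simp add: lookup_homog_part D_def)
  hence "fls_const c = 1" by (auto simp: c lookup_single when_def split: if_splits)
  hence H: "?H = single (single 0 D) 1" using c by simp
  define R where "R = P - ?H"
  show thesis
  proof
    show low: "\<forall>m\<in>keys R. tdeg m < D"
      using le by (fastforce simp: R_def in_keys_iff lookup_minus lookup_homog_part le_less split: if_splits)
    have PR: "P = R + single (single 0 D) 1" by (simp add: R_def flip: H)
    show "coeffs_in ratfun R" unfolding R_def H by (intro rat.coeffs_in_diff rat.coeffs_in_single P(1) rat.one_in)
    show "G^D + mpeval R ?v = 0" using P(2) by (simp add: PR mpeval_add add.commute)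
    show "poly_subst dil R w + w 0^D = single 0 (\<gamma>^D) * R + single (single 0 D) (\<gamma>^D)"
      using P(4) unfolding PR D_def[symmetric] poly_subst_add[of dil, OF dil_add \<sigma>_0]
        poly_subst_single[of dil, OF \<sigma>_0] by (simp add: distrib_left mult_single)
    show "D > 0"
    proof (rule ccontr)
      assume "\<not> D > 0"
      hence "R = 0" "D = 0" using low by (metis all_not_in_conv keys_eq_empty gr_zeroI not_less_zero)+
      thus False using P(2) by (simp add: PR)
    qed
  qed
qed

theorem diff_alg_homogeneous_imp_0:
  assumes "dil G = \<gamma> * G" "diff_alg G"
  shows "G = 0"
proof -
  obtain D R where R: "coeffs_in ratfun R" "\<forall>m\<in>keys R. tdeg m < D"
      "G^D + mpeval R (\<lambda>i. (theta ^^ i) G) = 0"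
      "poly_subst dil R (\<lambda>i. jet_form \<gamma> i + single 0 ((theta ^^ i) 0)) + (jet_form \<gamma> 0 + single 0 0)^D =
        single 0 (\<gamma>^D) * R + single (single 0 D) (\<gamma>^D)"
    using assms by (elim ex_monic_semi_invariant[of 0 G, rotated 2]) (auto simp: rat.zero_in)
  have "R = 0"
  proof (rule ccontr)
    assume "R \<noteq> 0"
    obtain N where N: "N \<in> keys R" "\<And>m. m \<in> keys R \<Longrightarrow> wdeg (\<lambda>i. 1 + i) m \<le> wdeg (\<lambda>i. 1 + i) N"
      using ex_max_wdeg[OF \<open>R \<noteq> 0\<close>, of "\<lambda>i. 1 + i"] by blast
    have "tdeg N = D"
      by (rule tdeg_leading_semi_invariant[OF R(1) _ N, of "\<lambda>i. (theta ^^ i) 0"])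
         (use R(4) in \<open>simp_all add: jet_form_def[of \<gamma> 0] power_single del: single_one\<close>)
    thus False using R(2) N(1) by auto
  qed
  thus ?thesis using R(3) by simp
qed

theorem diff_alg_imp_rational_solution:
  assumes \<delta>: "\<delta> \<in> ratfun" "\<delta> \<noteq> 0" and G: "dil G = \<gamma> * G + \<delta>" "diff_alg G"
  obtains p where "p \<in> ratfun" "dil p = \<gamma> * p + \<delta>"
proof -
  define w where "w = (\<lambda>i. jet_form \<gamma> i + single 0 ((theta ^^ i) \<delta>))"
  obtain D R where D: "D > 0" and R: "coeffs_in ratfun R" "\<forall>m\<in>keys R. tdeg m < D"
      "poly_subst dil R w + w 0^D = single 0 (\<gamma>^D) * R + single (single 0 D) (\<gamma>^D)"
    unfolding w_def by (rule ex_monic_semi_invariant[OF \<delta>(1) G]) (rule that[unfolded w_def]; assumption)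
  obtain n where n: "D = Suc n" using D gr0_conv_Suc by blast
  define H where "H = homog_part (\<lambda>_. 1) n R"
  have subst_H: "poly_subst dil H (jet_form \<gamma>) = homog_part (\<lambda>_. 1) n (poly_subst dil R w)"
    using R(2) unfolding H_def w_def
    by (intro homog_part_poly_subst[symmetric] leading_form_jet_form) (simp add: n less_Suc_eq_le)
  have w0: "w 0 = single (var_exp 0) \<gamma> + single 0 \<delta>" by (simp add: w_def jet_form_def)
  have coeff: "lookup (poly_subst dil H (jet_form \<gamma>)) N + (if N = single 0 n then of_nat D * \<gamma>^n * \<delta> else 0) =
      \<gamma>^D * lookup H N" if "tdeg N = n" for N
  proof -
    have "tdeg (single 0 D) \<noteq> tdeg N" using that by (simp add: n)
    hence "single 0 D \<noteq> N" by blast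
    thus ?thesis using arg_cong[OF R(3), of "\<lambda>p. lookup p N"] lookup_affine_var_power[OF that, of \<gamma> \<delta>] that
      unfolding subst_H w0 n
      by (simp add: lookup_homog_part H_def lookup_add lookup_const_mult lookup_single when_def)
  qed
  have D\<delta>: "of_nat D * \<gamma>^n * \<delta> \<noteq> 0" using \<delta>(2) \<gamma>(2) D by simp
  have "H \<noteq> 0" using coeff[of "single 0 n"] D\<delta> by auto
  then obtain N where N: "N \<in> keys H" "\<And>m. m \<in> keys H \<Longrightarrow> wdeg (\<lambda>i. 1 + i) m \<le> wdeg (\<lambda>i. 1 + i) N"
    using ex_max_wdeg[of H "\<lambda>i. 1 + i"] by blast
  define c where "c = lookup H N"
  have degN: "tdeg N = n" using N(1) by (simp add: H_def keys_homog_part)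
  have c: "c \<in> ratfun" "c \<noteq> 0" using N(1) R(1) by (auto simp: c_def in_keys_iff H_def lookup_homog_part coeffs_in_def)
  have lead: "leading_form (\<lambda>i. 1 + i) (1 + i) (jet_form \<gamma> i) (single (var_exp i) \<gamma>)" for i
    using leading_form_jet_form_weighted[of 1 i \<gamma> 0] by simp
  have eq: "dil c * \<gamma>^n + (if N = single 0 n then of_nat D * \<gamma>^n * \<delta> else 0) = \<gamma>^D * c"
    using coeff[OF degN] lookup_poly_subst_top[OF lead N(2), where \<sigma> = dil]
    by (simp add: c_def moneval_const degN)
  have "N = single 0 n"
    using non_telescoping_degree[OF nt \<gamma>(2) c, of n D] eq n by (auto split: if_splits)
  hence "\<gamma>^n * (dil c + of_nat D * \<delta>) = \<gamma>^n * (\<gamma> * c)" using eq by (simp add: n algebra_simps)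
  hence "dil c + of_nat D * \<delta> = \<gamma> * c" using \<gamma>(2) by simp
  hence "dil (- (c / of_nat D)) = \<gamma> * (- (c / of_nat D)) + \<delta>"
    using D by (simp add: \<sigma>_uminus \<sigma>_divide \<sigma>_of_nat field_simps)
  moreover have "- (c / of_nat D) \<in> ratfun" by (intro rat.uminus_in rat.divide_in rat.of_nat_in c)
  ultimately show thesis by (rule that[rotated])
qed

end

end

section \<open>Products of linear factors\<close>

definition linprod :: "complex list \<Rightarrow> complex fls" where
  "linprod zs = (\<Prod>z\<leftarrow>zs. lin z)"

lemma linprod_Nil [simp]: "linprod [] = 1"
  and linprod_Cons [simp]: "linprod (z # zs) = lin z * linprod zs"
  by (simp_all add: linprod_def)

lemma linprod_nz [simp]: "linprod zs \<noteq> 0"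
  by (induction zs) auto

lemma linprod_ratfun: "linprod zs \<in> ratfun"
  by (induction zs) (auto intro: rat.mult_in rat.one_in lin_ratfun)

lemma has_value_linprod: "has_value z (linprod zs) (\<Prod>w\<leftarrow>zs. z - w)"
  using has_value_const[of z 1] by (induction zs) (auto intro: has_value_mult has_value_lin)

lemma linprod_remove: "linprod zs = lin z^count_list zs z * linprod (filter (\<lambda>w. w \<noteq> z) zs)"
  by (induction zs) (auto simp flip: Suc_eq_plus1)

definition lin_ratio :: "complex \<Rightarrow> complex list \<Rightarrow> complex list \<Rightarrow> complex fls" where
  "lin_ratio c ns ds = fls_const c * linprod ns / linprod ds"

lemma lin_ratio_ratfun: "lin_ratio c ns ds \<in> ratfun"
  unfolding lin_ratio_def by (intro rat.divide_in rat.mult_in ratfun_const linprod_ratfun)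

lemma lin_ratio_nz: "c \<noteq> 0 \<Longrightarrow> lin_ratio c ns ds \<noteq> 0"
  by (simp add: lin_ratio_def)

lemma lin_ratio_pole:
  assumes "count_list ns z \<le> count_list ds z"
  obtains v where "has_value z (lin_ratio c ns ds * lin z^(count_list ds z - count_list ns z)) v"
    "c \<noteq> 0 \<Longrightarrow> v \<noteq> 0"
proof -
  let ?ns = "filter (\<lambda>w. w \<noteq> z) ns" and ?ds = "filter (\<lambda>w. w \<noteq> z) ds"
  define k where "k = count_list ds z - count_list ns z"
  have "lin z^count_list ds z = lin z^k * lin z^count_list ns z" using assms by (simp add: k_def flip: power_add)
  hence "lin_ratio c ns ds * lin z^k = fls_const c * linprod ?ns * inverse (linprod ?ds)"
    unfolding lin_ratio_def linprod_remove[of ns z] linprod_remove[of ds z] by (simp add: field_simps)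
  moreover have "(\<Prod>w\<leftarrow>?ds. z - w) \<noteq> 0" "(\<Prod>w\<leftarrow>?ns. z - w) \<noteq> 0" by (auto simp: prod_list_zero_iff)
  ultimately show thesis
    using that[of "c * (\<Prod>w\<leftarrow>?ns. z - w) * inverse (\<Prod>w\<leftarrow>?ds. z - w)", folded k_def]
    by (auto intro!: has_value_mult has_value_const has_value_linprod has_value_inverse)
qed

lemma pole_eq_lin_ratio:
  "c \<noteq> 0 \<Longrightarrow> count_list ns z \<le> count_list ds z \<Longrightarrow>
    pole_eq z (count_list ds z - count_list ns z) (lin_ratio c ns ds)"
  unfolding pole_eq_def by (rule lin_ratio_pole[of ns z ds c]) auto

lemma pole_le_lin_ratio: "pole_le z (count_list ds z) (lin_ratio c ns ds)"
proof -
  obtain v where "has_value z (lin_ratio 1 [] ds * lin z^count_list ds z) v"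
    by (rule lin_ratio_pole[of "[]" z ds 1]) auto
  hence "has_value z (fls_const c * linprod ns * (lin_ratio 1 [] ds * lin z^count_list ds z))
      (c * (\<Prod>w\<leftarrow>ns. z - w) * v)"
    by (intro has_value_mult has_value_const has_value_linprod)
  thus ?thesis unfolding pole_le_def by (auto simp: lin_ratio_def mult_ac)
qed

definition dlog :: "complex \<Rightarrow> complex fls" where
  "dlog z = fls_X / lin z"

lemma dlog_lin_ratio: "dlog z = lin_ratio 1 [0] [z]"
  by (simp add: dlog_def lin_ratio_def lin_eq)

lemma dlog_ratfun: "dlog z \<in> ratfun"
  unfolding dlog_lin_ratio by (rule lin_ratio_ratfun)

lemma dlog_nth: "z \<noteq> 0 \<Longrightarrow> n \<le> 0 \<Longrightarrow> fls_nth (dlog z) n = 0"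
proof -
  assume "z \<noteq> 0" "n \<le> 0"
  hence "fls_subdegree (lin z) = 0"
    unfolding lin_def toR_def fls_subdegree_fls_to_fps by (simp add: subdegree_eq_0)
  hence "fls_subdegree (dlog z) = 1" unfolding dlog_def by (subst fls_divide_subdegree) auto
  thus ?thesis using \<open>n \<le> 0\<close> by simp
qed

lemma theta_log_mult:
  "f \<noteq> 0 \<Longrightarrow> g \<noteq> 0 \<Longrightarrow> theta (f * g) / (f * g) = theta f / f + theta g / g"
  by (simp add: theta_mult field_simps)

lemma theta_log_linprod: "theta (linprod zs) / linprod zs = (\<Sum>z\<leftarrow>zs. dlog z)"
  by (induction zs) (simp_all add: theta_log_mult theta_lin dlog_def)

lemma theta_log_lin_ratio:
  assumes "c \<noteq> 0"
  shows "theta (lin_ratio c ns ds) / lin_ratio c ns ds = (\<Sum>z\<leftarrow>ns. dlog z) - (\<Sum>z\<leftarrow>ds. dlog z)"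
proof -
  have "lin_ratio c ns ds * linprod ds = fls_const c * linprod ns" by (simp add: lin_ratio_def)
  moreover have "theta (fls_const c * linprod ns) / (fls_const c * linprod ns) = (\<Sum>z\<leftarrow>ns. dlog z)"
    using assms by (simp add: theta_mult flip: theta_log_linprod)
  ultimately show ?thesis
    using theta_log_mult[OF lin_ratio_nz[OF assms] linprod_nz, of ns ds ds] by (simp add: theta_log_linprod)
qed

lemma theta_log_lin_ratio_nth:
  assumes "c \<noteq> 0" "0 \<notin> set ns" "0 \<notin> set ds" "n \<le> 0"
  shows "fls_nth (theta (lin_ratio c ns ds) / lin_ratio c ns ds) n = 0"
proof -
  have "fls_nth (\<Sum>z\<leftarrow>zs. dlog z) n = 0" if "0 \<notin> set zs" for zs
    using that assms(4) dlog_nth by (induction zs) auto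
  thus ?thesis using assms by (simp add: theta_log_lin_ratio)
qed

context q_dilation
begin

lemma isolated_pole_lin_ratio:
  assumes "c \<noteq> 0" "z0 \<noteq> 0" "count_list ns z0 < count_list ds z0"
    and "\<And>n. n \<noteq> 0 \<Longrightarrow> count_list ds (z0 * q powi n) + count_list ns z0 < count_list ds z0"
  obtains k where "isolated_pole z0 k (lin_ratio c ns ds)"
proof
  let ?k = "count_list ds z0 - count_list ns z0"
  have "pole_le (z0 * q powi n) (?k - 1) (lin_ratio c ns ds)" if "n \<noteq> 0" for n
    using assms(4)[OF that] by (intro pole_le_mono[OF pole_le_lin_ratio]) simp
  thus "isolated_pole z0 ?k (lin_ratio c ns ds)"
    using assms(1-3) by (auto simp: isolated_pole_def intro: pole_eq_lin_ratio)
qed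

lemma dil_lin: "dil (lin z) = fls_const q * lin (z / q)"
  by (simp add: lin_eq \<sigma>_diff right_diff_distrib)

lemma dil_dlog: "dil (dlog (q * z)) = dlog z"
  by (simp add: dlog_def \<sigma>_divide dil_lin)

definition in_orbit :: "complex \<Rightarrow> complex \<Rightarrow> bool" where
  "in_orbit z0 z \<longleftrightarrow> (\<exists>n::int. z = z0 * q powi n)"

lemma in_orbit_refl [simp]: "in_orbit z z"
  unfolding in_orbit_def by (rule exI[of _ 0]) simp

lemma in_orbit_q_mult [simp]: "in_orbit z0 (q * z) \<longleftrightarrow> in_orbit z0 z"
proof
  assume "in_orbit z0 z"
  then obtain n where "z = z0 * q powi n" by (auto simp: in_orbit_def)
  thus "in_orbit z0 (q * z)" unfolding in_orbit_def using q_mult_orbit by blast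
next
  assume "in_orbit z0 (q * z)"
  then obtain n where "q * z = q * (z0 * q powi (n - 1))" unfolding in_orbit_def q_mult_orbit by auto
  thus "in_orbit z0 z" unfolding in_orbit_def mult_cancel_left using q_nz by blast
qed

lemma in_orbit_sym: "in_orbit z0 z \<Longrightarrow> in_orbit z z0"
  unfolding in_orbit_def by (elim exE, rule_tac x = "- n" in exI) (simp add: power_int_minus)

lemma dlog_orbit:
  assumes "in_orbit z0 z"
  shows "\<exists>H\<in>ratfun. dlog z = dlog z0 + (dil H - H)"
proof -
  have step: "dlog (z0 * q powi n) = dil (dlog (z0 * q powi (n + 1)))" for n
    using dil_dlog[of "z0 * q powi n"] by (simp add: q_mult_orbit)
  have "\<exists>H\<in>ratfun. dlog (z0 * q powi n) = dlog z0 + (dil H - H)" for n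
  proof (induction n rule: int_induct[where k = 0])
    case base
    show ?case by (rule bexI[of _ 0]) (auto simp: rat.zero_in)
  next
    case (step1 n)
    then obtain H where "H \<in> ratfun" "dlog (z0 * q powi n) = dlog z0 + (dil H - H)" by blast
    thus ?case using step[of n]
      by (intro bexI[of _ "H - dlog (z0 * q powi (n + 1))"]) (auto simp: \<sigma>_diff intro: rat.diff_in dlog_ratfun)
  next
    case (step2 n)
    then obtain H where H: "H \<in> ratfun" "dlog (z0 * q powi n) = dlog z0 + (dil H - H)" by blast
    define K where "K = dlog (z0 * q powi n)"
    have "dlog (z0 * q powi (n - 1)) = dlog z0 + (dil (H + K) - (H + K))"
      using step[of "n - 1"] H(2) by (simp add: dil_add \<sigma>_diff K_def[symmetric])
    thus ?case by (intro bexI[of _ "H + K"]) (auto simp: K_def intro: rat.add_in H(1) dlog_ratfun)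
  qed
  thus ?thesis using assms by (auto simp: in_orbit_def)
qed

lemma dlog_sum_orbit:
  "\<exists>S H. H \<in> ratfun \<and> (\<forall>n. pole_le (z0 * q powi n) 0 S) \<and>
    (\<Sum>z\<leftarrow>zs. dlog z) = of_nat (length (filter (in_orbit z0) zs)) * dlog z0 + S + (dil H - H)"
proof (induction zs)
  case Nil
  show ?case by (rule exI[of _ 0], rule exI[of _ 0]) (auto simp: rat.zero_in pole_le_0)
next
  case (Cons z zs)
  then obtain S H where SH: "H \<in> ratfun" "\<And>n. pole_le (z0 * q powi n) 0 S"
    "(\<Sum>z\<leftarrow>zs. dlog z) = of_nat (length (filter (in_orbit z0) zs)) * dlog z0 + S + (dil H - H)" by blast
  show ?case
  proof (cases "in_orbit z0 z")
    case True
    then obtain K where K: "K \<in> ratfun" "dlog z = dlog z0 + (dil K - K)" using dlog_orbit by blast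
    show ?thesis
    proof (intro exI conjI allI)
      show "K + H \<in> ratfun" using K SH by (intro rat.add_in)
      show "(\<Sum>z\<leftarrow>z # zs. dlog z) = of_nat (length (filter (in_orbit z0) (z # zs))) * dlog z0 + S + (dil (K + H) - (K + H))"
        using True by (simp add: SH(3) K(2) dil_add algebra_simps)
    qed (rule SH)
  next
    case False
    have "pole_le (z0 * q powi n) 0 (dlog z)" for n
      using pole_le_lin_ratio[of "z0 * q powi n" "[z]" 1 "[0]"] False
      by (auto simp: dlog_lin_ratio in_orbit_def split: if_splits)
    thus ?thesis using False SH
      by (intro exI[of _ "dlog z + S"] exI[of _ H]) (auto intro: pole_le_add)
  qed
qed

theorem non_telescoping_lin_ratio:
  assumes "c \<noteq> 0" "z0 \<noteq> 0" and len: "length (filter (in_orbit z0) ns) \<noteq> length (filter (in_orbit z0) ds)"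
  shows "non_telescoping (theta (lin_ratio c ns ds) / lin_ratio c ns ds)"
proof -
  obtain S1 H1 where 1: "H1 \<in> ratfun" "\<And>n. pole_le (z0 * q powi n) 0 S1"
    "(\<Sum>z\<leftarrow>ns. dlog z) = of_nat (length (filter (in_orbit z0) ns)) * dlog z0 + S1 + (dil H1 - H1)"
    using dlog_sum_orbit by blast
  obtain S2 H2 where 2: "H2 \<in> ratfun" "\<And>n. pole_le (z0 * q powi n) 0 S2"
    "(\<Sum>z\<leftarrow>ds. dlog z) = of_nat (length (filter (in_orbit z0) ds)) * dlog z0 + S2 + (dil H2 - H2)"
    using dlog_sum_orbit by blast
  define e :: complex where "e = of_nat (length (filter (in_orbit z0) ns)) - of_nat (length (filter (in_orbit z0) ds))"
  have "e \<noteq> 0" using len by (simp add: e_def)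
  have S: "pole_le (z0 * q powi n) 0 (S1 - S2)" for n using 1(2) 2(2) by (intro pole_le_diff)
  have "isolated_pole z0 1 (fls_const e * dlog z0 + (S1 - S2))"
    unfolding isolated_pole_def
  proof (intro conjI allI impI)
    show "pole_eq z0 1 (fls_const e * dlog z0 + (S1 - S2))"
      using pole_eq_lin_ratio[of 1 "[0]" z0 "[z0]"] \<open>e \<noteq> 0\<close> \<open>z0 \<noteq> 0\<close> S[of 0]
      by (intro pole_eq_add[where j = 0] pole_eq_cmult) (simp_all add: dlog_lin_ratio)
    fix n :: int assume "n \<noteq> 0"
    hence "pole_le (z0 * q powi n) 0 (dlog z0)"
      using pole_le_lin_ratio[of "z0 * q powi n" "[z0]" 1 "[0]"] orbit_neq[OF \<open>z0 \<noteq> 0\<close>, of n]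
      by (simp add: dlog_lin_ratio)
    thus "pole_le (z0 * q powi n) (1 - 1) (fls_const e * dlog z0 + (S1 - S2))"
      using S by (intro pole_le_add) (auto intro: pole_le_cmult)
  qed (use \<open>z0 \<noteq> 0\<close> in auto)
  moreover have "theta (lin_ratio c ns ds) / lin_ratio c ns ds =
      fls_const e * dlog z0 + (S1 - S2) + (dil (H1 - H2) - (H1 - H2))"
    unfolding theta_log_lin_ratio[OF assms(1)] 1(3) 2(3)
    by (simp add: e_def \<sigma>_diff fls_of_nat algebra_simps flip: fls_minus_const)
  ultimately show ?thesis using 1(1) 2(1)
    by (metis non_telescoping_coboundary isolated_pole_non_telescoping rat.diff_in)
qed

theorem first_order_not_diff_alg:
  assumes c: "c \<noteq> 0" "0 \<notin> set ns" "0 \<notin> set ds"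
    and z0: "z0 \<noteq> 0" "length (filter (in_orbit z0) ns) \<noteq> length (filter (in_orbit z0) ds)"
    and g: "dil g = lin_ratio c ns ds * g + \<delta>" "g \<noteq> 0" and \<delta>: "\<delta> \<in> ratfun"
    and no_sol: "\<And>p. \<delta> \<noteq> 0 \<Longrightarrow> p \<in> ratfun \<Longrightarrow> dil p \<noteq> lin_ratio c ns ds * p + \<delta>"
  shows "\<not> diff_alg g"
proof
  assume "diff_alg g"
  note \<gamma> = lin_ratio_ratfun lin_ratio_nz[OF c(1)] non_telescoping_lin_ratio[OF c(1) z0]
    theta_log_lin_ratio_nth[OF c]
  show False
  proof (cases "\<delta> = 0")
    case True
    thus False using diff_alg_homogeneous_imp_0[OF \<gamma>] g \<open>diff_alg g\<close> by simp
  next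
    case False
    thus False using diff_alg_imp_rational_solution[OF \<gamma> \<delta> False g(1) \<open>diff_alg g\<close>] no_sol by blast
  qed
qed

text \<open>When \<open>\<gamma>\<close> is a multiple of \<open>\<sigma> W / W\<close>, a change of unknown makes the coefficient constant.\<close>

lemma gauge_not_diff_alg:
  assumes g: "dil g = \<gamma> * g + \<delta>" and W: "W \<in> ratfun" "W \<noteq> 0" "\<gamma> * W = fls_const \<mu> * dil W" and "\<mu> \<noteq> 0"
    and V: "V \<in> ratfun" and \<delta>: "\<delta> \<in> ratfun"
    and iso: "isolated_pole z0 k (\<delta> / dil W + dil V - fls_const \<mu> * V)"
  shows "\<not> diff_alg g"
proof
  assume "diff_alg g"
  define G where "G = g / W + V"
  have "g = W * G + - (W * V)" using W(2) by (simp add: G_def field_simps)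
  hence "diff_alg G"
    by (rule diff_alg_affine[OF \<open>diff_alg g\<close>]) (auto intro!: rat.uminus_in rat.mult_in W V)
  have "dil W \<noteq> 0" using W(2) by (simp add: \<sigma>_eq_0_iff)
  have "dil G = \<gamma> * W * (g / W) / dil W + \<delta> / dil W + dil V"
    using W(2) by (simp add: G_def dil_add \<sigma>_divide g add_divide_distrib)
  also have "... = fls_const \<mu> * (g / W) + \<delta> / dil W + dil V" using \<open>dil W \<noteq> 0\<close> by (simp add: W(3))
  also have "... = fls_const \<mu> * G + (\<delta> / dil W + dil V - fls_const \<mu> * V)" by (simp add: G_def algebra_simps)
  finally show False
    using isolated_pole_not_diff_alg[OF _ \<open>\<mu> \<noteq> 0\<close> _ iso] \<open>diff_alg G\<close> W V \<delta>
    by (blast intro: rat.add_in rat.diff_in rat.divide_in rat.mult_in ratfun_const dil_ratfun)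
qed

end

section \<open>Absence of rational solutions\<close>

lemma ratfun_regular_imp_poly:
  assumes "p \<in> ratfun" "\<And>z. pole_le z 0 p"
  obtains N where "p = toR N"
proof -
  define quot where "quot n \<longleftrightarrow> (\<exists>N D. D \<noteq> 0 \<and> p * toR D = toR N \<and> degree D = n)" for n
  have "\<exists>n. quot n" using assms(1) by (auto simp: ratfun_def quot_def)
  then obtain n where n: "quot n" "\<And>m. m < n \<Longrightarrow> \<not> quot m" by (metis exists_least_iff)
  then obtain N D where D: "D \<noteq> 0" "p * toR D = toR N" "degree D = n" by (auto simp: quot_def)
  have "degree D = 0"
  proof (rule ccontr)
    assume "degree D \<noteq> 0"
    then obtain z where z: "poly D z = 0" using alg_closed_imp_poly_has_root[of D] by auto
    obtain v where "has_value z p v" using assms(2)[of z] by (auto simp: pole_le_0_iff)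
    from has_value_mult[OF this has_value_toR[of z D]] have "has_value z (toR N) 0" by (simp add: D(2) z)
    hence "poly N z = 0" using has_value_unique[OF has_value_toR] by blast
    then obtain N1 D1 where 1: "N = [:-z, 1:] * N1" "D = [:-z, 1:] * D1"
      using z by (metis poly_eq_0_iff_dvd dvdE)
    hence "lin z * (p * toR D1) = lin z * toR N1" using D(2) by (simp only: toR_mult lin_def mult_ac)
    hence "p * toR D1 = toR N1" by (simp only: mult_cancel_left lin_nz simp_thms)
    moreover have "D1 \<noteq> 0" using D(1) 1 by auto
    moreover have "degree D1 < n" unfolding D(3)[symmetric] 1(2) using \<open>D1 \<noteq> 0\<close> by (subst degree_mult_eq) auto
    ultimately show False using n(2) by (auto simp: quot_def)
  qed
  then obtain d where d: "D = [:d:]" by (rule degree_eq_zeroE)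
  hence "p * fls_const d = toR N" "d \<noteq> 0" using D(1,2) by (auto simp: toR_const)
  hence "p = toR (smult (1 / d) N)"
    by (simp add: toR_smult mult.left_commute flip: \<open>p * fls_const d = toR N\<close>)
  thus thesis by (rule that)
qed

lemma ratfun_regular_off_0:
  assumes p: "p \<in> ratfun" "\<And>z. z \<noteq> 0 \<Longrightarrow> pole_le z 0 p"
  obtains N k where "p * fls_X^k = toR N" "k = 0 \<or> poly N 0 \<noteq> 0"
proof -
  define k where "k = pole_order 0 p"
  have X: "lin 0 = fls_X" by (simp add: lin_eq)
  obtain v where v: "has_value 0 (p * fls_X^k) v" "k = 0 \<or> v \<noteq> 0"
  proof (cases "k = 0")
    case True
    with pole_order_0D[OF p(1), of 0] that show ?thesis by (auto simp: k_def pole_le_0_iff)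
  next
    case False
    with pole_order_eq[OF p(1), of 0] that show ?thesis
      by (auto simp: k_def pole_eq_def X One_nat_def)
  qed
  have "pole_le z 0 (p * fls_X^k)" for z
  proof (cases "z = 0")
    case True
    thus ?thesis using v(1) by (auto simp: pole_le_0_iff)
  next
    case False
    thus ?thesis using p(2) has_value_power[OF has_value_X, of z k]
      by (auto simp: pole_le_0_iff intro: has_value_mult)
  qed
  then obtain N where N: "p * fls_X^k = toR N"
    using ratfun_regular_imp_poly[OF rat.mult_in[OF p(1) rat.power_in[OF ratfun_X]]] by blast
  have "poly N 0 = v" using has_value_unique[OF has_value_toR v(1)[unfolded N]] .
  thus thesis using that[OF N] v(2) by blast
qed

context q_dilation
begin

text \<open>At the leftmost pole of \<open>p\<close> on an orbit \<open>\<sigma> p\<close> has a pole one step to the left, which must be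
  compensated by a zero of \<open>a\<close>; at the rightmost one, the pole of \<open>p\<close> by a zero of \<open>b\<close>.\<close>

lemma regular_on_orbit:
  assumes p: "p \<in> ratfun" and eq: "toR a * dil p = toR b * p + toR e" and z: "z \<noteq> 0"
    and chain: "\<And>m n. m < n \<Longrightarrow> poly a (z * q powi m) = 0 \<Longrightarrow> poly b (z * q powi n) \<noteq> 0"
  shows "pole_le (z * q powi n) 0 p"
proof (rule ccontr)
  assume "\<not> pole_le (z * q powi n) 0 p"
  define P where "P n = pole_order (z * q powi n) p" for n
  note orbit = pole_order_orbit[where z = z, OF p, folded P_def]
  have "1 \<le> P n" using \<open>\<not> pole_le _ 0 p\<close> pole_order_0D[OF p] unfolding P_def by (metis less_one not_le)
  then obtain n0 n1 where n: "n0 \<le> n1" "1 \<le> P n0" "P (n0 - 1) < 1" "1 \<le> P n1" "P (n1 + 1) < 1"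
    using interval_of_large_values[of P 1 n] finite_orbit_poles[OF p z] unfolding P_def by blast
  have poly_mult: "pole_eq u (0 + k) (toR c * f)" if "poly c u \<noteq> 0" "pole_eq u k f" for u k c f
    using pole_eq_mult[OF pole_eq_0I[OF has_value_toR that(1)] that(2)] .
  have "poly a (z * q powi (n0 - 1)) = 0"
  proof (rule ccontr)
    assume "poly a (z * q powi (n0 - 1)) \<noteq> 0"
    hence "pole_eq (z * q powi (n0 - 1)) (P n0) (toR b * p + toR e)"
      using poly_mult[OF _ orbit(4)[of "n0 - 1"]] n(2) by (simp flip: eq)
    moreover have "pole_le (z * q powi (n0 - 1)) 0 (toR b * p + toR e)"
      using pole_le_mult[OF pole_le_toR orbit(1)[of "n0 - 1"]] n(3) by (intro pole_le_add pole_le_toR) auto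
    ultimately show False using pole_eq_not_le n(2) by (metis less_le_trans zero_less_one)
  qed
  moreover have "poly b (z * q powi n1) = 0"
  proof (rule ccontr)
    assume "poly b (z * q powi n1) \<noteq> 0"
    hence "pole_eq (z * q powi n1) (P n1) (toR a * dil p - toR e)"
      using poly_mult[OF _ orbit(3)[of n1]] n(4) by (simp add: eq)
    moreover have "pole_le (z * q powi n1) 0 (toR a * dil p - toR e)"
      using pole_le_mult[OF pole_le_toR orbit(2)[of n1]] n(5) by (intro pole_le_diff pole_le_toR) auto
    ultimately show False using pole_eq_not_le n(4) by (metis less_le_trans zero_less_one)
  qed
  ultimately show False using chain[of "n0 - 1" n1] n(1) by simp
qed

lemma common_zero_no_rational_solution:
  assumes p: "p \<in> ratfun" and eq: "toR a * dil p = toR b * p + toR e" and z: "z \<noteq> 0"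
    and chain: "\<And>n. poly a (z * q powi n) = 0 \<Longrightarrow> n \<ge> 0" "\<And>n. poly b (z * q powi n) = 0 \<Longrightarrow> n \<le> 0"
    and zero: "poly a z = 0" "poly b z = 0" "poly e z \<noteq> 0"
  shows False
proof -
  have reg: "pole_le (z * q powi n) 0 p" for n
    by (rule regular_on_orbit[OF p eq z]) (use chain in fastforce)
  obtain v w where v: "has_value z p v" "has_value (q * z) p w"
    using reg[of 0] reg[of 1] by (auto simp: pole_le_0_iff mult.commute)
  have "has_value z (toR a * dil p) 0"
    using has_value_mult[OF has_value_toR has_value_dil[OF v(2)], of a] zero(1) by simp
  moreover have "has_value z (toR b * p + toR e) (poly e z)"
    using has_value_add[OF has_value_mult[OF has_value_toR v(1), of b] has_value_toR] zero(2) by simp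
  ultimately show False using has_value_unique zero(3) unfolding eq by metis
qed

lemma regular_solution_const:
  assumes m: "m \<in> ratfun" "\<And>z. z \<noteq> 0 \<Longrightarrow> pole_le z 0 m" and eq: "toR a * dil m = toR b * m + toR e"
    and deg: "degree a = d" "degree b = d" "degree e \<le> d"
    and zero: "\<And>k. k \<ge> 1 \<Longrightarrow> poly a 0 \<noteq> q^k * poly b 0"
    and inf: "\<And>n. n \<ge> 1 \<Longrightarrow> lead_coeff a * q^n \<noteq> lead_coeff b"
  obtains m0 where "smult m0 a = smult m0 b + e"
proof -
  obtain N k where N: "m * fls_X^k = toR N" "k = 0 \<or> poly N 0 \<noteq> 0"
    using m by (rule ratfun_regular_off_0)
  have X: "fls_X = toR [:0, 1:]" by (simp add: toR_pCons)
  have "toR (pcompose N [:0, q:]) = fls_const (q^k) * (fls_X^k * dil m)"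
    unfolding dil_toR[symmetric] N(1)[symmetric]
    by (simp add: dil_mult \<sigma>_power power_mult_distrib mult_ac flip: fls_const_power)
  hence "toR (a * pcompose N [:0, q:]) = fls_const (q^k) * (toR a * dil m * fls_X^k)"
    by (simp only: toR_mult mult_ac)
  also have "... = fls_const (q^k) * (toR b * (m * fls_X^k) + toR e * fls_X^k)"
    unfolding eq by (simp add: distrib_left mult_ac)
  also have "... = toR (smult (q^k) (b * N + e * [:0, 1:]^k))"
    unfolding N(1) by (simp only: X toR_smult toR_add toR_mult toR_power)
  finally have poly_eq: "a * pcompose N [:0, q:] = smult (q^k) (b * N + e * [:0, 1:]^k)" by simp
  have "k = 0"
  proof (rule ccontr)
    assume k: "k \<noteq> 0"
    hence "poly a 0 * poly N 0 = q^k * poly b 0 * poly N 0"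
      using arg_cong[OF poly_eq, of "\<lambda>p. poly p 0"] by (simp add: poly_pcompose)
    thus False using zero[of k] N(2) k by (simp add: One_nat_def)
  qed
  hence poly_eq: "a * pcompose N [:0, q:] = b * N + e" using poly_eq by simp
  have "degree N = 0"
  proof (rule ccontr)
    define n where "n = degree N"
    assume "degree N \<noteq> 0"
    hence n: "n \<ge> 1" "N \<noteq> 0" by (auto simp: n_def One_nat_def)
    have comp: "degree (pcompose N [:0, q:]) = n" by (simp add: n_def degree_pcompose)
    moreover from this have "coeff (pcompose N [:0, q:]) n = q^n * coeff N n"
      using lead_coeff_comp[of "[:0, q:]" N] by (simp add: n_def)
    ultimately have "coeff (a * pcompose N [:0, q:]) (d + n) = lead_coeff a * (q^n * coeff N n)"
      using coeff_mult_degree_sum[of a "pcompose N [:0, q:]"] deg by simp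
    moreover have "coeff (b * N + e) (d + n) = lead_coeff b * coeff N n"
      using coeff_mult_degree_sum[of b N] deg n coeff_eq_0[of e "d + n"] by (simp add: n_def)
    ultimately have "lead_coeff a * q^n * coeff N n = lead_coeff b * coeff N n" by (simp add: poly_eq)
    moreover have "coeff N n \<noteq> 0" using n by (simp add: n_def)
    ultimately show False using inf[OF n(1)] by simp
  qed
  then obtain m0 where "N = [:m0:]" by (rule degree_eq_zeroE)
  thus thesis using that[of m0] poly_eq by (simp add: mult.commute)
qed

end

section \<open>The equation of the kernel curve\<close>

definition norm_near :: "real \<Rightarrow> real \<Rightarrow> complex \<Rightarrow> bool" where
  "norm_near R s z \<longleftrightarrow> s / R \<le> norm z \<and> norm z \<le> s * R"

context q_dilation
begin

text \<open>The logarithmic size of a number: multiplication by \<open>q\<close> raises it by one, so the position of a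
  number on its \<open>q\<close>-orbit is determined by any bound on its size.\<close>

definition val :: "complex \<Rightarrow> real" where
  "val z = log (norm q) (norm z)"

lemma val_mult: "z \<noteq> 0 \<Longrightarrow> w \<noteq> 0 \<Longrightarrow> val (z * w) = val z + val w"
  using q_gt1 by (simp add: val_def norm_mult log_mult)

lemma val_divide: "z \<noteq> 0 \<Longrightarrow> w \<noteq> 0 \<Longrightarrow> val (z / w) = val z - val w"
  using q_gt1 by (simp add: val_def norm_divide log_divide)

lemma val_1 [simp]: "val 1 = 0"
  and val_q [simp]: "val q = 1"
  and val_uminus [simp]: "val (- z) = val z"
  using q_gt1 by (simp_all add: val_def)

lemma val_q_powi [simp]: "val (q powi n) = of_int n"
proof -
  have "norm (q powi n) = norm q powr of_int n"
    using q_gt1 by (simp add: norm_power_int powr_real_of_int')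
  thus ?thesis using q_gt1 by (simp add: val_def)
qed

lemma q_neq: "q \<noteq> 1" "q \<noteq> -1" "q * q \<noteq> 1"
  using val_mult[of q q] val_q val_1 val_uminus[of 1] by (metis q_nz zero_neq_one one_add_one zero_neq_numeral)+

lemma in_orbit_val:
  assumes "in_orbit z0 z" "z0 \<noteq> 0"
  obtains n where "z = z0 * q powi n" "val z = val z0 + of_int n"
  using assms by (auto simp: in_orbit_def val_mult)

lemma in_orbit_imp_eq:
  assumes "in_orbit z0 z" "z0 \<noteq> 0" "\<bar>val z - val z0 - of_int n\<bar> < 1"
  shows "z = z0 * q powi n"
proof -
  obtain m where m: "z = z0 * q powi m" "val z = val z0 + of_int m" using assms(1,2) by (rule in_orbit_val)
  hence "\<bar>of_int (m - n) :: real\<bar> < 1" using assms(3) by simp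
  hence "\<bar>m - n\<bar> < 1" by (metis of_int_abs of_int_less_1_iff)
  thus ?thesis using m(1) by simp
qed

lemma not_in_orbit:
  assumes "z0 \<noteq> 0" "of_int n < val z - val z0" "val z - val z0 < of_int n + 1"
  shows "\<not> in_orbit z0 z"
proof
  assume "in_orbit z0 z"
  then obtain m where "val z = val z0 + of_int m" using assms(1) by (rule in_orbit_val)
  hence "(of_int n :: real) < of_int m" "(of_int m :: real) < of_int (n + 1)" using assms by auto
  thus False unfolding of_int_less_iff by linarith
qed

definition near :: "real \<Rightarrow> complex \<Rightarrow> bool" where
  "near s z \<longleftrightarrow> z \<noteq> 0 \<and> s - 1/8 < val z \<and> val z < s + 1/8"

lemma nearI:
  assumes q: "q = h^2" and R: "R \<ge> 1" "R^4 < norm h"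
    and z: "norm_near R (norm q powr s) z"
  shows "near s z"
proof -
  define \<rho> where "\<rho> = log (norm q) R"
  have "0 < norm q powr s / R" using R q_gt1 by simp
  hence "z \<noteq> 0" using z by (auto simp: norm_near_def)
  have "R^8 < norm q" using power_strict_mono[OF R(2), of 2] R(1) by (simp add: q norm_power flip: power_mult)
  hence "log (norm q) (R^8) < log (norm q) (norm q)" using q_gt1 R by (subst log_less_cancel_iff) auto
  hence "\<rho> < 1/8" using q_gt1 R by (simp add: \<rho>_def log_nat_power)
  moreover have "log (norm q) (norm q powr s / R) \<le> val z" "val z \<le> log (norm q) (norm q powr s * R)"
    using z R q_gt1 \<open>z \<noteq> 0\<close> unfolding val_def norm_near_def by (auto intro!: log_mono)
  moreover have "log (norm q) (norm q powr s / R) = s - \<rho>" "log (norm q) (norm q powr s * R) = s + \<rho>"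
    using R q_gt1 by (simp_all add: \<rho>_def log_divide log_mult)
  ultimately show ?thesis unfolding near_def using \<open>z \<noteq> 0\<close> by linarith
qed

definition curve_eq :: "complex \<Rightarrow> complex \<Rightarrow> complex \<Rightarrow> complex \<Rightarrow> complex \<Rightarrow> complex fls \<Rightarrow> bool" where
  "curve_eq p1 p2 r1 r2 c g \<longleftrightarrow>
      toR ([:-p1, 1:] * [:-p2, 1:] * [:1, -r1:] * [:1, -r2:]) * dil g =
        toR ([:1, -p1:] * [:1, -p2:] * [:-r1, 1:] * [:-r2, 1:]) * g +
        fls_const c * fls_X * toR ([:1, -p1:] * [:1, -p2:] - [:-p1, 1:] * [:-p2, 1:])"

lemma toR_reflected_lin:
  assumes "p \<noteq> 0" shows "toR [:1, -p:] = fls_const (-p) * lin (1 / p)"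
proof -
  have "[:1, -p:] = smult (-p) [:-(1 / p), 1:]" using assms by simp
  thus ?thesis unfolding lin_def by (simp only: toR_smult)
qed

lemma curve_eq_linprod:
  assumes nz: "p1 \<noteq> 0" "p2 \<noteq> 0" "r1 \<noteq> 0" "r2 \<noteq> 0"
  shows "curve_eq p1 p2 r1 r2 c g \<longleftrightarrow>
    fls_const (r1 * r2) * linprod [p1, p2, 1 / r1, 1 / r2] * dil g =
      fls_const (p1 * p2) * linprod [1 / p1, 1 / p2, r1, r2] * g - fls_const (c * (1 - p1 * p2)) * linprod [0, 1, -1]"
proof -
  have "[:1, -p1:] * [:1, -p2:] - [:-p1, 1:] * [:-p2, 1:] = smult (- (1 - p1 * p2)) ([:-1, 1:] * [:1, 1:])"
    by (simp add: algebra_simps)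
  hence inhom: "toR ([:1, -p1:] * [:1, -p2:] - [:-p1, 1:] * [:-p2, 1:]) =
      - fls_const (1 - p1 * p2) * (lin 1 * lin (-1))"
    by (simp only: toR_smult toR_mult lin_def minus_minus fls_const_uminus)
  have c: "fls_const c * fls_X * (- fls_const (1 - p1 * p2) * (lin 1 * lin (-1))) =
      - (fls_const (c * (1 - p1 * p2)) * (lin 0 * (lin 1 * lin (-1))))"
    by (simp add: lin_eq[of 0] mult_ac flip: fls_const_mult_const)
  have minus: "fls_const (x * y) = fls_const (-x) * fls_const (-y)" for x y :: complex by simp
  show ?thesis
    unfolding curve_eq_def inhom c toR_mult toR_reflected_lin[OF nz(1)] toR_reflected_lin[OF nz(2)]
      toR_reflected_lin[OF nz(3)] toR_reflected_lin[OF nz(4)] lin_def[symmetric] minus[of p1] minus[of r1]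
    by (simp only: linprod_Cons linprod_Nil mult_1_right mult_1_left mult_ac diff_conv_add_uminus)
qed

lemma curve_eq_first_order:
  assumes nz: "p1 \<noteq> 0" "p2 \<noteq> 0" "r1 \<noteq> 0" "r2 \<noteq> 0"
  shows "curve_eq p1 p2 r1 r2 c g \<longleftrightarrow>
    dil g = lin_ratio (p1 * p2 / (r1 * r2)) [1 / p1, 1 / p2, r1, r2] [p1, p2, 1 / r1, 1 / r2] * g +
      lin_ratio (- (c * (1 - p1 * p2) / (r1 * r2))) [0, 1, -1] [p1, p2, 1 / r1, 1 / r2]"
proof -
  define L where "L = fls_const (r1 * r2) * linprod [p1, p2, 1 / r1, 1 / r2]"
  have "L \<noteq> 0" using nz by (simp add: L_def del: linprod_Cons)
  have ratio: "lin_ratio (x / (r1 * r2)) ns [p1, p2, 1 / r1, 1 / r2] = fls_const x * linprod ns / L" for x ns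
  proof -
    have "fls_const x = fls_const (x / (r1 * r2)) * fls_const (r1 * r2)" using nz by simp
    thus ?thesis using nz by (simp add: lin_ratio_def L_def del: linprod_Cons fls_const_mult_const)
  qed
  show ?thesis
    unfolding curve_eq_linprod[OF nz] minus_divide_left ratio L_def[symmetric] fls_const_uminus
    using \<open>L \<noteq> 0\<close> by (auto simp: field_simps simp del: linprod_Cons)
qed

theorem curve_eq_not_diff_alg:
  assumes nz: "p1 \<noteq> 0" "p2 \<noteq> 0" "r1 \<noteq> 0" "r2 \<noteq> 0" and g: "curve_eq p1 p2 r1 r2 c g" "g \<noteq> 0"
    and z0: "z0 \<noteq> 0" "length (filter (in_orbit z0) [1 / p1, 1 / p2, r1, r2]) \<noteq>
      length (filter (in_orbit z0) [p1, p2, 1 / r1, 1 / r2])"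
    and no_sol: "\<And>p. c \<noteq> 0 \<Longrightarrow> p \<in> ratfun \<Longrightarrow> \<not> curve_eq p1 p2 r1 r2 c p"
  shows "\<not> diff_alg g"
proof (rule first_order_not_diff_alg[OF _ _ _ z0 g(1)[unfolded curve_eq_first_order[OF nz]] g(2) lin_ratio_ratfun])
  fix p assume "lin_ratio (- (c * (1 - p1 * p2) / (r1 * r2))) [0, 1, -1] [p1, p2, 1 / r1, 1 / r2] \<noteq> 0" "p \<in> ratfun"
  hence "c \<noteq> 0" "p \<in> ratfun" by (auto simp: lin_ratio_def)
  thus "dil p \<noteq> lin_ratio (p1 * p2 / (r1 * r2)) [1 / p1, 1 / p2, r1, r2] [p1, p2, 1 / r1, 1 / r2] * p +
      lin_ratio (- (c * (1 - p1 * p2) / (r1 * r2))) [0, 1, -1] [p1, p2, 1 / r1, 1 / r2]"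
    using no_sol[of p] by (simp add: curve_eq_first_order[OF nz])
qed (use nz in auto)

subsection \<open>Roots in general position\<close>

text \<open>With \<open>m = n\<^sub>B p / x\<close> the equation forces \<open>m\<close> to be a Laurent polynomial, then a constant.\<close>

lemma curve_eq_cleared:
  assumes eq: "curve_eq p1 p2 r1 r2 c p"
  defines "m \<equiv> toR ([:-r1, 1:] * [:-r2, 1:]) * p / fls_X" and "c' \<equiv> c * (1 - p1 * p2)"
  shows "toR (smult q ([:-p1, 1:] * [:-p2, 1:] * [:1, -r1:] * [:1, -r2:])) * dil m =
    toR ([:-r1, q:] * [:-r2, q:] * ([:1, -p1:] * [:1, -p2:])) * m + toR ([:-r1, q:] * [:-r2, q:] * [:c', 0, -c':])"
proof -
  define a b e where "a = smult q ([:-p1, 1:] * [:-p2, 1:] * [:1, -r1:] * [:1, -r2:])"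
    and "b = [:-r1, q:] * [:-r2, q:] * ([:1, -p1:] * [:1, -p2:])"
    and "e = [:-r1, q:] * [:-r2, q:] * [:c', 0, -c':]"
  have dil_R: "dil (toR ([:-r1, 1:] * [:-r2, 1:])) = toR ([:-r1, q:] * [:-r2, q:])"
    by (simp add: dil_toR pcompose_mult pcompose_pCons algebra_simps)
  have inhom: "fls_const c * toR ([:1, -p1:] * [:1, -p2:] - [:-p1, 1:] * [:-p2, 1:]) = toR [:c', 0, -c':]"
    unfolding toR_smult[symmetric] by (simp add: c'_def algebra_simps)
  have m_X: "toR ([:-r1, 1:] * [:-r2, 1:]) * p = m * fls_X"
    unfolding m_def times_divide_eq_left by (rule nonzero_mult_div_cancel_right[symmetric]) simp
  have "toR a * dil m * fls_X = toR ([:-p1, 1:] * [:-p2, 1:] * [:1, -r1:] * [:1, -r2:]) * dil (m * fls_X)"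
    unfolding a_def toR_smult dil_mult dil_X by (simp only: mult_ac)
  also have "... = toR ([:-r1, q:] * [:-r2, q:]) *
      (toR ([:-p1, 1:] * [:-p2, 1:] * [:1, -r1:] * [:1, -r2:]) * dil p)"
    unfolding m_X[symmetric] dil_mult dil_R by (simp only: mult_ac)
  also have "... = toR ([:-r1, q:] * [:-r2, q:]) * (toR ([:1, -p1:] * [:1, -p2:]) *
      (m * fls_X) + fls_X * toR [:c', 0, -c':])"
    unfolding eq[unfolded curve_eq_def] unfolding inhom[symmetric] m_X[symmetric] toR_mult
    by (simp only: distrib_left mult_ac)
  also have "toR ([:-r1, q:] * [:-r2, q:]) * (toR ([:1, -p1:] * [:1, -p2:]) * (m * fls_X) + fls_X * toR [:c', 0, -c':]) =
      (toR b * m + toR e) * fls_X"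
    unfolding b_def e_def toR_mult by (simp only: distrib_left distrib_right mult_ac)
  finally show ?thesis unfolding a_def b_def e_def by simp
qed

lemma separated_orbit_order:
  assumes nz: "p1 \<noteq> 0" "p2 \<noteq> 0" "r1 \<noteq> 0" "r2 \<noteq> 0" "z \<noteq> 0"
    and val: "\<And>x. x \<in> {p1, p2} \<Longrightarrow> val x > -1/2" "\<And>y. y \<in> {r1, r2} \<Longrightarrow> val y < 1"
      "\<And>x y. x \<in> {p1, p2} \<Longrightarrow> y \<in> {r1, r2} \<Longrightarrow> val y < val x + 1"
    and a: "poly (smult q ([:-p1, 1:] * [:-p2, 1:] * [:1, -r1:] * [:1, -r2:])) (z * q powi k) = 0" and "k < n"
  shows "poly ([:-r1, q:] * [:-r2, q:] * ([:1, -p1:] * [:1, -p2:])) (z * q powi n) \<noteq> 0"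
proof
  define u v where "u = z * q powi k" and "v = z * q powi n"
  assume b: "poly ([:-r1, q:] * [:-r2, q:] * ([:1, -p1:] * [:1, -p2:])) (z * q powi n) = 0"
  have le: "val v \<ge> val u + 1" using nz(5) \<open>k < n\<close> by (simp add: u_def v_def val_mult)
  have "u \<in> {p1, p2} \<or> (\<exists>y\<in>{r1, r2}. u = 1 / y)"
    using a nz unfolding u_def[symmetric] poly_smult poly_mult mult_eq_0_iff
    by (auto simp: eq_divide_eq add_eq_0_iff mult.commute)
  hence u: "(\<exists>x\<in>{p1, p2}. val u = val x) \<or> (\<exists>y\<in>{r1, r2}. val u = - val y)" using nz by (auto simp: val_divide)
  have "(\<exists>y\<in>{r1, r2}. v = y / q) \<or> (\<exists>x\<in>{p1, p2}. v = 1 / x)"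
    using b nz unfolding v_def[symmetric] poly_mult mult_eq_0_iff
    by (auto simp: eq_divide_eq add_eq_0_iff mult.commute)
  hence "(\<exists>y\<in>{r1, r2}. val v = val y - 1) \<or> (\<exists>x\<in>{p1, p2}. val v = - val x)" using nz by (auto simp: val_divide)
  moreover have "val p1 > -1/2" "val p2 > -1/2" "val r1 < 1" "val r2 < 1" "val r1 < val p1 + 1"
    "val r2 < val p1 + 1" "val r1 < val p2 + 1" "val r2 < val p2 + 1" using val(1-3) by auto
  ultimately show False using u le by auto
qed

lemma separated_roots_no_rational_solution:
  assumes nz: "p1 \<noteq> 0" "p2 \<noteq> 0" "r1 \<noteq> 0" "r2 \<noteq> 0" "c \<noteq> 0"
    and val: "\<And>x. x \<in> {p1, p2} \<Longrightarrow> val x > -1/2" "\<And>y. y \<in> {r1, r2} \<Longrightarrow> val y < 1"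
      "\<And>x y. x \<in> {p1, p2} \<Longrightarrow> y \<in> {r1, r2} \<Longrightarrow> val y < val x + 1" "val (p1 * p2) < val (r1 * r2) + 1"
    and prods: "r1 * r2 \<noteq> p1 * p2" "r1 * r2 \<noteq> q" "p1 * p2 \<noteq> 1"
    and p: "p \<in> ratfun"
  shows "\<not> curve_eq p1 p2 r1 r2 c p"
proof
  assume eq: "curve_eq p1 p2 r1 r2 c p"
  define m where "m = toR ([:-r1, 1:] * [:-r2, 1:]) * p / fls_X"
  define c' where "c' = c * (1 - p1 * p2)"
  have "c' \<noteq> 0" using nz prods by (simp add: c'_def)
  define a where "a = smult q ([:-p1, 1:] * [:-p2, 1:] * [:1, -r1:] * [:1, -r2:])"
  define b where "b = [:-r1, q:] * [:-r2, q:] * ([:1, -p1:] * [:1, -p2:])"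
  define e where "e = [:-r1, q:] * [:-r2, q:] * [:c', 0, -c':]"
  have m: "m \<in> ratfun" unfolding m_def by (intro rat.divide_in rat.mult_in ratfun_toR ratfun_X p)
  have m_eq: "toR a * dil m = toR b * m + toR e"
    unfolding a_def b_def e_def m_def c'_def by (rule curve_eq_cleared[OF eq])
  have chain: "poly b (z * q powi n) \<noteq> 0" if "poly a (z * q powi k) = 0" "k < n" "z \<noteq> 0" for z k n
    unfolding b_def by (rule separated_orbit_order[OF nz(1-4) that(3) val(1-3) that(1)[unfolded a_def] that(2)])
  obtain m0 where "smult m0 a = smult m0 b + e"
  proof (rule regular_solution_const[OF m _ m_eq])
    show "pole_le z 0 m" if "z \<noteq> 0" for z
      using regular_on_orbit[OF m m_eq that, of 0] chain[OF _ _ that] by auto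
    have "r1 * r2 * q^n \<noteq> p1 * p2" for n
    proof (cases "n = 0")
      case False
      have "val (r1 * r2 * q^n) = val (r1 * r2) + real n"
        using val_mult[of "r1 * r2" "q^n"] val_q_powi[of "int n"] nz by simp
      moreover have "real n \<ge> 1" using False by simp
      ultimately show ?thesis using val(4) by auto
    qed (use prods in simp)
    hence shift: "q * (r1 * r2) * q^n \<noteq> q^2 * (p1 * p2)" "q * (p1 * p2) \<noteq> q^n * (r1 * r2)" if "n \<ge> 1" for n
      using that by (cases n; auto simp: One_nat_def power2_eq_square mult_ac)+
    thus "k \<ge> 1 \<Longrightarrow> poly a 0 \<noteq> q^k * poly b 0" "n \<ge> 1 \<Longrightarrow> lead_coeff a * q^n \<noteq> lead_coeff b" for k n
      using nz by (auto simp: a_def b_def lead_coeff_mult power2_eq_square mult_ac simp del: mult_pCons_left mult_pCons_right)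
    show "degree a = 4" "degree b = 4" "degree e \<le> 4"
      using nz by (simp_all add: a_def b_def e_def degree_mult_eq)
  qed
  hence coeff: "m0 * coeff a i = m0 * coeff b i + coeff e i" for i
    by (metis coeff_add coeff_smult)
  have "q * (p1 * p2) * m0 = r1 * r2 * m0 + r1 * r2 * c'"
    using coeff[of 0] by (simp add: a_def b_def e_def algebra_simps)
  moreover have "q * (r1 * r2) * m0 = q^2 * (p1 * p2) * m0 - q^2 * c'"
    using coeff[of 4] by (simp add: a_def b_def e_def algebra_simps power2_eq_square numeral_eq_Suc)
  ultimately have "q * c' * (r1 * r2 - q) = 0" by algebra
  thus False using \<open>c' \<noteq> 0\<close> prods by simp
qed

lemma p_orbit_unbalanced:
  assumes p: "near 0 p1" "near 0 p2" "p1 * p2 \<noteq> 1" and z0: "z0 \<in> {p1, p2}" "z0^2 \<noteq> 1"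
    and r: "near (1/2) r1 \<and> near (1/2) r2 \<or> r1 * r2 = 1"
  shows "length (filter (in_orbit z0) [1 / p1, 1 / p2, r1, r2]) \<noteq> length (filter (in_orbit z0) [p1, p2, 1 / r1, 1 / r2])"
proof -
  have nz: "p1 \<noteq> 0" "p2 \<noteq> 0" "z0 \<noteq> 0" using p z0(1) by (auto simp: near_def)
  have "\<not> in_orbit z0 (1 / x)" if "x \<in> {p1, p2}" for x
  proof
    assume "in_orbit z0 (1 / x)"
    hence "1 / x = z0 * q powi 0"
      by (rule in_orbit_imp_eq) (use that p(1,2) z0(1) in \<open>auto simp: near_def val_divide abs_less_iff\<close>)
    thus False using that z0 p(3) nz by (auto simp: field_simps power2_eq_square)
  qed
  moreover have "length (filter (in_orbit z0) [r1, r2]) = length (filter (in_orbit z0) [1 / r1, 1 / r2])"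
    using r
  proof
    assume "near (1/2) r1 \<and> near (1/2) r2"
    hence y: "near (1/2) y" if "y \<in> {r1, r2}" for y using that by auto
    have "\<not> in_orbit z0 y" if "y \<in> {r1, r2}" for y
      by (rule not_in_orbit[of z0 0]) (use y[OF that] p(1,2) z0(1) in \<open>auto simp: near_def\<close>)
    moreover have "\<not> in_orbit z0 (1 / y)" if "y \<in> {r1, r2}" for y
      by (rule not_in_orbit[of z0 "-1"]) (use y[OF that] p(1,2) z0(1) in \<open>auto simp: near_def val_divide\<close>)
    ultimately show ?thesis by simp
  next
    assume "r1 * r2 = 1"
    hence "1 / r1 = r2" "1 / r2 = r1" by (auto simp: divide_eq_eq mult.commute)
    thus ?thesis by simp
  qed
  moreover have "filter (in_orbit z0) [p1, p2] \<noteq> []" using z0(1) by (auto simp: filter_empty_conv)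
  moreover have "filter P [a, b, c, d] = filter P [a, b] @ filter P [c, d]" for P and a b c d :: complex by simp
  ultimately show ?thesis by simp
qed

lemma r_orbit_unbalanced:
  assumes r: "near (1/2) r1" "near (1/2) r2" "r1 * r2 \<noteq> q" and z0: "z0 \<in> {r1, r2}" "z0^2 \<noteq> q"
    and p: "near 0 p1 \<and> near 0 p2 \<or> p1 * p2 = q"
  shows "length (filter (in_orbit z0) [1 / p1, 1 / p2, r1, r2]) \<noteq> length (filter (in_orbit z0) [p1, p2, 1 / r1, 1 / r2])"
proof -
  have nz: "r1 \<noteq> 0" "r2 \<noteq> 0" "z0 \<noteq> 0" using r z0(1) by (auto simp: near_def)
  have "\<not> in_orbit z0 (1 / y)" if "y \<in> {r1, r2}" for y
  proof
    assume "in_orbit z0 (1 / y)"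
    hence "1 / y = z0 * q powi -1"

      by (rule in_orbit_imp_eq) (use that r(1,2) z0(1) in \<open>auto simp: near_def val_divide abs_less_iff\<close>)
    thus False using that z0 r(3) nz by (auto simp: power_int_minus field_simps power2_eq_square)
  qed
  moreover have "length (filter (in_orbit z0) [1 / p1, 1 / p2]) = length (filter (in_orbit z0) [p1, p2])"
    using p
  proof
    assume "near 0 p1 \<and> near 0 p2"
    hence x: "near 0 x" if "x \<in> {p1, p2}" for x using that by auto
    have "\<not> in_orbit z0 x" if "x \<in> {p1, p2}" for x
      by (rule not_in_orbit[of z0 "-1"]) (use x[OF that] r(1,2) z0(1) in \<open>auto simp: near_def\<close>)
    moreover have "\<not> in_orbit z0 (1 / x)" if "x \<in> {p1, p2}" for x
      by (rule not_in_orbit[of z0 "-1"]) (use x[OF that] r(1,2) z0(1) in \<open>auto simp: near_def val_divide\<close>)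
    ultimately show ?thesis by simp
  next
    assume "p1 * p2 = q"
    hence "q * (1 / p1) = p2" "q * (1 / p2) = p1" using q_nz by (auto simp flip: \<open>p1 * p2 = q\<close>)
    hence "in_orbit z0 (1 / p1) = in_orbit z0 p2" "in_orbit z0 (1 / p2) = in_orbit z0 p1"
      by (metis in_orbit_q_mult)+
    thus ?thesis by simp
  qed
  moreover have "filter (in_orbit z0) [r1, r2] \<noteq> []" using z0(1) by (auto simp: filter_empty_conv)
  moreover have "filter P [a, b, c, d] = filter P [a, b] @ filter P [c, d]" for P and a b c d :: complex by simp
  ultimately show ?thesis by simp
qed

lemma near_roots_no_rational_solution:
  assumes p: "near 0 p1 \<and> near 0 p2 \<and> p1 * p2 \<noteq> 1 \<or> near (1/2) p1 \<and> near (1/2) p2 \<and> p1 * p2 = q"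
    and r: "near (1/2) r1 \<and> near (1/2) r2 \<and> r1 * r2 \<noteq> q \<or> near 0 r1 \<and> near 0 r2 \<and> r1 * r2 = 1"
    and generic: "near 0 p1 \<or> near (1/2) r1" and "c \<noteq> 0" "s \<in> ratfun"
  shows "\<not> curve_eq p1 p2 r1 r2 c s"
proof -
  have disjoint: "\<not> near (1/2) x" if "near 0 x" for x using that by (auto simp: near_def)
  have nz: "p1 \<noteq> 0" "p2 \<noteq> 0" "r1 \<noteq> 0" "r2 \<noteq> 0" using p r by (auto simp: near_def)
  have near_p: "near 0 p1 \<and> near 0 p2 \<or> near (1/2) p1 \<and> near (1/2) p2"
    and near_r: "near (1/2) r1 \<and> near (1/2) r2 \<or> near 0 r1 \<and> near 0 r2" using p r by blast+
  show ?thesis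
  proof (rule separated_roots_no_rational_solution[OF nz \<open>c \<noteq> 0\<close> _ _ _ _ _ _ _ \<open>s \<in> ratfun\<close>])
    show "val x > -1/2" if "x \<in> {p1, p2}" for x using that near_p by (auto simp: near_def)
    show "val y < 1" if "y \<in> {r1, r2}" for y using that near_r by (auto simp: near_def)
    show "val y < val x + 1" if "x \<in> {p1, p2}" "y \<in> {r1, r2}" for x y
      using that near_p near_r by (auto simp: near_def)
    have "near 0 p1 \<and> near 0 p2 \<or> near (1/2) r1 \<and> near (1/2) r2"
      using generic near_p near_r disjoint by blast
    thus "val (p1 * p2) < val (r1 * r2) + 1"
      using near_p near_r by (auto simp: near_def val_mult)
    have "q \<noteq> 1" using q_gt1 by auto
    thus "r1 * r2 \<noteq> q" "p1 * p2 \<noteq> 1" using p r by metis+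
    show "r1 * r2 \<noteq> p1 * p2"
    proof
      assume eq: "r1 * r2 = p1 * p2"
      hence "val r1 + val r2 = val p1 + val p2" using nz by (simp flip: val_mult)
      moreover have "\<not> (near 0 p1 \<and> near 0 r1)" "\<not> (near (1/2) p1 \<and> near (1/2) r1)"
        using p r eq disjoint by metis+
      ultimately show False using near_p near_r by (auto simp: near_def)
    qed
  qed
qed

theorem separated_roots_not_diff_alg:
  assumes g: "curve_eq p1 p2 r1 r2 c g" "g \<noteq> 0"
    and p: "near 0 p1 \<and> near 0 p2 \<and> p1 * p2 \<noteq> 1 \<or> near (1/2) p1 \<and> near (1/2) p2 \<and> p1 * p2 = q"
    and r: "near (1/2) r1 \<and> near (1/2) r2 \<and> r1 * r2 \<noteq> q \<or> near 0 r1 \<and> near 0 r2 \<and> r1 * r2 = 1"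
    and nondegenerate: "near 0 p1 \<and> (p1^2 \<noteq> 1 \<or> p2^2 \<noteq> 1) \<or> near (1/2) r1 \<and> (r1^2 \<noteq> q \<or> r2^2 \<noteq> q)"
  shows "\<not> diff_alg g"
proof -
  have disjoint: "\<not> near (1/2) x" if "near 0 x" for x using that by (auto simp: near_def)
  have nz: "p1 \<noteq> 0" "p2 \<noteq> 0" "r1 \<noteq> 0" "r2 \<noteq> 0" using p r by (auto simp: near_def)
  have no_sol: "\<not> curve_eq p1 p2 r1 r2 c s" if "c \<noteq> 0" "s \<in> ratfun" for s
    using near_roots_no_rational_solution[OF p r _ that] nondegenerate by blast
  from nondegenerate show ?thesis
  proof
    assume "near 0 p1 \<and> (p1^2 \<noteq> 1 \<or> p2^2 \<noteq> 1)"
    moreover from this have "near 0 p2" "p1 * p2 \<noteq> 1" using p disjoint by blast+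
    ultimately obtain z0 where "near 0 p1" "near 0 p2" "p1 * p2 \<noteq> 1" "z0 \<in> {p1, p2}" "z0^2 \<noteq> 1" by blast
    hence "length (filter (in_orbit z0) [1 / p1, 1 / p2, r1, r2]) \<noteq> length (filter (in_orbit z0) [p1, p2, 1 / r1, 1 / r2])"
      by (rule p_orbit_unbalanced) (use r in blast)
    thus ?thesis using \<open>z0 \<in> _\<close> nz by (intro curve_eq_not_diff_alg[OF nz g _ _ no_sol]) auto
  next
    assume "near (1/2) r1 \<and> (r1^2 \<noteq> q \<or> r2^2 \<noteq> q)"
    moreover from this have "near (1/2) r2" "r1 * r2 \<noteq> q" using r disjoint by blast+
    ultimately obtain z0 where "near (1/2) r1" "near (1/2) r2" "r1 * r2 \<noteq> q" "z0 \<in> {r1, r2}" "z0^2 \<noteq> q" by blast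
    hence "length (filter (in_orbit z0) [1 / p1, 1 / p2, r1, r2]) \<noteq> length (filter (in_orbit z0) [p1, p2, 1 / r1, 1 / r2])"
      by (rule r_orbit_unbalanced) (use p in blast)
    thus ?thesis using \<open>z0 \<in> _\<close> nz by (intro curve_eq_not_diff_alg[OF nz g _ _ no_sol]) auto
  qed
qed

end

context q_dilation
begin

subsection \<open>Equations with constant coefficient\<close>

lemma isolated_pole_pair:
  assumes "c \<noteq> 0" "z1 \<noteq> 0" "z2 \<noteq> 0" "\<bar>val z1 - val z2\<bar> < 1"
  obtains z0 k where "isolated_pole z0 k (lin_ratio c [0] [z1, z2])"
proof -
  have "z2 \<noteq> z1 * q powi n" if "n \<noteq> 0" for n
    using assms that by (cases "n > 0") (auto simp: val_mult)
  hence "count_list [z1, z2] (z1 * q powi n) + count_list [0] z1 < count_list [z1, z2] z1" if "n \<noteq> 0" for n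
    using orbit_neq[OF \<open>z1 \<noteq> 0\<close> that] that assms(2) by auto
  from isolated_pole_lin_ratio[OF assms(1,2) _ this] show thesis using that assms(2) by fastforce
qed

lemma linprod_reflected_roots_not_diff_alg:
  assumes g: "curve_eq p1 p2 r1 r2 c g" and p: "p1 * p2 = q" and r: "r1 * r2 = 1" and "c \<noteq> 0"
    and z0: "z0 \<noteq> 0" and isolated: "\<And>n. n \<noteq> 0 \<Longrightarrow> count_list [p1, p2, 1 / p1, 1 / p2, r1, r2] (z0 * q powi n)
      + count_list [1, -1] z0 < count_list [p1, p2, 1 / p1, 1 / p2, r1, r2] z0"
  shows "\<not> diff_alg g"
proof -
  have nz: "p1 \<noteq> 0" "p2 \<noteq> 0" "r1 \<noteq> 0" "r2 \<noteq> 0" using p r q_nz by auto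
  have inv: "1 / r1 = r2" "1 / r2 = r1" "p1 / q = 1 / p2" "p2 / q = 1 / p1"
    using p r nz q_nz by (auto simp: field_simps)
  define W where "W = lin p1 * lin p2"
  have dil_W: "dil W = fls_const (q^2) * (lin (1 / p1) * lin (1 / p2))"
    by (simp add: W_def dil_mult dil_lin inv power2_eq_square mult_ac flip: fls_const_mult_const)
  define K where "K = - (c * (1 - q) / q^2)"
  have "q \<noteq> 1" using q_gt1 by auto
  hence "K \<noteq> 0" using \<open>c \<noteq> 0\<close> q_nz by (simp add: K_def)
  have "fls_const (- (c * (1 - q))) = fls_const K * fls_const (q^2)" using q_nz by (simp add: K_def)
  hence \<delta>: "lin_ratio (- (c * (1 - q) / 1)) [0, 1, -1] [p1, p2, 1 / r1, 1 / r2] / dil W =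
      lin_ratio K [0, 1, -1] [p1, p2, 1 / p1, 1 / p2, r1, r2]"
    by (simp add: lin_ratio_def dil_W inv field_simps del: fls_const_mult_const fls_const_power)
  obtain k where "isolated_pole z0 k (lin_ratio K [0, 1, -1] [p1, p2, 1 / p1, 1 / p2, r1, r2])"
    using isolated_pole_lin_ratio[OF \<open>K \<noteq> 0\<close> z0, of "[0, 1, -1]" "[p1, p2, 1 / p1, 1 / p2, r1, r2]"] isolated
      isolated[of 1] z0 by auto
  note iso = this
  show ?thesis
  proof (rule gauge_not_diff_alg[OF g[unfolded curve_eq_first_order[OF nz] p r]])
    show "lin_ratio (q / 1) [1 / p1, 1 / p2, r1, r2] [p1, p2, 1 / r1, 1 / r2] * W = fls_const (1 / q) * dil W"
      by (simp add: lin_ratio_def W_def inv dil_W[unfolded W_def] q_nz field_simps power2_eq_square)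
    show "isolated_pole z0 k (lin_ratio (- (c * (1 - q) / 1)) [0, 1, -1] [p1, p2, 1 / r1, 1 / r2] / dil W
        + dil 0 - fls_const (1 / q) * 0)" using iso by (simp only: \<delta>) simp
  qed (auto simp: W_def q_nz intro!: rat.mult_in rat.zero_in lin_ratio_ratfun lin_ratfun)
qed

lemma antisymmetric_p_not_diff_alg:
  assumes g: "curve_eq 1 (-1) r1 r2 c g" and r: "r1 * r2 = 1" "\<bar>val r1 - val r2\<bar> < 1" and "c \<noteq> 0"
  shows "\<not> diff_alg g"
proof -
  have nz: "r1 \<noteq> 0" "r2 \<noteq> 0" using r by auto
  have inv: "1 / r1 = r2" "1 / r2 = r1" using r nz by (auto simp: field_simps)
  have "dil g = - 1 * g + lin_ratio (- (2 * c)) [0] [r1, r2]"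
    using g nz r by (simp add: curve_eq_first_order lin_ratio_def inv field_simps fls_const_minus_1)
  moreover obtain z0 k where "isolated_pole z0 k (lin_ratio (- (2 * c)) [0] [r1, r2])"
    using isolated_pole_pair[of "- (2 * c)" r1 r2] nz r(2) \<open>c \<noteq> 0\<close> by auto
  ultimately show ?thesis
    by (intro isolated_pole_not_diff_alg[of g "-1"]) (auto simp: fls_const_minus_1 lin_ratio_ratfun)
qed

lemma antisymmetric_r_not_diff_alg:
  assumes g: "curve_eq p1 p2 s (- s) c g" and p: "p1 * p2 = q" "\<bar>val p1 - val p2\<bar> < 1" and s: "s^2 = q" and "c \<noteq> 0"
  shows "\<not> diff_alg g"
proof -
  have nz: "p1 \<noteq> 0" "p2 \<noteq> 0" "s \<noteq> 0" "- s \<noteq> 0" using p s q_nz by auto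
  have inv: "s / q = 1 / s" "p1 / q = 1 / p2" "p2 / q = 1 / p1"
    using p s nz q_nz by (auto simp: field_simps power2_eq_square)
  have rr: "s * - s = - q" using s by (simp add: power2_eq_square)
  define P P' S S' where "P = lin p1 * lin p2" and "P' = fls_const q * (lin (1 / p1) * lin (1 / p2))"
    and "S = lin s * lin (- s)" and "S' = lin (1 / s) * lin (- (1 / s))"
  note defs = P_def P'_def S_def S'_def
  have PS_nz: "P \<noteq> 0" "P' \<noteq> 0" "S \<noteq> 0" "S' \<noteq> 0" by (auto simp: defs)
  have dil_PS: "dil P = fls_const q * P'" "dil S = fls_const q * (fls_const q * S')"
    by (simp_all add: defs dil_mult dil_lin inv mult_ac flip: fls_const_mult_const)
  have "[:-p1, 1:] * [:-p2, 1:] - smult q ([:-(1 / p1), 1:] * [:-(1 / p2), 1:]) = smult (1 - q) ([:-1, 1:] * [:1, 1:])"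
    using q_nz p by (simp add: algebra_simps flip: inv(2,3))
  from arg_cong[OF this, of toR] have PP': "fls_const (1 - q) * (lin 1 * lin (-1)) = P - P'"
    by (simp only: toR_diff toR_smult toR_mult lin_def P_def P'_def minus_minus)
  let ?\<gamma> = "lin_ratio (q / - q) [1 / p1, 1 / p2, s, - s] [p1, p2, 1 / s, 1 / - s]"
    and ?\<delta> = "lin_ratio (- (c * (1 - q) / - q)) [0, 1, -1] [p1, p2, 1 / s, 1 / - s]"
  define W V where "W = P / S" and "V = - (fls_const c * fls_X / P)"
  have dil_WV: "dil W = P' / (fls_const q * S')" "dil V = - (fls_const c * fls_X / P')"
    by (simp_all add: W_def V_def \<sigma>_uminus \<sigma>_divide dil_mult dil_PS del: fls_const_mult_const)
  have "fls_const (c * (1 - q) / q) = fls_const (c / q) * fls_const (1 - q)" by simp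
  hence \<delta>: "?\<delta> = fls_const (c / q) * fls_X * (P - P') / (P * S')"
    by (simp add: lin_ratio_def P_def[symmetric] S'_def lin_eq[of 0] mult_ac del: fls_const_mult_const flip: PP')
  have "fls_const c = fls_const (c / q) * fls_const q" by simp
  hence ratio: "?\<delta> / dil W = fls_const c * fls_X * (P - P') / (P * P')"
    unfolding \<delta> dil_WV using PS_nz by (simp add: divide_simps mult_ac del: fls_const_mult_const)
  have "fls_const (c * 2) = fls_const c * 2" by (simp only: mult_2_right fls_plus_const)
  hence \<delta>: "?\<delta> / dil W + dil V - fls_const (-1) * V = lin_ratio (- (2 * c)) [0] [p1, p2]"
    unfolding ratio unfolding dil_WV using PS_nz
    by (simp add: V_def lin_ratio_def lin_eq[of 0] fls_const_minus_1 P_def[symmetric] field_simps)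
  obtain z0 k where iso: "isolated_pole z0 k (lin_ratio (- (2 * c)) [0] [p1, p2])"
    using isolated_pole_pair[of "- (2 * c)" p1 p2] nz p(2) \<open>c \<noteq> 0\<close> by auto
  show ?thesis
  proof (rule gauge_not_diff_alg[OF g[unfolded curve_eq_first_order[OF nz] p(1) rr]])
    show "?\<gamma> * W = fls_const (-1) * dil W"
      unfolding dil_WV unfolding W_def using PS_nz q_nz
      by (simp add: lin_ratio_def fls_const_minus_1 field_simps) (simp add: defs mult_ac)
    show "isolated_pole z0 k (?\<delta> / dil W + dil V - fls_const (-1) * V)" unfolding \<delta> by (rule iso)
  qed (auto simp: W_def V_def P_def S_def intro!: rat.divide_in rat.mult_in rat.uminus_in
      ratfun_const ratfun_X lin_ratio_ratfun lin_ratfun)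
qed

lemma double_minus_one_root_not_diff_alg:
  assumes g: "curve_eq (- q) (-1) q (-1) c g" and "c \<noteq> 0"
  shows "\<not> diff_alg g"
proof -
  have nz: "- q \<noteq> 0" "-1 \<noteq> (0::complex)" "q \<noteq> 0" "-1 \<noteq> (0::complex)" by auto
  let ?\<gamma> = "lin_ratio (- q * -1 / (q * -1)) [1 / - q, 1 / -1, q, -1] [- q, -1, 1 / q, 1 / -1]"
    and ?\<delta> = "lin_ratio (- (c * (1 - - q * -1) / (q * -1))) [0, 1, -1] [- q, -1, 1 / q, 1 / -1]"
  define W where "W = lin (- q) * lin (-1) / (lin q * lin 1)"
  have dil_W: "dil W = lin (-1) * lin (- (1 / q)) / (lin 1 * lin (1 / q))"
    by (simp add: W_def \<sigma>_divide dil_mult dil_lin)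
  define K where "K = c * (1 - q) / q"
  have "K \<noteq> 0" using \<open>c \<noteq> 0\<close> q_neq by (simp add: K_def)
  have \<delta>: "?\<delta> / dil W = lin_ratio K [0, 1, 1] [- q, -1, -1, - (1 / q)]"
    by (simp add: lin_ratio_def dil_W K_def field_simps)
  have count: "count_list [- q, -1, -1, - (1 / q)] (-1 * q powi n) + count_list [0, 1, 1] (-1 :: complex) <
      count_list [- q, -1, -1, - (1 / q)] (-1)" if "n \<noteq> 0" for n
    using orbit_neq[of "-1" n] that q_neq by (auto simp: field_simps)
  obtain k where iso: "isolated_pole (-1) k (lin_ratio K [0, 1, 1] [- q, -1, -1, - (1 / q)])"
    by (rule isolated_pole_lin_ratio[OF \<open>K \<noteq> 0\<close> nz(2) _ count]) (auto split: if_splits)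
  show ?thesis
  proof (rule gauge_not_diff_alg[OF g[unfolded curve_eq_first_order[OF nz]]])
    show "?\<gamma> * W = fls_const (-1) * dil W"
      unfolding dil_W by (simp add: W_def lin_ratio_def fls_const_minus_1 field_simps)
    show "isolated_pole (-1) k (?\<delta> / dil W + dil 0 - fls_const (-1) * 0)" using iso by (simp only: \<delta>) simp
  qed (auto simp: W_def intro!: rat.divide_in rat.mult_in rat.zero_in lin_ratio_ratfun lin_ratfun)
qed

lemma reflected_root_pairs_not_diff_alg:
  assumes g: "curve_eq p1 p2 r1 r2 c g" and p: "near (1/2) p1" "near (1/2) p2" "p1 * p2 = q"
    and r: "near 0 r1" "near 0 r2" "r1 * r2 = 1" and "c \<noteq> 0"
  shows "\<not> diff_alg g"
proof -
  have nz: "r1 \<noteq> 0" "p1 \<noteq> 0" "p2 \<noteq> 0" using p r by (auto simp: near_def)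
  show ?thesis
  proof (rule linprod_reflected_roots_not_diff_alg[OF g p(3) r(3) \<open>c \<noteq> 0\<close> nz(1)])
    fix n :: int assume "n \<noteq> 0"
    have "val (r1 * q powi n) = val r1 + of_int n" using nz by (simp add: val_mult)
    moreover have "of_int n \<ge> (1::real) \<or> of_int n \<le> (-1::real)" using \<open>n \<noteq> 0\<close> by linarith
    moreover have "r2 = r1 * q powi n \<Longrightarrow> val r2 = val (r1 * q powi n)" by simp
    ultimately have "r1 * q powi n \<notin> {p1, p2, 1 / p1, 1 / p2, r1, r2}"
      using p(1,2) r(1,2) nz by (auto simp: near_def val_divide)
    hence "count_list [p1, p2, 1 / p1, 1 / p2, r1, r2] (r1 * q powi n) = 0"
      unfolding count_list_0_iff by simp
    moreover have "count_list [1, -1] r1 < count_list [p1, p2, 1 / p1, 1 / p2, r1, r2] r1"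
    proof (cases "r1 = 1 \<or> r1 = -1")
      case True
      hence "r1 * r1 = 1" by auto
      hence "r2 = r1" using r(3) nz(1) by (metis mult_left_cancel)
      thus ?thesis using True by auto
    qed auto
    ultimately show "count_list [p1, p2, 1 / p1, 1 / p2, r1, r2] (r1 * q powi n) + count_list [1, -1] r1 <
        count_list [p1, p2, 1 / p1, 1 / p2, r1, r2] r1"
      by linarith
  qed
qed

theorem bounded_roots_not_diff_alg:
  assumes g: "curve_eq p1 p2 r1 r2 c g" "g \<noteq> 0"
    and p: "near 0 p1 \<and> near 0 p2 \<and> p1 * p2 \<noteq> 1 \<or> near (1/2) p1 \<and> near (1/2) p2 \<and> p1 * p2 = q"
    and r: "near (1/2) r1 \<and> near (1/2) r2 \<and> r1 * r2 \<noteq> q \<or> near 0 r1 \<and> near 0 r2 \<and> r1 * r2 = 1"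
    and c: "c \<noteq> 0 \<or> near 0 p1 \<and> near (1/2) r1"
    and nondegenerate: "\<not> (near 0 p1 \<and> near (1/2) r1 \<and> p1^2 = 1 \<and> p2^2 = 1 \<and> r1^2 = q \<and> r2^2 = q)"
  shows "\<not> diff_alg g"
proof -
  have disjoint: "\<not> near (1/2) x" if "near 0 x" for x using that by (auto simp: near_def)
  consider
      (generic) "near 0 p1 \<and> (p1^2 \<noteq> 1 \<or> p2^2 \<noteq> 1) \<or> near (1/2) r1 \<and> (r1^2 \<noteq> q \<or> r2^2 \<noteq> q)"
    | (reflected) "near (1/2) p1" "near (1/2) p2" "p1 * p2 = q" "near 0 r1" "near 0 r2" "r1 * r2 = 1" "c \<noteq> 0"
    | (antisymmetric_p) "p1 * p2 \<noteq> 1" "p1^2 = 1" "p2^2 = 1" "near 0 r1" "near 0 r2" "r1 * r2 = 1" "c \<noteq> 0"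
    | (antisymmetric_r) "near (1/2) p1" "near (1/2) p2" "p1 * p2 = q" "r1 * r2 \<noteq> q" "r1^2 = q" "r2^2 = q" "c \<noteq> 0"
    using p r c nondegenerate disjoint by metis
  thus ?thesis
  proof cases
    case generic
    show ?thesis by (rule separated_roots_not_diff_alg[OF g p r generic])
  next
    case reflected
    show ?thesis by (rule reflected_root_pairs_not_diff_alg[OF g(1) reflected])
  next
    case antisymmetric_p
    have "p1 = 1 \<and> p2 = -1 \<or> p1 = -1 \<and> p2 = 1" using antisymmetric_p(1-3) unfolding power2_eq_1_iff by auto
    moreover have "curve_eq p2 p1 r1 r2 c g" using g(1) unfolding curve_eq_def by (simp only: mult_ac)
    ultimately have "curve_eq 1 (-1) r1 r2 c g" using g(1) by auto
    thus ?thesis by (rule antisymmetric_p_not_diff_alg) (use antisymmetric_p in \<open>auto simp: near_def\<close>)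
  next
    case antisymmetric_r
    have "r2 = - r1" using antisymmetric_r(4-6) power2_eq_iff[of r2 r1] by (auto simp: power2_eq_square)
    thus ?thesis using g(1) antisymmetric_r
      by (intro antisymmetric_r_not_diff_alg[of p1 p2 r1 c g]) (auto simp: near_def)
  qed
qed

subsection \<open>Equations with a common root\<close>

text \<open>The factor \<open>s\<close> vanishing at \<open>z\<close> is common to both sides of the equation; nothing else on the
  orbit of \<open>z\<close> can compensate for it.\<close>

lemma common_factor_no_rational_solution:
  assumes P: "P \<in> ratfun" "toR ([:-p, 1:] * [:1, -r:] * s) * dil P = toR ([:1, -p:] * [:-r, 1:] * s) * P + toR e"
    and nz: "p \<noteq> 0" "r \<noteq> 0" "z \<noteq> 0" and zero: "poly s z = 0" "poly e z \<noteq> 0"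
    and s: "\<And>n. poly s (z * q powi n) = 0 \<Longrightarrow> n = 0"
    and p: "\<And>n. p = z * q powi n \<Longrightarrow> n \<ge> 0" "\<And>n. 1 / p = z * q powi n \<Longrightarrow> n \<le> 0"
    and r: "\<And>n. r = z * q powi n \<Longrightarrow> n \<le> 0" "\<And>n. 1 / r = z * q powi n \<Longrightarrow> n \<ge> 0"
  shows False
proof (rule common_zero_no_rational_solution[OF P nz(3)])
  fix n
  show "n \<ge> 0" if "poly ([:-p, 1:] * [:1, -r:] * s) (z * q powi n) = 0"
  proof -
    have "p = z * q powi n \<or> 1 / r = z * q powi n \<or> poly s (z * q powi n) = 0"
      using that nz unfolding poly_mult mult_eq_0_iff by (auto simp: divide_eq_eq mult.commute)
    thus ?thesis using p(1) r(2) s by auto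
  qed
  show "n \<le> 0" if "poly ([:1, -p:] * [:-r, 1:] * s) (z * q powi n) = 0"
  proof -
    have "1 / p = z * q powi n \<or> r = z * q powi n \<or> poly s (z * q powi n) = 0"
      using that nz unfolding poly_mult mult_eq_0_iff by (auto simp: divide_eq_eq mult.commute)
    thus ?thesis using p(2) r(1) s by auto
  qed
qed (use zero in auto)

lemma curve_eq_common_root:
  "curve_eq p \<zeta> r \<zeta> c P \<longleftrightarrow>
    toR ([:-p, 1:] * [:1, -r:] * ([:-\<zeta>, 1:] * [:1, -\<zeta>:])) * dil P =
      toR ([:1, -p:] * [:-r, 1:] * ([:-\<zeta>, 1:] * [:1, -\<zeta>:])) * P + toR (smult (c * (1 - p * \<zeta>)) [:0, 1, 0, -1:])"
proof -
  have "smult c ([:0, 1:] * ([:1, -p:] * [:1, -\<zeta>:] - [:-p, 1:] * [:-\<zeta>, 1:])) = smult (c * (1 - p * \<zeta>)) [:0, 1, 0, -1:]"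
    by (simp add: algebra_simps)
  moreover have "fls_X = toR [:0, 1:]" by (simp add: toR_pCons)
  ultimately have "fls_const c * fls_X * toR ([:1, -p:] * [:1, -\<zeta>:] - [:-p, 1:] * [:-\<zeta>, 1:]) =
      toR (smult (c * (1 - p * \<zeta>)) [:0, 1, 0, -1:])" by (metis mult.assoc toR_mult toR_smult)
  thus ?thesis unfolding curve_eq_def toR_mult by (simp only: mult_ac)
qed

lemma curve_eq_common_root_minus_1:
  assumes "curve_eq p (-1) r (-1) c P"
  shows "toR ([:-p, 1:] * [:1, -r:] * [:1, 1:]) * dil P =
      toR ([:1, -p:] * [:-r, 1:] * [:1, 1:]) * P + toR (smult (c * (1 + p)) [:0, 1, -1:])"
proof -
  have "smult (c * (1 - p * -1)) [:0, 1, 0, -1:] = smult (c * (1 + p)) [:0, 1, -1:] * [:1, 1:]" by simp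
  with assms have "toR [:1, 1:] * (toR ([:-p, 1:] * [:1, -r:] * [:1, 1:]) * dil P) =
      toR [:1, 1:] * (toR ([:1, -p:] * [:-r, 1:] * [:1, 1:]) * P + toR (smult (c * (1 + p)) [:0, 1, -1:]))"
    unfolding curve_eq_common_root by (simp only: toR_mult minus_minus distrib_left mult_ac)
  thus ?thesis by simp
qed

lemma near_1_powi:
  assumes "near 1 v \<and> v \<noteq> q \<or> v = 1" "v = q powi n"
  shows "n = 0"
proof -
  have "val v = of_int n" by (simp add: assms(2))
  moreover have "val v \<in> {7/8<..<9/8} \<or> val v = 0" using assms(1) by (auto simp: near_def)
  ultimately have "n = 1 \<or> n = 0" by auto
  thus ?thesis using assms q_neq by auto
qed

lemma common_root_ratio_not_in_orbit:
  assumes "\<zeta> \<noteq> 0" and u: "near 0 u \<and> u \<noteq> 1 \<or> u = q" and v: "near 1 v \<and> v \<noteq> q \<or> v = 1"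
    and uv: "v \<noteq> q * u" "\<not> (u = q \<and> v = 1)"
  shows "\<not> in_orbit (u / \<zeta>) (v / \<zeta>)"
proof
  assume orbit: "in_orbit (u / \<zeta>) (v / \<zeta>)"
  have nz: "u \<noteq> 0" "v \<noteq> 0" using u v by (auto simp: near_def)
  have eq: "v = u * q powi n" if "\<bar>val v - val u - of_int n\<bar> < 1" for n
    using in_orbit_imp_eq[OF orbit, of n] that nz \<open>\<zeta> \<noteq> 0\<close> by (simp add: val_divide field_simps)
  consider "near 0 u" "near 1 v" | "near 0 u" "u \<noteq> 1" "v = 1" | "u = q" "near 1 v" "v \<noteq> q"
    using u v uv by blast
  thus False
  proof cases
    case 1
    thus False using eq[of 1] uv by (auto simp: near_def abs_less_iff mult.commute)
  next
    case 2
    thus False using eq[of 0] by (auto simp: near_def abs_less_iff)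
  next
    case 3
    thus False using eq[of 0] by (auto simp: near_def abs_less_iff)
  qed
qed

lemma common_root_equation_not_diff_alg:
  assumes "\<zeta> \<noteq> 0" "u \<noteq> 0" "v \<noteq> 0" and g: "curve_eq (u / \<zeta>) \<zeta> (v / \<zeta>) \<zeta> c g" "g \<noteq> 0"
    and z0: "z0 \<noteq> 0" "in_orbit z0 (u / \<zeta>) \<and> \<not> in_orbit z0 (\<zeta> / u) \<and> \<not> in_orbit z0 (v / \<zeta>) \<or>
      in_orbit z0 (v / \<zeta>) \<and> \<not> in_orbit z0 (u / \<zeta>) \<and> \<not> in_orbit z0 (\<zeta> / v)"
    and no_sol: "\<And>P. P \<in> ratfun \<Longrightarrow> \<not> curve_eq (u / \<zeta>) \<zeta> (v / \<zeta>) \<zeta> c P"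
  shows "\<not> diff_alg g"
  using assms by (intro curve_eq_not_diff_alg[OF _ _ _ _ g z0(1)]) auto

lemma common_root_off_orbit:
  assumes \<zeta>: "near (1/2) (\<zeta>^2)" and u: "near 0 u \<and> u \<noteq> 1 \<or> u = q" and v: "near 1 v \<and> v \<noteq> q \<or> v = 1"
  shows "\<not> in_orbit \<zeta> (u / \<zeta>)" "\<not> in_orbit \<zeta> (v / \<zeta>)" "\<not> in_orbit \<zeta> (1 / \<zeta>)"
proof -
  have "\<zeta> \<noteq> 0" using \<zeta> by (auto simp: near_def)
  hence val_\<zeta>: "3/16 < val \<zeta>" "val \<zeta> < 5/16" using \<zeta> by (auto simp: near_def power2_eq_square val_mult)
  have val_uv: "near 0 u \<or> val u = 1" "near 1 v \<or> val v = 0" and nz: "u \<noteq> 0" "v \<noteq> 0"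
    using u v by (auto simp: near_def)
  show "\<not> in_orbit \<zeta> (u / \<zeta>)"
    using val_uv(1) not_in_orbit[OF \<open>\<zeta> \<noteq> 0\<close>, of "-1" "u / \<zeta>"] not_in_orbit[OF \<open>\<zeta> \<noteq> 0\<close>, of 0 "u / \<zeta>"] val_\<zeta> nz \<open>\<zeta> \<noteq> 0\<close>
    by (auto simp: near_def val_divide)
  show "\<not> in_orbit \<zeta> (v / \<zeta>)"
    using val_uv(2) not_in_orbit[OF \<open>\<zeta> \<noteq> 0\<close>, of 0 "v / \<zeta>"] not_in_orbit[OF \<open>\<zeta> \<noteq> 0\<close>, of "-1" "v / \<zeta>"] val_\<zeta> nz \<open>\<zeta> \<noteq> 0\<close>
    by (auto simp: near_def val_divide)
  show "\<not> in_orbit \<zeta> (1 / \<zeta>)"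
    using not_in_orbit[OF \<open>\<zeta> \<noteq> 0\<close>, of "-1" "1 / \<zeta>"] val_\<zeta> \<open>\<zeta> \<noteq> 0\<close> by (auto simp: val_divide)
qed

lemma common_root_no_rational_solution:
  assumes \<zeta>: "near (1/2) (\<zeta>^2)" and "c \<noteq> 0" "P \<in> ratfun"
    and u: "near 0 u \<and> u \<noteq> 1 \<or> u = q" and v: "near 1 v \<and> v \<noteq> q \<or> v = 1"
  shows "\<not> curve_eq (u / \<zeta>) \<zeta> (v / \<zeta>) \<zeta> c P"
proof
  note off_orbit = common_root_off_orbit[OF \<zeta> u v]
  have "\<zeta> \<noteq> 0" using \<zeta> by (auto simp: near_def)
  hence val_\<zeta>: "val \<zeta> > 0" using \<zeta> by (auto simp: near_def power2_eq_square val_mult)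
  have val_uv: "near 0 u \<or> val u = 1" and nz: "u \<noteq> 0" "v \<noteq> 0"
    using u v by (auto simp: near_def)
  assume "curve_eq (u / \<zeta>) \<zeta> (v / \<zeta>) \<zeta> c P"
  thus False
  proof (rule common_factor_no_rational_solution[OF \<open>P \<in> ratfun\<close> _ _ _ \<open>\<zeta> \<noteq> 0\<close>, OF iffD1[OF curve_eq_common_root]])
    have "u \<noteq> 1" "\<zeta> * \<zeta> \<noteq> 1" using u q_neq val_\<zeta> val_mult[of \<zeta> \<zeta>] \<open>\<zeta> \<noteq> 0\<close> by auto
    moreover have "poly (smult (c * (1 - u / \<zeta> * \<zeta>)) [:0, 1, 0, - 1:]) \<zeta> = c * (1 - u) * (\<zeta> * (1 - \<zeta> * \<zeta>))"
      using \<open>\<zeta> \<noteq> 0\<close> by (simp add: algebra_simps)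
    ultimately show "poly (smult (c * (1 - u / \<zeta> * \<zeta>)) [:0, 1, 0, - 1:]) \<zeta> \<noteq> 0" using \<open>c \<noteq> 0\<close> \<open>\<zeta> \<noteq> 0\<close> by simp
    show "n = 0" if "poly ([:- \<zeta>, 1:] * [:1, - \<zeta>:]) (\<zeta> * q powi n) = 0" for n
    proof -
      have "\<zeta> * q powi n = \<zeta> \<or> \<zeta> * q powi n = 1 / \<zeta>"
        using that \<open>\<zeta> \<noteq> 0\<close> unfolding poly_mult mult_eq_0_iff by (auto simp: eq_divide_eq mult.commute)
      thus ?thesis using off_orbit(3) orbit_neq[OF \<open>\<zeta> \<noteq> 0\<close>] by (metis in_orbit_def)
    qed
    show "n \<ge> 0" if "u / \<zeta> = \<zeta> * q powi n" for n using off_orbit(1) that by (auto simp: in_orbit_def)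
    show "n \<le> 0" if "v / \<zeta> = \<zeta> * q powi n" for n using off_orbit(2) that by (auto simp: in_orbit_def)
    show "n \<le> 0" if "1 / (u / \<zeta>) = \<zeta> * q powi n" for n
    proof -
      have "val \<zeta> - val u = val \<zeta> + of_int n"
        using arg_cong[OF that, of val] nz \<open>\<zeta> \<noteq> 0\<close> by (simp add: val_divide val_mult)
      thus ?thesis using val_uv by (auto simp: near_def)
    qed
    show "n \<ge> 0" if eq: "1 / (v / \<zeta>) = \<zeta> * q powi n" for n
    proof -
      have "v = q powi (- n)" using eq nz \<open>\<zeta> \<noteq> 0\<close> by (simp add: power_int_minus field_simps)
      from near_1_powi[OF v this] show ?thesis by simp
    qed
  qed (use nz \<open>\<zeta> \<noteq> 0\<close> in auto)
qed

theorem common_root_not_diff_alg: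
  assumes \<zeta>: "near (1/2) (\<zeta>^2)" and g: "curve_eq (u / \<zeta>) \<zeta> (v / \<zeta>) \<zeta> c g" "g \<noteq> 0" and "c \<noteq> 0"
    and u: "near 0 u \<and> u \<noteq> 1 \<or> u = q" and v: "near 1 v \<and> v \<noteq> q \<or> v = 1" and uv: "v \<noteq> q * u"
  shows "\<not> diff_alg g"
proof -
  have "\<zeta> \<noteq> 0" using \<zeta> by (auto simp: near_def)
  hence val_\<zeta>: "3/16 < val \<zeta>" "val \<zeta> < 5/16" using \<zeta> by (auto simp: near_def power2_eq_square val_mult)
  have val_uv: "near 0 u \<or> val u = 1" "near 1 v \<or> val v = 0" and nz: "u \<noteq> 0" "v \<noteq> 0"
    using u v by (auto simp: near_def)
  note off_orbit = common_root_off_orbit[OF \<zeta> u v]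
  show ?thesis
  proof (cases "u = q \<and> v = 1")
    case True
    show ?thesis
    proof (rule linprod_reflected_roots_not_diff_alg[OF g(1) _ _ \<open>c \<noteq> 0\<close> \<open>\<zeta> \<noteq> 0\<close>])
      fix n :: int assume "n \<noteq> 0"
      moreover have "in_orbit \<zeta> (\<zeta> * q powi n)" by (auto simp: in_orbit_def)
      ultimately have "\<zeta> * q powi n \<notin> {u / \<zeta>, \<zeta>, 1 / \<zeta>, v / \<zeta>}" using orbit_neq[OF \<open>\<zeta> \<noteq> 0\<close>] off_orbit by auto
      moreover have "\<zeta> \<noteq> 1" "\<zeta> \<noteq> -1" using val_\<zeta> by auto
      ultimately show "count_list [u / \<zeta>, \<zeta>, 1 / (u / \<zeta>), 1 / \<zeta>, v / \<zeta>, \<zeta>] (\<zeta> * q powi n) + count_list [1, -1] \<zeta> <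
          count_list [u / \<zeta>, \<zeta>, 1 / (u / \<zeta>), 1 / \<zeta>, v / \<zeta>, \<zeta>] \<zeta>"
        by (auto split: if_splits)
    qed (use True \<open>\<zeta> \<noteq> 0\<close> in auto)
  next
    case False
    have "\<not> in_orbit (u / \<zeta>) (\<zeta> / u)"
      using val_uv(1) not_in_orbit[of "u / \<zeta>" 0 "\<zeta> / u"] not_in_orbit[of "u / \<zeta>" "-2" "\<zeta> / u"] val_\<zeta> nz \<open>\<zeta> \<noteq> 0\<close>
      by (auto simp: near_def val_divide)
    moreover have "\<not> in_orbit (u / \<zeta>) (v / \<zeta>)"
      using common_root_ratio_not_in_orbit[OF \<open>\<zeta> \<noteq> 0\<close> u v uv False] .
    ultimately show ?thesis
      using nz \<open>\<zeta> \<noteq> 0\<close> by (intro common_root_equation_not_diff_alg[OF _ _ _ g _ _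
          common_root_no_rational_solution[OF \<zeta> \<open>c \<noteq> 0\<close> _ u v], of "u / \<zeta>"]) auto
  qed
qed

lemma minus_1_root_no_rational_solution:
  assumes "P \<in> ratfun" "c \<noteq> 0" and u: "near 0 u \<and> u \<noteq> 1 \<or> u = q" and v: "near 1 v \<and> v \<noteq> q \<or> v = 1"
  shows "\<not> curve_eq (- u) (-1) (- v) (-1) c P"
proof
  assume "curve_eq (- u) (-1) (- v) (-1) c P"
  have val_uv: "near 0 u \<or> val u = 1" "near 1 v \<or> val v = 0" and nz: "u \<noteq> 0" "v \<noteq> 0"
    using u v by (auto simp: near_def)
  show False
  proof (rule common_factor_no_rational_solution[OF \<open>P \<in> ratfun\<close> curve_eq_common_root_minus_1[OF \<open>curve_eq _ _ _ _ _ _\<close>],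
        where z = "-1"])
    have "u \<noteq> 1" using u q_neq by auto
    thus "poly (smult (c * (1 + - u)) [:0, 1, - 1:]) (-1) \<noteq> 0" using \<open>c \<noteq> 0\<close> by simp
    show "n = 0" if "poly [:1, 1:] (-1 * q powi n) = 0" for n using that q_powi_eq_1_iff[of n] by simp
    show "n \<ge> 0" if "- u = -1 * q powi n" for n using that val_uv(1) by (auto simp: near_def)
    show "n \<le> 0" if "- v = -1 * q powi n" for n using near_1_powi[OF v, of n] that by force
    show "n \<le> 0" if "1 / - u = -1 * q powi n" for n
      using arg_cong[OF that, of val] val_uv(1) nz by (auto simp: near_def val_divide val_mult)
    show "n \<ge> 0" if "1 / - v = -1 * q powi n" for n
    proof -
      have "v = q powi (- n)" using that nz by (simp add: power_int_minus field_simps)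
      from near_1_powi[OF v this] show ?thesis by simp
    qed
  qed (use nz in auto)
qed

lemma not_in_orbit_inverse:
  assumes "near 0 u" "u^2 \<noteq> 1"
  shows "\<not> in_orbit (- u) (- (1 / u))"
proof
  have nz: "u \<noteq> 0" using assms by (auto simp: near_def)
  assume "in_orbit (- u) (- (1 / u))"
  hence "- (1 / u) = - u * q powi 0"
    by (rule in_orbit_imp_eq) (use assms nz in \<open>auto simp: near_def val_divide abs_less_iff\<close>)
  thus False using assms nz by (simp add: field_simps power2_eq_square)
qed

lemma not_in_orbit_inverse_q:
  assumes "near 1 v" "v^2 \<noteq> q^2"
  shows "\<not> in_orbit (- v) (- (1 / v))"
proof
  have nz: "v \<noteq> 0" using assms by (auto simp: near_def)
  assume "in_orbit (- v) (- (1 / v))"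
  hence "- (1 / v) = - v * q powi -2"
    by (rule in_orbit_imp_eq) (use assms nz in \<open>auto simp: near_def val_divide abs_less_iff\<close>)
  thus False using assms nz by (simp add: field_simps power2_eq_square power_int_minus)
qed

theorem minus_1_root_not_diff_alg:
  assumes g: "curve_eq (- u) (-1) (- v) (-1) c g" "g \<noteq> 0" and "c \<noteq> 0"
    and u: "near 0 u \<and> u \<noteq> 1 \<or> u = q" and v: "near 1 v \<and> v \<noteq> q \<or> v = 1" and uv: "v \<noteq> q * u"
  shows "\<not> diff_alg g"
proof -
  have nz: "u \<noteq> 0" "v \<noteq> 0" using u v by (auto simp: near_def)
  have generic: ?thesis if "z0 \<noteq> 0"
    "in_orbit z0 (- u) \<and> \<not> in_orbit z0 (- (1 / u)) \<and> \<not> in_orbit z0 (- v) \<or>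
     in_orbit z0 (- v) \<and> \<not> in_orbit z0 (- u) \<and> \<not> in_orbit z0 (- (1 / v))" for z0
    using common_root_equation_not_diff_alg[of "-1" u v c g z0] g nz that
      minus_1_root_no_rational_solution[OF _ \<open>c \<noteq> 0\<close> u v] by simp
  have ratio: "\<not> in_orbit (- u) (- v)" if "\<not> (u = q \<and> v = 1)"
    using common_root_ratio_not_in_orbit[OF _ u v uv that, of "-1"] by simp
  consider (generic_u) "near 0 u" "u^2 \<noteq> 1" | (generic_v) "near 1 v" "v^2 \<noteq> q^2" | (reflected) "u = q" "v = 1"
    | (antisymmetric) "u = -1" "v = 1" | (double) "u = q" "v = - q"
    using u v uv power2_eq_1_iff[of u] power2_eq_iff[of v q] by auto
  thus ?thesis
  proof cases
    case generic_u
    moreover from this have "u \<noteq> q" by (auto simp: near_def)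
    ultimately show ?thesis using generic[of "- u"] not_in_orbit_inverse[of u] ratio nz by simp
  next
    case generic_v
    moreover from this have "v \<noteq> 1" by (auto simp: near_def)
    ultimately show ?thesis
      using generic[of "- v"] not_in_orbit_inverse_q[of v] ratio in_orbit_sym[of "- v" "- u"] nz by auto
  next
    case reflected
    have "curve_eq (- q) (-1) (-1) (-1) c g" using g(1) reflected by simp
    thus ?thesis
    proof (rule linprod_reflected_roots_not_diff_alg[OF _ _ _ \<open>c \<noteq> 0\<close>])
      fix n :: int assume "n \<noteq> 0"
      thus "count_list [- q, -1, 1 / - q, 1 / -1, -1, -1] (-1 * q powi n) + count_list [1, -1] (-1 :: complex) <
          count_list [- q, -1, 1 / - q, 1 / -1, -1, -1] (-1)"
        using orbit_neq[of "-1" n] q_neq by (auto simp: field_simps split: if_splits)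
    qed auto
  next
    case antisymmetric
    have "curve_eq 1 (-1) (-1) (-1) c g" using g(1) antisymmetric by simp
    thus ?thesis by (rule antisymmetric_p_not_diff_alg) (use \<open>c \<noteq> 0\<close> in auto)
  next
    case double
    show ?thesis using g(1) double \<open>c \<noteq> 0\<close> by (intro double_minus_one_root_not_diff_alg[of c]) simp_all
  qed
qed

end

section \<open>The two quadratic polynomials of the kernel curve\<close>

definition nA :: "complex \<Rightarrow> complex \<Rightarrow> complex \<Rightarrow> complex \<Rightarrow> complex poly" where
  "nA A ex ey h = [:A - h^2, (h^2 + 1) * A * ex - (A + 1) * h * ey, A * h^2 - 1:]"

definition nA' :: "complex \<Rightarrow> complex \<Rightarrow> complex \<Rightarrow> complex \<Rightarrow> complex poly" where
  "nA' A ex ey h = [:A * h^2 - 1, (h^2 + 1) * A * ex - (A + 1) * h * ey, A - h^2:]"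

definition nB :: "complex \<Rightarrow> complex \<Rightarrow> complex \<Rightarrow> complex \<Rightarrow> complex poly" where
  "nB B ex ey h = [:h^2 * (B * h^2 - 1), h * ((h^2 + 1) * B * ey - (B + 1) * h * ex), B - h^2:]"

definition nB' :: "complex \<Rightarrow> complex \<Rightarrow> complex \<Rightarrow> complex \<Rightarrow> complex poly" where
  "nB' B ex ey h = [:B - h^2, h * ((h^2 + 1) * B * ey - (B + 1) * h * ex), h^2 * (B * h^2 - 1):]"

lemma quadratic_roots:
  fixes c0 c1 c2 :: complex
  assumes "c2 \<noteq> 0"
  obtains z1 z2 where "c2 * (z1 + z2) = - c1" "c2 * (z1 * z2) = c0"
proof
  define s where "s = csqrt (c1^2 - 4 * c0 * c2)"
  have s: "s * s = c1 * c1 - 4 * c0 * c2" by (simp add: s_def power2_eq_square[symmetric])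
  show "c2 * ((-c1 + s) / (2 * c2) + (-c1 - s) / (2 * c2)) = - c1" using assms by (simp add: field_simps)
  have "c2 * ((-c1 + s) / (2 * c2) * ((-c1 - s) / (2 * c2))) = (c1 * c1 - s * s) / (4 * c2)"
    using assms by (simp add: field_simps)
  thus "c2 * ((-c1 + s) / (2 * c2) * ((-c1 - s) / (2 * c2))) = c0" unfolding s using assms by (simp add: field_simps)
qed

lemma quadratic_factor:
  assumes "c2 * (z1 + z2) = - c1" "c2 * (z1 * z2) = (c0::complex)"
  shows "[:c0, c1, c2:] = smult c2 ([:-z1, 1:] * [:-z2, 1:])"
    "[:c2, c1, c0:] = smult c2 ([:1, -z1:] * [:1, -z2:])"
  using assms by (simp_all add: algebra_simps eq_neg_iff_add_eq_0)

lemma quadratic_root_le: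
  fixes z :: complex
  assumes "c0 + c1 * z + c2 * z^2 = 0" "norm c0 \<le> M" "norm c1 \<le> M" "m \<le> norm c2" "m > 0"
  shows "norm z \<le> max 1 (2 * M / m)"
proof (cases "norm z \<le> 1")
  case False
  have "M \<ge> 0" by (rule order_trans[OF norm_ge_zero assms(2)])
  have "c2 * (z * z) = - (c0 + c1 * z)" using assms(1) unfolding eq_neg_iff_add_eq_0 power2_eq_square by (simp add: add_ac)
  hence "norm c2 * (norm z * norm z) = norm (c0 + c1 * z)" by (metis norm_minus_cancel norm_mult)
  also have "... \<le> norm c0 + norm c1 * norm z" using norm_triangle_ineq[of c0 "c1 * z"] by (simp add: norm_mult)
  also have "... \<le> M * norm z + M * norm z"
    using mult_left_mono[of 1 "norm z" M] assms(2,3) False \<open>M \<ge> 0\<close>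
    by (intro add_mono mult_right_mono) auto
  finally have "norm c2 * norm z * norm z \<le> 2 * M * norm z" by (simp add: mult_ac)
  hence "norm c2 * norm z \<le> 2 * M" by (rule mult_right_le_imp_le) (use False in linarith)
  moreover have "m * norm z \<le> norm c2 * norm z" using assms(4) by (intro mult_right_mono) auto
  ultimately have "norm z \<le> 2 * M / m" using assms(5) by (simp add: field_simps)
  thus ?thesis by simp
qed simp

lemma quadratic_root_norm_near:
  fixes z :: complex
  assumes "c0 + c1 * z + c2 * z^2 = 0" "norm c0 \<le> M" "norm c1 \<le> M" "norm c2 \<le> M"
    "m \<le> norm c0" "m \<le> norm c2" "m > 0"
  shows "norm_near (max 1 (2 * M / m)) 1 z"
proof -
  have z: "z \<noteq> 0" using assms by auto
  have "c2 + c1 * (1 / z) + c0 * (1 / z)^2 = (c0 + c1 * z + c2 * z^2) / z^2"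
    using z by (simp add: field_simps power2_eq_square)
  hence "norm (1 / z) \<le> max 1 (2 * M / m)" using quadratic_root_le[of c2 c1 "1 / z" c0 M m] assms by simp
  hence "1 / max 1 (2 * M / m) \<le> norm z" using z by (simp add: norm_divide field_simps)
  thus ?thesis using quadratic_root_le[OF assms(1,2,3,6,7)] by (simp add: norm_near_def)
qed

subsection \<open>The size of the roots\<close>

lemma q_dilation_square: "h > 1 \<Longrightarrow> q_dilation ((cr h)^2)"
  by unfold_locales (simp add: norm_power)

lemma eventually_near:
  assumes "R \<ge> 1"
  shows "\<forall>\<^sub>F h in at_top. \<forall>z. norm_near R (h powr (2 * s)) z \<longrightarrow> q_dilation.near ((cr h)^2) s z"
  using eventually_gt_at_top[of "max 1 (R^4)"]
proof eventually_elim
  case (elim h)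
  interpret q_dilation "(cr h)^2" using elim by (intro q_dilation_square) simp
  have "norm ((cr h)^2) powr s = h powr (2 * s)"
    using elim by (simp add: norm_power powr_powr flip: powr_numeral)
  thus ?case using nearI[OF refl assms] elim by simp
qed

lemma tendsto_imp_eventually_near:
  assumes lim: "((\<lambda>h. norm (f h) / h powr (2 * s)) \<longlongrightarrow> L) at_top" and "L > 0"
  shows "\<forall>\<^sub>F h in at_top. q_dilation.near ((cr h)^2) s (f h)"
proof -
  define R where "R = max 1 (max (2 * L) (2 / L))"
  have "R \<ge> 1" "2 / L \<le> R" "2 * L \<le> R" by (auto simp: R_def)
  moreover from this have "1 / R \<le> L / 2" using \<open>L > 0\<close> by (simp add: field_simps)
  ultimately have R: "R \<ge> 1" "1 / R \<le> L / 2" "2 * L \<le> R" by auto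
  have "\<forall>\<^sub>F h in at_top. L / 2 < norm (f h) / h powr (2 * s)" "\<forall>\<^sub>F h in at_top. norm (f h) / h powr (2 * s) < 2 * L"
    by (rule order_tendstoD(1)[OF lim] order_tendstoD(2)[OF lim]; use \<open>L > 0\<close> in simp)+
  with eventually_near[OF R(1), of s] eventually_gt_at_top[of 0] show ?thesis
  proof eventually_elim
    case (elim h)
    define x where "x = norm (f h) / h powr (2 * s)"
    have f: "norm (f h) = h powr (2 * s) * x" using elim by (simp add: x_def)
    have "1 / R \<le> x" "x \<le> R" using elim(3,4) R(2,3) unfolding x_def by linarith+
    hence "h powr (2 * s) * (1 / R) \<le> norm (f h)" "norm (f h) \<le> h powr (2 * s) * R"
      unfolding f by (intro mult_left_mono; simp)+
    thus ?case using elim by (simp add: norm_near_def)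
  qed
qed

lemma nA_root_norm_near:
  assumes "A \<noteq> 0" and h: "h \<ge> max 1 (max (2 * norm A) (2 / norm A))"
    and M: "norm ex \<le> M" "norm ey \<le> M" and z: "poly (nA A ex ey (cr h)) z = 0"
  shows "norm_near (max 1 (2 * ((norm A + 1) * (3 * M + 1)) / min (norm A / 2) (1 / 2))) 1 z"
proof -
  let ?K = "(norm A + 1) * (3 * M + 1)" and ?m = "min (norm A / 2) (1 / 2)"
  have A: "norm A > 0" using assms(1) by simp
  have h1: "h \<ge> 1" "h \<ge> 2 * norm A" "h \<ge> 2 / norm A" using h by auto
  moreover have "h \<le> h^2" using \<open>h \<ge> 1\<close> by (intro self_le_power) auto
  ultimately have h: "h^2 \<ge> 1" "h^2 \<ge> 2 * norm A" "h^2 \<ge> 2 / norm A" "h \<le> h^2" by linarith+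
  hence Ah: "norm A * h^2 \<ge> 2" using A by (simp add: field_simps)
  have n: "norm (cr h ^ 2) = h^2" "norm (A * cr h ^ 2) = norm A * h^2" by (simp_all add: norm_mult norm_power)
  have "M \<ge> 0" using M(1) norm_ge_zero order_trans by blast
  let ?c1 = "((cr h)^2 + 1) * A * ex - (A + 1) * cr h * ey"
  have "norm (A - (cr h)^2) \<le> (norm A + 1) * h^2"
    using norm_triangle_ineq4[of A "(cr h)^2"] mult_left_mono[OF h(1), of "norm A"] n by (simp add: algebra_simps)
  moreover have "norm (A * (cr h)^2 - 1) \<le> (norm A + 1) * h^2"
    using norm_triangle_ineq4[of "A * (cr h)^2" 1] h(1) n by (simp add: algebra_simps)
  moreover have "norm ?c1 \<le> 2 * h^2 * norm A * M + (norm A + 1) * h^2 * M"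
  proof -
    have "norm ?c1 \<le> norm ((cr h)^2 + 1) * norm A * norm ex + norm (A + 1) * norm (cr h) * norm ey"
      using norm_triangle_ineq4[of "((cr h)^2 + 1) * A * ex" "(A + 1) * cr h * ey"] by (simp add: norm_mult)
    also have "... \<le> 2 * h^2 * norm A * M + (norm A + 1) * h^2 * M"
      using norm_triangle_ineq[of "(cr h)^2" 1] norm_triangle_ineq[of A 1] h h1 n M \<open>M \<ge> 0\<close>
      by (intro add_mono mult_mono) auto
    finally show ?thesis .
  qed
  moreover have "(norm A + 1) * h^2 \<le> ?K * h^2" "2 * h^2 * norm A * M + (norm A + 1) * h^2 * M \<le> ?K * h^2"
    using \<open>M \<ge> 0\<close> A h(1) by (auto simp: algebra_simps intro!: add_increasing mult_nonneg_nonneg)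
  moreover have "?m * h^2 \<le> h^2 / 2" "?m * h^2 \<le> norm A * h^2 / 2"
    using mult_right_mono[of ?m "1 / 2" "h^2"] mult_right_mono[of ?m "norm A / 2" "h^2"] by auto
  moreover have "h^2 / 2 \<le> norm (A - (cr h)^2)" "norm A * h^2 / 2 \<le> norm (A * (cr h)^2 - 1)"
    using norm_triangle_ineq2[of "(cr h)^2" A] norm_triangle_ineq2[of "A * (cr h)^2" 1] n h(2) Ah
    by (auto simp: norm_minus_commute)
  moreover have "?m * h^2 > 0" using A h(1) by (intro mult_pos_pos) auto
  ultimately have "norm_near (max 1 (2 * (?K * h^2) / (?m * h^2))) 1 z"
    using z by (intro quadratic_root_norm_near[of "A - (cr h)^2" ?c1 z "A * (cr h)^2 - 1"])
      (auto simp: nA_def algebra_simps power2_eq_square intro: order_trans)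
  thus ?thesis using h1(1) by simp
qed

lemma eventually_nA_root_near:
  assumes "M \<ge> 0"
  shows "\<forall>\<^sub>F h in at_top. \<forall>ex ey z. norm ex \<le> M \<longrightarrow> norm ey \<le> M \<longrightarrow> poly (nA A ex ey (cr h)) z = 0 \<longrightarrow>
      q_dilation.near ((cr h)^2) (if A = 0 then 1/2 else 0) z"
proof (cases "A = 0")
  case False
  let ?R = "max 1 (2 * ((norm A + 1) * (3 * M + 1)) / min (norm A / 2) (1 / 2))"
  have "?R \<ge> 1" by simp
  show ?thesis
    using eventually_near[OF \<open>?R \<ge> 1\<close>, of 0] eventually_ge_at_top[of "max 1 (max (2 * norm A) (2 / norm A))"]
  proof eventually_elim
    case (elim h)
    thus ?case using nA_root_norm_near[OF False elim(2), of _ M] False by (auto simp: field_simps)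
  qed
next
  case True
  let ?R = "max 1 (2 * (M + 1) / 1)"
  have "?R \<ge> 1" by simp
  show ?thesis
    using eventually_near[OF \<open>?R \<ge> 1\<close>, of "1 / 2"] eventually_gt_at_top[of 1]
  proof eventually_elim
    case (elim h)
    have "norm_near ?R h z"
      if "norm ey \<le> M" "poly (nA 0 ex ey (cr h)) z = 0" for ex ey z
    proof -
      have "1 + ey * (z / cr h) + 1 * (z / cr h)^2 = - poly (nA 0 ex ey (cr h)) z / (cr h)^2"
        using elim by (simp add: nA_def field_simps power2_eq_square)
      hence "norm_near ?R 1 (z / cr h)"
        using that assms by (intro quadratic_root_norm_near[where ?c0.0 = 1 and ?c1.0 = ey and ?c2.0 = 1]) auto
      thus ?thesis using elim by (simp add: norm_near_def norm_divide field_simps)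
    qed
    thus ?case using elim True by simp
  qed
qed

context q_dilation
begin

lemma near_reflect:
  assumes "q = h^2" "z \<noteq> 0" "near s (h / z)" shows "near (1/2 - s) z"
proof -
  have "h \<noteq> 0" using assms(1) q_nz by auto
  hence "2 * val h = 1" using val_mult[of h h] val_q by (simp add: assms(1)[symmetric] flip: power2_eq_square)
  thus ?thesis using assms(2,3) \<open>h \<noteq> 0\<close> by (auto simp: near_def val_divide)
qed

definition roots_near :: "complex \<Rightarrow> complex \<Rightarrow> complex \<Rightarrow> complex \<Rightarrow> complex \<Rightarrow> bool" where
  "roots_near A B ex ey h \<longleftrightarrow>
      (\<forall>z. poly (nA A ex ey h) z = 0 \<longrightarrow> near (if A = 0 then 1/2 else 0) z) \<and>
      (\<forall>z. poly (nB B ex ey h) z = 0 \<longrightarrow> near (if B = 0 then 0 else 1/2) z)"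

end

lemma eventually_nonresonant: "\<forall>\<^sub>F h in at_top. A * (cr h)^2 \<noteq> 1 \<and> B \<noteq> (cr h)^2"
  using eventually_gt_at_top[of "max 1 (max (norm B) (1 / norm A))"]
proof eventually_elim
  case (elim h)
  have "h \<le> h^2" using elim by (intro self_le_power) auto
  hence h: "norm B < h^2" "1 / norm A < h^2" "norm ((cr h)^2) = h^2" using elim by (auto simp: norm_power)
  moreover have "norm A * h^2 \<noteq> 1" using h(2) by (cases "A = 0") (auto simp: field_simps)
  ultimately show ?case by (metis less_irrefl norm_mult norm_one)
qed

theorem eventually_roots_near:
  assumes "M \<ge> 0"
  shows "\<forall>\<^sub>F h in at_top. \<forall>ex ey. norm ex \<le> M \<longrightarrow> norm ey \<le> M \<longrightarrow> q_dilation.roots_near ((cr h)^2) A B ex ey (cr h)"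
  using eventually_nA_root_near[OF assms, of A] eventually_nA_root_near[OF assms, of B] eventually_gt_at_top[of 1]
    eventually_nonresonant[of B 0]
proof eventually_elim
  case (elim h)
  interpret q_dilation "(cr h)^2" using elim(3) by (rule q_dilation_square)
  have "near (if B = 0 then 0 else 1/2) z"
    if M: "norm ex \<le> M" "norm ey \<le> M" and z: "poly (nB B ex ey (cr h)) z = 0" for ex ey z
  proof -
    have "z \<noteq> 0" using z elim(3,4) by (auto simp: nB_def)
    have "poly (nA B ey ex (cr h)) (cr h / z) = poly (nB B ex ey (cr h)) z / z^2"
      using \<open>z \<noteq> 0\<close> by (simp add: nA_def nB_def field_simps power2_eq_square)
    hence "near (if B = 0 then 1/2 else 0) (cr h / z)" using elim(2) M z by simp
    from near_reflect[OF refl \<open>z \<noteq> 0\<close> this] show ?thesis by (cases "B = 0") simp_all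
  qed
  thus ?case using elim(1) by (simp add: roots_near_def)
qed

subsection \<open>Differential transcendence on the kernel curve\<close>

context q_dilation
begin

definition kernel_eq :: "complex \<Rightarrow> complex \<Rightarrow> complex \<Rightarrow> complex \<Rightarrow> complex \<Rightarrow> complex \<Rightarrow> complex fls \<Rightarrow> bool" where
  "kernel_eq A B ex ey h k g \<longleftrightarrow>
      toR (nA A ex ey h * nB' B ex ey h) * dil g =
        toR (nA' A ex ey h * nB B ex ey h) * g + fls_const k * fls_X * toR (nA' A ex ey h - nA A ex ey h)"

lemma kernel_eq_curve_eq:
  assumes A: "A * h^2 - 1 \<noteq> 0" "(A * h^2 - 1) * (p1 + p2) = - ((h^2 + 1) * A * ex - (A + 1) * h * ey)"
      "(A * h^2 - 1) * (p1 * p2) = A - h^2"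
    and B: "B - h^2 \<noteq> 0" "(B - h^2) * (r1 + r2) = - (h * ((h^2 + 1) * B * ey - (B + 1) * h * ex))"
      "(B - h^2) * (r1 * r2) = h^2 * (B * h^2 - 1)"
    and g: "kernel_eq A B ex ey h k g"
  shows "curve_eq p1 p2 r1 r2 (k / (B - h^2)) g"
proof -
  define P P' S S' where "P = [:-p1, 1:] * [:-p2, 1:]" and "P' = [:1, -p1:] * [:1, -p2:]"
    and "S = [:-r1, 1:] * [:-r2, 1:]" and "S' = [:1, -r1:] * [:1, -r2:]"
  define a b where "a = fls_const (A * h^2 - 1)" and "b = fls_const (B - h^2)"
  have ab: "a \<noteq> 0" "b \<noteq> 0" using A B by (auto simp: a_def b_def)
  have n: "toR (nA A ex ey h) = a * toR P" "toR (nA' A ex ey h) = a * toR P'"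
    "toR (nB B ex ey h) = b * toR S" "toR (nB' B ex ey h) = b * toR S'"
    unfolding nA_def nA'_def nB_def nB'_def a_def b_def P_def P'_def S_def S'_def
    by (simp_all only: quadratic_factor[OF A(2,3)] quadratic_factor[OF B(2,3)] toR_smult)
  have k: "fls_const k = b * fls_const (k / (B - h^2))" using B(1) by (simp add: b_def)
  have "(a * b) * (toR P * toR S' * dil g) =
      (a * b) * (toR P' * toR S * g + fls_const (k / (B - h^2)) * fls_X * (toR P' - toR P))"
    using g[unfolded kernel_eq_def toR_mult toR_diff n k] by (simp only: algebra_simps)
  hence "toR (P * S') * dil g = toR (P' * S) * g + fls_const (k / (B - h^2)) * fls_X * toR (P' - P)"
    using ab by (simp only: toR_mult toR_diff mult_cancel_left mult_eq_0_iff simp_thms)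
  thus ?thesis unfolding curve_eq_def P_def P'_def S_def S'_def by (simp only: mult.assoc)
qed

lemma root_products_ne:
  assumes "A \<noteq> -1" "B \<noteq> -1" "(A * q - 1) * P = A - q" "(B - q) * R = q * (B * q - 1)"
  shows "P \<noteq> 1" "R \<noteq> q"
proof -
  have "(A + 1) * (q - 1) = 0" if "P = 1" using assms(3) that by (simp add: algebra_simps)
  thus "P \<noteq> 1" using assms(1) q_neq by (auto simp: add_eq_0_iff2)
  have "(B + 1) * (q - 1) = 0" if "R = q"
  proof -
    have "(B - q) * q = (B * q - 1) * q" using assms(4) that by (simp add: mult.commute)
    hence "B - q = B * q - 1" by (simp only: mult_right_cancel[OF q_nz])
    thus ?thesis by algebra
  qed
  thus "R \<noteq> q" using assms(2) q_neq by (auto simp: add_eq_0_iff2)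
qed

lemma opposite_roots_imp_degenerate:
  assumes q: "q = h^2"
    and p: "(A * q - 1) * (p1 + p2) = - ((q + 1) * A * ex - (A + 1) * h * ey)" "(A * q - 1) * (p1 * p2) = A - q"
    and r: "(B - q) * (r1 + r2) = - (h * ((q + 1) * B * ey - (B + 1) * h * ex))" "(B - q) * (r1 * r2) = q * (B * q - 1)"
    and ne: "p1 * p2 \<noteq> 1" "r1 * r2 \<noteq> q" and squares: "p1^2 = 1" "p2^2 = 1" "r1^2 = q" "r2^2 = q"
  shows "A = 1" "B = 1" "ex = 0" "ey = 0"
proof -
  have "p2 \<noteq> p1" "r2 \<noteq> r1" using squares ne by (auto simp: power2_eq_square)
  hence "p2 = - p1" "r2 = - r1" using squares power2_eq_iff by metis+
  hence sums: "p1 + p2 = 0" "p1 * p2 = -1" "r1 + r2 = 0" "r1 * r2 = - q"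
    using squares by (simp_all add: power2_eq_square)
  have "(A - 1) * (q + 1) = 0" using p(2) unfolding sums by algebra
  moreover have "q * ((B - 1) * (q + 1)) = 0" using r(2) unfolding sums by algebra
  ultimately show "A = 1" "B = 1" using q_neq(2) by (auto simp: add_eq_0_iff2)
  hence e: "(q + 1) * ex = 2 * h * ey" "(q + 1) * ey = 2 * h * ex"
    using p(1) r(1) q_nz unfolding sums by (auto simp: q)
  have "(q + 1) * ((q + 1) * ex) = 2 * h * ((q + 1) * ey)" unfolding e(1) by (simp add: mult_ac)
  also have "... = 4 * q * ex" unfolding e(2) by (simp add: q power2_eq_square)
  finally have "(q - 1)^2 * ex = 0" by (simp add: power2_eq_square algebra_simps)
  thus "ex = 0" using q_neq by simp
  thus "ey = 0" using e(2) q_neq(2) by (simp add: add_eq_0_iff2)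
qed

theorem bounded_not_diff_alg:
  assumes q: "q = h^2" and roots: "roots_near A B ex ey h"
    and nz: "A \<noteq> -1" "B \<noteq> -1" "A * q \<noteq> 1" "B \<noteq> q"
    and g: "kernel_eq A B ex ey h k g" "g \<noteq> 0" and k: "A * B \<noteq> 1 \<Longrightarrow> k \<noteq> 0"
    and ne: "\<not> (A = 1 \<and> B = 1 \<and> ex = 0 \<and> ey = 0)"
  shows "\<not> diff_alg g"
proof -
  have AB: "A * h^2 - 1 \<noteq> 0" "B - h^2 \<noteq> 0" using nz(3,4) by (auto simp: q)
  obtain p1 p2 where p: "(A * h^2 - 1) * (p1 + p2) = - ((h^2 + 1) * A * ex - (A + 1) * h * ey)"
      "(A * h^2 - 1) * (p1 * p2) = A - h^2"
    using quadratic_roots[OF AB(1)] by metis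
  obtain r1 r2 where r: "(B - h^2) * (r1 + r2) = - (h * ((h^2 + 1) * B * ey - (B + 1) * h * ex))"
      "(B - h^2) * (r1 * r2) = h^2 * (B * h^2 - 1)"
    using quadratic_roots[OF AB(2)] by metis
  have curve: "curve_eq p1 p2 r1 r2 (k / (B - h^2)) g" by (rule kernel_eq_curve_eq[OF AB(1) p AB(2) r g(1)])
  have "poly (nA A ex ey h) x = 0" if "x \<in> {p1, p2}" for x
    unfolding nA_def quadratic_factor(1)[OF p] poly_smult poly_mult using that by auto
  hence near_p: "near (if A = 0 then 1/2 else 0) p1" "near (if A = 0 then 1/2 else 0) p2"
    using roots by (simp_all add: roots_near_def)
  have "poly (nB B ex ey h) y = 0" if "y \<in> {r1, r2}" for y
    unfolding nB_def quadratic_factor(1)[OF r] poly_smult poly_mult using that by auto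
  hence near_r: "near (if B = 0 then 0 else 1/2) r1" "near (if B = 0 then 0 else 1/2) r2"
    using roots by (simp_all add: roots_near_def)
  note p = p[folded q] and r = r[folded q]
  note products = root_products_ne[OF nz(1,2) p(2) r(2)]
  show ?thesis
  proof (rule bounded_roots_not_diff_alg[OF curve g(2)])
    show "near 0 p1 \<and> near 0 p2 \<and> p1 * p2 \<noteq> 1 \<or> near (1/2) p1 \<and> near (1/2) p2 \<and> p1 * p2 = q"
      using near_p products(1) p(2) by (auto split: if_splits)
    show "near (1/2) r1 \<and> near (1/2) r2 \<and> r1 * r2 \<noteq> q \<or> near 0 r1 \<and> near 0 r2 \<and> r1 * r2 = 1"
      using near_r products(2) r(2) by (auto split: if_splits)
    show "k / (B - h^2) \<noteq> 0 \<or> near 0 p1 \<and> near (1/2) r1"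
      using near_p near_r k AB by (cases "A = 0"; cases "B = 0") auto
    show "\<not> (near 0 p1 \<and> near (1/2) r1 \<and> p1^2 = 1 \<and> p2^2 = 1 \<and> r1^2 = q \<and> r2^2 = q)"
      using opposite_roots_imp_degenerate[OF q p r products] ne by blast
  qed
qed

definition mob :: "complex \<Rightarrow> complex" where
  "mob A = (A - q) / (A * q - 1)"

definition separated :: "complex \<Rightarrow> complex \<Rightarrow> bool" where
  "separated A B \<longleftrightarrow> A \<noteq> -1 \<and> B \<noteq> -1 \<and> A * B \<noteq> 1 \<and> A * q \<noteq> 1 \<and> B \<noteq> q \<and>
    (A = 0 \<or> near 0 (mob A)) \<and> (B = 0 \<or> near 0 (mob B))"

lemma mob_0 [simp]: "mob 0 = q"
  by (simp add: mob_def)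

lemma separated_mob:
  assumes "separated A B"
  shows "near 0 (mob A) \<and> mob A \<noteq> 1 \<or> mob A = q"
    "near 1 (q / mob B) \<and> q / mob B \<noteq> q \<or> q / mob B = 1" "q / mob B \<noteq> q * mob A"
proof -
  have mob_1: "mob C \<noteq> 1" if "near 0 (mob C)" "C \<noteq> -1" for C
  proof
    assume "mob C = 1"
    moreover have "C * q \<noteq> 1" using that(1) by (auto simp: mob_def near_def)
    ultimately have "C - q = C * q - 1" by (simp add: mob_def)
    hence "(C + 1) * (q - 1) = 0" by algebra
    thus False using that(2) q_neq by (simp add: add_eq_0_iff2)
  qed
  note s = assms[unfolded separated_def]
  show "near 0 (mob A) \<and> mob A \<noteq> 1 \<or> mob A = q" using s mob_1[of A] by auto
  have B: "near 0 (mob B) \<and> mob B \<noteq> 1 \<or> B = 0" using s mob_1[of B] by auto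
  thus "near 1 (q / mob B) \<and> q / mob B \<noteq> q \<or> q / mob B = 1"
    by (auto simp: near_def val_divide divide_eq_eq)
  show "q / mob B \<noteq> q * mob A"
  proof
    assume "q / mob B = q * mob A"
    moreover have "mob B \<noteq> 0" using B by (auto simp: near_def)
    moreover from this have "B * q \<noteq> 1" by (auto simp: mob_def)
    ultimately have "mob A * mob B = 1" "B * q \<noteq> 1" by (auto simp: field_simps)
    hence "(A - q) * (B - q) = (A * q - 1) * (B * q - 1)" using s by (simp add: mob_def)
    hence "(A * B - 1) * ((q - 1) * (q + 1)) = 0" by (simp add: algebra_simps)
    thus False using s q_neq by (simp add: add_eq_0_iff2)
  qed
qed

lemma kernel_eq_common_root:
  assumes q: "q = h^2" and AB: "A * q \<noteq> 1" "B \<noteq> q" "mob B \<noteq> 0"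
    and \<zeta>: "\<zeta> \<noteq> 0" "poly (nA A ex ey h) \<zeta> = 0" "poly (nB B ex ey h) \<zeta> = 0" and g: "kernel_eq A B ex ey h k g"
  shows "curve_eq (mob A / \<zeta>) \<zeta> (q / mob B / \<zeta>) \<zeta> (k / (B - q)) g"
proof -
  define p r where "p = mob A / \<zeta>" and "r = q / mob B / \<zeta>"
  have "curve_eq p \<zeta> r \<zeta> (k / (B - h^2)) g"
  proof (rule kernel_eq_curve_eq[OF _ _ _ _ _ _ g])
    show a: "A * h^2 - 1 \<noteq> 0" and b: "B - h^2 \<noteq> 0" using AB by (auto simp: q)
    show prod_p: "(A * h^2 - 1) * (p * \<zeta>) = A - h^2" using a \<zeta>(1) unfolding q[symmetric] by (simp add: p_def mob_def)
    have "B * q \<noteq> 1" using AB(3) by (auto simp: mob_def)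
    thus prod_r: "(B - h^2) * (r * \<zeta>) = h^2 * (B * h^2 - 1)" using b \<zeta>(1) unfolding q[symmetric] by (simp add: r_def mob_def)
    let ?c1 = "(h^2 + 1) * A * ex - (A + 1) * h * ey" and ?d1 = "h * ((h^2 + 1) * B * ey - (B + 1) * h * ex)"
    have "\<zeta> * ((A * h^2 - 1) * (p + \<zeta>) + ?c1) = poly (nA A ex ey h) \<zeta>"
      using prod_p by (simp add: nA_def algebra_simps)
    thus "(A * h^2 - 1) * (p + \<zeta>) = - ?c1" unfolding eq_neg_iff_add_eq_0 using \<zeta> by simp
    have "\<zeta> * ((B - h^2) * (r + \<zeta>) + ?d1) = poly (nB B ex ey h) \<zeta>"
      using prod_r by (simp add: nB_def algebra_simps)
    thus "(B - h^2) * (r + \<zeta>) = - ?d1" unfolding eq_neg_iff_add_eq_0 using \<zeta> by simp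
  qed
  thus ?thesis by (simp only: q[symmetric] p_def r_def)
qed

theorem kernel_eq_common_root_not_diff_alg:
  assumes q: "q = h^2" and AB: "separated A B" and \<zeta>: "near (1/2) (\<zeta>^2) \<or> \<zeta> = -1"
    "poly (nA A ex ey h) \<zeta> = 0" "poly (nB B ex ey h) \<zeta> = 0"
    and g: "kernel_eq A B ex ey h k g" "g \<noteq> 0" and "k \<noteq> 0"
  shows "\<not> diff_alg g"
proof -
  note mob = separated_mob[OF AB]
  have "A * q \<noteq> 1" "B \<noteq> q" using AB by (auto simp: separated_def)
  moreover have "mob B \<noteq> 0" using mob(2) by (auto simp: near_def)
  moreover have "\<zeta> \<noteq> 0" using \<zeta>(1) by (auto simp: near_def)
  ultimately have curve: "curve_eq (mob A / \<zeta>) \<zeta> (q / mob B / \<zeta>) \<zeta> (k / (B - q)) g"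
    by (rule kernel_eq_common_root[OF q _ _ _ _ \<zeta>(2,3) g(1)])
  have c: "k / (B - q) \<noteq> 0" using \<open>k \<noteq> 0\<close> \<open>B \<noteq> q\<close> by simp
  from \<zeta>(1) show ?thesis
  proof
    assume "near (1/2) (\<zeta>^2)"
    thus ?thesis by (rule common_root_not_diff_alg[OF _ curve g(2) c mob])
  next
    assume "\<zeta> = -1"
    hence "curve_eq (- mob A) (-1) (- (q / mob B)) (-1) (k / (B - q)) g" using curve by simp
    thus ?thesis by (rule minus_1_root_not_diff_alg[OF _ g(2) c mob])
  qed
qed

end

theorem eventually_separated:
  assumes "A \<noteq> -1" "B \<noteq> -1" "A * B \<noteq> 1"
  shows "\<forall>\<^sub>F h in at_top. q_dilation.separated ((cr h)^2) A B"
proof -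
  have mob: "\<forall>\<^sub>F h in at_top. C = 0 \<or> q_dilation.near ((cr h)^2) 0 ((C - (cr h)^2) / (C * (cr h)^2 - 1))" for C
  proof (cases "C = 0")
    case False
    have "((\<lambda>h. norm ((C - (cr h)^2) / (C * (cr h)^2 - 1)) / h powr (2 * 0)) \<longlongrightarrow> norm (- 1 / C)) at_top"
    proof (rule Lim_transform_eventually)
      let ?w = "\<lambda>h. inverse ((cr h)^2)"
      have "((\<lambda>h. norm (?w h)) \<longlongrightarrow> 0) at_top"
        by (simp add: norm_inverse norm_power) real_asymp
      hence "(?w \<longlongrightarrow> 0) at_top" by (simp add: tendsto_norm_zero_iff)
      hence "((\<lambda>h. norm ((C * ?w h - 1) / (C - ?w h))) \<longlongrightarrow> norm ((C * 0 - 1) / (C - 0))) at_top"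
        by (intro tendsto_intros) (use False in auto)
      thus "((\<lambda>h. norm ((C * ?w h - 1) / (C - ?w h))) \<longlongrightarrow> norm (- 1 / C)) at_top" by simp
      show "\<forall>\<^sub>F h in at_top. norm ((C * ?w h - 1) / (C - ?w h)) =
          norm ((C - (cr h)^2) / (C * (cr h)^2 - 1)) / h powr (2 * 0)"
        using eventually_gt_at_top[of 0]
      proof eventually_elim
        case (elim h)
        have "(C * ?w h - 1) / (C - ?w h) = ((C * ?w h - 1) * (cr h)^2) / ((C - ?w h) * (cr h)^2)" using elim by simp
        also have "... = (C - (cr h)^2) / (C * (cr h)^2 - 1)" using elim by (simp add: algebra_simps)
        finally show ?case using elim by simp
      qed
    qed
    from tendsto_imp_eventually_near[OF this] show ?thesis using False by (auto elim: eventually_mono)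
  qed simp
  show ?thesis
    using mob[of A] mob[of B] eventually_nonresonant[of A B] eventually_gt_at_top[of 1]
  proof eventually_elim
    case (elim h)
    interpret q_dilation "(cr h)^2" using elim(4) by (rule q_dilation_square)
    show ?case using elim assms by (simp add: separated_def mob_def)
  qed
qed

section \<open>Walks and the functional equation\<close>

lemma px_append: "k \<le> length w \<Longrightarrow> px (w @ [v]) k = px w k"
    "px (w @ [v]) (Suc (length w)) = px w (length w) + fst v"
  and py_append: "k \<le> length w \<Longrightarrow> py (w @ [v]) k = py w k" "py (w @ [v]) (Suc (length w)) = py w (length w) + snd v"
  by (simp_all add: px_def py_def)

lemma card_atMost_Suc_filter:
  "card {k\<in>{1..Suc n}. P k} = card {k\<in>{1..n}. P k} + (if P (Suc n) then 1 else 0)"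
proof -
  have "{k\<in>{1..Suc n}. P k} = {k\<in>{1..n}. P k} \<union> (if P (Suc n) then {Suc n} else {})"
    by (auto simp: le_Suc_eq One_nat_def)
  thus ?thesis by (auto simp: card_insert_if One_nat_def)
qed

lemma nx_append: "nx (w @ [v]) = nx w + (if py w (length w) + snd v = 0 then 1 else 0)"
proof -
  have "{k\<in>{1..length w}. py (w @ [v]) k = 0} = {k\<in>{1..length w}. py w k = 0}"
    by (auto simp: py_append)
  moreover have "nx (w @ [v]) = card {k\<in>{1..Suc (length w)}. py (w @ [v]) k = 0}" by (simp add: nx_def)
  ultimately show ?thesis unfolding card_atMost_Suc_filter py_append(2) nx_def by (simp only:)
qed

lemma ny_append: "ny (w @ [v]) = ny w + (if px w (length w) + fst v = 0 then 1 else 0)"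
proof -
  have "{k\<in>{1..length w}. px (w @ [v]) k = 0} = {k\<in>{1..length w}. px w k = 0}"
    by (auto simp: px_append)
  moreover have "ny (w @ [v]) = card {k\<in>{1..Suc (length w)}. px (w @ [v]) k = 0}" by (simp add: ny_def)
  ultimately show ?thesis unfolding card_atMost_Suc_filter px_append(2) ny_def by (simp only:)
qed

lemma weight_append:
  assumes "finite S" "v \<in> S"
  shows "weight S d a b (w @ [v]) = weight S d a b w *
    (d v * (if py w (length w) + snd v = 0 then a else 1) * (if px w (length w) + fst v = 0 then b else 1))"
proof -
  have "(\<Prod>u\<in>S. d u ^ count_list (w @ [v]) u) = (\<Prod>u\<in>S. d u ^ count_list w u * (if v = u then d u else 1))"
    by (intro prod.cong) (auto simp: power_add)
  also have "... = (\<Prod>u\<in>S. d u ^ count_list w u) * d v"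
    using assms by (simp add: prod.distrib prod.delta)
  finally have e: "(\<Prod>u\<in>S. d u ^ count_list (w @ [v]) u) = (\<Prod>u\<in>S. d u ^ count_list w u) * d v" .
  show ?thesis unfolding weight_def e nx_append ny_append by (auto simp: power_add)
qed

lemma finite_walks: "finite S \<Longrightarrow> finite (walks S n)"
  using finite_lists_length_eq[of S n] by (rule finite_subset[rotated]) (auto simp: walks_def)

lemma walks_0: "walks S 0 = {[]}"
  by (auto simp: walks_def)

definition stays_in_quadrant :: "int \<Rightarrow> int \<Rightarrow> int \<times> int \<Rightarrow> bool" where
  "stays_in_quadrant i j v \<longleftrightarrow> 0 \<le> i + fst v \<and> 0 \<le> j + snd v"

lemma walks_Suc: "walks S (Suc n) =
  (\<lambda>(w, v). w @ [v]) ` (SIGMA w:walks S n. {v\<in>S. stays_in_quadrant (px w n) (py w n) v})"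
proof (intro equalityI subsetI)
  fix u assume u: "u \<in> walks S (Suc n)"
  hence l: "length u = Suc n" by (simp add: walks_def)
  then obtain w v where wv: "u = w @ [v]" by (metis length_Suc_conv_rev)
  have lw: "length w = n" using l wv by simp
  have pos: "0 \<le> px u k \<and> 0 \<le> py u k" if "k \<in> {1..Suc n}" for k using u that by (auto simp: walks_def)
  have "w \<in> walks S n"
    unfolding walks_def
  proof (intro CollectI conjI ballI)
    show "set w \<subseteq> S" using u by (auto simp: walks_def wv)
    fix k assume k: "k \<in> {1..n}"
    hence "0 \<le> px u k \<and> 0 \<le> py u k" by (intro pos) auto
    thus "0 \<le> px w k" "0 \<le> py w k" using k px_append(1)[of k w v] py_append(1)[of k w v] lw by (auto simp: wv)
  qed (rule lw)
  moreover have "v \<in> S" using u by (auto simp: walks_def wv)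
  moreover have "0 \<le> px w n + fst v \<and> 0 \<le> py w n + snd v"
    using pos[of "Suc n"] px_append(2)[of w v] py_append(2)[of w v] lw by (simp add: wv)
  ultimately show "u \<in> (\<lambda>(w, v). w @ [v]) ` (SIGMA w:walks S n. {v\<in>S. stays_in_quadrant (px w n) (py w n) v})"
    using wv by (force simp: stays_in_quadrant_def)
next
  fix u assume "u \<in> (\<lambda>(w, v). w @ [v]) ` (SIGMA w:walks S n. {v\<in>S. stays_in_quadrant (px w n) (py w n) v})"
  then obtain w v where wv: "u = w @ [v]" "w \<in> walks S n" "v \<in> S" "0 \<le> px w n + fst v" "0 \<le> py w n + snd v"
    by (auto simp: stays_in_quadrant_def)
  have lw: "length w = n" using wv(2) by (simp add: walks_def)
  have "0 \<le> px u k \<and> 0 \<le> py u k" if k: "k \<in> {1..Suc n}" for k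
  proof (cases "k = Suc n")
    case True thus ?thesis using wv px_append(2)[of w v] py_append(2)[of w v] lw by simp
  next
    case False
    hence "k \<in> {1..n}" using k by auto
    thus ?thesis using wv(2) px_append(1)[of k w v] py_append(1)[of k w v] lw by (auto simp: walks_def wv(1))
  qed
  thus "u \<in> walks S (Suc n)" using wv lw by (auto simp: walks_def)
qed

definition step_weight :: "(int \<times> int \<Rightarrow> real) \<Rightarrow> real \<Rightarrow> real \<Rightarrow> int \<Rightarrow> int \<Rightarrow> int \<times> int \<Rightarrow> real" where
  "step_weight d a b i j v =
    d v * (if j + snd v = 0 then a else 1) * (if i + fst v = 0 then b else 1)"

definition walk_sum :: "(int \<times> int) set \<Rightarrow> (int \<times> int \<Rightarrow> real) \<Rightarrow> real \<Rightarrow> real \<Rightarrow> nat \<Rightarrow> (int \<Rightarrow> int \<Rightarrow> complex) \<Rightarrow> complex" where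
  "walk_sum S d a b n F = (\<Sum>w\<in>walks S n. cr (weight S d a b w) * F (px w n) (py w n))"

lemma walk_sum_Suc:
  assumes "finite S"
  shows "walk_sum S d a b (Suc n) F = walk_sum S d a b n (\<lambda>i j. \<Sum>v\<in>S.
    if stays_in_quadrant i j v then cr (step_weight d a b i j v) * F (i + fst v) (j + snd v) else 0)"
proof -
  let ?ext = "\<lambda>w. {v\<in>S. stays_in_quadrant (px w n) (py w n) v}"
  let ?term = "\<lambda>w v. cr (step_weight d a b (px w n) (py w n) v) * F (px w n + fst v) (py w n + snd v)"
  have inj: "inj_on (\<lambda>(w, v). w @ [v]) (SIGMA w:walks S n. ?ext w)" by (auto simp: inj_on_def)
  have summand: "cr (weight S d a b (w @ [v])) * F (px (w @ [v]) (Suc n)) (py (w @ [v]) (Suc n)) =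
      cr (weight S d a b w) * ?term w v" if "w \<in> walks S n" "v \<in> ?ext w" for w v
  proof -
    have "length w = n" using that(1) by (simp add: walks_def)
    thus ?thesis using that(2) px_append(2)[of w v] py_append(2)[of w v]
      by (simp add: weight_append[OF assms] step_weight_def mult.assoc)
  qed
  have "walk_sum S d a b (Suc n) F = (\<Sum>(w, v)\<in>(SIGMA w:walks S n. ?ext w).
      cr (weight S d a b (w @ [v])) * F (px (w @ [v]) (Suc n)) (py (w @ [v]) (Suc n)))"
    unfolding walk_sum_def walks_Suc by (subst sum.reindex[OF inj]) (simp add: case_prod_unfold)
  also have "... = (\<Sum>w\<in>walks S n. \<Sum>v\<in>?ext w.
      cr (weight S d a b (w @ [v])) * F (px (w @ [v]) (Suc n)) (py (w @ [v]) (Suc n)))"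
    using assms by (subst sum.Sigma) (auto intro: finite_walks)
  also have "... = (\<Sum>w\<in>walks S n. \<Sum>v\<in>?ext w. cr (weight S d a b w) * ?term w v)"
    by (intro sum.cong refl summand)
  finally show ?thesis
    by (simp only: walk_sum_def sum_distrib_left[symmetric] sum.inter_filter[OF assms])
qed

lemma walk_sum_cong:
  "(\<And>w. w \<in> walks S n \<Longrightarrow> F (px w n) (py w n) = G (px w n) (py w n)) \<Longrightarrow> walk_sum S d a b n F = walk_sum S d a b n G"
  unfolding walk_sum_def by (intro sum.cong) auto

lemma walk_sum_linear:
  "walk_sum S d a b n (\<lambda>i j. F i j + G i j) = walk_sum S d a b n F + walk_sum S d a b n G"
  "walk_sum S d a b n (\<lambda>i j. F i j - G i j) = walk_sum S d a b n F - walk_sum S d a b n G"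
  "walk_sum S d a b n (\<lambda>i j. c * F i j) = c * walk_sum S d a b n F"
  by (simp_all add: walk_sum_def algebra_simps sum.distrib sum_subtractf sum_distrib_left)

lemma finite_S5: "finite S5" by (simp add: S5_def)

lemma walks_nonneg: "w \<in> walks S n \<Longrightarrow> 0 \<le> px w n" "w \<in> walks S n \<Longrightarrow> 0 \<le> py w n"
proof -
  have "0 \<le> px w n \<and> 0 \<le> py w n" if "w \<in> walks S n"
  proof (cases "n = 0")
    case True thus ?thesis by (simp add: px_def py_def)
  next
    case False
    hence "n \<in> {1..n}" by auto
    thus ?thesis using that unfolding walks_def by blast
  qed
  thus "w \<in> walks S n \<Longrightarrow> 0 \<le> px w n" "w \<in> walks S n \<Longrightarrow> 0 \<le> py w n" by auto
qed

lemma walks_S5_pos: "w \<in> walks S5 (Suc n) \<Longrightarrow> px w (Suc n) + py w (Suc n) \<ge> 1"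
proof (induction n arbitrary: w)
  case (0 w)
  then obtain v where v: "w = [v]" "v \<in> S5" "0 \<le> fst v" "0 \<le> snd v"
    unfolding walks_Suc walks_0 by (auto simp: px_def py_def stays_in_quadrant_def)
  thus ?case by (auto simp: S5_def px_def py_def)
next
  case (Suc n w)
  then obtain u v where uv: "w = u @ [v]" "u \<in> walks S5 (Suc n)" "v \<in> S5" unfolding walks_Suc[of S5 "Suc n"] by auto
  have lu: "length u = Suc n" using uv by (simp add: walks_def)
  have "fst v + snd v \<ge> 0" using uv(3) by (auto simp: S5_def)
  thus ?case using Suc.IH[OF uv(2)] px_append(2)[of u v] py_append(2)[of u v] lu uv(1) by simp
qed

lemma Qgf_walk_sum: "Qgf S d a b t x y = suminf (\<lambda>n. cr (t^n) * walk_sum S d a b n (\<lambda>i j. x^nat i * y^nat j))"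
  by (simp add: Qgf_def walk_sum_def mult.assoc)

lemma weight_S5:
  assumes "S \<subseteq> S5" "set w \<subseteq> S"
  shows "weight S d a b w = weight S5 d a b w"
proof -
  have "count_list w v = 0" if "v \<notin> S" for v
    using assms(2) that by (metis count_list_0_iff subsetD)
  hence "(\<Prod>v\<in>S. d v ^ count_list w v) = (\<Prod>v\<in>S5. d v ^ count_list w v)"
    by (intro prod.mono_neutral_left finite_S5 assms(1)) simp
  thus ?thesis by (simp add: weight_def)
qed

lemma weight_S5_eq_0:
  assumes "v \<in> set w" "v \<in> S5" "d v = 0"
  shows "weight S5 d a b w = 0"
proof -
  have "d v ^ count_list w v = 0" using assms count_list_0_iff[of w v] by simp
  hence "(\<Prod>v\<in>S5. d v ^ count_list w v) = 0" using assms(2) by (intro prod_zero finite_S5 bexI[of _ v])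
  thus ?thesis by (simp add: weight_def)
qed

lemma Qgf_S5:
  assumes S: "S \<subseteq> S5" and d: "\<forall>v. v \<notin> S \<longrightarrow> d v = 0"
  shows "Qgf S d a b t = Qgf S5 d a b t"
proof -
  have "walk_sum S d a b n F = walk_sum S5 d a b n F" for n F
    unfolding walk_sum_def
  proof (rule sum.mono_neutral_cong_left)
    show "\<forall>w\<in>walks S5 n - walks S n. cr (weight S5 d a b w) * F (px w n) (py w n) = 0"
    proof
      fix w assume "w \<in> walks S5 n - walks S n"
      then obtain v where "v \<in> set w" "v \<notin> S" "v \<in> S5" by (auto simp: walks_def)
      hence "weight S5 d a b w = 0" by (intro weight_S5_eq_0[of v] d[rule_format])
      thus "cr (weight S5 d a b w) * F (px w n) (py w n) = 0" by simp
    qed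
    show "finite (walks S5 n)" by (rule finite_walks[OF finite_S5])
  qed (use S in \<open>auto simp: walks_def weight_S5[OF S]\<close>)
  thus ?thesis by (intro ext) (simp add: Qgf_walk_sum)
qed

lemma holomorphic_on_suminf_geometric:
  fixes f :: "nat \<Rightarrow> complex \<Rightarrow> complex"
  assumes "\<And>n. f n holomorphic_on ball 0 1" "\<And>n z. norm z < 1 \<Longrightarrow> norm (f n z) \<le> (1 / 2)^n"
  shows "(\<lambda>z. suminf (\<lambda>n. f n z)) holomorphic_on ball 0 1"
proof (rule holomorphic_uniform_sequence)
  show "(\<lambda>z. \<Sum>i<n. f i z) holomorphic_on ball 0 1" for n by (intro holomorphic_on_sum assms)
  fix z :: complex assume "z \<in> ball 0 1"
  then obtain e where e: "e > 0" "cball z e \<subseteq> ball 0 1"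
    using open_contains_cball[of "ball (0::complex) 1"] open_ball by blast
  have "uniform_limit (cball z e) (\<lambda>n z. \<Sum>i<n. f i z) (\<lambda>z. suminf (\<lambda>i. f i z)) sequentially"
    by (rule Weierstrass_m_test[where M = "\<lambda>n. (1 / 2)^n"]) (use e assms in \<open>auto dest!: subsetD\<close>)
  thus "\<exists>e>0. cball z e \<subseteq> ball 0 1 \<and>
      uniform_limit (cball z e) (\<lambda>n z. \<Sum>i<n. f i z) (\<lambda>z. suminf (\<lambda>i. f i z)) sequentially"
    using e by blast
qed simp

locale quadrant =
  fixes d :: "int \<times> int \<Rightarrow> real" and a b t :: real
  assumes d_nonneg: "\<And>v. 0 \<le> d v" and ab_pos: "a > 0" "b > 0" and t_pos: "t > 0"
    and t_small: "t * ((\<Sum>v\<in>S5. d v) * ((1 + a) * (1 + b))) \<le> 1 / 2"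
begin

definition growth :: real where "growth = (\<Sum>v\<in>S5. d v) * ((1 + a) * (1 + b))"

abbreviation "W n \<equiv> walk_sum S5 d a b n"
abbreviation "Q \<equiv> Qgf S5 d a b t"

lemma growth_nonneg: "growth \<ge> 0"
  unfolding growth_def using d_nonneg ab_pos by (intro mult_nonneg_nonneg sum_nonneg) auto

lemma weight_nonneg: "0 \<le> weight S5 d a b w"
  unfolding weight_def using d_nonneg ab_pos by (intro mult_nonneg_nonneg prod_nonneg) auto

lemma walk_sum_norm:
  assumes "\<And>w. w \<in> walks S5 n \<Longrightarrow> norm (F (px w n) (py w n)) \<le> M"
  shows "norm (W n F) \<le> (\<Sum>w\<in>walks S5 n. weight S5 d a b w) * M"
  unfolding walk_sum_def sum_distrib_right
  by (rule sum_norm_le)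
     (use assms weight_nonneg in \<open>auto simp: norm_mult abs_of_nonneg intro!: mult_left_mono\<close>)

lemma sum_step_weight_le:
  "norm (\<Sum>v\<in>S5. if stays_in_quadrant i j v then cr (step_weight d a b i j v) else 0) \<le> growth"
proof -
  have "norm (if stays_in_quadrant i j v then cr (step_weight d a b i j v) else 0) \<le> d v * ((1 + a) * (1 + b))" for v
  proof -
    have "0 \<le> d v * ((if j + snd v = 0 then a else 1) * (if i + fst v = 0 then b else 1))"
      using ab_pos d_nonneg[of v] by (intro mult_nonneg_nonneg) auto
    moreover have "d v * ((if j + snd v = 0 then a else 1) * (if i + fst v = 0 then b else 1)) \<le> d v * ((1 + a) * (1 + b))"
      using ab_pos d_nonneg[of v] by (intro mult_left_mono mult_mono) auto
    ultimately show ?thesis by (simp add: step_weight_def mult.assoc del: of_real_mult)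
  qed
  thus ?thesis unfolding growth_def sum_distrib_right by (intro sum_norm_le)
qed

lemma sum_weight_le: "(\<Sum>w\<in>walks S5 n. weight S5 d a b w) \<le> growth^n"
proof (induction n)
  case 0
  show ?case by (simp add: walks_0 weight_def nx_def ny_def One_nat_def)
next
  case (Suc n)
  have "cr (\<Sum>w\<in>walks S5 (Suc n). weight S5 d a b w) = W (Suc n) (\<lambda>_ _. 1)" by (simp add: walk_sum_def)
  also have "norm ... \<le> (\<Sum>w\<in>walks S5 n. weight S5 d a b w) * growth"
    unfolding walk_sum_Suc[OF finite_S5] mult_1_right by (intro walk_sum_norm sum_step_weight_le)
  also have "... \<le> growth^n * growth" using Suc growth_nonneg by (rule mult_right_mono)
  finally show ?case unfolding norm_of_real power_Suc2 by (rule abs_le_D1)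
qed

lemma term_bound:
  assumes "\<And>w. w \<in> walks S5 n \<Longrightarrow> norm (F (px w n) (py w n)) \<le> M" "M \<ge> 0"
  shows "norm (cr (t^n) * W n F) \<le> (1 / 2)^n * M"
proof -
  have "norm (cr (t^n) * W n F) = t^n * norm (W n F)" using t_pos by (simp add: norm_mult norm_power)
  also have "... \<le> t^n * (growth^n * M)"
  proof (rule mult_left_mono)
    have "norm (W n F) \<le> (\<Sum>w\<in>walks S5 n. weight S5 d a b w) * M" by (rule walk_sum_norm) (rule assms(1))
    also have "... \<le> growth^n * M" by (rule mult_right_mono[OF sum_weight_le assms(2)])
    finally show "norm (W n F) \<le> growth^n * M" .
  qed (use t_pos in simp)
  also have "... = (t * growth)^n * M" by (simp add: power_mult_distrib)
  also have "... \<le> (1 / 2)^n * M"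
    using t_small t_pos growth_nonneg assms(2) by (intro mult_right_mono power_mono) (auto simp: growth_def)
  finally show ?thesis .
qed

lemma norm_monomial: "norm x \<le> 1 \<Longrightarrow> norm y \<le> 1 \<Longrightarrow> norm (x^i * y^j) \<le> 1" for x y :: complex
  by (simp add: norm_mult norm_power mult_le_one power_le_one)

definition qterm where "qterm n x y = cr (t^n) * W n (\<lambda>i j. x^nat i * y^nat j)"

lemma qterm_bound: "norm x \<le> 1 \<Longrightarrow> norm y \<le> 1 \<Longrightarrow> norm (qterm n x y) \<le> (1 / 2)^n"
  unfolding qterm_def using term_bound[of n "\<lambda>i j. x^nat i * y^nat j" 1] norm_monomial[of x y] by simp

lemma Q_qterm: "Q x y = suminf (\<lambda>n. qterm n x y)"
  by (simp add: Qgf_walk_sum qterm_def)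

lemma qterm_summable: "norm x \<le> 1 \<Longrightarrow> norm y \<le> 1 \<Longrightarrow> summable (\<lambda>n. qterm n x y)"
  by (rule summable_comparison_test'[OF complete_algebra_summable_geometric[of "1 / 2 :: real"]])
    (auto intro: qterm_bound)

lemma qterm_sums: "norm x \<le> 1 \<Longrightarrow> norm y \<le> 1 \<Longrightarrow> (\<lambda>n. qterm n x y) sums Q x y"
  unfolding Q_qterm by (intro summable_sums qterm_summable)

lemma qterm_holomorphic: "(\<lambda>x. qterm n x y) holomorphic_on A" "(\<lambda>y. qterm n x y) holomorphic_on A"
  unfolding qterm_def walk_sum_def by (intro holomorphic_intros)+

lemma Q_holomorphic_x: "norm y \<le> 1 \<Longrightarrow> (\<lambda>x. Q x y) holomorphic_on ball 0 1"
  and Q_holomorphic_y: "norm x \<le> 1 \<Longrightarrow> (\<lambda>y. Q x y) holomorphic_on ball 0 1"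
  unfolding Q_qterm
  by (intro holomorphic_on_suminf_geometric qterm_holomorphic qterm_bound; simp)+

lemma norm_Q_diff_le:
  assumes norms: "norm x \<le> 1" "norm y \<le> 1" "norm x' \<le> 1" "norm y' \<le> 1"
    and monomials: "\<And>i j. norm (x^i * y^j - x'^i * y'^j) \<le> M"
  shows "norm (Q x y - Q x' y') \<le> 2 * M"
proof -
  have "norm (qterm n x y - qterm n x' y') \<le> (1 / 2)^n * M" for n
  proof -
    have "qterm n x y - qterm n x' y' = cr (t^n) * W n (\<lambda>i j. x^nat i * y^nat j - x'^nat i * y'^nat j)"
      unfolding qterm_def walk_sum_linear by (simp add: algebra_simps)
    thus ?thesis
      using term_bound[of n "\<lambda>i j. x^nat i * y^nat j - x'^nat i * y'^nat j" M] monomials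
        order_trans[OF norm_ge_zero monomials[of 0 0]] by simp
  qed
  moreover have "(\<lambda>n. qterm n x y - qterm n x' y') sums (Q x y - Q x' y')"
    by (intro sums_diff qterm_sums norms)
  moreover have "(\<lambda>n. (1 / 2)^n * M) sums (2 * M)"
    using sums_mult2[OF geometric_sums[of "1 / 2 :: real"], of M] by simp
  ultimately show ?thesis
    using norm_suminf_le[of "\<lambda>n. qterm n x y - qterm n x' y'" "\<lambda>n. (1 / 2)^n * M"] by (simp add: sums_iff)
qed

lemma Q_lipschitz:
  assumes norms: "norm x \<le> 1" "norm y \<le> 1"
  shows "norm (Q x y - Q x 0) \<le> 2 * norm y" "norm (Q x y - Q 0 y) \<le> 2 * norm x"
proof -
  have pow: "norm (z^n - 0^n) \<le> norm z" if "norm z \<le> 1" for z :: complex and n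
    using that power_decreasing[of 1 n "norm z"] by (cases "n = 0") (auto simp: norm_power power_0_left)
  have "norm (x^i * (y^j - 0^j)) \<le> norm y" for i j
    using mult_mono[OF power_le_one[of "norm x" i] pow[OF norms(2), of j]] norms by (simp add: norm_mult norm_power)
  thus "norm (Q x y - Q x 0) \<le> 2 * norm y"
    using norms by (intro norm_Q_diff_le) (auto simp: right_diff_distrib)
  have "norm ((x^i - 0^i) * y^j) \<le> norm x" for i j
    using mult_mono[OF pow[OF norms(1), of i] power_le_one[of "norm y" j]] norms by (simp add: norm_mult norm_power)
  thus "norm (Q x y - Q 0 y) \<le> 2 * norm x"
    using norms by (intro norm_Q_diff_le) (auto simp: left_diff_distrib)
qed

lemma qterm_0: "qterm 0 x y = 1"
  by (simp add: qterm_def walk_sum_def walks_0 weight_def nx_def ny_def px_def py_def One_nat_def)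

lemma Q_0_0: "Q 0 0 = 1"
proof -
  have "qterm (Suc n) 0 0 = 0" for n
  proof -
    have "W (Suc n) (\<lambda>i j. 0^nat i * 0^nat j) = W (Suc n) (\<lambda>i j. 0 * 1)"
    proof (rule walk_sum_cong)
      fix w assume "w \<in> walks S5 (Suc n)"
      hence "nat (px w (Suc n)) \<noteq> 0 \<or> nat (py w (Suc n)) \<noteq> 0" using walks_S5_pos[of w n] by linarith
      thus "0^nat (px w (Suc n)) * 0^nat (py w (Suc n)) = (0 * 1 :: complex)" by (auto simp: power_0_left)
    qed
    thus ?thesis by (simp add: qterm_def walk_sum_def)
  qed
  hence "(\<lambda>n. qterm n 0 0) = (\<lambda>n. if n = 0 then 1 else 0)" by (auto simp: qterm_0 fun_eq_iff gr0_conv_Suc)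
  moreover have "(\<lambda>n. if n = 0 then 1 else 0 :: complex) sums 1" using sums_single[of 0 "\<lambda>_. 1 :: complex"] by simp
  ultimately have "(\<lambda>n. qterm n 0 0) sums 1" by simp
  thus ?thesis using qterm_sums[of 0 0] sums_unique2 by fastforce
qed

definition step_poly :: "complex \<Rightarrow> complex \<Rightarrow> complex" where
  "step_poly x y = of_real (d (1, -1)) * x^2 + of_real (d (-1, 1)) * y^2 + of_real (d (1, 0)) * x^2 * y
      + of_real (d (0, 1)) * x * y^2 + of_real (d (1, 1)) * x^2 * y^2"

lemma sum_over_steps:
  assumes "0 \<le> i" "0 \<le> j"
  shows "(\<Sum>v\<in>S5. if stays_in_quadrant i j v then cr (d v) * (x * y * (x^nat (i + fst v) * y^nat (j + snd v))) else 0)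
    = step_poly x y * (x^nat i * y^nat j) - of_real (d (1, -1)) * x^2 * (x^nat i * 0^nat j)
        - of_real (d (-1, 1)) * y^2 * (0^nat i * y^nat j)"
proof -
  obtain m n where mn: "i = int m" "j = int n" using assms by (metis nonneg_int_cases)
  have "nat (int k + 1) = Suc k" for k by simp
  thus ?thesis unfolding mn S5_def stays_in_quadrant_def
    by (cases m; cases n) (simp_all add: nat_add_distrib step_poly_def power2_eq_square algebra_simps)
qed

lemma boundary_factor:
  assumes "0 \<le> i" "0 \<le> j" "i + j \<ge> 1"
  shows "(if j = 0 then 1 / of_real a else 1) * (if i = 0 then 1 / of_real b else 1) * (x^nat i * y^nat j)
    = x^nat i * y^nat j + (1 / of_real a - 1) * (x^nat i * 0^nat j) + (1 / of_real b - 1) * (0^nat i * y^nat j :: complex)"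
  using assms by (auto simp: algebra_simps power_0_left)

lemma qterm_recurrence:
  "x * y * (qterm (Suc n) x y + (1 / of_real a - 1) * qterm (Suc n) x 0 + (1 / of_real b - 1) * qterm (Suc n) 0 y) =
      of_real t * (step_poly x y * qterm n x y - of_real (d (1, -1)) * x^2 * qterm n x 0
         - of_real (d (-1, 1)) * y^2 * qterm n 0 y)"
proof -
  define F where
    "F i j = x * y * ((if j = 0 then 1 / of_real a else 1) * (if i = 0 then 1 / of_real b else 1) * (x^nat i * y^nat j))"
    for i j :: int
  have "W (Suc n) F = W (Suc n) (\<lambda>i j. x * y * (x^nat i * y^nat j +
      (1 / of_real a - 1) * (x^nat i * 0^nat j) + (1 / of_real b - 1) * (0^nat i * y^nat j)))"
    unfolding F_def
    by (intro walk_sum_cong arg_cong[where f = "\<lambda>z. x * y * z"] boundary_factor walks_nonneg walks_S5_pos)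
  also have "... = x * y * (W (Suc n) (\<lambda>i j. x^nat i * y^nat j) +
      (1 / of_real a - 1) * W (Suc n) (\<lambda>i j. x^nat i * 0^nat j) +
      (1 / of_real b - 1) * W (Suc n) (\<lambda>i j. 0^nat i * y^nat j))"
    unfolding walk_sum_linear ..
  finally have "W (Suc n) F = ..." .
  hence endpoint: "of_real (t^Suc n) * W (Suc n) F = x * y * (qterm (Suc n) x y +
      (1 / of_real a - 1) * qterm (Suc n) x 0 + (1 / of_real b - 1) * qterm (Suc n) 0 y)"
    unfolding qterm_def by (simp only:) (simp add: algebra_simps)
  have cancel: "cr (step_weight d a b i j v) * F (i + fst v) (j + snd v) =
      cr (d v) * (x * y * (x^nat (i + fst v) * y^nat (j + snd v)))" for i j v
    using ab_pos by (simp add: F_def step_weight_def)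
  have "W (Suc n) F = W n (\<lambda>i j. step_poly x y * (x^nat i * y^nat j) -
      of_real (d (1, -1)) * x^2 * (x^nat i * 0^nat j)
        - of_real (d (-1, 1)) * y^2 * (0^nat i * y^nat j))"
    unfolding walk_sum_Suc[OF finite_S5] cancel by (intro walk_sum_cong sum_over_steps walks_nonneg)
  hence "of_real (t^Suc n) * W (Suc n) F = of_real t * (step_poly x y * qterm n x y -
      of_real (d (1, -1)) * x^2 * qterm n x 0 - of_real (d (-1, 1)) * y^2 * qterm n 0 y)"
    unfolding qterm_def by (simp only: walk_sum_linear) (simp add: algebra_simps)
  thus ?thesis unfolding endpoint .
qed

definition kernel :: "(real \<Rightarrow> 'a) \<Rightarrow> 'a \<Rightarrow> 'a \<Rightarrow> 'a :: comm_ring_1" where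
  "kernel \<iota> x y = x * y - (\<iota> (t * d (1, -1)) * x^2 + \<iota> (t * d (-1, 1)) * y^2 + \<iota> (t * d (1, 0)) * x^2 * y
      + \<iota> (t * d (0, 1)) * x * y^2 + \<iota> (t * d (1, 1)) * x^2 * y^2)"

definition x_coeff :: "(real \<Rightarrow> 'a) \<Rightarrow> 'a \<Rightarrow> 'a \<Rightarrow> 'a :: comm_ring_1" where
  "x_coeff \<iota> x y = \<iota> (1 - 1 / a) * (x * y) - \<iota> (t * d (1, -1)) * x^2"

definition y_coeff :: "(real \<Rightarrow> 'a) \<Rightarrow> 'a \<Rightarrow> 'a \<Rightarrow> 'a :: comm_ring_1" where
  "y_coeff \<iota> x y = \<iota> (1 - 1 / b) * (x * y) - \<iota> (t * d (-1, 1)) * y^2"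

theorem functional_equation:
  assumes "norm x \<le> 1" "norm y \<le> 1"
  shows "kernel cr x y * Q x y =
    cr (1 / a + 1 / b - 1) * (x * y) + x_coeff cr x y * Q x 0 + y_coeff cr x y * Q 0 y"
proof -
  have Q: "(\<lambda>n. qterm n x y) sums Q x y" "(\<lambda>n. qterm n x 0) sums Q x 0" "(\<lambda>n. qterm n 0 y) sums Q 0 y"
    using assms by (auto intro!: qterm_sums)
  have Q_minus_1: "(\<lambda>n. qterm (Suc n) x y) sums (Q x y - 1)" "(\<lambda>n. qterm (Suc n) x 0) sums (Q x 0 - 1)"
    "(\<lambda>n. qterm (Suc n) 0 y) sums (Q 0 y - 1)"
    using Q by (subst sums_Suc_iff; simp add: qterm_0)+
  have "(\<lambda>n. x * y * (qterm (Suc n) x y + (1 / of_real a - 1) * qterm (Suc n) x 0 + (1 / of_real b - 1) * qterm (Suc n) 0 y)) sums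
    (x * y * ((Q x y - 1) + (1 / of_real a - 1) * (Q x 0 - 1) + (1 / of_real b - 1) * (Q 0 y - 1)))"
    by (intro sums_mult sums_add Q_minus_1)
  moreover have "(\<lambda>n. x * y * (qterm (Suc n) x y + (1 / of_real a - 1) * qterm (Suc n) x 0 + (1 / of_real b - 1) * qterm (Suc n) 0 y)) sums
    (of_real t * (step_poly x y * Q x y - of_real (d (1, -1)) * x^2 * Q x 0 - of_real (d (-1, 1)) * y^2 * Q 0 y))"
    unfolding qterm_recurrence by (intro sums_mult sums_diff Q)
  ultimately have "x * y * ((Q x y - 1) + (1 / of_real a - 1) * (Q x 0 - 1) + (1 / of_real b - 1) * (Q 0 y - 1)) =
    of_real t * (step_poly x y * Q x y - of_real (d (1, -1)) * x^2 * Q x 0 - of_real (d (-1, 1)) * y^2 * Q 0 y)"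
    by (rule sums_unique2)
  thus ?thesis by (simp add: kernel_def x_coeff_def y_coeff_def step_poly_def algebra_simps)
qed

end

section \<open>From differential equations for functions to formal ones\<close>

definition jet_point :: "nat \<Rightarrow> nat \<Rightarrow> 'a \<Rightarrow> 'a \<Rightarrow> (nat \<Rightarrow> 'a) \<Rightarrow> nat \<Rightarrow> 'a" where
  "jet_point i0 i1 x y f i = (if i = i0 then x else if i = i1 then y else f (i - 2))"

lemma moneval_jet_point:
  assumes "{i0, i1} = {0, 1}"
  shows "moneval m (jet_point i0 i1 x y f) = y^lookup m i1 * (x^lookup m i0 * moneval (drop_vars 2 m) f)"
proof -
  have i: "i0 = 0 \<and> i1 = 1 \<or> i0 = 1 \<and> i1 = 0" using assms by (auto simp: doubleton_eq_iff)
  hence "(\<lambda>j. jet_point i0 i1 x y f (j + 2)) = f" by (auto simp: jet_point_def)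
  thus ?thesis
    using i by (subst moneval_drop_vars[of _ _ 2]) (auto simp: jet_point_def numeral_2_eq_2 One_nat_def mult_ac)
qed

lemma sum_lowest_powers_eq_0:
  fixes c :: "'b \<Rightarrow> complex \<Rightarrow> complex"
  assumes fin: "finite A" and lim: "\<And>m. m \<in> A \<Longrightarrow> (c m \<longlongrightarrow> L m) (at 0)" and k: "\<And>m. m \<in> A \<Longrightarrow> k \<le> e m"
    and zero: "\<forall>\<^sub>F y in at 0. (\<Sum>m\<in>A. y^e m * c m y) = 0"
  shows "(\<Sum>m\<in>{m\<in>A. e m = k}. L m) = 0"
proof -
  have "(\<Sum>m\<in>A. y^(e m - k) * c m y) = 0" if "(\<Sum>m\<in>A. y^e m * c m y) = 0" "y \<noteq> 0" for y
  proof -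
    have "(\<Sum>m\<in>A. y^e m * c m y) = y^k * (\<Sum>m\<in>A. y^(e m - k) * c m y)"
      unfolding sum_distrib_left mult.assoc[symmetric]
      by (intro sum.cong) (simp_all add: k flip: power_add)
    thus ?thesis using that by simp
  qed
  hence "\<forall>\<^sub>F y in at 0. (\<Sum>m\<in>A. y^(e m - k) * c m y) = 0"
    using eventually_conj[OF zero eventually_neq_at_within[of 0]] by (auto elim: eventually_mono)
  hence "((\<lambda>y. \<Sum>m\<in>A. y^(e m - k) * c m y) \<longlongrightarrow> 0) (at 0)" by (rule tendsto_eventually)
  moreover have "((\<lambda>y. \<Sum>m\<in>A. y^(e m - k) * c m y) \<longlongrightarrow> (\<Sum>m\<in>A. 0^(e m - k) * L m)) (at 0)"
    by (intro tendsto_intros lim)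
  ultimately have "(\<Sum>m\<in>A. 0^(e m - k) * L m) = 0" using tendsto_unique at_neq_bot by blast
  also have "(\<Sum>m\<in>A. 0^(e m - k) * L m) = (\<Sum>m\<in>A. if e m = k then L m else 0)"
    by (intro sum.cong) (use k in \<open>fastforce simp: power_0_left\<close>)+
  finally show ?thesis by (simp add: sum.inter_filter fin)
qed

lemma tendsto_higher_deriv:
  fixes F :: "complex \<Rightarrow> complex \<Rightarrow> complex"
  assumes holo: "\<And>y. norm y \<le> 1 \<Longrightarrow> (\<lambda>x. F x y) holomorphic_on ball 0 1"
    and lip: "\<And>x y. norm x \<le> 1 \<Longrightarrow> norm y \<le> 1 \<Longrightarrow> norm (F x y - F x 0) \<le> C * norm y"
    and x: "norm x < 1"
  shows "((\<lambda>y. (deriv ^^ n) (\<lambda>u. F u y) x) \<longlongrightarrow> (deriv ^^ n) (\<lambda>u. F u 0) x) (at 0)"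
proof (rule higher_deriv_complex_uniform_limit)
  have small: "\<forall>\<^sub>F y::complex in at 0. norm y < 1"
    by (rule order_tendstoD(2)[of _ 0]) (auto intro!: tendsto_eq_intros)
  show "uniform_limit (ball 0 1) (\<lambda>y x. F x y) (\<lambda>x. F x 0) (at 0)"
  proof (rule uniform_limitI)
    fix \<epsilon> :: real assume "\<epsilon> > 0"
    hence "\<forall>\<^sub>F y::complex in at 0. C * norm y < \<epsilon>"
      by (intro order_tendstoD(2)[of _ 0]) (auto intro!: tendsto_eq_intros)
    thus "\<forall>\<^sub>F y in at 0. \<forall>x\<in>ball 0 1. dist (F x y) (F x 0) < \<epsilon>" using small
    proof eventually_elim
      case (elim y)
      show ?case
      proof
        fix x :: complex assume "x \<in> ball 0 1"
        thus "dist (F x y) (F x 0) < \<epsilon>" using lip[of x y] elim by (auto simp: dist_norm)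
      qed
    qed
  qed
  show "\<forall>\<^sub>F y in at 0. (\<lambda>x. F x y) holomorphic_on ball 0 1" using small by eventually_elim (auto intro: holo)
qed (use x in auto)

text \<open>Dividing by the largest power of \<open>y\<close> and letting \<open>y\<close> tend to \<open>0\<close> keeps the monomials of least degree in \<open>y\<close>.\<close>

lemma lowest_terms_relation:
  fixes P :: "complex mpoly"
  assumes P: "P \<noteq> 0" and i: "{i0, i1} = {0, 1}" and r: "r > 0"
    and rel: "\<And>x y. norm x < r \<Longrightarrow> norm y < r \<Longrightarrow> mpeval P (jet_point i0 i1 x y (\<lambda>n. J n x y)) = 0"
    and lim: "\<And>n x. norm x < r \<Longrightarrow> (J n x \<longlongrightarrow> J n x 0) (at 0)"
  obtains K where "K \<subseteq> keys P" "K \<noteq> {}" "inj_on (\<lambda>m. (lookup m i0, drop_vars 2 m)) K"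
    "\<And>x. norm x < r \<Longrightarrow>
      (\<Sum>m\<in>K. lookup P m * (x^lookup m i0 * moneval (drop_vars 2 m) (\<lambda>n. J n x 0))) = 0"
proof -
  define k where "k = Min ((\<lambda>m. lookup m i1) ` keys P)"
  define K where "K = {m\<in>keys P. lookup m i1 = k}"
  have "k \<in> (\<lambda>m. lookup m i1) ` keys P" unfolding k_def using P by (intro Min_in) auto
  hence "K \<noteq> {}" by (auto simp: K_def)
  moreover have "inj_on (\<lambda>m. (lookup m i0, drop_vars 2 m)) K"
  proof (rule inj_onI, rule poly_mapping_eqI)
    fix m m' j assume m: "m \<in> K" "m' \<in> K" "(lookup m i0, drop_vars 2 m) = (lookup m' i0, drop_vars 2 m')"
    have "j \<in> {i0, i1} \<or> j \<ge> 2" unfolding i by auto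
    moreover have "lookup m j = lookup m' j" if "j \<ge> 2"
      using m(3) that lookup_drop_vars[of 2 m "j - 2"] lookup_drop_vars[of 2 m' "j - 2"]
      by (simp del: add_2_eq_Suc')
    ultimately show "lookup m j = lookup m' j" using m by (auto simp: K_def)
  qed
  moreover have "(\<Sum>m\<in>K. lookup P m * (x^lookup m i0 * moneval (drop_vars 2 m) (\<lambda>n. J n x 0))) = 0"
    if x: "norm x < r" for x
    unfolding K_def
  proof (rule sum_lowest_powers_eq_0)
    show "((\<lambda>y. lookup P m * (x^lookup m i0 * moneval (drop_vars 2 m) (\<lambda>n. J n x y))) \<longlongrightarrow>
        lookup P m * (x^lookup m i0 * moneval (drop_vars 2 m) (\<lambda>n. J n x 0))) (at 0)" for m
      unfolding moneval_def by (intro tendsto_intros lim x)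
    show "k \<le> lookup m i1" if "m \<in> keys P" for m using that by (simp add: k_def)
    have "\<forall>\<^sub>F y::complex in at 0. norm y < r"
      using r by (intro order_tendstoD(2)[of _ 0]) (auto intro!: tendsto_eq_intros)
    thus "\<forall>\<^sub>F y in at 0. (\<Sum>m\<in>keys P. y^lookup m i1 *
        (lookup P m * (x^lookup m i0 * moneval (drop_vars 2 m) (\<lambda>n. J n x y)))) = 0"
      by eventually_elim
         (use rel[OF x] in \<open>simp add: mpeval_def moneval_jet_point[OF i] mult.left_commute\<close>)
  qed simp
  ultimately show ?thesis using that[of K] by (auto simp: K_def)
qed

lemma formal_relation:
  assumes g: "g has_fps_expansion G"
    and rel: "\<forall>\<^sub>F x in nhds 0. (\<Sum>m\<in>K. c m * (x^e m * moneval (\<delta> m) (\<lambda>n. (deriv ^^ n) g x))) = 0"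
  shows "(\<Sum>m\<in>K. fps_const (c m) * (fps_X^e m * moneval (\<delta> m) (\<lambda>n. (fps_deriv ^^ n) G))) = (0 :: complex fps)"
proof -
  have "(deriv ^^ n) g has_fps_expansion (fps_deriv ^^ n) G" for n
    by (induction n) (auto intro: has_fps_expansion_deriv g)
  hence "(\<lambda>x. \<Sum>m\<in>K. c m * (x^e m * moneval (\<delta> m) (\<lambda>n. (deriv ^^ n) g x))) has_fps_expansion
      (\<Sum>m\<in>K. fps_const (c m) * (fps_X^e m * moneval (\<delta> m) (\<lambda>n. (fps_deriv ^^ n) G)))"
    unfolding moneval_def by (intro fps_expansion_intros)
  moreover have "(\<lambda>x. \<Sum>m\<in>K. c m * (x^e m * moneval (\<delta> m) (\<lambda>n. (deriv ^^ n) g x))) has_fps_expansion 0"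
    unfolding has_fps_expansion_0_iff by (rule rel)
  ultimately show ?thesis by (rule fps_expansion_unique_complex)
qed

lemma fps_to_fls_sum: "fps_to_fls (sum f A) = (\<Sum>x\<in>A. fps_to_fls (f x))"
  by (induction A rule: infinite_finite_induct) auto

lemma moneval_hom:
  assumes "\<And>x y. h (x * y) = h x * h y" "h 1 = 1"
  shows "h (moneval m v) = moneval m (\<lambda>i. h (v i))"
proof -
  have "h (x^n) = h x^n" for x n by (induction n) (auto simp: assms)
  moreover have "h (\<Prod>i\<in>A. f i) = (\<Prod>i\<in>A. h (f i))" for A :: "nat set" and f
    by (induction A rule: infinite_finite_induct) (auto simp: assms)
  ultimately show ?thesis by (simp add: moneval_def)
qed

lemma alg_dep_of_relation:
  fixes \<Xi> :: "complex fps"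
  assumes \<Xi>: "fps_nth \<Xi> 0 = 0" "\<Xi> \<noteq> 0" "fps_to_fls \<Xi> \<in> ratfun"
    and K: "finite K" "K \<noteq> {}" "inj_on (\<lambda>m. (e m, \<delta> m)) K" "\<And>m. m \<in> K \<Longrightarrow> c m \<noteq> 0"
    and rel: "(\<Sum>m\<in>K. fls_const (c m) * (fps_to_fls \<Xi>^e m * moneval (\<delta> m) f)) = 0"
  shows "rat.alg_dep f"
proof -
  define P where "P = (\<Sum>m\<in>K. single (\<delta> m) (fls_const (c m) * fps_to_fls \<Xi>^e m))"
  have "mpeval P f = 0" using rel by (simp add: P_def mpeval_sum mult.assoc)
  moreover have "coeffs_in ratfun P"
    unfolding P_def by (intro rat.coeffs_in_sum rat.coeffs_in_single rat.mult_in rat.power_in ratfun_const \<Xi>)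
  moreover have "P \<noteq> 0"
  proof
    assume "P = 0"
    obtain n where n: "n \<in> K" using K(2) by blast
    define A where "A = (\<Sum>m\<in>{m\<in>K. \<delta> m = \<delta> n}. fps_const (c m) * fps_X^e m)"
    have "fps_to_fls (fps_compose A \<Xi>) = (\<Sum>m\<in>{m\<in>K. \<delta> m = \<delta> n}. fls_const (c m) * fps_to_fls \<Xi>^e m)"
      by (simp add: A_def fps_compose_sum_distrib fps_compose_mult_distrib fps_compose_power[symmetric]
        \<Xi>(1) fps_to_fls_sum fls_times_fps_to_fls fps_to_fls_power)
    also have "... = lookup P (\<delta> n)"
      by (simp add: P_def lookup_sum lookup_single when_def sum.inter_filter K(1))
    finally have "A = 0" using fps_compose_eq_0_iff[OF \<Xi>(1), of A] \<Xi>(2) \<open>P = 0\<close> by simp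
    have "m = n" if "m \<in> K" "\<delta> m = \<delta> n" "e m = e n" for m
      by (rule inj_onD[OF K(3)]) (use that n in auto)
    hence "(\<Sum>m\<in>{m\<in>K. \<delta> m = \<delta> n}. c m * fps_nth (fps_X^e m) (e n)) = (\<Sum>m\<in>{m\<in>K. \<delta> m = \<delta> n}. if m = n then c n else 0)"
      by (intro sum.cong) (auto simp: fps_X_power_nth)
    also have "... = c n" using n K(1) by simp
    finally have "fps_nth A (e n) = c n" by (simp add: A_def fps_sum_nth)
    thus False using K(4)[OF n] \<open>A = 0\<close> by simp
  qed
  ultimately show ?thesis unfolding rat.alg_dep_def by blast
qed

lemma diff_alg_of_derivation:
  assumes dep: "rat.alg_dep f" and \<kappa>: "\<kappa> \<in> ratfun" "\<kappa> \<noteq> 0" and f: "\<And>i. f (Suc i) = \<kappa> * theta (f i)"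
  shows "diff_alg (f 0)"
proof -
  define D where "D i = (theta ^^ i) (f 0)" for i
  have D: "theta (D i) = D (Suc i)" for i by (simp add: D_def)
  have "\<exists>c a. c \<in> ratfun \<and> c \<noteq> 0 \<and> (\<forall>j. a j \<in> ratfun) \<and> f i = c * D i + (\<Sum>j<i. a j * D j)" for i
  proof (induction i)
    case 0
    show ?case by (rule exI[of _ 1], rule exI[of _ "\<lambda>_. 0"]) (simp add: D_def)
  next
    case (Suc i)
    then obtain c a where IH: "c \<in> ratfun" "c \<noteq> 0" "\<And>j. a j \<in> ratfun" "f i = c * D i + (\<Sum>j<i. a j * D j)" by blast
    define a' where
      "a' j = \<kappa> * ((if j < i then theta (a j) else theta c) + (if j = 0 then 0 else a (j - 1)))" for j
    have same: "(\<Sum>j<Suc i. (if j < i then theta (a j) else theta c) * D j) =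
        (\<Sum>j<i. theta (a j) * D j) + theta c * D i" by simp
    have shifted: "(\<Sum>j<Suc i. (if j = 0 then 0 else a (j - 1)) * D j) = (\<Sum>j<i. a j * D (Suc j))"
      unfolding sum.lessThan_Suc_shift by simp
    have "f (Suc i) = \<kappa> * (theta c * D i + c * D (Suc i) + (\<Sum>j<i. theta (a j) * D j + a j * D (Suc j)))"
      unfolding f IH(4) by (simp add: theta_add theta_mult theta_sum D)
    also have "... = \<kappa> * c * D (Suc i) + \<kappa> * ((\<Sum>j<Suc i. (if j < i then theta (a j) else theta c) * D j) +
        (\<Sum>j<Suc i. (if j = 0 then 0 else a (j - 1)) * D j))"
      unfolding same shifted sum.distrib by (simp add: algebra_simps)
    also have "... = \<kappa> * c * D (Suc i) + (\<Sum>j<Suc i. a' j * D j)"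
      unfolding a'_def sum.distrib[symmetric] sum_distrib_left by (simp only: algebra_simps)
    finally show ?case using IH \<kappa>
      by (intro exI[of _ "\<kappa> * c"] exI[of _ a']) (auto simp: a'_def intro!: rat.mult_in rat.add_in theta_ratfun)
  qed
  then obtain c a where "\<And>i. c i \<in> ratfun" "\<And>i. c i \<noteq> 0" "\<And>i j. a i j \<in> ratfun"
      "\<And>i. f i = c i * D i + (\<Sum>j<i. a i j * D j)"
    by metis
  thus ?thesis unfolding diff_alg_def D_def[symmetric]
    by (intro rat.alg_dep_affine[OF dep, where c = c and a = a and b = "\<lambda>_. 0"]) auto
qed

lemma theta_fps_compose:
  assumes "fps_nth \<Xi> 0 = 0"
  shows "theta (fps_to_fls (fps_compose A \<Xi>)) = fps_to_fls (fps_compose (fps_deriv A) \<Xi>) * theta (fps_to_fls (\<Xi> :: complex fps))"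
  unfolding theta_def fls_deriv_fps_to_fls fps_compose_deriv[OF assms]
  by (simp add: fls_times_fps_to_fls mult_ac)

theorem ADE_imp_diff_alg:
  fixes P :: "complex mpoly" and \<Xi> \<Phi> :: "complex fps"
  assumes P: "P \<noteq> 0" and i: "{i0, i1} = {0, 1}" and r: "r > 0"
    and rel: "\<And>x y. norm x < r \<Longrightarrow> norm y < r \<Longrightarrow>
      mpeval P (jet_point i0 i1 x y (\<lambda>n. (deriv ^^ n) (\<lambda>u. F u y) x)) = 0"
    and holo: "\<And>y. norm y \<le> 1 \<Longrightarrow> (\<lambda>x. F x y) holomorphic_on ball 0 1"
    and lip: "\<And>x y. norm x \<le> 1 \<Longrightarrow> norm y \<le> 1 \<Longrightarrow> norm (F x y - F x 0) \<le> C * norm y"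
    and \<Phi>: "(\<lambda>x. F x 0) has_fps_expansion \<Phi>"
    and \<Xi>: "fps_nth \<Xi> 0 = 0" "fps_nth \<Xi> 1 \<noteq> 0" "fps_to_fls \<Xi> \<in> ratfun"
  shows "diff_alg (fps_to_fls (fps_compose \<Phi> \<Xi>))"
proof -
  obtain K where K: "K \<subseteq> keys P" "K \<noteq> {}" "inj_on (\<lambda>m. (lookup m i0, drop_vars 2 m)) K"
    and low: "\<And>x. norm x < min r 1 \<Longrightarrow> (\<Sum>m\<in>K. lookup P m *
      (x^lookup m i0 * moneval (drop_vars 2 m) (\<lambda>n. (deriv ^^ n) (\<lambda>u. F u 0) x))) = 0"
    by (rule lowest_terms_relation[OF P i, where r = "min r 1" and J = "\<lambda>n x y. (deriv ^^ n) (\<lambda>u. F u y) x"])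
       (use r rel tendsto_higher_deriv[OF holo lip] in auto)
  have "\<forall>\<^sub>F x::complex in nhds 0. norm x < min r 1"
    using r eventually_nhds_in_open[of "ball (0::complex) (min r 1)" 0] by simp
  hence formal: "(\<Sum>m\<in>K. fps_const (lookup P m) *
      (fps_X^lookup m i0 * moneval (drop_vars 2 m) (\<lambda>n. (fps_deriv ^^ n) \<Phi>))) = 0"
    by (intro formal_relation[OF \<Phi>]) (auto elim!: eventually_mono intro: low)
  define f where "f n = fps_to_fls (fps_compose ((fps_deriv ^^ n) \<Phi>) \<Xi>)" for n
  have mon: "fps_to_fls (fps_compose (moneval m (\<lambda>n. (fps_deriv ^^ n) \<Phi>)) \<Xi>) = moneval m f" for m
    unfolding f_def using \<Xi>(1)
    by (intro moneval_hom[where h = "\<lambda>A. fps_to_fls (fps_compose A \<Xi>)"])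
       (auto simp: fps_compose_mult_distrib fls_times_fps_to_fls)
  have "(\<Sum>m\<in>K. fls_const (lookup P m) * (fps_to_fls \<Xi>^lookup m i0 * moneval (drop_vars 2 m) f)) = 0"
    using arg_cong[OF formal, of "\<lambda>A. fps_to_fls (fps_compose A \<Xi>)"] \<Xi>(1)
    by (simp add: fps_compose_sum_distrib fps_to_fls_sum fps_compose_mult_distrib fls_times_fps_to_fls
      fps_compose_power[symmetric] fps_to_fls_power mon)
  hence dep: "rat.alg_dep f"
    by (rule alg_dep_of_relation[OF \<Xi>(1) _ \<Xi>(3) _ K(2,3), rotated -1])
       (use K(1) \<Xi>(2) finite_subset[OF K(1)] in \<open>auto simp: in_keys_iff\<close>)
  have "fls_nth (theta (fps_to_fls \<Xi>)) 1 \<noteq> 0" using \<Xi>(2) by (simp add: theta_nth One_nat_def)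
  hence "theta (fps_to_fls \<Xi>) \<noteq> 0" by auto
  moreover have "theta (f i) = f (Suc i) * theta (fps_to_fls \<Xi>)" for i
    by (simp add: f_def theta_fps_compose[OF \<Xi>(1)])
  ultimately have "diff_alg (f 0)"
    by (intro diff_alg_of_derivation[OF dep, of "inverse (theta (fps_to_fls \<Xi>))"])
       (auto intro: rat.inverse_in theta_ratfun \<Xi>)
  thus ?thesis by (simp add: f_def)
qed

section \<open>The rational parametrization of the kernel curve\<close>

lemma joukowski_conic:
  fixes s h z :: complex
  assumes "s \<noteq> 0" "h \<noteq> 0" "z = s \<or> z = h^2 * s"
  defines "p \<equiv> s + 1 / s" and "r \<equiv> z / h + h / z"
  shows "h * (p^2 + r^2 - 4) = (h^2 + 1) * (p * r - (h + 1 / h))"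
  using assms(3)
proof
  assume "z = s"
  thus ?thesis using assms(1,2) by (simp add: p_def r_def power2_eq_square field_simps)
next
  assume "z = h^2 * s"
  hence r: "r = h * s + 1 / (h * s)" using assms(1,2) by (simp add: r_def power2_eq_square)
  show ?thesis using assms(1,2) unfolding p_def r by (simp add: power2_eq_square field_simps)
qed

lemma eventually_norm_le_1:
  fixes f :: "complex \<Rightarrow> complex"
  assumes "isCont f 0" "f 0 = 0"
  shows "\<forall>\<^sub>F s in nhds 0. norm (f s) \<le> 1"
proof -
  have "(f \<longlongrightarrow> f 0) (nhds 0)" using assms(1) by (simp add: isCont_def tendsto_at_iff_tendsto_nhds)
  hence "((\<lambda>s. norm (f s)) \<longlongrightarrow> 0) (nhds 0)" using assms(2) by (simp add: tendsto_norm_zero)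
  hence "\<forall>\<^sub>F s in nhds 0. norm (f s) < 1" by (rule order_tendstoD(2)) simp
  thus ?thesis by (auto elim: eventually_mono)
qed

lemma eventually_nonzero:
  fixes f :: "complex \<Rightarrow> complex"
  assumes "isCont f 0" "f 0 \<noteq> 0"
  shows "\<forall>\<^sub>F s in nhds 0. f s \<noteq> 0"
proof -
  have "(f \<longlongrightarrow> f 0) (nhds 0)" using assms(1) by (simp add: isCont_def tendsto_at_iff_tendsto_nhds)
  thus ?thesis using assms(2) by (rule tendsto_imp_eventually_ne)
qed

lemma diff_alg_affine_image:
  assumes "diff_alg f" "w \<in> ratfun" "w0 \<in> ratfun" "w \<noteq> 0"
  shows "diff_alg (w * f + w0)"
proof (rule diff_alg_affine[OF assms(1)])
  show "f = inverse w * (w * f + w0) + - (inverse w * w0)"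
    using assms(4) by (simp add: distrib_left mult.assoc[symmetric])
qed (use assms in \<open>auto intro: rat.inverse_in rat.mult_in rat.uminus_in\<close>)

lemma has_fps_expansion_poly: "poly p has_fps_expansion fps_of_poly p" for p :: "complex poly"
proof (induction p)
  case 0
  have "poly (0 :: complex poly) = (\<lambda>_. 0)" by auto
  thus ?case by (simp only: fps_of_poly_0) (intro fps_expansion_intros)
next
  case (pCons c p)
  have "(\<lambda>x. c + x * poly p x) has_fps_expansion fps_const c + fps_X * fps_of_poly p"
    by (intro fps_expansion_intros pCons)
  moreover have "poly (pCons c p) = (\<lambda>x. c + x * poly p x)" by auto
  ultimately show ?case by (simp add: fps_of_poly_pCons mult.commute)
qed

locale kernel_curve = quadrant +
  fixes h :: real
  assumes d_pos: "d (1, -1) > 0" "d (-1, 1) > 0" and d_nz: "d (1, 0) > 0 \<or> d (0, 1) > 0 \<or> d (1, 1) > 0"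
    and h_gt1: "h > 1" and h_t: "t * sqrt (d (1, -1) * d (-1, 1)) = h / (h^2 + 1)"
begin

text \<open>In the coordinates \<open>X = 1 / (\<alpha> L x)\<close> and \<open>Y = 1 / (\<beta> L y)\<close> the kernel becomes the conic
\<open>X Y = \<tau> (X\<^sup>2 + Y\<^sup>2) + (u0 / L) Y + (v0 / L) X + w0 / L\<^sup>2\<close>. The scale \<open>L\<close> and the center \<open>(-ex, -ey)\<close> are
chosen such that \<open>X + ex = s + 1 / s\<close> and \<open>Y + ey = s / h + h / s\<close> parametrize it.\<close>

definition \<tau> where "\<tau> = h / (h^2 + 1)"
definition \<Delta> where "\<Delta> = 1 - 4 * \<tau>^2"
definition \<alpha> where "\<alpha> = sqrt (d (1, -1))"
definition \<beta> where "\<beta> = sqrt (d (-1, 1))"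
definition u0 where "u0 = t * d (1, 0) / \<alpha>"
definition v0 where "v0 = t * d (0, 1) / \<beta>"
definition w0 where "w0 = t * d (1, 1) / (\<alpha> * \<beta>)"
definition L where "L = sqrt (\<tau> / \<Delta> * (w0 + (u0 * v0 + \<tau> * (u0^2 + v0^2)) / \<Delta>))"
definition ex where "ex = (u0 + 2 * \<tau> * v0) / (\<Delta> * L)"
definition ey where "ey = (v0 + 2 * \<tau> * u0) / (\<Delta> * L)"

lemma \<alpha>_\<beta>: "\<alpha> > 0" "\<beta> > 0" "\<alpha>^2 = d (1, -1)" "\<beta>^2 = d (-1, 1)" "t * (\<alpha> * \<beta>) = \<tau>"
  using d_pos h_t by (auto simp: \<alpha>_def \<beta>_def \<tau>_def real_sqrt_mult)

lemma h_nonzero [simp]: "h \<noteq> 0"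
  using h_gt1 by simp

lemma h_square: "h^2 > 1" "h^2 + 1 > 0"
  using h_gt1 by (auto simp: one_less_power add_pos_pos)

lemma \<tau>_pos: "\<tau> > 0"
  using h_gt1 h_square by (simp add: \<tau>_def)

lemma \<tau>_h: "\<tau> * (h^2 + 1) = h" "1 / \<tau> = h + 1 / h"
  using h_square by (auto simp: \<tau>_def field_simps power2_eq_square)

lemma \<Delta>_eq: "\<Delta> = ((h^2 - 1) / (h^2 + 1))^2"
proof -
  have "h^2 + 1 \<noteq> 0" using h_square by simp
  hence "\<Delta> = ((h^2 + 1)^2 - 4 * h^2) / (h^2 + 1)^2"
    by (simp add: \<Delta>_def \<tau>_def power_divide diff_divide_distrib)
  also have "(h^2 + 1)^2 - 4 * h^2 = (h^2 - 1)^2" by (simp add: power2_eq_square algebra_simps)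
  finally show ?thesis by (simp add: power_divide)
qed

lemma \<Delta>_pos: "\<Delta> > 0"
  using h_square by (simp add: \<Delta>_eq)

lemma uvw_nonneg: "u0 \<ge> 0" "v0 \<ge> 0" "w0 \<ge> 0"
  using d_nonneg \<alpha>_\<beta> t_pos by (auto simp: u0_def v0_def w0_def)

lemma L_pos: "L > 0"
  and L_square: "L^2 = \<tau> / \<Delta> * (w0 + (u0 * v0 + \<tau> * (u0^2 + v0^2)) / \<Delta>)"
proof -
  have "u0 > 0 \<or> v0 > 0 \<or> w0 > 0" using d_nz \<alpha>_\<beta> t_pos by (auto simp: u0_def v0_def w0_def)
  moreover have "0 \<le> u0 * v0" "0 \<le> \<tau> * (u0^2 + v0^2)" using uvw_nonneg \<tau>_pos by auto
  moreover have "0 < \<tau> * (u0^2 + v0^2)" if "u0 > 0 \<or> v0 > 0"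
    using that \<tau>_pos by (intro mult_pos_pos) (auto intro: add_pos_nonneg add_nonneg_pos)
  ultimately have "0 < w0 + (u0 * v0 + \<tau> * (u0^2 + v0^2)) / \<Delta>"
    using uvw_nonneg(3) \<Delta>_pos by (smt (verit) divide_nonneg_pos divide_pos_pos)
  hence "0 < \<tau> / \<Delta> * (w0 + (u0 * v0 + \<tau> * (u0^2 + v0^2)) / \<Delta>)" using \<tau>_pos \<Delta>_pos by simp
  thus "L > 0" "L^2 = \<tau> / \<Delta> * (w0 + (u0 * v0 + \<tau> * (u0^2 + v0^2)) / \<Delta>)" by (auto simp: L_def)
qed

lemma ex_ey_nonneg: "ex \<ge> 0" "ey \<ge> 0"
  using uvw_nonneg \<tau>_pos \<Delta>_pos L_pos by (auto simp: ex_def ey_def)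

lemma u0_eq: "u0 / L = ex - 2 * \<tau> * ey" and v0_eq: "v0 / L = ey - 2 * \<tau> * ex"
proof -
  have "u0 * \<Delta> = (u0 + 2 * \<tau> * v0) - 2 * \<tau> * (v0 + 2 * \<tau> * u0)" "v0 * \<Delta> = (v0 + 2 * \<tau> * u0) - 2 * \<tau> * (u0 + 2 * \<tau> * v0)"
    by (simp_all add: \<Delta>_def power2_eq_square algebra_simps)
  hence "u0 * \<Delta> / (\<Delta> * L) = ex - 2 * \<tau> * ey" "v0 * \<Delta> / (\<Delta> * L) = ey - 2 * \<tau> * ex"
    by (simp_all add: ex_def ey_def diff_divide_distrib)
  thus "u0 / L = ex - 2 * \<tau> * ey" "v0 / L = ey - 2 * \<tau> * ex" using \<Delta>_pos by simp_all
qed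

lemma w0_eq: "w0 / L^2 = h + 1 / h - 4 * \<tau> + \<tau> * (ex^2 + ey^2) - ex * ey"
proof -
  define q where "q = u0 * v0 + \<tau> * (u0^2 + v0^2)"
  have nz: "L \<noteq> 0" "\<Delta> \<noteq> 0" "\<tau> \<noteq> 0" using L_pos \<Delta>_pos \<tau>_pos by auto
  have "q / L^2 = u0 / L * (v0 / L) + \<tau> * ((u0 / L)^2 + (v0 / L)^2)"
    using nz by (simp add: q_def power2_eq_square field_simps)
  also have "... = \<Delta> * (ex * ey - \<tau> * (ex^2 + ey^2))"
    unfolding u0_eq v0_eq \<Delta>_def by (simp add: power2_eq_square algebra_simps)
  finally have q: "q / L^2 / \<Delta> = ex * ey - \<tau> * (ex^2 + ey^2)" using nz by simp
  have "\<Delta> / \<tau> * L^2 = w0 + q / \<Delta>" using nz by (simp add: L_square q_def)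
  hence "\<Delta> / \<tau> = (w0 + q / \<Delta>) / L^2" using nz by (simp add: eq_divide_eq)
  hence "w0 / L^2 = \<Delta> / \<tau> - q / L^2 / \<Delta>" by (simp add: add_divide_distrib mult.commute)
  moreover have "\<Delta> / \<tau> = 1 / \<tau> - 4 * \<tau>" using nz by (simp add: \<Delta>_def diff_divide_distrib power2_eq_square)
  ultimately show ?thesis using \<tau>_h(2) q by simp
qed

abbreviation "A \<equiv> cr (a - 1)"
abbreviation "B \<equiv> cr (b - 1)"
abbreviation "ch \<equiv> cr h"
abbreviation "cx \<equiv> cr ex"
abbreviation "cy \<equiv> cr ey"

lemma on_conic:
  assumes "s \<noteq> 0" "z = s \<or> z = ch^2 * s"
  defines "X \<equiv> cx + s + 1 / s" and "Y \<equiv> cy + z / ch + ch / z"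
  shows "X * Y = cr \<tau> * (X^2 + Y^2) + cr (u0 / L) * Y + cr (v0 / L) * X + cr (w0 / L^2)"
proof -
  define p r where "p = s + 1 / s" and "r = z / ch + ch / z"
  have \<tau>_ch: "cr \<tau> * (ch^2 + 1) = ch" by (metis of_real_1 of_real_add of_real_mult of_real_power \<tau>_h(1))
  have "(ch^2 + 1) * (cr \<tau> * (p^2 + r^2 - 4)) = cr \<tau> * (ch^2 + 1) * (p^2 + r^2 - 4)" by (simp only: mult_ac)
  also have "... = ch * (p^2 + r^2 - 4)" unfolding \<tau>_ch ..
  also have "... = (ch^2 + 1) * (p * r - (ch + 1 / ch))"
    unfolding p_def r_def by (rule joukowski_conic[OF assms(1) _ assms(2)]) simp
  finally have conic: "cr \<tau> * (p^2 + r^2 - 4) = p * r - (ch + 1 / ch)"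
    using \<tau>_ch by (metis h_nonzero mult_eq_0_iff mult_left_cancel of_real_eq_0_iff)
  moreover have "X = cx + p" "Y = cy + r" by (simp_all add: X_def Y_def p_def r_def)
  ultimately show ?thesis
    unfolding u0_eq v0_eq w0_eq by (simp add: power2_eq_square algebra_simps)
qed

definition X1 where "X1 = cr (\<alpha> * L)"
definition Y1 where "Y1 = cr (\<beta> * L)"

lemma scale_nonzero [simp]: "X1 \<noteq> 0" "Y1 \<noteq> 0" "ch \<noteq> 0"
  using \<alpha>_\<beta> L_pos h_gt1 by (auto simp: X1_def Y1_def)

lemma kernel_conic:
  fixes X Y :: complex
  assumes "X \<noteq> 0" "Y \<noteq> 0"
  shows "kernel cr (1 / (X1 * X)) (1 / (Y1 * Y)) = 1 / (X1 * Y1 * (X * Y)^2) *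
    (X * Y - (cr \<tau> * (X^2 + Y^2) + cr (u0 / L) * Y + cr (v0 / L) * X + cr (w0 / L^2)))"
proof -
  define c\<alpha> c\<beta> cL ct where "c\<alpha> = cr \<alpha>" and "c\<beta> = cr \<beta>" and "cL = cr L" and "ct = cr t"
  have nz: "c\<alpha> \<noteq> 0" "c\<beta> \<noteq> 0" "cL \<noteq> 0" "ct \<noteq> 0"
    using \<alpha>_\<beta> L_pos t_pos by (auto simp: c\<alpha>_def c\<beta>_def cL_def ct_def)
  have "cr \<tau> = ct * (c\<alpha> * c\<beta>)" unfolding \<alpha>_\<beta>(5)[symmetric] by (simp add: ct_def c\<alpha>_def c\<beta>_def)
  moreover have "cr (d (1, -1)) = c\<alpha>^2" "cr (d (-1, 1)) = c\<beta>^2"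
    by (simp_all add: c\<alpha>_def c\<beta>_def \<alpha>_\<beta> flip: of_real_power)
  ultimately show ?thesis using assms nz
    unfolding kernel_def X1_def Y1_def u0_def v0_def w0_def of_real_mult of_real_divide of_real_power
      c\<alpha>_def[symmetric] c\<beta>_def[symmetric] cL_def[symmetric] ct_def[symmetric]
    by (simp add: field_simps power2_eq_square)
qed

definition DX where "DX = [:1, cx, 1:]"
definition DY where "DY = [:ch^2, ch * cy, 1:]"
definition DY' where "DY' = [:1, ch * cy, ch^2:]"
definition curve_x where "curve_x s = s / (X1 * poly DX s)"
definition curve_y where "curve_y s = ch * s / (Y1 * poly DY s)"

lemma DX_DY_0: "poly DX 0 = 1" "poly DY 0 = ch^2" "poly DY' 0 = 1"
  by (simp_all add: DX_def DY_def DY'_def)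

lemma curve_0 [simp]: "curve_x 0 = 0" "curve_y 0 = 0"
  by (simp_all add: curve_x_def curve_y_def)

lemma DX_DY_nonzero: "toR DX \<noteq> 0" "toR DY \<noteq> 0" "toR DY' \<noteq> 0"
  by (simp_all add: DX_def DY_def DY'_def)

lemma kernel_on_curve:
  assumes nz: "poly DX s \<noteq> 0" "poly DY z \<noteq> 0" and z: "z = s \<or> z = ch^2 * s"
  shows "kernel cr (curve_x s) (curve_y z) = 0"
proof (cases "s = 0")
  case True
  thus ?thesis using z by (auto simp: kernel_def)
next
  case False
  hence "z \<noteq> 0" using z by auto
  define X Y where "X = cx + s + 1 / s" and "Y = cy + z / ch + ch / z"
  have XY: "X = poly DX s / s" "Y = poly DY z / (ch * z)"
    using False \<open>z \<noteq> 0\<close> by (simp_all add: X_def Y_def DX_def DY_def field_simps power2_eq_square)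
  hence "X \<noteq> 0" "Y \<noteq> 0" using nz False \<open>z \<noteq> 0\<close> by simp_all
  moreover have "curve_x s = 1 / (X1 * X)" "curve_y z = 1 / (Y1 * Y)"
    using nz False \<open>z \<noteq> 0\<close> by (simp_all add: curve_x_def curve_y_def XY)
  ultimately show ?thesis
    using on_conic[OF False z] by (simp add: kernel_conic X_def[symmetric] Y_def[symmetric])
qed

lemma eventually_on_curve:
  "\<forall>\<^sub>F s in nhds 0. poly DX s \<noteq> 0 \<and> poly DY s \<noteq> 0 \<and> poly DY (ch^2 * s) \<noteq> 0 \<and>
      norm (curve_x s) \<le> 1 \<and> norm (curve_y s) \<le> 1 \<and> norm (curve_y (ch^2 * s)) \<le> 1"
  unfolding curve_x_def curve_y_def
  by (intro eventually_conj eventually_nonzero eventually_norm_le_1)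
     (auto simp: DX_DY_0 intro!: continuous_intros)

sublocale qd: q_dilation "ch^2"
  using h_gt1 by (rule q_dilation_square)

abbreviation \<iota> :: "real \<Rightarrow> complex fls" where "\<iota> \<equiv> \<lambda>r. fls_const (cr r)"

definition \<Phi> where "\<Phi> = fps_expansion (\<lambda>x. Q x 0) 0"
definition \<Psi> where "\<Psi> = fps_expansion (\<lambda>y. Q 0 y) 0"
definition \<Xi> where "\<Xi> = fps_X * inverse (fps_of_poly (smult X1 DX))"
definition \<Upsilon> where "\<Upsilon> = fps_const ch * fps_X * inverse (fps_of_poly (smult Y1 DY))"

abbreviation "X \<equiv> fps_to_fls \<Xi>"
abbreviation "Y \<equiv> fps_to_fls \<Upsilon>"
abbreviation "U \<equiv> fps_to_fls (fps_compose \<Phi> \<Xi>)"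
abbreviation "V \<equiv> fps_to_fls (fps_compose \<Psi> \<Upsilon>)"

lemma \<Phi>_expansion: "(\<lambda>x. Q x 0) has_fps_expansion \<Phi>" and \<Psi>_expansion: "(\<lambda>y. Q 0 y) has_fps_expansion \<Psi>"
  unfolding \<Phi>_def \<Psi>_def
  by (rule has_fps_expansion_fps_expansion[of "ball 0 1"]; use Q_holomorphic_x Q_holomorphic_y in simp)+

lemma \<Xi>_expansion: "curve_x has_fps_expansion \<Xi>" and \<Upsilon>_expansion: "curve_y has_fps_expansion \<Upsilon>"
proof -
  have "(\<lambda>s. s * inverse (poly (smult X1 DX) s)) has_fps_expansion \<Xi>"
    unfolding \<Xi>_def by (intro fps_expansion_intros has_fps_expansion_poly) (simp add: fps_of_poly_nth DX_def)
  thus "curve_x has_fps_expansion \<Xi>" unfolding curve_x_def by (simp add: divide_inverse)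
  have "(\<lambda>s. ch * s * inverse (poly (smult Y1 DY) s)) has_fps_expansion \<Upsilon>"
    unfolding \<Upsilon>_def by (intro fps_expansion_intros has_fps_expansion_poly) (simp add: fps_of_poly_nth DY_def)
  thus "curve_y has_fps_expansion \<Upsilon>" unfolding curve_y_def by (simp add: divide_inverse)
qed

lemma \<Xi>_\<Upsilon>_nth: "fps_nth \<Xi> 0 = 0" "fps_nth \<Xi> 1 \<noteq> 0" "fps_nth \<Upsilon> 0 = 0" "fps_nth \<Upsilon> 1 \<noteq> 0"
  by (simp_all add: \<Xi>_def \<Upsilon>_def fps_X_mult_nth mult.assoc DX_def DY_def)

lemma X_eq: "X = fls_X / (fls_const X1 * toR DX)"
  and Y_eq: "Y = fls_const ch * fls_X / (fls_const Y1 * toR DY)"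
proof -
  have nz: "fps_nth (fps_of_poly (smult X1 DX)) 0 \<noteq> 0" "fps_nth (fps_of_poly (smult Y1 DY)) 0 \<noteq> 0"
    by (simp_all add: DX_def DY_def)
  have "fps_to_fls (\<Xi> * fps_of_poly (smult X1 DX)) = fls_X"
    unfolding \<Xi>_def mult.assoc inverse_mult_eq_1[OF nz(1)] by simp
  hence "X * (fls_const X1 * toR DX) = fls_X"
    by (simp only: fls_times_fps_to_fls toR_def[symmetric] toR_smult)
  thus "X = fls_X / (fls_const X1 * toR DX)" using DX_DY_nonzero by (simp add: eq_divide_eq)
  have "fps_to_fls (\<Upsilon> * fps_of_poly (smult Y1 DY)) = fps_to_fls (fps_const ch * fps_X)"
    unfolding \<Upsilon>_def mult.assoc inverse_mult_eq_1[OF nz(2)] by simp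
  hence "Y * (fls_const Y1 * toR DY) = fls_const ch * fls_X"
    by (simp only: fls_times_fps_to_fls toR_def[symmetric] toR_smult fps_const_to_fls fps_X_to_fls)
  thus "Y = fls_const ch * fls_X / (fls_const Y1 * toR DY)" using DX_DY_nonzero by (simp add: eq_divide_eq)
qed

lemma X_Y_ratfun: "X \<in> ratfun" "Y \<in> ratfun"
  unfolding X_eq Y_eq by (intro rat.divide_in rat.mult_in ratfun_const ratfun_X ratfun_toR)+

lemma X_Y_nonzero: "X \<noteq> 0" "Y \<noteq> 0" "qd.dil Y \<noteq> 0"
  using \<Xi>_\<Upsilon>_nth by (auto simp: qd.\<sigma>_eq_0_iff)

lemma U_V_nth: "fls_nth U 0 = 1" "fls_nth V 0 = 1"
proof -
  have "fps_nth \<Phi> 0 = 1" "fps_nth \<Psi> 0 = 1"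
    using has_fps_expansion_imp_0_eq_fps_nth_0[OF \<Phi>_expansion]
      has_fps_expansion_imp_0_eq_fps_nth_0[OF \<Psi>_expansion] Q_0_0 by simp_all
  thus "fls_nth U 0 = 1" "fls_nth V 0 = 1" by simp_all
qed

lemma dil_toR_DY: "qd.dil (toR DY) = fls_const (ch^2) * toR DY'"
  unfolding qd.dil_toR toR_smult[symmetric]
  by (simp add: DY_def DY'_def pcompose_pCons algebra_simps power2_eq_square)

lemma dil_divide_DY: "qd.dil (fls_X * f / toR DY) = fls_X * qd.dil f / toR DY'"
proof -
  have "fls_const (ch^2) \<noteq> 0" by simp
  thus ?thesis by (simp add: qd.\<sigma>_divide qd.\<sigma>_mult dil_toR_DY del: fls_const_nonzero)
qed

lemma dil_Y: "qd.dil Y = fls_const ch * fls_X / (fls_const Y1 * toR DY')"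
proof -
  have "Y = fls_X * fls_const (ch / Y1) / toR DY"
    by (simp add: Y_eq fls_const_divide_const[symmetric] mult.commute)
  thus ?thesis by (simp add: dil_divide_DY) (simp add: fls_const_divide_const[symmetric] mult.commute)
qed

lemma formal_relations:
  assumes c: "c = 1 \<or> c = ch^2" and y: "(\<lambda>s. curve_y (c * s)) has_fps_expansion y"
    and v: "(\<lambda>s. Q 0 (curve_y (c * s))) has_fps_expansion v"
  shows "kernel \<iota> X (fps_to_fls y) = 0" (is ?kernel)
    "\<iota> (1 / a + 1 / b - 1) * (X * fps_to_fls y) + x_coeff \<iota> X (fps_to_fls y) * U +
      y_coeff \<iota> X (fps_to_fls y) * fps_to_fls v = 0" (is ?relation)
proof -
  have u: "(\<lambda>s. Q (curve_x s) 0) has_fps_expansion fps_compose \<Phi> \<Xi>"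
    using has_fps_expansion_compose[OF \<Phi>_expansion \<Xi>_expansion \<Xi>_\<Upsilon>_nth(1)] by (simp add: o_def)
  have kernel: "\<forall>\<^sub>F s in nhds 0. kernel cr (curve_x s) (curve_y (c * s)) = 0"
    using eventually_on_curve by eventually_elim (rule kernel_on_curve, use c in auto)
  have relation: "\<forall>\<^sub>F s in nhds 0. cr (1 / a + 1 / b - 1) * (curve_x s * curve_y (c * s)) +
      x_coeff cr (curve_x s) (curve_y (c * s)) * Q (curve_x s) 0 +
      y_coeff cr (curve_x s) (curve_y (c * s)) * Q 0 (curve_y (c * s)) = 0"
    using eventually_on_curve kernel
  proof eventually_elim
    case (elim s)
    thus ?case using functional_equation[of "curve_x s" "curve_y (c * s)"] c by auto
  qed
  have vanish: "F = 0" if "f has_fps_expansion F" "\<forall>\<^sub>F s in nhds 0. f s = 0" for f and F :: "complex fps"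
    using that fps_expansion_unique_complex by (metis has_fps_expansion_0_iff)
  let ?\<kappa> = "\<lambda>r. fps_const (cr r)"
  have "kernel ?\<kappa> \<Xi> y = 0"
    by (rule vanish[OF _ kernel]) (unfold kernel_def, intro fps_expansion_intros \<Xi>_expansion y)
  hence "fps_to_fls (kernel ?\<kappa> \<Xi> y) = 0" by simp
  thus ?kernel by (simp add: kernel_def fls_times_fps_to_fls fps_to_fls_power)
  have "?\<kappa> (1 / a + 1 / b - 1) * (\<Xi> * y) + x_coeff ?\<kappa> \<Xi> y * fps_compose \<Phi> \<Xi> + y_coeff ?\<kappa> \<Xi> y * v = 0"
    by (rule vanish[OF _ relation])
       (unfold x_coeff_def y_coeff_def, intro fps_expansion_intros \<Xi>_expansion y u v)
  hence "fps_to_fls (?\<kappa> (1 / a + 1 / b - 1) * (\<Xi> * y) + x_coeff ?\<kappa> \<Xi> y * fps_compose \<Phi> \<Xi> + y_coeff ?\<kappa> \<Xi> y * v) = 0"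
    by simp
  thus ?relation by (simp add: x_coeff_def y_coeff_def fls_times_fps_to_fls fps_to_fls_power)
qed

lemma V_expansion: "(\<lambda>s. Q 0 (curve_y s)) has_fps_expansion fps_compose \<Psi> \<Upsilon>"
  using has_fps_expansion_compose[OF \<Psi>_expansion \<Upsilon>_expansion \<Xi>_\<Upsilon>_nth(3)] by (simp add: o_def)

lemma dilated_expansion:
  "(\<lambda>s. curve_y (ch^2 * s)) has_fps_expansion fps_compose \<Upsilon> (fps_const (ch^2) * fps_X)"
  "(\<lambda>s. Q 0 (curve_y (ch^2 * s))) has_fps_expansion fps_compose (fps_compose \<Psi> \<Upsilon>) (fps_const (ch^2) * fps_X)"
proof -
  have "(\<lambda>s. ch^2 * s) has_fps_expansion (fps_const (ch^2) * fps_X)" by (intro fps_expansion_intros)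
  from has_fps_expansion_compose[OF \<Upsilon>_expansion this] has_fps_expansion_compose[OF V_expansion this]
  show "(\<lambda>s. curve_y (ch^2 * s)) has_fps_expansion fps_compose \<Upsilon> (fps_const (ch^2) * fps_X)"
    "(\<lambda>s. Q 0 (curve_y (ch^2 * s))) has_fps_expansion fps_compose (fps_compose \<Psi> \<Upsilon>) (fps_const (ch^2) * fps_X)"
    by (simp_all add: o_def)
qed

theorem kernel_X_Y: "kernel \<iota> X Y = 0" "kernel \<iota> X (qd.dil Y) = 0"
  and functional_equation_X_Y:
    "\<iota> (1 / a + 1 / b - 1) * (X * Y) + x_coeff \<iota> X Y * U + y_coeff \<iota> X Y * V = 0"
    "\<iota> (1 / a + 1 / b - 1) * (X * qd.dil Y) + x_coeff \<iota> X (qd.dil Y) * U + y_coeff \<iota> X (qd.dil Y) * qd.dil V = 0"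
  using formal_relations[of 1 \<Upsilon> "fps_compose \<Psi> \<Upsilon>"] formal_relations[OF _ dilated_expansion]
    \<Upsilon>_expansion V_expansion
  by (simp_all add: qd.dil_def)

lemma nA_nB_eq:
  "nA A cx cy ch = smult (A * (ch^2 + 1)) DX - smult (A + 1) DY"
  "nA' A cx cy ch = smult (A * (ch^2 + 1)) DX - smult (A + 1) DY'"
  "nB B cx cy ch = smult (B * (ch^2 + 1)) DY - smult ((B + 1) * ch^2) DX"
  "nB' B cx cy ch = smult (B * (ch^2 + 1)) DY' - smult ((B + 1) * ch^2) DX"
  by (simp_all add: nA_def nA'_def nB_def nB'_def DX_def DY_def DY'_def algebra_simps power2_eq_square)

lemma nA_nB_nonzero:
  "nA A cx cy ch \<noteq> 0" "nB B cx cy ch \<noteq> 0" "nA' A cx cy ch \<noteq> 0" "nB' B cx cy ch \<noteq> 0"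
proof -
  have "ch^2 * ch^2 \<noteq> 1"
    using less_1_mult[OF qd.q_gt1 qd.q_gt1] by (metis less_irrefl norm_mult norm_one)
  hence z: "\<not> (z - ch^2 = 0 \<and> z * ch^2 - 1 = 0)" for z by auto
  show "nA A cx cy ch \<noteq> 0" "nA' A cx cy ch \<noteq> 0"
    using z[of A] unfolding nA_def nA'_def pCons_eq_0_iff by blast+
  show "nB B cx cy ch \<noteq> 0" "nB' B cx cy ch \<noteq> 0"
    using z[of B] unfolding nB_def nB'_def pCons_eq_0_iff mult_eq_0_iff by auto
qed

lemma coeffs_on_curve:
  assumes y: "y = fls_const ch * fls_X / (fls_const Y1 * toR D)" and D: "toR D \<noteq> 0"
    and n: "n = smult (A * (ch^2 + 1)) DX - smult (A + 1) D"
    and m: "m = smult (B * (ch^2 + 1)) D - smult ((B + 1) * ch^2) DX"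
  shows "\<iota> (a * (h^2 + 1)) * toR DX * x_coeff \<iota> X y = X * y * toR n"
    and "\<iota> (b * (h^2 + 1)) * toR D * y_coeff \<iota> X y = X * y * toR m"
proof -
  define H ca cb ct c\<alpha> c\<beta> where "H = \<iota> (h^2 + 1)" and "ca = \<iota> a" and "cb = \<iota> b" and "ct = \<iota> t"
    and "c\<alpha> = \<iota> \<alpha>" and "c\<beta> = \<iota> \<beta>"
  define dx e where "dx = toR DX" and "e = toR D"
  have X1Y1: "fls_const X1 = c\<alpha> * \<iota> L" "fls_const Y1 = c\<beta> * \<iota> L" by (simp_all add: X1_def Y1_def c\<alpha>_def c\<beta>_def)
  have nz: "c\<alpha> \<noteq> 0" "c\<beta> \<noteq> 0" "\<iota> L \<noteq> 0" "\<iota> h \<noteq> 0" "dx \<noteq> 0" "e \<noteq> 0"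
    using \<alpha>_\<beta> L_pos DX_DY_nonzero D by (simp_all add: c\<alpha>_def c\<beta>_def dx_def e_def)
  have ratio: "\<iota> h * (c\<alpha> * dx * X) = c\<beta> * e * y"
    using nz by (simp add: X_eq y X1Y1 dx_def[symmetric] e_def[symmetric])
  have "\<iota> (t * (\<alpha> * \<beta>) * (h^2 + 1)) = \<iota> h" unfolding \<alpha>_\<beta>(5) \<tau>_h(1) ..
  hence \<tau>: "ct * c\<alpha> * c\<beta> * H = \<iota> h" by (simp add: ct_def c\<alpha>_def c\<beta>_def H_def mult.assoc)
  have c: "ca * \<iota> (1 - 1 / a) = ca - 1" "cb * \<iota> (1 - 1 / b) = cb - 1" "\<iota> (t * d (1, -1)) = ct * c\<alpha>^2"
      "\<iota> (t * d (-1, 1)) = ct * c\<beta>^2" "\<iota> (a * (h^2 + 1)) = ca * H" "\<iota> (b * (h^2 + 1)) = cb * H"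
    using ab_pos unfolding ca_def cb_def ct_def c\<alpha>_def c\<beta>_def H_def \<alpha>_\<beta>(3,4)[symmetric]
    by (simp_all add: power2_eq_square right_diff_distrib flip: fls_const_1 fls_minus_const)
  have "ca - 1 = \<iota> (a - 1)" "cb - 1 = \<iota> (b - 1)"
    by (simp_all add: ca_def cb_def flip: fls_const_1 fls_minus_const)
  hence "toR n = (ca - 1) * H * dx - ca * e" "toR m = (cb - 1) * H * e - cb * \<iota> h^2 * dx"
    by (simp_all add: n m toR_diff toR_smult ca_def cb_def H_def dx_def e_def power2_eq_square)
  moreover have "ca * H * dx * x_coeff \<iota> X y = X * y * ((ca - 1) * H * dx - ca * e)"
  proof -
    have "\<iota> h * (ca * H * dx * x_coeff \<iota> X y) =
        \<iota> h * (ca * \<iota> (1 - 1 / a)) * H * dx * X * y - ca * ct * c\<alpha> * H * (\<iota> h * (c\<alpha> * dx * X)) * X"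
      unfolding x_coeff_def c(3) by (simp only: power2_eq_square algebra_simps)
    also have "... = \<iota> h * (ca - 1) * H * dx * X * y - ca * (ct * c\<alpha> * c\<beta> * H) * e * y * X"
      unfolding ratio c(1) by (simp add: algebra_simps)
    also have "... = \<iota> h * (X * y * ((ca - 1) * H * dx - ca * e))"
      unfolding \<tau> by (simp add: algebra_simps)
    finally show ?thesis using nz by simp
  qed
  moreover have "cb * H * e * y_coeff \<iota> X y = X * y * ((cb - 1) * H * e - cb * \<iota> h^2 * dx)"
  proof -
    have "cb * H * e * y_coeff \<iota> X y = (cb * \<iota> (1 - 1 / b)) * H * e * X * y - cb * ct * c\<beta> * H * (c\<beta> * e * y) * y"
      unfolding y_coeff_def c(4) by (simp only: power2_eq_square algebra_simps)
    also have "... = (cb - 1) * H * e * X * y - cb * (ct * c\<alpha> * c\<beta> * H) * \<iota> h * dx * X * y"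
      unfolding ratio[symmetric] c(2) by (simp add: algebra_simps)
    finally show ?thesis unfolding \<tau> by (simp add: power2_eq_square algebra_simps)
  qed
  ultimately show "\<iota> (a * (h^2 + 1)) * toR DX * x_coeff \<iota> X y = X * y * toR n"
    "\<iota> (b * (h^2 + 1)) * toR D * y_coeff \<iota> X y = X * y * toR m"
    unfolding c(5,6) by (simp_all only: dx_def e_def)
qed

definition F where "F = fls_X * U / toR DX"
definition G where "G = fls_X * V / toR DY"

lemma linear_relation:
  assumes y: "y = fls_const ch * fls_X / (fls_const Y1 * toR D)" "y \<noteq> 0" and D: "toR D \<noteq> 0"
    and n: "n = smult (A * (ch^2 + 1)) DX - smult (A + 1) D"
    and m: "m = smult (B * (ch^2 + 1)) D - smult ((B + 1) * ch^2) DX"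
    and rel: "\<iota> (1 / a + 1 / b - 1) * (X * y) + x_coeff \<iota> X y * U + y_coeff \<iota> X y * v = 0"
  shows "fls_const ((1 - A * B) * (ch^2 + 1)) * fls_X + \<iota> b * toR n * F + \<iota> a * toR m * (fls_X * v / toR D) = 0"
proof -
  define H where "H = \<iota> (h^2 + 1)"
  define dx e where "dx = toR DX" and "e = toR D"
  have nz: "dx \<noteq> 0" "e \<noteq> 0" using DX_DY_nonzero D by (simp_all add: dx_def e_def)
  note coeffs = coeffs_on_curve[OF y(1) D n m, folded dx_def e_def]
  have ab: "\<iota> (a * (h^2 + 1)) = \<iota> a * H" "\<iota> (b * (h^2 + 1)) = \<iota> b * H" by (simp_all add: H_def)
  have "(1 - (a - 1) * (b - 1)) * (h^2 + 1) = a * b * (1 / a + 1 / b - 1) * (h^2 + 1)"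
    using ab_pos by (simp add: field_simps)
  hence "\<iota> ((1 - (a - 1) * (b - 1)) * (h^2 + 1)) = \<iota> (a * b * (1 / a + 1 / b - 1) * (h^2 + 1))" by (simp only:)
  hence const: "fls_const ((1 - A * B) * (ch^2 + 1)) = \<iota> a * \<iota> b * \<iota> (1 / a + 1 / b - 1) * H"
    by (simp add: H_def)
  have "0 = \<iota> a * \<iota> b * H * dx * e *
      (\<iota> (1 / a + 1 / b - 1) * (X * y) + x_coeff \<iota> X y * U + y_coeff \<iota> X y * v)"
    unfolding rel by simp
  also have "... = (\<iota> a * \<iota> b * \<iota> (1 / a + 1 / b - 1) * H) * dx * e * (X * y) +
      \<iota> b * e * (\<iota> a * H * dx * x_coeff \<iota> X y) * U + \<iota> a * dx * (\<iota> b * H * e * y_coeff \<iota> X y) * v"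
    by (simp only: algebra_simps)
  also have "... = X * y * (fls_const ((1 - A * B) * (ch^2 + 1)) * dx * e + \<iota> b * toR n * e * U + \<iota> a * toR m * dx * v)"
    unfolding coeffs[unfolded ab] const by (simp only: algebra_simps)
  finally have "fls_const ((1 - A * B) * (ch^2 + 1)) * dx * e + \<iota> b * toR n * e * U + \<iota> a * toR m * dx * v = 0"
    using X_Y_nonzero y(2) by (metis mult_eq_0_iff)
  hence "fls_X / (dx * e) * (fls_const ((1 - A * B) * (ch^2 + 1)) * dx * e + \<iota> b * toR n * e * U + \<iota> a * toR m * dx * v) = 0"
    by simp
  thus ?thesis using nz by (simp add: F_def dx_def[symmetric] e_def[symmetric] field_simps)
qed

lemma F_G_relation: "fls_const ((1 - A * B) * (ch^2 + 1)) * fls_X +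
    \<iota> b * toR (nA A cx cy ch) * F + \<iota> a * toR (nB B cx cy ch) * G = 0"
  unfolding G_def
  by (rule linear_relation[OF Y_eq X_Y_nonzero(2) DX_DY_nonzero(2) nA_nB_eq(1,3) functional_equation_X_Y(1)])

lemma F_dil_G_relation: "fls_const ((1 - A * B) * (ch^2 + 1)) * fls_X +
    \<iota> b * toR (nA' A cx cy ch) * F + \<iota> a * toR (nB' B cx cy ch) * qd.dil G = 0"
  unfolding G_def dil_divide_DY
  by (rule linear_relation[OF dil_Y X_Y_nonzero(3) DX_DY_nonzero(3) nA_nB_eq(2,4) functional_equation_X_Y(2)])

theorem kernel_equation: "qd.kernel_eq A B cx cy ch ((1 - A * B) * (ch^2 + 1) / cr a) G"
proof -
  define p p' r r' where "p = toR (nA A cx cy ch)" and "p' = toR (nA' A cx cy ch)"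
    and "r = toR (nB B cx cy ch)" and "r' = toR (nB' B cx cy ch)"
  define k where "k = fls_const ((1 - A * B) * (ch^2 + 1) / cr a)"
  have a: "\<iota> a \<noteq> 0" and k: "fls_const ((1 - A * B) * (ch^2 + 1)) = \<iota> a * k" using ab_pos by (simp_all add: k_def)
  have "0 = p' * (\<iota> a * k * fls_X + \<iota> b * p * F + \<iota> a * r * G) - p * (\<iota> a * k * fls_X + \<iota> b * p' * F + \<iota> a * r' * qd.dil G)"
    using F_G_relation F_dil_G_relation unfolding k p_def p'_def r_def r'_def by (simp only: mult_zero_right diff_0_right)
  also have "... = \<iota> a * ((p' * r * G + k * fls_X * (p' - p)) - p * r' * qd.dil G)" by (simp only: algebra_simps)
  finally have "p * r' * qd.dil G = p' * r * G + k * fls_X * (p' - p)" using a by (metis eq_iff_diff_eq_0 mult_eq_0_iff)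
  thus ?thesis unfolding qd.kernel_eq_def toR_mult toR_diff p_def p'_def r_def r'_def k_def .
qed

lemma U_V_nonzero: "U \<noteq> 0" "V \<noteq> 0"
  using U_V_nth by (metis fls_zero_nth zero_neq_one)+

lemma G_nonzero: "G \<noteq> 0"
  unfolding G_def divide_eq_0_iff mult_eq_0_iff using U_V_nonzero DX_DY_nonzero by simp

lemma diff_alg_V_imp_G:
  assumes "diff_alg V" shows "diff_alg G"
proof -
  have "diff_alg (fls_X / toR DY * V + 0)"
    by (rule diff_alg_affine_image[OF assms])
       (use DX_DY_nonzero in \<open>auto intro: rat.divide_in ratfun_toR ratfun_X rat.zero_in\<close>)
  thus ?thesis by (simp add: G_def)
qed

lemma diff_alg_U_imp_G:
  assumes "diff_alg U" shows "diff_alg G"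
proof -
  define p r where "p = \<iota> b * toR (nA A cx cy ch)" and "r = \<iota> a * toR (nB B cx cy ch)"
  define k where "k = fls_const ((1 - A * B) * (ch^2 + 1))"
  define w where "w = fls_X / toR DX"
  have nz: "p \<noteq> 0" "r \<noteq> 0" "w \<noteq> 0"
    using ab_pos nA_nB_nonzero DX_DY_nonzero by (simp_all add: p_def r_def w_def)
  have "k * fls_X + p * F + r * G = 0"
    using F_G_relation by (simp only: k_def p_def r_def)
  hence "r * G = - (p * F) - k * fls_X" by (simp add: algebra_simps eq_neg_iff_add_eq_0)
  hence "G = (- (p * F) - k * fls_X) / r" using nz by (simp add: eq_divide_eq mult.commute)
  hence "G = - (p * w / r) * U + - (k * fls_X / r)"
    by (simp add: diff_divide_distrib F_def w_def)
  moreover have "diff_alg (- (p * w / r) * U + - (k * fls_X / r))"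
  proof (rule diff_alg_affine_image[OF assms])
    have "k \<in> ratfun" "p \<in> ratfun" "r \<in> ratfun" "w \<in> ratfun"
      by (auto simp: k_def p_def r_def w_def intro!: ratfun_const ratfun_toR ratfun_X rat.divide_in rat.mult_in)
    thus "- (p * w / r) \<in> ratfun" "- (k * fls_X / r) \<in> ratfun"
      by (auto intro!: rat.mult_in rat.divide_in rat.uminus_in ratfun_X)
  qed (use nz in simp)
  ultimately show ?thesis by (simp only:)
qed

theorem D_algebraic_imp_diff_alg:
  assumes "x_D_algebraic Q \<or> y_D_algebraic Q"
  shows "diff_alg G"
  using assms
proof
  assume "x_D_algebraic Q"
  then obtain P :: "complex mpoly" and r where "P \<noteq> 0" "r > 0"
    and "\<And>x y. norm x < r \<Longrightarrow> norm y < r \<Longrightarrow> mpeval P (jet_point 0 1 x y (\<lambda>n. (deriv ^^ n) (\<lambda>u. Q u y) x)) = 0"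
    unfolding x_D_algebraic_def jet_point_def[abs_def] by blast
  hence "diff_alg U"
    by (intro ADE_imp_diff_alg[where F = "\<lambda>x y. Q x y" and P = P and r = r and C = 2,
          OF _ _ _ _ _ _ \<Phi>_expansion \<Xi>_\<Upsilon>_nth(1,2) X_Y_ratfun(1)])
       (use Q_holomorphic_x Q_lipschitz(1) in auto)
  thus ?thesis by (rule diff_alg_U_imp_G)
next
  assume "y_D_algebraic Q"
  then obtain P :: "complex mpoly" and r where P: "P \<noteq> 0" "r > 0"
    and rel: "\<And>x y. norm x < r \<Longrightarrow> norm y < r \<Longrightarrow> mpeval P (jet_point 0 1 x y (\<lambda>n. (deriv ^^ n) (\<lambda>u. Q x u) y)) = 0"
    unfolding y_D_algebraic_def jet_point_def[abs_def] by blast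
  have "jet_point 0 1 x y f = jet_point 1 0 y x f" for x y and f :: "nat \<Rightarrow> complex"
    by (auto simp: jet_point_def fun_eq_iff)
  hence "diff_alg V"
    using P rel
    by (intro ADE_imp_diff_alg[where F = "\<lambda>u v. Q v u" and P = P and r = r and C = 2, of 1 0,
        OF _ _ _ _ _ _ \<Psi>_expansion \<Xi>_\<Upsilon>_nth(3,4) X_Y_ratfun(2)])
       (use Q_holomorphic_y Q_lipschitz(2) in auto)
  thus ?thesis by (rule diff_alg_V_imp_G)
qed

end

section \<open>Transcendence for small \<open>t\<close>\<close>

lemma ex_joukowski_parameter:
  fixes \<tau> H :: real
  assumes "H \<ge> 1" "\<tau> > 0" "\<tau> < H / (H^2 + 1)"
  obtains h where "h > H" "\<tau> = h / (h^2 + 1)"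
proof -
  have pos: "x^2 + 1 > 0" for x :: real by (rule add_nonneg_pos) auto
  have upper: "(1 / \<tau>) / ((1 / \<tau>)^2 + 1) \<le> \<tau>"
    using assms(2) pos[of \<tau>] by (simp add: divide_simps power2_eq_square)
  have "\<tau> * (H^2 + 1) < H" using assms(3) pos[of H] by (simp add: pos_less_divide_eq)
  moreover have "\<tau> * (H^2 + 1) = H * (\<tau> * H) + \<tau>" by (simp add: power2_eq_square algebra_simps)
  ultimately have "H * (\<tau> * H) < H * 1" using assms(2) by simp
  hence "\<tau> * H < 1" using assms(1) by (subst (asm) mult_less_cancel_left_pos) auto
  hence "H \<le> 1 / \<tau>" using assms by (simp add: field_simps)
  moreover have "continuous_on {H..1 / \<tau>} (\<lambda>h. h / (h^2 + 1))"
    using pos by (intro continuous_intros) (auto simp: less_imp_neq[THEN not_sym])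
  ultimately obtain h where "H \<le> h" "h / (h^2 + 1) = \<tau>"
    using IVT2'[of "\<lambda>h. h / (h^2 + 1)" "1 / \<tau>" \<tau> H] upper assms by auto
  moreover have "h \<noteq> H" using calculation(2) assms(3) by auto
  ultimately show ?thesis using that[of h] by auto
qed

lemma eventually_ex_kernel_curve:
  assumes d: "\<And>v. 0 \<le> d v" "a > 0" "b > 0" "d (1, -1) > 0" "d (-1, 1) > 0" "d (1, 0) > 0 \<or> d (0, 1) > 0 \<or> d (1, 1) > 0"
    and P: "\<forall>\<^sub>F h in at_top. P h"
  shows "\<forall>\<^sub>F t in at_right 0. \<exists>h. P h \<and> kernel_curve d a b t h"
proof -
  define M where "M = (\<Sum>v\<in>S5. d v) * ((1 + a) * (1 + b))"
  define \<kappa> where "\<kappa> = sqrt (d (1, -1) * d (-1, 1))"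
  have "\<kappa> > 0" using d by (simp add: \<kappa>_def)
  obtain H where H: "\<And>h. h > H \<Longrightarrow> P h" using P by (auto simp: eventually_at_top_dense)
  define H' where "H' = max H 1"
  have H': "H' / (H'^2 + 1) > 0" by (auto simp: H'_def intro!: divide_pos_pos add_nonneg_pos)
  have "\<forall>\<^sub>F t in at_right 0. t * x < e" if "0 < e" for x e :: real
    by (rule order_tendstoD(2)[OF _ that]) (auto intro!: tendsto_eq_intros)
  from this[of "1 / 2" M] this[OF H', of \<kappa>]
  have "\<forall>\<^sub>F t in at_right 0. t * M < 1 / 2" "\<forall>\<^sub>F t in at_right 0. t * \<kappa> < H' / (H'^2 + 1)" by simp_all
  thus ?thesis using eventually_at_right_less[of 0]
  proof eventually_elim
    case (elim t)
    obtain h where h: "h > H'" "t * \<kappa> = h / (h^2 + 1)"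
      by (rule ex_joukowski_parameter[of H' "t * \<kappa>"]) (use elim \<open>\<kappa> > 0\<close> in \<open>auto simp: H'_def\<close>)
    have "kernel_curve d a b t h"
      by unfold_locales (use d elim h in \<open>auto simp: M_def \<kappa>_def H'_def\<close>)
    moreover have "P h" using H h(1) by (simp add: H'_def)
    ultimately show ?case by blast
  qed
qed

context kernel_curve
begin

lemma A_B_ne: "A \<noteq> -1" "B \<noteq> -1"
  using ab_pos by (auto simp: complex_eq_iff)

lemma constant_term_nonzero: "A * B \<noteq> 1 \<Longrightarrow> (1 - A * B) * (ch^2 + 1) / cr a \<noteq> 0"
proof -
  have "ch^2 + 1 = cr (h^2 + 1)" by simp
  hence "ch^2 + 1 \<noteq> 0" using h_square by (metis less_irrefl of_real_eq_0_iff)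
  thus "A * B \<noteq> 1 \<Longrightarrow> (1 - A * B) * (ch^2 + 1) / cr a \<noteq> 0" using ab_pos by simp
qed

lemma L_lower_bound: "t * sqrt (d (1, 1)) \<le> L"
proof -
  have "\<Delta> \<le> 1" "0 \<le> (u0 * v0 + \<tau> * (u0^2 + v0^2)) / \<Delta>"
    using uvw_nonneg \<tau>_pos \<Delta>_pos by (auto simp: \<Delta>_def)
  hence "\<tau> * w0 \<le> \<tau> / \<Delta> * (w0 + (u0 * v0 + \<tau> * (u0^2 + v0^2)) / \<Delta>)"
    using \<tau>_pos \<Delta>_pos uvw_nonneg by (intro mult_mono) (auto simp: le_divide_eq)
  hence "\<tau> * w0 \<le> L^2" by (simp add: L_square)
  moreover have "\<tau> * w0 = t^2 * d (1, 1)"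
    using \<alpha>_\<beta>(1,2) unfolding \<alpha>_\<beta>(5)[symmetric] w0_def by (simp add: power2_eq_square)
  ultimately have "(t * sqrt (d (1, 1)))^2 \<le> L^2" using d_nonneg by (simp add: power_mult_distrib)
  thus ?thesis by (rule power2_le_imp_le) (use L_pos in simp)
qed

lemma ex_ey_bounded:
  assumes d11: "d (1, 1) > 0" and h: "h \<ge> 2"
  defines "M \<equiv> 3 * (d (1, 0) / sqrt (d (1, -1)) + d (0, 1) / sqrt (d (-1, 1))) / sqrt (d (1, 1))"
  shows "norm cx \<le> M" "norm cy \<le> M"
proof -
  have "0 \<le> (h - 2) * (2 * h - 1)" using h by (intro mult_nonneg_nonneg) auto
  hence "\<tau> \<le> 2 / 5" using h_square by (simp add: \<tau>_def divide_le_eq power2_eq_square algebra_simps)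
  moreover from this have "\<tau>^2 \<le> (2 / 5)^2" using \<tau>_pos by (intro power_mono) auto
  ultimately have \<tau>: "2 * \<tau> \<le> 1" and "1 / 3 \<le> \<Delta>" by (auto simp: \<Delta>_def power2_eq_square)
  have scale: "t * sqrt (d (1, 1)) > 0" using t_pos d11 by simp
  hence denominator: "1 / 3 * (t * sqrt (d (1, 1))) \<le> \<Delta> * L"
    using \<open>1 / 3 \<le> \<Delta>\<close> L_lower_bound by (intro mult_mono) auto
  have "z / (\<Delta> * L) \<le> M" if "0 \<le> z" "z \<le> u0 + v0" for z
  proof -
    have "z / (\<Delta> * L) \<le> (u0 + v0) / (1 / 3 * (t * sqrt (d (1, 1))))"
      by (rule frac_le) (use that denominator scale uvw_nonneg in auto)
    also have "... = M"
      unfolding M_def u0_def v0_def \<alpha>_def \<beta>_def using t_pos d11 d_pos by (simp add: field_simps)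
    finally show ?thesis .
  qed
  moreover have "2 * \<tau> * v0 \<le> v0" "2 * \<tau> * u0 \<le> u0"
    using \<tau> uvw_nonneg mult_right_mono[of "2 * \<tau>" 1] by auto
  ultimately have "ex \<le> M" "ey \<le> M" unfolding ex_def ey_def using uvw_nonneg \<tau>_pos by auto
  thus "norm cx \<le> M" "norm cy \<le> M" using ex_ey_nonneg by simp_all
qed

lemma scale_without_diagonal_step:
  assumes "d (1, 1) = 0"
  shows "\<tau>^2 * ((h * u0 + v0) * (h * v0 + u0)) = h * (\<Delta> * L)^2"
proof -
  have "w0 = 0" using assms by (simp add: w0_def)
  have "(h * u0 + v0) * (h * v0 + u0) = (h^2 + 1) * (u0 * v0) + h * (u0^2 + v0^2)"
    by (simp add: power2_eq_square algebra_simps)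
  also have "... = (h^2 + 1) * (u0 * v0 + \<tau> * (u0^2 + v0^2))"
    by (subst (2) \<tau>_h(1)[symmetric]) (simp add: algebra_simps)
  finally have "\<tau> * ((h * u0 + v0) * (h * v0 + u0)) = h * (u0 * v0 + \<tau> * (u0^2 + v0^2))"
    using \<tau>_h(1) by (metis mult.assoc)
  moreover have "(\<Delta> * L)^2 = \<tau> * (u0 * v0 + \<tau> * (u0^2 + v0^2))"
    using \<Delta>_pos by (simp add: power_mult_distrib L_square \<open>w0 = 0\<close>) (simp add: power2_eq_square)
  ultimately show ?thesis
    by (simp add: power2_eq_square[of \<tau>] mult_ac)
qed

text \<open>If \<open>d (1, 1) = 0\<close> then the conic passes through \<open>X = Y = 0\<close>, at the parameter \<open>s = - \<rho>\<close>.\<close>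

lemma common_root:
  assumes d11: "d (1, 1) = 0"
  defines "\<rho> \<equiv> \<tau> * (h * u0 + v0) / (\<Delta> * L)"
  shows "poly (nA A cx cy ch) (cr (- \<rho>)) = 0" "poly (nB B cx cy ch) (cr (- \<rho>)) = 0"
    "\<rho> > 0" "\<rho>^2 = h * (h * u0 + v0) / (h * v0 + u0)"
proof -
  have "u0 > 0 \<or> v0 > 0" using d_nz d11 \<alpha>_\<beta> t_pos by (auto simp: u0_def v0_def)
  hence pos: "h * u0 + v0 > 0" "h * v0 + u0 > 0"
    using uvw_nonneg h_gt1 by (auto intro: add_pos_nonneg add_nonneg_pos)
  have nz: "\<Delta> \<noteq> 0" "L \<noteq> 0" "\<tau> \<noteq> 0" using \<Delta>_pos L_pos \<tau>_pos by auto
  show "\<rho> > 0" using pos \<tau>_pos \<Delta>_pos L_pos by (simp add: \<rho>_def)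
  define \<rho>' where "\<rho>' = \<tau> * (h * v0 + u0) / (\<Delta> * L)"
  have "\<rho> * \<rho>' = \<tau>^2 * ((h * u0 + v0) * (h * v0 + u0)) / (\<Delta> * L)^2"
    by (simp add: \<rho>_def \<rho>'_def power2_eq_square mult_ac)
  hence inv: "\<rho> * \<rho>' = h" unfolding scale_without_diagonal_step[OF d11] using nz by simp
  hence "\<rho>' \<noteq> 0" using h_nonzero by (metis mult_zero_right)
  hence "\<rho>^2 = h * (\<rho> / \<rho>')" unfolding inv[symmetric] by (simp add: power2_eq_square)
  also have "... = h * (h * u0 + v0) / (h * v0 + u0)" using nz pos by (simp add: \<rho>_def \<rho>'_def)
  finally show "\<rho>^2 = h * (h * u0 + v0) / (h * v0 + u0)" .
  have "u0 = \<tau> * (h + 1 / h) * u0" "v0 = \<tau> * (h + 1 / h) * v0"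
    using nz unfolding \<tau>_h(2)[symmetric] by simp_all
  hence "ex = (\<tau> * (h + 1 / h) * u0 + 2 * \<tau> * v0) / (\<Delta> * L)" "ey = (\<tau> * (h + 1 / h) * v0 + 2 * \<tau> * u0) / (\<Delta> * L)"
    unfolding ex_def ey_def by simp_all
  moreover have "\<tau> * (h + 1 / h) * u0 + 2 * \<tau> * v0 = \<tau> * (h * u0 + v0) + \<tau> * (h * v0 + u0) / h"
      "\<tau> * (h + 1 / h) * v0 + 2 * \<tau> * u0 = \<tau> * (h * u0 + v0) / h + \<tau> * (h * v0 + u0)"
    by (simp_all add: field_simps)
  ultimately have "ex = (\<tau> * (h * u0 + v0) + \<tau> * (h * v0 + u0) / h) / (\<Delta> * L)"
      "ey = (\<tau> * (h * u0 + v0) / h + \<tau> * (h * v0 + u0)) / (\<Delta> * L)"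
    by (simp_all only:)
  hence sum: "ex = \<rho> + \<rho>' / h" "ey = \<rho> / h + \<rho>'"
    by (simp_all add: \<rho>_def \<rho>'_def add_divide_distrib mult.commute)
  have "\<rho>^2 - ex * \<rho> + 1 = 0" "\<rho>^2 - h * ey * \<rho> + h^2 = 0"
    using inv unfolding sum by (simp_all add: power2_eq_square algebra_simps)
  hence "cr (\<rho>^2 - ex * \<rho> + 1) = 0" "cr (\<rho>^2 - h * ey * \<rho> + h^2) = 0" by simp_all
  hence "poly DX (cr (- \<rho>)) = 0" "poly DY (cr (- \<rho>)) = 0"
    by (simp_all add: DX_def DY_def power2_eq_square algebra_simps)
  thus "poly (nA A cx cy ch) (cr (- \<rho>)) = 0" "poly (nB B cx cy ch) (cr (- \<rho>)) = 0"
    unfolding nA_nB_eq poly_diff poly_smult by simp_all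
qed

end

lemma eventually_not_diff_alg_of_diagonal_step:
  assumes d: "\<And>v. 0 \<le> d v" "d (1, -1) > 0" "d (-1, 1) > 0" "d (1, 1) > 0"
    and ne: "\<not> (a = 2 \<and> b = 2 \<and> d (1, 0) = 0 \<and> d (0, 1) = 0)"
  shows "\<forall>\<^sub>F h in at_top. \<forall>t. kernel_curve d a b t h \<longrightarrow> \<not> diff_alg (kernel_curve.G d a b t h)"
proof -
  define M where "M = 3 * (d (1, 0) / sqrt (d (1, -1)) + d (0, 1) / sqrt (d (-1, 1))) / sqrt (d (1, 1))"
  have "M \<ge> 0" using d by (auto simp: M_def intro!: divide_nonneg_nonneg add_nonneg_nonneg mult_nonneg_nonneg)
  from eventually_roots_near[OF this, of "cr (a - 1)" "cr (b - 1)"]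
    eventually_nonresonant[of "cr (a - 1)" "cr (b - 1)"] eventually_ge_at_top[of 2]
  show ?thesis
  proof eventually_elim
    case (elim h)
    show ?case
    proof (intro allI impI)
      fix t assume "kernel_curve d a b t h"
      then interpret kernel_curve d a b t h .
      have "norm cx \<le> M" "norm cy \<le> M" unfolding M_def by (rule ex_ey_bounded[OF d(4) elim(3)])+
      hence roots: "qd.roots_near A B cx cy ch" using elim(1) by blast
      have "\<not> (A = 1 \<and> B = 1 \<and> cx = 0 \<and> cy = 0)"
      proof
        assume "A = 1 \<and> B = 1 \<and> cx = 0 \<and> cy = 0"
        hence "a = 2" "b = 2" "ex = 0" "ey = 0" by (auto simp: complex_eq_iff)
        moreover from this have "u0 = 0" "v0 = 0" using u0_eq v0_eq L_pos by simp_all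
        ultimately show False using ne t_pos \<alpha>_\<beta> by (simp add: u0_def v0_def)
      qed
      thus "\<not> diff_alg G"
        using elim(2) constant_term_nonzero
        by (intro qd.bounded_not_diff_alg[OF refl roots A_B_ne _ _ kernel_equation G_nonzero]) auto
    qed
  qed
qed

lemma eventually_near_half:
  assumes "u > 0" "v > 0"
  shows "\<forall>\<^sub>F h in at_top. q_dilation.near ((cr h)^2) (1/2) (cr (h * (h * u + v) / (h * v + u)))"
proof (rule tendsto_imp_eventually_near)
  have "((\<lambda>h. \<bar>h * (h * u + v) / (h * v + u)\<bar> / h) \<longlongrightarrow> u / v) at_top"
    using assms unfolding divide_inverse[of u] by real_asymp
  moreover have "\<forall>\<^sub>F h::real in at_top. norm (cr (h * (h * u + v) / (h * v + u))) / h powr (2 * (1/2)) =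
      \<bar>h * (h * u + v) / (h * v + u)\<bar> / h"
    using eventually_gt_at_top[of 0] by eventually_elim (simp only: norm_of_real, simp)
  ultimately show "((\<lambda>h. norm (cr (h * (h * u + v) / (h * v + u))) / h powr (2 * (1/2))) \<longlongrightarrow> u / v) at_top"
    by (simp only: tendsto_cong)
qed (use assms in simp)

lemma eventually_not_diff_alg_of_no_diagonal_step:
  assumes ab: "a > 0" "b > 0" "a + b \<noteq> a * b" and d: "\<And>v. 0 \<le> d v" "d (1, -1) > 0" "d (-1, 1) > 0"
    and d11: "d (1, 1) = 0" and d01: "d (0, 1) > 0"
  shows "\<forall>\<^sub>F h in at_top. \<forall>t. kernel_curve d a b t h \<longrightarrow> \<not> diff_alg (kernel_curve.G d a b t h)"
proof -
  define u v where "u = d (1, 0) / sqrt (d (1, -1))" and "v = d (0, 1) / sqrt (d (-1, 1))"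
  have "(a - 1) * (b - 1) \<noteq> 1" using ab(3) by (simp add: algebra_simps)
  hence AB: "cr (a - 1) * cr (b - 1) \<noteq> 1" by (metis of_real_1 of_real_eq_iff of_real_mult)
  have "cr (a - 1) \<noteq> -1" "cr (b - 1) \<noteq> -1" using ab(1,2) by (auto simp: complex_eq_iff)
  hence separated: "\<forall>\<^sub>F h in at_top. q_dilation.separated ((cr h)^2) (cr (a - 1)) (cr (b - 1))"
    using AB by (rule eventually_separated)
  have "v > 0" using d01 d by (simp add: v_def)
  have near: "\<forall>\<^sub>F h in at_top. u = 0 \<or> q_dilation.near ((cr h)^2) (1/2) (cr (h * (h * u + v) / (h * v + u)))"
  proof (cases "u = 0")
    case False
    hence "u > 0" using d(1)[of "(1, 0)"] d(2) by (simp add: u_def order.strict_iff_order)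
    from eventually_near_half[OF this \<open>v > 0\<close>] show ?thesis by (auto elim: eventually_mono)
  qed simp
  show ?thesis using separated near
  proof eventually_elim
    case (elim h)
    show ?case
    proof (intro allI impI)
      fix t assume "kernel_curve d a b t h"
      then interpret kernel_curve d a b t h .
      define \<rho> where "\<rho> = \<tau> * (h * u0 + v0) / (\<Delta> * L)"
      note root = common_root[OF d11, folded \<rho>_def]
      have "u0 = t * u" "v0 = t * v" by (simp_all add: u0_def v0_def u_def v_def \<alpha>_def \<beta>_def)
      hence "\<rho>^2 = t * (h * (h * u + v)) / (t * (h * v + u))" unfolding root(4) by (simp add: algebra_simps)
      hence \<rho>: "\<rho>^2 = h * (h * u + v) / (h * v + u)" using t_pos by simp
      hence "\<rho>^2 = 1" if "u = 0" using that \<open>v > 0\<close> by simp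
      hence "u = 0 \<Longrightarrow> cr (- \<rho>) = -1" using root(3) by (auto simp: power2_eq_1_iff)
      moreover have "cr (- \<rho>)^2 = cr (h * (h * u + v) / (h * v + u))" unfolding \<rho>[symmetric] by simp
      ultimately have "qd.near (1/2) (cr (- \<rho>)^2) \<or> cr (- \<rho>) = -1" using elim(2) by auto
      thus "\<not> diff_alg G"
        using constant_term_nonzero[OF AB]
        by (intro qd.kernel_eq_common_root_not_diff_alg[OF refl elim(1) _ root(1,2) kernel_equation G_nonzero])
    qed
  qed
qed

theorem small_t_not_D_algebraic:
  fixes d :: "int \<times> int \<Rightarrow> real"
  assumes d: "\<And>v. 0 \<le> d v" and ab: "a > 0" "b > 0" and pos: "d (1, -1) > 0" "d (-1, 1) > 0"
    and cs: "d (1, 1) > 0 \<and> \<not> (a = 2 \<and> b = 2 \<and> d (1, 0) = 0 \<and> d (0, 1) = 0) \<or>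
      d (1, 1) = 0 \<and> d (0, 1) > 0 \<and> a + b \<noteq> a * b"
  shows "\<forall>\<^sub>F t in at_right 0. \<not> x_D_algebraic (Qgf S5 d a b t) \<and> \<not> y_D_algebraic (Qgf S5 d a b t)"
proof -
  have "\<forall>\<^sub>F h in at_top. \<forall>t. kernel_curve d a b t h \<longrightarrow> \<not> diff_alg (kernel_curve.G d a b t h)"
    using cs eventually_not_diff_alg_of_diagonal_step[OF d pos]
      eventually_not_diff_alg_of_no_diagonal_step[OF ab _ d pos] by blast
  moreover have "d (1, 0) > 0 \<or> d (0, 1) > 0 \<or> d (1, 1) > 0" using cs by auto
  ultimately have "\<forall>\<^sub>F t in at_right 0. \<exists>h. (\<forall>t. kernel_curve d a b t h \<longrightarrow> \<not> diff_alg (kernel_curve.G d a b t h)) \<and>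
      kernel_curve d a b t h"
    by (intro eventually_ex_kernel_curve d ab pos)
  thus ?thesis by eventually_elim (use kernel_curve.D_algebraic_imp_diff_alg in blast)
qed

section \<open>The exceptional cases\<close>

lemma (in q_dilation) proportional_solutions:
  assumes M: "M1 * U = M2 * V" "M1 * U0 = M2 * V0" and N: "N1 * U = N2 * dil V" "N1 * U0 = N2 * dil V0"
    and nz: "M1 \<noteq> 0" "M2 \<noteq> 0" "N1 \<noteq> 0" "N2 \<noteq> 0" "U0 \<noteq> 0" "V0 \<noteq> 0"
  shows "\<exists>c. U = fls_const c * U0 \<and> V = fls_const c * V0"
proof -
  have ratio: "U / U0 = W / W0" if "P1 * U = P2 * W" "P1 * U0 = P2 * W0" "P1 \<noteq> 0" "P2 \<noteq> 0" "W0 \<noteq> 0" for P1 P2 W W0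
  proof -
    have "U / U0 = (P1 * U) / (P1 * U0)" using that(3) by simp
    also have "... = W / W0" unfolding that(1,2) using that(4) by simp
    finally show ?thesis .
  qed
  have "dil V0 \<noteq> 0" using nz(6) by (simp add: \<sigma>_eq_0_iff)
  hence eq: "U / U0 = V / V0" "U / U0 = dil V / dil V0"
    using ratio[OF M] ratio[OF N] nz by simp_all
  hence "dil (V / V0) = V / V0" by (simp add: \<sigma>_divide)
  hence "V / V0 = fls_const (fls_nth (V / V0) 0)" by (rule dil_fixed)
  moreover have "U = V / V0 * U0" using eq(1)[symmetric] nz by simp
  moreover have "V = V / V0 * V0" using nz by simp
  ultimately show ?thesis by metis
qed

lemma closed_form:
  fixes f :: "complex \<Rightarrow> complex"
  assumes f: "f has_fps_expansion P" "fps_nth P 0 = 1" and G: "fps_nth G 0 = 0" "fps_nth G 1 \<noteq> 0"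
    and n: "n > 0" and eq: "fps_to_fls (fps_compose P G)^n * (1 - fls_const z * fps_to_fls G^n) = fls_const c"
  shows "\<forall>\<^sub>F x in nhds 0. f x^n * (1 - z * x^n) = 1"
proof -
  define R where "R = P^n * (1 - fps_const z * fps_X^n)"
  have "fps_to_fls (fps_compose R G) = fps_to_fls (fps_const c)"
    using eq G(1) by (simp add: R_def fps_compose_mult_distrib fps_compose_sub_distrib fps_compose_power[symmetric]
      fls_times_fps_to_fls fps_to_fls_power)
  hence R: "fps_compose R G = fps_const c" by simp
  have "c = fps_nth (fps_compose R G) 0" unfolding R by simp
  also have "... = 1" using f(2) n by (simp add: R_def fps_power_zeroth)
  finally have "fps_compose (R - 1) G = 0" by (simp add: fps_compose_sub_distrib R)
  hence "R - 1 = 0" using fps_compose_eq_0_iff[OF G(1)] G(2) by fastforce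
  moreover have "(\<lambda>x. f x^n * (1 - z * x^n) - 1) has_fps_expansion R - 1"
    unfolding R_def by (intro fps_expansion_intros f(1))
  ultimately show ?thesis by (simp add: has_fps_expansion_0_iff)
qed

locale real_embedding =
  fixes \<iota> :: "real \<Rightarrow> 'a :: comm_ring_1"
  assumes hom: "\<iota> 1 = 1" "\<iota> (r + s) = \<iota> r + \<iota> s" "\<iota> (r * s) = \<iota> r * \<iota> s"
begin

lemma hom_0: "\<iota> 0 = 0"
  using hom(2)[of 0 0] by simp

lemma hom_diff: "\<iota> (r - s) = \<iota> r - \<iota> s"
  using hom(2)[of "r - s" s] by simp

end

interpretation complex_embedding: real_embedding cr
  by unfold_locales simp_all

interpretation fls_embedding: real_embedding "\<lambda>r. fls_const (cr r)"
  by unfold_locales (simp_all add: fls_plus_const)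

context quadrant
begin

text \<open>If \<open>a + b = a b\<close> and \<open>d (1, 1) = 0\<close> this identity turns the functional equation into
\<open>Q x y = Q x 0 * Q 0 y\<close>.\<close>

lemma kernel_splits:
  assumes "real_embedding \<iota>" and ab: "a + b = a * b" and d11: "d (1, 1) = 0"
    and p: "p = a * (t * d (1, 0) + t * d (1, -1) * p')" and p': "p' = b * (t * d (0, 1) + t * d (-1, 1) * p)"
  shows "x_coeff \<iota> x y * (1 - \<iota> p' * y) + y_coeff \<iota> x y * (1 - \<iota> p * x) = kernel \<iota> x y"
proof -
  interpret real_embedding \<iota> by (rule assms(1))
  have inv: "1 - 1 / a = 1 / b" "1 - 1 / b = 1 / a" using ab ab_pos by (auto simp: field_simps)
  have "p / a = t * d (1, 0) + t * d (1, -1) * p'" by (subst p) (use ab_pos in simp)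
  moreover have "p' / b = t * d (0, 1) + t * d (-1, 1) * p" by (subst p') (use ab_pos in simp)
  moreover have "(1 - 1 / b) * p = p / a" "(1 - 1 / a) * p' = p' / b" unfolding inv by simp_all
  moreover have "(1 - 1 / a) + (1 - 1 / b) = 1" using inv(1) by simp
  ultimately have "(1 - 1 / a) + (1 - 1 / b) = 1" "(1 - 1 / b) * p = t * d (1, 0) + t * d (1, -1) * p'"
      "(1 - 1 / a) * p' = t * d (0, 1) + t * d (-1, 1) * p"
    by simp_all
  hence \<iota>: "\<iota> (1 - 1 / a) + \<iota> (1 - 1 / b) = 1" "\<iota> (1 - 1 / b) * \<iota> p = \<iota> (t * d (1, 0)) + \<iota> (t * d (1, -1)) * \<iota> p'"
      "\<iota> (1 - 1 / a) * \<iota> p' = \<iota> (t * d (0, 1)) + \<iota> (t * d (-1, 1)) * \<iota> p"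
    by (metis hom)+
  have "x_coeff \<iota> x y * (1 - \<iota> p' * y) + y_coeff \<iota> x y * (1 - \<iota> p * x) =
      (\<iota> (1 - 1 / a) + \<iota> (1 - 1 / b)) * (x * y) - \<iota> (t * d (1, -1)) * x^2 - \<iota> (t * d (-1, 1)) * y^2
      + (\<iota> (t * d (1, -1)) * \<iota> p' - \<iota> (1 - 1 / b) * \<iota> p) * (x^2 * y)
      + (\<iota> (t * d (-1, 1)) * \<iota> p - \<iota> (1 - 1 / a) * \<iota> p') * (x * y^2)"
    by (simp add: x_coeff_def y_coeff_def power2_eq_square algebra_simps)
  thus ?thesis unfolding \<iota>
    by (simp add: kernel_def d11 hom_0 power2_eq_square algebra_simps)
qed

lemma coeff_squares:
  assumes "real_embedding \<iota>" and ab: "a = 2" "b = 2" and d0: "d (1, 0) = 0" "d (0, 1) = 0"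
    and p: "D * p = 4 * d (1, 1) * d (1, -1) * t^2" and p': "D * p' = 4 * d (1, 1) * d (-1, 1) * t^2"
    and D: "D = 1 - 4 * d (1, -1) * d (-1, 1) * t^2" and curve: "kernel \<iota> x y = 0"
  shows "x_coeff \<iota> x y^2 * (1 - \<iota> p' * y^2) = y_coeff \<iota> x y^2 * (1 - \<iota> p * x^2)"
proof -
  interpret real_embedding \<iota> by (rule assms(1))
  define \<alpha> \<beta> \<delta> \<kappa> where "\<alpha> = \<iota> (t * d (1, -1))" and "\<beta> = \<iota> (t * d (-1, 1))" and "\<delta> = \<iota> (t * d (1, 1))"
    and "\<kappa> = \<iota> (1 / 2)"
  have \<kappa>: "\<kappa> + \<kappa> = 1" unfolding \<kappa>_def hom(2)[symmetric] by (simp add: hom)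
  have "D / 4 = 1 / 2 * (1 / 2) - t * d (1, -1) * (t * d (-1, 1))"
    by (simp add: D power2_eq_square)
  hence D4: "\<iota> (D / 4) = \<kappa> * \<kappa> - \<alpha> * \<beta>" unfolding \<kappa>_def \<alpha>_def \<beta>_def hom(3)[symmetric] hom_diff[symmetric] by (simp only:)
  have "D / 4 * p = t * d (1, -1) * (t * d (1, 1))" "D / 4 * p' = t * d (-1, 1) * (t * d (1, 1))"
    using p p' by (simp_all add: power2_eq_square)
  hence Dp: "\<iota> (D / 4) * \<iota> p = \<alpha> * \<delta>" "\<iota> (D / 4) * \<iota> p' = \<beta> * \<delta>" unfolding \<alpha>_def \<beta>_def \<delta>_def by (metis hom(3))+
  have on_curve: "x * y - \<alpha> * x^2 = \<beta> * y^2 + \<delta> * x^2 * y^2"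
    using curve by (simp add: kernel_def d0 hom_0 \<alpha>_def \<beta>_def \<delta>_def algebra_simps)
  have half: "1 - 1 / a = 1 / 2" "1 - 1 / b = 1 / 2" using ab by simp_all
  have square: "(\<kappa> * z - w)^2 = \<kappa> * \<kappa> * z^2 - w * (z - w)" for z w
  proof -
    have "(\<kappa> * z - w)^2 = \<kappa> * \<kappa> * z^2 - (\<kappa> + \<kappa>) * z * w + w * w" by (simp add: power2_eq_square algebra_simps)
    thus ?thesis unfolding \<kappa> by (simp add: algebra_simps)
  qed
  have "x_coeff \<iota> x y^2 = \<kappa> * \<kappa> * (x * y)^2 - \<alpha> * x^2 * (x * y - \<alpha> * x^2)"
    unfolding x_coeff_def half \<kappa>_def[symmetric] \<alpha>_def[symmetric] by (rule square)
  also have "... = (x * y)^2 * \<iota> (D / 4) - (x * y)^2 * x^2 * (\<iota> (D / 4) * \<iota> p)"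
    unfolding on_curve Dp unfolding D4 by (simp add: power2_eq_square algebra_simps)
  also have "... = (x * y)^2 * \<iota> (D / 4) * (1 - \<iota> p * x^2)" by (simp add: algebra_simps)
  finally have x2: "x_coeff \<iota> x y^2 = (x * y)^2 * \<iota> (D / 4) * (1 - \<iota> p * x^2)" .
  have "y_coeff \<iota> x y^2 = \<kappa> * \<kappa> * (x * y)^2 - \<beta> * y^2 * (x * y - \<beta> * y^2)"
    unfolding y_coeff_def half \<kappa>_def[symmetric] \<beta>_def[symmetric] by (rule square)
  also have "x * y - \<beta> * y^2 = \<alpha> * x^2 + \<delta> * x^2 * y^2" using on_curve by (simp add: algebra_simps)
  also have "\<kappa> * \<kappa> * (x * y)^2 - \<beta> * y^2 * (\<alpha> * x^2 + \<delta> * x^2 * y^2) =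
      (x * y)^2 * \<iota> (D / 4) - (x * y)^2 * y^2 * (\<iota> (D / 4) * \<iota> p')"
    unfolding Dp unfolding D4 by (simp add: power2_eq_square algebra_simps)
  also have "... = (x * y)^2 * \<iota> (D / 4) * (1 - \<iota> p' * y^2)" by (simp add: algebra_simps)
  finally show ?thesis unfolding x2 by (simp only: mult_ac)
qed

end

context kernel_curve
begin

lemma x_y_coeff_nonzero:
  "x_coeff \<iota> X Y \<noteq> 0" "y_coeff \<iota> X Y \<noteq> 0" "x_coeff \<iota> X (qd.dil Y) \<noteq> 0" "y_coeff \<iota> X (qd.dil Y) \<noteq> 0"
  using coeffs_on_curve[OF Y_eq DX_DY_nonzero(2) nA_nB_eq(1,3)]
    coeffs_on_curve[OF dil_Y DX_DY_nonzero(3) nA_nB_eq(2,4)]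
    X_Y_nonzero nA_nB_nonzero by auto

lemma boundary_series_unique:
  assumes ab: "1 / a + 1 / b = 1" and nz: "U0 \<noteq> 0" "V0 \<noteq> 0"
    and U0: "x_coeff \<iota> X Y^n * U0 = (- y_coeff \<iota> X Y)^n * V0"
      "x_coeff \<iota> X (qd.dil Y)^n * U0 = (- y_coeff \<iota> X (qd.dil Y))^n * qd.dil V0"
  shows "\<exists>c. U^n = fls_const c * U0 \<and> V^n = fls_const c * V0"
proof (rule qd.proportional_solutions[OF _ U0(1) _ U0(2)])
  have "\<iota> (1 / a + 1 / b - 1) = 0" by (simp only: ab diff_self of_real_0 fls_const_0)
  hence "x_coeff \<iota> X Y * U = - y_coeff \<iota> X Y * V" "x_coeff \<iota> X (qd.dil Y) * U = - y_coeff \<iota> X (qd.dil Y) * qd.dil V"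
    using functional_equation_X_Y by (simp_all only: mult_zero_left add_0_left mult_minus_left eq_neg_iff_add_eq_0)
  thus "x_coeff \<iota> X Y^n * U^n = (- y_coeff \<iota> X Y)^n * V^n"
    "x_coeff \<iota> X (qd.dil Y)^n * U^n = (- y_coeff \<iota> X (qd.dil Y))^n * qd.dil (V^n)"
    by (simp_all only: power_mult_distrib[symmetric] qd.\<sigma>_power)
qed (use nz x_y_coeff_nonzero in simp_all)

lemma boundary_closed_form:
  assumes ab: "1 / a + 1 / b = 1" and n: "n > 0"
    and eq: "x_coeff \<iota> X Y^n * (1 - \<iota> p' * Y^n) = (- y_coeff \<iota> X Y)^n * (1 - \<iota> p * X^n)"
      "x_coeff \<iota> X (qd.dil Y)^n * (1 - \<iota> p' * qd.dil Y^n) = (- y_coeff \<iota> X (qd.dil Y))^n * (1 - \<iota> p * X^n)"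
  shows "\<forall>\<^sub>F x in nhds 0. Q x 0^n * (1 - cr p * x^n) = 1"
    and "\<forall>\<^sub>F y in nhds 0. Q 0 y^n * (1 - cr p' * y^n) = 1"
proof -
  define P P' where "P = 1 - \<iota> p * X^n" and "P' = 1 - \<iota> p' * Y^n"
  have "fls_nth (1 - \<iota> r * fps_to_fls T^n) 0 = 1" if "fps_nth T 0 = 0" for r and T :: "complex fps"
    using that n by (simp add: fps_to_fls_power[symmetric] fps_power_zeroth)
  hence "fls_nth P 0 = 1" "fls_nth P' 0 = 1" using \<Xi>_\<Upsilon>_nth by (simp_all only: P_def P'_def)
  hence nz: "P \<noteq> 0" "P' \<noteq> 0" by auto
  have dil_P': "qd.dil P' = 1 - \<iota> p' * qd.dil Y^n"
    by (simp add: P'_def qd.\<sigma>_diff qd.\<sigma>_mult qd.\<sigma>_power)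
  have "qd.dil P' \<noteq> 0" using nz by (simp add: qd.\<sigma>_eq_0_iff)
  hence "x_coeff \<iota> X Y^n * (1 / P) = (- y_coeff \<iota> X Y)^n * (1 / P')"
      "x_coeff \<iota> X (qd.dil Y)^n * (1 / P) = (- y_coeff \<iota> X (qd.dil Y))^n * qd.dil (1 / P')"
    using eq nz by (simp_all add: P_def[symmetric] P'_def[symmetric] dil_P'[symmetric] qd.\<sigma>_divide frac_eq_eq)
  then obtain c where "U^n = fls_const c * (1 / P)" "V^n = fls_const c * (1 / P')"
    using boundary_series_unique[OF ab _ _, of "1 / P" "1 / P'" n] nz by auto
  hence "U^n * P = fls_const c" "V^n * P' = fls_const c" using nz by simp_all
  thus "\<forall>\<^sub>F x in nhds 0. Q x 0^n * (1 - cr p * x^n) = 1" "\<forall>\<^sub>F y in nhds 0. Q 0 y^n * (1 - cr p' * y^n) = 1"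
    unfolding P_def P'_def using U_V_nth
      closed_form[OF \<Phi>_expansion _ \<Xi>_\<Upsilon>_nth(1,2) n, of p c] closed_form[OF \<Psi>_expansion _ \<Xi>_\<Upsilon>_nth(3,4) n, of p' c]
    by simp_all
qed

lemma rational_closed_form:
  assumes ab: "a + b = a * b" and d11: "d (1, 1) = 0"
    and p: "p = a * (t * d (1, 0) + t * d (1, -1) * p')" "p' = b * (t * d (0, 1) + t * d (-1, 1) * p)"
  shows "\<forall>\<^sub>F x in nhds 0. Q x 0 * (1 - cr p * x) = 1" "\<forall>\<^sub>F y in nhds 0. Q 0 y * (1 - cr p' * y) = 1"
proof -
  have inv: "1 / a + 1 / b = 1" using ab ab_pos by (simp add: field_simps)
  have "x_coeff \<iota> X y * (1 - \<iota> p' * y) = - y_coeff \<iota> X y * (1 - \<iota> p * X)" if "kernel \<iota> X y = 0" for y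
    using kernel_splits[OF fls_embedding.real_embedding_axioms ab d11 p, of X y] that
    by (simp add: eq_neg_iff_add_eq_0)
  from boundary_closed_form[OF inv, of 1 p' p] this[OF kernel_X_Y(1)] this[OF kernel_X_Y(2)]
  show "\<forall>\<^sub>F x in nhds 0. Q x 0 * (1 - cr p * x) = 1" "\<forall>\<^sub>F y in nhds 0. Q 0 y * (1 - cr p' * y) = 1"
    by simp_all
qed

lemma algebraic_closed_form:
  assumes ab: "a = 2" "b = 2" and d0: "d (1, 0) = 0" "d (0, 1) = 0"
    and p: "D * p = 4 * d (1, 1) * d (1, -1) * t^2" "D * p' = 4 * d (1, 1) * d (-1, 1) * t^2"
    and D: "D = 1 - 4 * d (1, -1) * d (-1, 1) * t^2"
  shows "\<forall>\<^sub>F x in nhds 0. Q x 0^2 * (1 - cr p * x^2) = 1" "\<forall>\<^sub>F y in nhds 0. Q 0 y^2 * (1 - cr p' * y^2) = 1"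
proof -
  note squares = coeff_squares[OF fls_embedding.real_embedding_axioms ab d0 p D]
  show "\<forall>\<^sub>F x in nhds 0. Q x 0^2 * (1 - cr p * x^2) = 1" "\<forall>\<^sub>F y in nhds 0. Q 0 y^2 * (1 - cr p' * y^2) = 1"
    using boundary_closed_form[of 2 p' p] squares[OF kernel_X_Y(1)] squares[OF kernel_X_Y(2)]
    by (simp_all add: ab)
qed

end

section \<open>Polynomial functions\<close>

lemma deg_in_le_iff: "deg_in i p \<le> n \<longleftrightarrow> (\<forall>m\<in>keys p. lookup m i \<le> n)"
  unfolding deg_in_def by (subst Max_le_iff) auto

definition poly_fun :: "nat set \<Rightarrow> nat \<Rightarrow> ((nat \<Rightarrow> complex) \<Rightarrow> complex) \<Rightarrow> bool" where
  "poly_fun V n f \<longleftrightarrow> (\<exists>P. vars_in V P \<and> deg_in 2 P \<le> n \<and> (\<forall>v. mpeval P v = f v))"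

lemma poly_fun_const: "poly_fun V n (\<lambda>v. c)"
  unfolding poly_fun_def
  by (rule exI[of _ "single 0 c"]) (auto simp: vars_in_def deg_in_le_iff split: if_splits)

lemma poly_fun_var: "i \<in> V \<Longrightarrow> (if i = 2 then 1 else 0) \<le> n \<Longrightarrow> poly_fun V n (\<lambda>v. v i)"
  unfolding poly_fun_def
  by (rule exI[of _ "single (single i 1) 1"])
    (auto simp: vars_in_def deg_in_le_iff lookup_single when_def split: if_splits)

lemma poly_fun_add:
  assumes "poly_fun V n f" "poly_fun V n g"
  shows "poly_fun V n (\<lambda>v. f v + g v)"
proof -
  from assms obtain P R where P: "vars_in V P" "deg_in 2 P \<le> n" "\<And>v. mpeval P v = f v"
    and R: "vars_in V R" "deg_in 2 R \<le> n" "\<And>v. mpeval R v = g v" unfolding poly_fun_def by blast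
  have "vars_in V (P + R)" "deg_in 2 (P + R) \<le> n"
    using P(1,2) R(1,2) Poly_Mapping.keys_add[of P R] unfolding vars_in_def deg_in_le_iff by blast+
  thus ?thesis unfolding poly_fun_def using P(3) R(3) by (auto simp: mpeval_add)
qed

lemma poly_fun_mult:
  assumes "poly_fun V n f" "poly_fun V m g" and k: "n + m \<le> k"
  shows "poly_fun V k (\<lambda>v. f v * g v)"
proof -
  from assms(1,2) obtain P R where P: "vars_in V P" "deg_in 2 P \<le> n" "\<And>v. mpeval P v = f v"
    and R: "vars_in V R" "deg_in 2 R \<le> m" "\<And>v. mpeval R v = g v" unfolding poly_fun_def by blast
  have factors: "\<exists>a\<in>keys P. \<exists>b\<in>keys R. u = a + b" if "u \<in> keys (P * R)" for u
    using that Poly_Mapping.keys_mult[of P R] by blast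
  have "vars_in V (P * R)" unfolding vars_in_def
  proof
    fix u assume "u \<in> keys (P * R)"
    then obtain a b where ab: "a \<in> keys P" "b \<in> keys R" "u = a + b" using factors by blast
    thus "keys u \<subseteq> V" using P(1) R(1) Poly_Mapping.keys_add[of a b] unfolding vars_in_def by blast
  qed
  moreover have "deg_in 2 (P * R) \<le> k" unfolding deg_in_le_iff
  proof
    fix u assume "u \<in> keys (P * R)"
    then obtain a b where ab: "a \<in> keys P" "b \<in> keys R" "u = a + b" using factors by blast
    hence "lookup a 2 \<le> n" "lookup b 2 \<le> m" using P(2) R(2) unfolding deg_in_le_iff by blast+
    thus "lookup u 2 \<le> k" using k by (simp add: ab(3) lookup_add)
  qed
  ultimately show ?thesis unfolding poly_fun_def using P(3) R(3) by (auto simp: mpeval_mult)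
qed

lemma poly_fun_mult0: "poly_fun V 0 f \<Longrightarrow> poly_fun V n g \<Longrightarrow> poly_fun V n (\<lambda>v. f v * g v)"
  by (rule poly_fun_mult) auto

lemma poly_fun_diff: "poly_fun V n f \<Longrightarrow> poly_fun V n g \<Longrightarrow> poly_fun V n (\<lambda>v. f v - g v)"
  using poly_fun_add[of V n f "\<lambda>v. - 1 * g v"] poly_fun_mult0[OF poly_fun_const[of V 0 "- 1"], of n g] by simp

lemma poly_fun_power0: "poly_fun V 0 f \<Longrightarrow> poly_fun V 0 (\<lambda>v. f v^k)"
  by (induction k) (auto intro: poly_fun_const poly_fun_mult0)

lemmas poly_fun_intros = poly_fun_const poly_fun_add poly_fun_diff poly_fun_mult0 poly_fun_power0

lemma poly_eq_0_of_near_0: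
  fixes p :: "complex poly"
  assumes "r > 0" "\<And>x. norm x < r \<Longrightarrow> poly p x = 0"
  shows "p = 0"
proof (rule ccontr)
  assume "p \<noteq> 0"
  hence "finite {x. poly p x = 0}" by (rule poly_roots_finite)
  moreover have "ball 0 r \<subseteq> {x. poly p x = 0}" using assms(2) by auto
  ultimately show False
    using uncountable_ball[OF assms(1), of "0::complex"] countable_finite finite_subset by blast
qed

lemma power_sum_coeff_eq_0:
  fixes c :: "'b \<Rightarrow> complex"
  assumes "finite S" "\<And>x. (\<Sum>m\<in>S. c m * x^e m) = 0"
  shows "(\<Sum>m\<in>{m\<in>S. e m = k}. c m) = 0"
proof -
  define R where "R = (\<Sum>m\<in>S. monom (c m) (e m))"
  have "poly R x = 0" for x using assms(2) by (simp add: R_def poly_sum poly_monom)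
  hence "coeff R k = 0" using poly_all_0_iff_0[of R] by simp
  thus ?thesis by (simp add: R_def coeff_sum sum.inter_filter assms(1))
qed

definition separately_poly :: "(complex \<Rightarrow> complex \<Rightarrow> complex) \<Rightarrow> bool" where
  "separately_poly f \<longleftrightarrow> (\<forall>y. \<exists>p. \<forall>x. f x y = poly p x) \<and> (\<forall>x. \<exists>p. \<forall>y. f x y = poly p y)"

lemma separately_poly_const: "separately_poly (\<lambda>x y. c)"
  unfolding separately_poly_def by (auto intro: exI[of _ "[:c:]"])

lemma separately_poly_fst: "separately_poly (\<lambda>x y. x)"
proof -
  have "\<exists>p. \<forall>x :: complex. x = poly p x" by (rule exI[of _ "[:0, 1:]"]) simp
  moreover have "\<exists>p. \<forall>y :: complex. x = poly p y" for x by (rule exI[of _ "[:x:]"]) simp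
  ultimately show ?thesis unfolding separately_poly_def by blast
qed

lemma separately_poly_swap: "separately_poly (\<lambda>x y. f y x) \<longleftrightarrow> separately_poly f"
  unfolding separately_poly_def by blast

lemma separately_poly_snd: "separately_poly (\<lambda>x y. y)"
  using separately_poly_fst separately_poly_swap[of "\<lambda>x y. x"] by simp

lemma separately_poly_add:
  assumes "separately_poly f" "separately_poly g"
  shows "separately_poly (\<lambda>x y. f x y + g x y)"
  using assms unfolding separately_poly_def by (metis poly_add)

lemma separately_poly_mult:
  assumes "separately_poly f" "separately_poly g"
  shows "separately_poly (\<lambda>x y. f x y * g x y)"
  using assms unfolding separately_poly_def by (metis poly_mult)

lemma separately_poly_diff:
  assumes "separately_poly f" "separately_poly g"
  shows "separately_poly (\<lambda>x y. f x y - g x y)"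
  using assms unfolding separately_poly_def by (metis poly_diff)

lemma separately_poly_power: "separately_poly f \<Longrightarrow> separately_poly (\<lambda>x y. f x y^n)"
  by (induction n) (auto intro: separately_poly_const separately_poly_mult)

lemma separately_poly_sum: "(\<And>i. i \<in> I \<Longrightarrow> separately_poly (f i)) \<Longrightarrow> separately_poly (\<lambda>x y. \<Sum>i\<in>I. f i x y)"
  by (induction I rule: infinite_finite_induct) (auto intro: separately_poly_const separately_poly_add)

lemmas separately_poly_intros = separately_poly_const separately_poly_fst separately_poly_snd
  separately_poly_add separately_poly_mult separately_poly_diff separately_poly_power separately_poly_sum

lemma separately_poly_mult_eq_0:
  assumes f: "separately_poly f" "f x0 y0 \<noteq> 0" and g: "separately_poly g" and r: "r > 0"
    and zero: "\<And>x y. norm x < r \<Longrightarrow> norm y < r \<Longrightarrow> f x y * g x y = 0"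
  shows "g x y = 0"
proof -
  have dichotomy: "f x0 y = 0 \<or> g x y = 0" if y: "norm y < r" for x y
  proof -
    obtain p q where pq: "\<And>x. f x y = poly p x" "\<And>x. g x y = poly q x"
      using f(1) g unfolding separately_poly_def by metis
    have "p * q = 0" by (rule poly_eq_0_of_near_0[OF r]) (use zero[OF _ y] pq in simp)
    thus ?thesis using pq by auto
  qed
  obtain p q where pq: "\<And>y. f x0 y = poly p y" "\<And>y. g x y = poly q y"
    using f(1) g unfolding separately_poly_def by metis
  have "p * q = 0" by (rule poly_eq_0_of_near_0[OF r]) (use dichotomy[of _ x] pq in simp)
  moreover have "p \<noteq> 0" using f(2) pq(1) by auto
  ultimately show ?thesis using pq(2) by simp
qed

text \<open>\<open>e\<^sub>0\<^sup>2 D = e\<^sub>1\<^sup>2\<close> is impossible for polynomials, since the roots of \<open>D\<close> are simple.\<close>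

lemma sqrt_not_rational:
  fixes e0 e1 :: "complex poly"
  assumes p: "p \<noteq> 0" and eq: "[:1, 0, -p:] * e0^2 = e1^2"
  shows "e0 = 0" "e1 = 0"
proof -
  define w where "w = csqrt (1 / p)"
  have w: "w * w = 1 / p" by (simp add: w_def power2_eq_square[symmetric])
  hence D: "[:1, 0, -p:] = smult (-p) ([:-w, 1:] * [:-(-w), 1:])" using p by simp
  have "w \<noteq> - w" using w p by auto
  hence "order w [:-(-w), 1:] = 0" by (intro order_0I) (simp add: eq_neg_iff_add_eq_0)
  moreover have "order w [:-w, 1:] = 1" using order_power_n_n[of w 1] by simp
  ultimately have simple: "order w [:1, 0, -p:] = 1"
    unfolding D using p by (simp add: order_smult order_mult del: mult_pCons_left mult_pCons_right)
  show "e0 = 0"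
  proof (rule ccontr)
    assume "e0 \<noteq> 0"
    moreover have "[:1, 0, -p:] \<noteq> 0" by simp
    ultimately have "[:1, 0, -p:] * e0^2 \<noteq> 0" by (metis mult_eq_0_iff zero_eq_power2)
    hence nz: "[:1, 0, -p:] * e0^2 \<noteq> 0" "e1 \<noteq> 0" using eq by auto
    have "1 + 2 * order w e0 = order w ([:1, 0, -p:] * e0^2)"
      using nz \<open>e0 \<noteq> 0\<close> by (simp add: order_mult simple power2_eq_square del: mult_pCons_left)
    also have "... = 2 * order w e1" unfolding eq using nz by (simp add: order_mult power2_eq_square)
    finally show False by presburger
  qed
  thus "e1 = 0" using eq by simp
qed

lemma one_sqrt_independent:
  fixes e0 e1 :: "complex poly"
  assumes p: "p \<noteq> 0" and r: "r > 0" and \<phi>: "\<And>x. norm x < r \<Longrightarrow> \<phi> x^2 * (1 - p * x^2) = 1"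
    and rel: "\<And>x. norm x < r \<Longrightarrow> poly e0 x + poly e1 x * \<phi> x = 0"
  shows "e0 = 0" "e1 = 0"
proof -
  have "[:1, 0, -p:] * e0^2 - e1^2 = 0"
  proof (rule poly_eq_0_of_near_0[OF r])
    fix x :: complex assume x: "norm x < r"
    have "poly e0 x = - (poly e1 x * \<phi> x)" using rel[OF x] by (simp add: eq_neg_iff_add_eq_0)
    hence "(1 - p * x^2) * poly e0 x^2 = poly e1 x^2 * (\<phi> x^2 * (1 - p * x^2))"
      by (simp add: power_mult_distrib mult_ac)
    moreover have "poly [:1, 0, -p:] x = 1 - p * x^2" by (simp add: power2_eq_square algebra_simps)
    ultimately show "poly ([:1, 0, -p:] * e0^2 - e1^2) x = 0"
      using \<phi>[OF x] by (simp only: poly_diff poly_mult poly_power) simp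
  qed
  thus "e0 = 0" "e1 = 0" using sqrt_not_rational[OF p, of e0 e1] by simp_all
qed

lemma one_sqrts_independent:
  assumes p: "p \<noteq> 0" "p' \<noteq> 0" and r: "r > 0"
    and \<phi>: "\<And>x. norm x < r \<Longrightarrow> \<phi> x^2 * (1 - p * x^2) = 1" and \<psi>: "\<And>y. norm y < r \<Longrightarrow> \<psi> y^2 * (1 - p' * y^2) = 1"
    and e: "separately_poly e0" "separately_poly e1" "separately_poly e2" "separately_poly e3"
    and rel: "\<And>x y. norm x < r \<Longrightarrow> norm y < r \<Longrightarrow> e0 x y + e1 x y * \<phi> x + e2 x y * \<psi> y + e3 x y * (\<phi> x * \<psi> y) = 0"
    and xy: "norm x < r" "norm y < r"
  shows "e0 x y = 0" "e1 x y = 0" "e2 x y = 0" "e3 x y = 0"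
proof -
  have split: "e0 x y + e2 x y * \<psi> y = 0 \<and> e1 x y + e3 x y * \<psi> y = 0" if xy: "norm x < r" "norm y < r" for x y
  proof -
    obtain p0 p1 p2 p3 where P: "\<And>x. e0 x y = poly p0 x" "\<And>x. e1 x y = poly p1 x"
      "\<And>x. e2 x y = poly p2 x" "\<And>x. e3 x y = poly p3 x"
      using e unfolding separately_poly_def by metis
    have "p0 + smult (\<psi> y) p2 = 0" "p1 + smult (\<psi> y) p3 = 0"
      by (rule one_sqrt_independent[OF p(1) r \<phi>, of "p0 + smult (\<psi> y) p2" "p1 + smult (\<psi> y) p3"];
          use rel[OF _ xy(2)] in \<open>simp add: P algebra_simps\<close>)+
    hence "poly (p0 + smult (\<psi> y) p2) x = 0" "poly (p1 + smult (\<psi> y) p3) x = 0" by simp_all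
    thus ?thesis by (simp add: P mult.commute)
  qed
  obtain p0 p1 p2 p3 where P: "\<And>y. e0 x y = poly p0 y" "\<And>y. e1 x y = poly p1 y"
      "\<And>y. e2 x y = poly p2 y" "\<And>y. e3 x y = poly p3 y"
    using e unfolding separately_poly_def by metis
  have "p0 = 0 \<and> p2 = 0" "p1 = 0 \<and> p3 = 0"
    using one_sqrt_independent[OF p(2) r \<psi>, of p0 p2] one_sqrt_independent[OF p(2) r \<psi>, of p1 p3] split[OF xy(1)]
    by (auto simp: P)
  thus "e0 x y = 0" "e1 x y = 0" "e2 x y = 0" "e3 x y = 0" by (simp_all add: P)
qed

section \<open>The algebraic degree\<close>

lemma moneval_3:
  assumes "keys m \<subseteq> {0, 1, 2}"
  shows "moneval m (\<lambda>i. if i = 0 then x else if i = 1 then y else z) =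
    x^lookup m 0 * y^lookup m 1 * z^lookup m 2"
  by (subst moneval_superset[OF _ assms]) (auto simp: mult.assoc)

definition z_coeff :: "complex mpoly \<Rightarrow> nat \<Rightarrow> complex \<Rightarrow> complex \<Rightarrow> complex" where
  "z_coeff P k x y = (\<Sum>m\<in>{m\<in>keys P. lookup m 2 = k}. lookup P m * x^lookup m 0 * y^lookup m 1)"

lemma mpeval_cubic:
  assumes P: "\<And>m. m \<in> keys P \<Longrightarrow> keys m \<subseteq> {0, 1, 2}" and deg: "\<And>m. m \<in> keys P \<Longrightarrow> lookup m 2 \<le> 3"
  shows "mpeval P (\<lambda>i. if i = 0 then x else if i = 1 then y else z) =
    z_coeff P 0 x y + z_coeff P 1 x y * z + z_coeff P 2 x y * z^2 + z_coeff P 3 x y * z^3"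
proof -
  have "mpeval P (\<lambda>i. if i = 0 then x else if i = 1 then y else z) =
      (\<Sum>m\<in>keys P. lookup P m * x^lookup m 0 * y^lookup m 1 * z^lookup m 2)"
    unfolding mpeval_def by (intro sum.cong refl) (simp add: moneval_3[OF P] mult.assoc)
  also have "... = (\<Sum>k\<le>3. \<Sum>m\<in>{m\<in>keys P. lookup m 2 = k}. lookup P m * x^lookup m 0 * y^lookup m 1 * z^lookup m 2)"
    by (rule sum.group[symmetric]) (use deg in auto)
  also have "... = (\<Sum>k\<le>3. z_coeff P k x y * z^k)"
    unfolding z_coeff_def sum_distrib_right by (intro sum.cong refl) auto
  finally show ?thesis by (simp add: numeral_3_eq_3 numeral_2_eq_2 One_nat_def)
qed

lemma z_coeff_eq_0_imp_lookup_eq_0: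
  assumes P: "\<And>m. m \<in> keys P \<Longrightarrow> keys m \<subseteq> {0, 1, 2}" and n: "n \<in> keys P"
    and zero: "\<And>x y. z_coeff P (lookup n 2) x y = 0"
  shows "lookup P n = 0"
proof -
  define S where "S = {m\<in>keys P. lookup m 2 = lookup n 2}"
  have S: "(\<Sum>m\<in>S. lookup P m * y^lookup m 1 * x^lookup m 0) = 0" for x y
    using zero[of x y] by (simp add: z_coeff_def S_def mult_ac)
  have S0: "(\<Sum>m\<in>{m\<in>S. lookup m 0 = lookup n 0}. lookup P m * y^lookup m 1) = 0" for y
    by (rule power_sum_coeff_eq_0[OF _ S]) (simp add: S_def)
  have "(\<Sum>m\<in>{m\<in>{m\<in>S. lookup m 0 = lookup n 0}. lookup m 1 = lookup n 1}. lookup P m) = 0"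
    by (rule power_sum_coeff_eq_0[OF _ S0]) (simp add: S_def)
  moreover have "{m\<in>{m\<in>S. lookup m 0 = lookup n 0}. lookup m 1 = lookup n 1} = {n}"
  proof -
    have "m = n" if m: "m \<in> keys P" and eq: "lookup m 0 = lookup n 0" "lookup m 1 = lookup n 1" "lookup m 2 = lookup n 2" for m
    proof (rule poly_mapping_eqI)
      fix i
      show "lookup m i = lookup n i"
      proof (cases "i \<in> {0, 1, 2}")
        case False
        hence "i \<notin> keys m" "i \<notin> keys n" using P m n by blast+
        thus ?thesis by (simp add: in_keys_iff)
      qed (use eq in auto)
    qed
    thus ?thesis using n by (auto simp: S_def)
  qed
  ultimately show ?thesis by simp
qed

lemma cubic_expansion:
  fixes A B K D1 D2 \<phi> \<psi> z p0 p1 p2 p3 :: complex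
  assumes "D1 * \<phi>^2 = 1" "D2 * \<psi>^2 = 1" "K * z = A * \<phi> + B * \<psi>"
  shows "D1 * D2 * K^3 * (p0 + p1 * z + p2 * z^2 + p3 * z^3) =
      (p0 * K^3 * D1 * D2 + p2 * K * (A^2 * D2 + B^2 * D1)) +
      A * (p1 * K^2 * D1 * D2 + p3 * (A^2 * D2 + 3 * B^2 * D1)) * \<phi> +
      B * (p1 * K^2 * D1 * D2 + p3 * (3 * A^2 * D2 + B^2 * D1)) * \<psi> +
      2 * K * A * B * D1 * D2 * p2 * (\<phi> * \<psi>)"
proof -
  have "D1 * D2 * K^3 * (p0 + p1 * z + p2 * z^2 + p3 * z^3) =
      D1 * D2 * (p0 * K^3 + p1 * K^2 * (K * z) + p2 * K * (K * z)^2 + p3 * (K * z)^3)"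
    by (simp add: power2_eq_square power3_eq_cube algebra_simps)
  also have "... = p0 * K^3 * D1 * D2 + p1 * K^2 * D1 * D2 * (A * \<phi> + B * \<psi>) +
      p2 * K * (A^2 * D2 * (D1 * \<phi>^2) + B^2 * D1 * (D2 * \<psi>^2) + 2 * A * B * D1 * D2 * (\<phi> * \<psi>)) +
      p3 * (A^3 * D2 * (D1 * \<phi>^2) * \<phi> + 3 * A^2 * B * D2 * (D1 * \<phi>^2) * \<psi> +
        3 * A * B^2 * D1 * (D2 * \<psi>^2) * \<phi> + B^3 * D1 * (D2 * \<psi>^2) * \<psi>)"
    unfolding assms(3) by (simp add: power2_eq_square power3_eq_cube algebra_simps)
  finally show ?thesis unfolding assms(1,2)
    by (simp add: power2_eq_square power3_eq_cube algebra_simps)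
qed

locale biquadratic =
  fixes \<alpha> \<beta> \<delta> p p' :: complex and F :: "complex \<Rightarrow> complex \<Rightarrow> complex" and \<phi> \<psi> :: "complex \<Rightarrow> complex" and r :: real
  assumes nz: "\<alpha> \<noteq> 0" "\<beta> \<noteq> 0" "p \<noteq> 0" "p' \<noteq> 0" and r: "r > 0"
    and \<phi>: "\<And>x. norm x < r \<Longrightarrow> \<phi> x^2 * (1 - p * x^2) = 1" and \<psi>: "\<And>y. norm y < r \<Longrightarrow> \<psi> y^2 * (1 - p' * y^2) = 1"
    and F_eq: "\<And>x y. norm x < r \<Longrightarrow> norm y < r \<Longrightarrow>
      (x * y - (\<alpha> * x^2 + \<beta> * y^2 + \<delta> * x^2 * y^2)) * F x y = (x * y / 2 - \<alpha> * x^2) * \<phi> x + (x * y / 2 - \<beta> * y^2) * \<psi> y"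
begin

definition K where "K x y = x * y - (\<alpha> * x^2 + \<beta> * y^2 + \<delta> * x^2 * y^2)"
definition A where "A x y = x * y / 2 - \<alpha> * x^2"
definition B where "B x y = x * y / 2 - \<beta> * y^2"
definition D1 where "D1 x = 1 - p * x^2"
definition D2 where "D2 y = 1 - p' * y^2"

lemma K_F: "norm x < r \<Longrightarrow> norm y < r \<Longrightarrow> K x y * F x y = A x y * \<phi> x + B x y * \<psi> y"
  using F_eq by (simp add: K_def A_def B_def)

lemma D_squares: "norm x < r \<Longrightarrow> D1 x * \<phi> x^2 = 1" "norm y < r \<Longrightarrow> D2 y * \<psi> y^2 = 1"
  using \<phi> \<psi> by (simp_all add: D1_def D2_def mult.commute)

lemma separately_poly_K_A_B_D:
  "separately_poly K" "separately_poly A" "separately_poly B"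
  "separately_poly (\<lambda>x y. D1 x)" "separately_poly (\<lambda>x y. D2 y)"
  unfolding K_def[abs_def] A_def[abs_def] B_def[abs_def] D1_def D2_def divide_inverse
  by (intro separately_poly_intros)+

lemma obtain_generic_point:
  obtains x y where "K x y * (A x y * (B x y * (D1 x * D2 y))) \<noteq> 0"
proof (rule ccontr)
  assume "\<not> thesis"
  hence "K x y * (A x y * (B x y * (D1 x * D2 y))) = 0" for x y using that by blast
  note zero = this
  have points: "K 1 0 \<noteq> 0" "A 1 0 \<noteq> 0" "B 0 1 \<noteq> 0" "D1 0 * D2 0 \<noteq> 0"
    using nz by (simp_all add: K_def A_def B_def D1_def D2_def)
  note cancel = separately_poly_mult_eq_0[OF _ _ _ zero_less_one]
  have "A x y * (B x y * (D1 x * D2 y)) = 0" for x y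
    by (rule cancel[OF separately_poly_K_A_B_D(1) points(1) _ zero])
       (intro separately_poly_intros separately_poly_K_A_B_D)
  hence "B x y * (D1 x * D2 y) = 0" for x y
    by (rule cancel[OF separately_poly_K_A_B_D(2) points(2), rotated])
       (intro separately_poly_intros separately_poly_K_A_B_D)
  hence "D1 x * D2 y = 0" for x y
    by (rule cancel[OF separately_poly_K_A_B_D(3) points(3), rotated])
       (intro separately_poly_intros separately_poly_K_A_B_D)
  thus False using points(4) by blast
qed

lemma cubic_relation_coeffs:
  assumes poly: "separately_poly p0" "separately_poly p1" "separately_poly p2" "separately_poly p3" and s: "s > 0"
    and rel: "\<And>x y. norm x < s \<Longrightarrow> norm y < s \<Longrightarrow> p0 x y + p1 x y * F x y + p2 x y * F x y^2 + p3 x y * F x y^3 = 0"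
    and xy: "norm x < min r s" "norm y < min r s"
  shows "p0 x y * K x y^3 * D1 x * D2 y + p2 x y * K x y * (A x y^2 * D2 y + B x y^2 * D1 x) = 0"
    and "A x y * (p1 x y * K x y^2 * D1 x * D2 y + p3 x y * (A x y^2 * D2 y + 3 * B x y^2 * D1 x)) = 0"
    and "B x y * (p1 x y * K x y^2 * D1 x * D2 y + p3 x y * (3 * A x y^2 * D2 y + B x y^2 * D1 x)) = 0"
    and "2 * K x y * A x y * B x y * D1 x * D2 y * p2 x y = 0"
proof -
  define e0 e1 e2 e3 where
    "e0 x y = p0 x y * K x y^3 * D1 x * D2 y + p2 x y * K x y * (A x y^2 * D2 y + B x y^2 * D1 x)" and
    "e1 x y = A x y * (p1 x y * K x y^2 * D1 x * D2 y + p3 x y * (A x y^2 * D2 y + 3 * B x y^2 * D1 x))" and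
    "e2 x y = B x y * (p1 x y * K x y^2 * D1 x * D2 y + p3 x y * (3 * A x y^2 * D2 y + B x y^2 * D1 x))" and
    "e3 x y = 2 * K x y * A x y * B x y * D1 x * D2 y * p2 x y" for x y
  have sep: "separately_poly e0" "separately_poly e1" "separately_poly e2" "separately_poly e3"
    unfolding e0_def[abs_def] e1_def[abs_def] e2_def[abs_def] e3_def[abs_def]
    by (intro separately_poly_intros poly separately_poly_K_A_B_D)+
  have "e0 x y + e1 x y * \<phi> x + e2 x y * \<psi> y + e3 x y * (\<phi> x * \<psi> y) = 0"
    if "norm x < min r s" "norm y < min r s" for x y
    using cubic_expansion[OF D_squares K_F, of x y "p0 x y" "p1 x y" "p2 x y" "p3 x y"] rel[of x y] that
    by (simp add: e0_def e1_def e2_def e3_def)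
  hence "e0 x y = 0" "e1 x y = 0" "e2 x y = 0" "e3 x y = 0"
    using one_sqrts_independent[OF nz(3,4) _ \<phi> \<psi> sep _ xy] r s by auto
  thus "p0 x y * K x y^3 * D1 x * D2 y + p2 x y * K x y * (A x y^2 * D2 y + B x y^2 * D1 x) = 0"
    "A x y * (p1 x y * K x y^2 * D1 x * D2 y + p3 x y * (A x y^2 * D2 y + 3 * B x y^2 * D1 x)) = 0"
    "B x y * (p1 x y * K x y^2 * D1 x * D2 y + p3 x y * (3 * A x y^2 * D2 y + B x y^2 * D1 x)) = 0"
    "2 * K x y * A x y * B x y * D1 x * D2 y * p2 x y = 0"
    by (simp_all only: e0_def e1_def e2_def e3_def)
qed

lemma cubic_relation_trivial:
  assumes poly: "separately_poly p0" "separately_poly p1" "separately_poly p2" "separately_poly p3" and s: "s > 0"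
    and rel: "\<And>x y. norm x < s \<Longrightarrow> norm y < s \<Longrightarrow> p0 x y + p1 x y * F x y + p2 x y * F x y^2 + p3 x y * F x y^3 = 0"
  shows "p0 x y = 0 \<and> p1 x y = 0 \<and> p2 x y = 0 \<and> p3 x y = 0"
proof -
  define s' where "s' = min r s"
  have s': "s' > 0" using r s by (simp add: s'_def)
  note polys = poly separately_poly_K_A_B_D
  define N where "N x y = K x y * (A x y * (B x y * (D1 x * D2 y)))" for x y
  define f1 where "f1 x y = p1 x y * K x y^2 * D1 x * D2 y + p3 x y * (A x y^2 * D2 y + 3 * B x y^2 * D1 x)" for x y
  define f2 where "f2 x y = p1 x y * K x y^2 * D1 x * D2 y + p3 x y * (3 * A x y^2 * D2 y + B x y^2 * D1 x)" for x y
  have sep: "separately_poly N" "separately_poly f1" "separately_poly f2"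
    unfolding N_def[abs_def] f1_def[abs_def] f2_def[abs_def] by (intro separately_poly_intros polys)+
  note coeffs = cubic_relation_coeffs[OF poly s rel, folded s'_def f1_def f2_def]
  have zero: "N x y * f1 x y = 0" "N x y * f2 x y = 0" "N x y * p2 x y = 0"
    if "norm x < s'" "norm y < s'" for x y
    using coeffs(2-4)[OF _ _ that] by (auto simp: N_def)
  obtain x0 y0 where N: "N x0 y0 \<noteq> 0" unfolding N_def by (rule obtain_generic_point)
  note cancel_N = separately_poly_mult_eq_0[OF sep(1) N _ s']
  have f1: "f1 x y = 0" and f2: "f2 x y = 0" and p2: "p2 x y = 0" for x y
    using cancel_N[OF sep(2) zero(1)] cancel_N[OF sep(3) zero(2)] cancel_N[OF poly(3) zero(3)] by simp_all
  have cancel_power: "f x y = 0" if "separately_poly f" "\<And>x y. norm x < s' \<Longrightarrow> norm y < s' \<Longrightarrow> N x y^n * f x y = 0" for f x y n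
    using separately_poly_mult_eq_0[of "\<lambda>x y. N x y^n" x0 y0 f s' x y] separately_poly_power[OF sep(1)] N s' that
    by simp
  have p0: "p0 x y = 0" for x y
  proof (rule cancel_power[of p0 3])
    fix x y :: complex assume "norm x < s'" "norm y < s'"
    from coeffs(1)[OF _ _ this] have "p0 x y * K x y^3 * D1 x * D2 y = 0" by (simp add: p2)
    thus "N x y^3 * p0 x y = 0" by (auto simp: N_def)
  qed (rule poly)
  have difference: "(A x y^2 * D2 y - B x y^2 * D1 x) * p3 x y = 0" for x y
  proof -
    have "2 * ((A x y^2 * D2 y - B x y^2 * D1 x) * p3 x y) = f2 x y - f1 x y"
      by (simp add: f1_def f2_def algebra_simps)
    thus ?thesis by (simp add: f1 f2)
  qed
  have "separately_poly (\<lambda>x y. A x y^2 * D2 y - B x y^2 * D1 x)"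
    by (intro separately_poly_intros polys)
  moreover have "A 1 0^2 * D2 0 - B 1 0^2 * D1 1 \<noteq> 0"
    using nz by (simp add: A_def B_def D2_def)
  ultimately have p3: "p3 x y = 0" for x y
    using separately_poly_mult_eq_0[of "\<lambda>x y. A x y^2 * D2 y - B x y^2 * D1 x" 1 0 p3 1 x y] poly(4) difference
    by simp
  have p1: "p1 x y = 0" for x y
  proof (rule cancel_power[of p1 2])
    fix x y :: complex
    have "p1 x y * K x y^2 * D1 x * D2 y = 0" using f1[of x y] by (simp add: f1_def p3)
    thus "N x y^2 * p1 x y = 0" by (auto simp: N_def)
  qed (rule poly)
  show ?thesis by (simp add: p0 p1 p2 p3)
qed

lemma degree_ge_4:
  assumes "alg_annihilates F P"
  shows "4 \<le> deg_in 2 P"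
proof (rule ccontr)
  assume "\<not> 4 \<le> deg_in 2 P"
  hence deg: "\<And>m. m \<in> keys P \<Longrightarrow> lookup m 2 \<le> 3" using deg_in_le_iff[of 2 P 3] by simp
  from assms obtain s where "P \<noteq> 0" "vars_in {0, 1, 2} P" and s: "s > 0"
    and ann: "\<And>x y. norm x < s \<Longrightarrow> norm y < s \<Longrightarrow> mpeval P (\<lambda>i. if i = 0 then x else if i = 1 then y else F x y) = 0"
    unfolding alg_annihilates_def by auto
  hence P: "\<And>m. m \<in> keys P \<Longrightarrow> keys m \<subseteq> {0, 1, 2}" by (simp add: vars_in_def)
  have sep: "separately_poly (z_coeff P k)" for k
    unfolding z_coeff_def[abs_def] by (intro separately_poly_intros)
  have "z_coeff P 0 x y = 0 \<and> z_coeff P 1 x y = 0 \<and> z_coeff P 2 x y = 0 \<and> z_coeff P 3 x y = 0" for x y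
    using ann by (intro cubic_relation_trivial[OF sep sep sep sep s]) (simp add: mpeval_cubic[OF P deg])
  moreover have "k \<in> {0, 1, 2, 3}" if "k \<le> 3" for k :: nat using that by auto
  ultimately have "z_coeff P k x y = 0" if "k \<le> 3" for k x y using that by blast
  hence "lookup P n = 0" if "n \<in> keys P" for n
    using z_coeff_eq_0_imp_lookup_eq_0[OF P that] deg[OF that] by blast
  moreover obtain n where "n \<in> keys P" using \<open>P \<noteq> 0\<close> by (metis all_not_in_conv keys_eq_empty)
  ultimately show False by (simp add: in_keys_iff)
qed

lemma quartic_relation:
  assumes "norm x < r" "norm y < r"
  shows "(D1 x * D2 y * K x y^2 * (F x y * F x y) - (A x y^2 * D2 y + B x y^2 * D1 x))^2 =
    4 * A x y^2 * B x y^2 * D1 x * D2 y"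
proof -
  note D = D_squares(1)[OF assms(1)] D_squares(2)[OF assms(2)]
  have "D1 x * D2 y * K x y^2 * (F x y * F x y) = D1 x * D2 y * (K x y * F x y)^2"
    by (simp add: power2_eq_square mult_ac)
  also have "... = A x y^2 * D2 y * (D1 x * \<phi> x^2) + B x y^2 * D1 x * (D2 y * \<psi> y^2) +
      2 * A x y * B x y * D1 x * D2 y * (\<phi> x * \<psi> y)"
    unfolding K_F[OF assms] by (simp add: power2_eq_square algebra_simps)
  finally have "(D1 x * D2 y * K x y^2 * (F x y * F x y) - (A x y^2 * D2 y + B x y^2 * D1 x))^2 =
      (2 * A x y * B x y * D1 x * D2 y * (\<phi> x * \<psi> y))^2"
    unfolding D by simp
  also have "... = 4 * A x y^2 * B x y^2 * D1 x * D2 y * ((D1 x * \<phi> x^2) * (D2 y * \<psi> y^2))"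
    by (simp add: power2_eq_square mult_ac)
  finally show ?thesis unfolding D by simp
qed

lemma ex_quartic_annihilator:
  obtains P where "alg_annihilates F P" "deg_in 2 P \<le> 4"
proof -
  define g where "g v = D1 (v 0) * D2 (v 1) * K (v 0) (v 1)^2 * (v 2 * v 2) -
      (A (v 0) (v 1)^2 * D2 (v 1) + B (v 0) (v 1)^2 * D1 (v 0))" for v :: "nat \<Rightarrow> complex"
  define f where "f v = g v * g v - 4 * A (v 0) (v 1)^2 * B (v 0) (v 1)^2 * D1 (v 0) * D2 (v 1)" for v :: "nat \<Rightarrow> complex"
  have v: "poly_fun {0, 1, 2} n (\<lambda>v. v 0)" "poly_fun {0, 1, 2} n (\<lambda>v. v 1)" "poly_fun {0, 1, 2} 1 (\<lambda>v. v 2)" for n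
    by (intro poly_fun_var; simp)+
  have coeffs: "poly_fun {0, 1, 2} 0 (\<lambda>v. K (v 0) (v 1))" "poly_fun {0, 1, 2} 0 (\<lambda>v. A (v 0) (v 1))"
    "poly_fun {0, 1, 2} 0 (\<lambda>v. B (v 0) (v 1))" "poly_fun {0, 1, 2} 0 (\<lambda>v. D1 (v 0))" "poly_fun {0, 1, 2} 0 (\<lambda>v. D2 (v 1))"
    unfolding K_def A_def B_def D1_def D2_def divide_inverse by (intro poly_fun_intros v)+
  have raise: "poly_fun {0, 1, 2} n f" if "poly_fun {0, 1, 2} 0 f" for n f
    using poly_fun_mult0[OF that poly_fun_const[of _ n 1]] by simp
  have "poly_fun {0, 1, 2} 2 (\<lambda>v. v 2 * v 2)" by (rule poly_fun_mult[OF v(3) v(3)]) simp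
  hence "poly_fun {0, 1, 2} 2 (\<lambda>v. D1 (v 0) * D2 (v 1) * K (v 0) (v 1)^2 * (v 2 * v 2))"
    by (rule poly_fun_mult0[rotated]) (intro poly_fun_intros coeffs)
  moreover have "poly_fun {0, 1, 2} 2 (\<lambda>v. A (v 0) (v 1)^2 * D2 (v 1) + B (v 0) (v 1)^2 * D1 (v 0))"
    by (rule raise) (intro poly_fun_intros coeffs)
  ultimately have "poly_fun {0, 1, 2} 2 g" unfolding g_def by (rule poly_fun_diff)
  hence "poly_fun {0, 1, 2} 4 (\<lambda>v. g v * g v)" using poly_fun_mult by fastforce
  moreover have "poly_fun {0, 1, 2} 4 (\<lambda>v. 4 * A (v 0) (v 1)^2 * B (v 0) (v 1)^2 * D1 (v 0) * D2 (v 1))"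
    by (rule raise) (intro poly_fun_intros coeffs)
  ultimately have "poly_fun {0, 1, 2} 4 f" unfolding f_def by (rule poly_fun_diff)
  then obtain P where P: "vars_in {0, 1, 2} P" "deg_in 2 P \<le> 4" "\<And>v. mpeval P v = f v"
    unfolding poly_fun_def by blast
  have "mpeval P (\<lambda>i. if i = 1 then 1 else 0) \<noteq> 0"
    unfolding P(3) f_def g_def using nz by (simp add: A_def B_def K_def D1_def)
  hence "P \<noteq> 0" by auto
  moreover have "mpeval P (\<lambda>i. if i = 0 then x else if i = 1 then y else F x y) = 0"
    if "norm x < r" "norm y < r" for x y
    unfolding P(3) f_def g_def using quartic_relation[OF that] by (simp add: power2_eq_square)
  ultimately have "alg_annihilates F P" unfolding alg_annihilates_def using P(1) r by blast
  thus ?thesis using that P(2) by blast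
qed

theorem algebraic_degree_4: "algebraic_deg2 F 4"
proof -
  obtain P where P: "alg_annihilates F P" "deg_in 2 P \<le> 4" by (rule ex_quartic_annihilator)
  hence "deg_in 2 P = 4" using degree_ge_4 by (simp add: order_antisym)
  thus ?thesis unfolding algebraic_deg2_def using P(1) degree_ge_4 by blast
qed

end

section \<open>The three regimes\<close>

lemma reciprocal_csqrt:
  assumes cont: "isCont f 0" "f 0 = 1" and sq: "\<forall>\<^sub>F x in nhds 0. f x^2 * (1 - p * x^2) = 1"
  shows "\<forall>\<^sub>F x in nhds 0. f x = 1 / csqrt (1 - x^2 * p)"
proof -
  have "isCont (\<lambda>x. csqrt (1 - x^2 * p)) 0"
    by (rule isCont_o2[where f = "\<lambda>x. 1 - x^2 * p"])
       (auto intro!: continuous_intros continuous_at_csqrt simp: complex_nonpos_Reals_iff)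
  hence "isCont (\<lambda>x. f x * csqrt (1 - x^2 * p) + 1) 0" by (intro continuous_intros cont(1))
  hence "\<forall>\<^sub>F x in nhds 0. f x * csqrt (1 - x^2 * p) + 1 \<noteq> 0"
    by (rule eventually_nonzero) (simp add: cont(2))
  with sq show ?thesis
  proof eventually_elim
    case (elim x)
    have "(f x * csqrt (1 - x^2 * p))^2 = 1" using elim(1) by (simp add: power_mult_distrib mult.commute)
    hence "f x * csqrt (1 - x^2 * p) = 1" using elim(2) by (auto simp: power2_eq_1_iff)
    thus ?case by (metis div_by_1 divide_divide_eq_right mult_zero_right nonzero_mult_div_cancel_right one_neq_zero)
  qed
qed

context kernel_curve
begin

lemma Q_isCont: "isCont (\<lambda>x. Q x 0) 0" "isCont (\<lambda>y. Q 0 y) 0"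
  using holomorphic_on_imp_continuous_on[OF Q_holomorphic_x[of 0]]
    holomorphic_on_imp_continuous_on[OF Q_holomorphic_y[of 0]]
  by (auto simp: continuous_on_eq_continuous_at)

lemma Q_product_formula:
  assumes ab: "a + b = a * b" and d11: "d (1, 1) = 0"
    and p: "p = a * (t * d (1, 0) + t * d (1, -1) * p')" "p' = b * (t * d (0, 1) + t * d (-1, 1) * p)"
    and xy: "norm x \<le> 1" "norm y \<le> 1" and Q: "Q x 0 * (1 - cr p * x) = 1" "Q 0 y * (1 - cr p' * y) = 1"
  shows "Q x y * (kernel cr x y * ((1 - cr p * x) * (1 - cr p' * y))) = kernel cr x y"
proof -
  have "1 / a + 1 / b - 1 = 0" using ab ab_pos by (simp add: field_simps)
  hence "cr (1 / a + 1 / b - 1) = 0" by (simp only: of_real_0)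
  hence "kernel cr x y * Q x y = x_coeff cr x y * Q x 0 + y_coeff cr x y * Q 0 y"
    using functional_equation[OF xy] by (simp only: mult_zero_left add_0_left)
  hence "Q x y * (kernel cr x y * ((1 - cr p * x) * (1 - cr p' * y))) =
      (x_coeff cr x y * Q x 0 + y_coeff cr x y * Q 0 y) * ((1 - cr p * x) * (1 - cr p' * y))"
    by (simp add: mult_ac)
  also have "... = x_coeff cr x y * (1 - cr p' * y) * (Q x 0 * (1 - cr p * x)) +
      y_coeff cr x y * (1 - cr p * x) * (Q 0 y * (1 - cr p' * y))" by (simp add: algebra_simps)
  also have "... = kernel cr x y"
    unfolding Q mult_1_right by (rule kernel_splits[OF complex_embedding.real_embedding_axioms ab d11 p])
  finally show ?thesis .
qed

theorem rational_case:
  assumes ab: "a + b = a * b" and d11: "d (1, 1) = 0" and N: "a * b * d (1, -1) * d (-1, 1) * t^2 \<noteq> 1"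
  defines "p \<equiv> (a * d (1, 0) * t + a * b * d (1, -1) * d (0, 1) * t^2) / (1 - a * b * d (1, -1) * d (-1, 1) * t^2)"
    and "p' \<equiv> (b * d (0, 1) * t + a * b * d (-1, 1) * d (1, 0) * t^2) / (1 - a * b * d (1, -1) * d (-1, 1) * t^2)"
  shows "is_rational2 Q \<and> (\<exists>r>0. \<forall>x y. norm x < r \<and> norm y < r \<longrightarrow>
    Q x 0 = 1 / (1 - x * cr p) \<and> Q 0 y = 1 / (1 - y * cr p'))"
proof -
  have p: "p = a * (t * d (1, 0) + t * d (1, -1) * p')" "p' = b * (t * d (0, 1) + t * d (-1, 1) * p)"
    using N by (simp_all add: p_def p'_def field_simps power2_eq_square)
  obtain r1 r2 where r1: "r1 > 0" "\<And>x. norm x < r1 \<Longrightarrow> Q x 0 * (1 - cr p * x) = 1"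
    and r2: "r2 > 0" "\<And>y. norm y < r2 \<Longrightarrow> Q 0 y * (1 - cr p' * y) = 1"
    using rational_closed_form[OF ab d11 p] unfolding eventually_nhds_metric by (auto simp: dist_norm)
  define r where "r = min 1 (min r1 r2)"
  have r: "r > 0" "r \<le> 1" using r1 r2 by (simp_all add: r_def)
  have Qx: "Q x 0 * (1 - cr p * x) = 1" and Qy: "Q 0 x * (1 - cr p' * x) = 1" if "norm x < r" for x
    using r1(2) r2(2) that by (simp_all add: r_def)
  have product: "Q x y * (kernel cr x y * ((1 - cr p * x) * (1 - cr p' * y))) = kernel cr x y"
    if "norm x < r" "norm y < r" for x y
    using that r by (intro Q_product_formula[OF ab d11 p] Qx Qy) auto
  have v: "poly_fun {0, 1} 0 (\<lambda>v. v 0)" "poly_fun {0, 1} 0 (\<lambda>v. v 1)" by (intro poly_fun_var; simp)+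
  have "poly_fun {0, 1} 0 (\<lambda>v. kernel cr (v 0) (v 1))"
    "poly_fun {0, 1} 0 (\<lambda>v. kernel cr (v 0) (v 1) * ((1 - cr p * v 0) * (1 - cr p' * v 1)))"
    unfolding kernel_def by (intro poly_fun_intros v)+
  then obtain P R where P: "vars_in {0, 1} P" "\<And>v. mpeval P v = kernel cr (v 0) (v 1)"
    and R: "vars_in {0, 1} R" "\<And>v. mpeval R v = kernel cr (v 0) (v 1) * ((1 - cr p * v 0) * (1 - cr p' * v 1))"
    unfolding poly_fun_def by blast
  have "R \<noteq> 0"
  proof
    assume "R = 0"
    hence "kernel cr 0 (cr (r / 2)) * (1 - cr p' * cr (r / 2)) = 0"
      using R(2)[of "\<lambda>i. if i = 1 then cr (r / 2) else 0"] by simp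
    moreover have "kernel cr 0 (cr (r / 2)) \<noteq> 0" using d_pos t_pos r by (simp add: kernel_def)
    moreover have "1 - cr p' * cr (r / 2) \<noteq> 0" using Qy[of "cr (r / 2)"] r by auto
    ultimately show False by simp
  qed
  hence "is_rational2 Q"
    unfolding is_rational2_def using P R r product
    by (intro exI[of _ P] exI[of _ R] conjI exI[of _ r]) auto
  moreover have "q = 1 / (1 - x * z)" if "q * (1 - z * x) = 1" for q x z :: complex
    using that by (metis mult.commute mult_zero_right nonzero_eq_divide_eq zero_neq_one)
  ultimately show ?thesis using r(1) Qx Qy by blast
qed

theorem algebraic_case:
  assumes ab: "a = 2" "b = 2" and d0: "d (1, 0) = 0" "d (0, 1) = 0"
  defines "p \<equiv> 4 * d (1, 1) * d (1, -1) * t^2 / (1 - 4 * d (1, -1) * d (-1, 1) * t^2)"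
    and "p' \<equiv> 4 * d (1, 1) * d (-1, 1) * t^2 / (1 - 4 * d (1, -1) * d (-1, 1) * t^2)"
  shows "algebraic_deg2 Q 4 \<and> (\<exists>r>0. \<forall>x y. norm x < r \<and> norm y < r \<longrightarrow>
    Q x 0 = 1 / csqrt (1 - x^2 * cr p) \<and> Q 0 y = 1 / csqrt (1 - y^2 * cr p'))"
proof -
  define D where "D = 1 - 4 * d (1, -1) * d (-1, 1) * t^2"
  have "\<tau>^2 = t^2 * (\<alpha>^2 * \<beta>^2)" unfolding \<alpha>_\<beta>(5)[symmetric] by (simp add: power_mult_distrib)
  hence "D = \<Delta>" by (simp add: D_def \<Delta>_def \<alpha>_\<beta>(3,4))
  hence "D \<noteq> 0" using \<Delta>_pos by simp
  hence p: "D * p = 4 * d (1, 1) * d (1, -1) * t^2" "D * p' = 4 * d (1, 1) * d (-1, 1) * t^2"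
    by (simp_all add: p_def p'_def D_def)
  have "d (1, 1) \<noteq> 0" using d_nz d0 by auto
  hence "p \<noteq> 0" "p' \<noteq> 0" using p d_pos t_pos by auto
  note closed = algebraic_closed_form[OF ab d0 p D_def]
  obtain r1 r2 where r1: "r1 > 0" "\<And>x. norm x < r1 \<Longrightarrow> Q x 0^2 * (1 - cr p * x^2) = 1"
    and r2: "r2 > 0" "\<And>y. norm y < r2 \<Longrightarrow> Q 0 y^2 * (1 - cr p' * y^2) = 1"
    using closed unfolding eventually_nhds_metric by (auto simp: dist_norm)
  interpret quartic: biquadratic "cr (t * d (1, -1))" "cr (t * d (-1, 1))" "cr (t * d (1, 1))" "cr p" "cr p'"
      Q "\<lambda>x. Q x 0" "\<lambda>y. Q 0 y" "min 1 (min r1 r2)"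
  proof
    fix x y :: complex assume xy: "norm x < min 1 (min r1 r2)" "norm y < min 1 (min r1 r2)"
    have "1 / a + 1 / b - 1 = 0" "1 - 1 / a = 1 / 2" "1 - 1 / b = 1 / 2" using ab by simp_all
    hence "cr (1 / a + 1 / b - 1) = 0" "cr (1 - 1 / a) = 1 / 2" "cr (1 - 1 / b) = 1 / 2" by simp_all
    thus "(x * y - (cr (t * d (1, -1)) * x^2 + cr (t * d (-1, 1)) * y^2 + cr (t * d (1, 1)) * x^2 * y^2)) * Q x y =
      (x * y / 2 - cr (t * d (1, -1)) * x^2) * Q x 0 + (x * y / 2 - cr (t * d (-1, 1)) * y^2) * Q 0 y"
      using functional_equation[of x y] xy by (simp add: kernel_def x_coeff_def y_coeff_def d0)
  qed (use d_pos t_pos \<open>p \<noteq> 0\<close> \<open>p' \<noteq> 0\<close> r1 r2 in auto)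
  have "algebraic_deg2 Q 4" by (rule quartic.algebraic_degree_4)
  moreover obtain e1 e2 where "e1 > 0" "\<And>x. norm x < e1 \<Longrightarrow> Q x 0 = 1 / csqrt (1 - x^2 * cr p)"
    and "e2 > 0" "\<And>y. norm y < e2 \<Longrightarrow> Q 0 y = 1 / csqrt (1 - y^2 * cr p')"
    using reciprocal_csqrt[OF Q_isCont(1) Q_0_0 closed(1)] reciprocal_csqrt[OF Q_isCont(2) Q_0_0 closed(2)]
    unfolding eventually_nhds_metric by (auto simp: dist_norm)
  ultimately show ?thesis by (intro conjI exI[of _ "min e1 e2"]) auto
qed

end

lemma eventually_rational:
  assumes d: "\<And>v. 0 \<le> d v" "a > 0" "b > 0" "d (1, -1) > 0" "d (-1, 1) > 0" "d (0, 1) > 0"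
    and case1: "d (1, 1) = 0" "a + b = a * b"
  shows "\<forall>\<^sub>F t in at_right 0. is_rational2 (Qgf S5 d a b t) \<and>
    (\<exists>r>0. \<forall>x y. norm x < r \<and> norm y < r \<longrightarrow>
      Qgf S5 d a b t x 0 = 1 / (1 - x * cr ((a * d (1,0) * t + a * b * d (1,-1) * d (0,1) * t^2) /
        (1 - a * b * d (1,-1) * d (-1,1) * t^2))) \<and>
      Qgf S5 d a b t 0 y = 1 / (1 - y * cr ((b * d (0,1) * t + a * b * d (-1,1) * d (1,0) * t^2) /
        (1 - a * b * d (1,-1) * d (-1,1) * t^2))))"
proof -
  have "((\<lambda>t. a * b * d (1, -1) * d (-1, 1) * t^2) \<longlongrightarrow> 0) (at_right 0)"
    by (auto intro!: tendsto_eq_intros)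
  hence "\<forall>\<^sub>F t in at_right 0. a * b * d (1, -1) * d (-1, 1) * t^2 \<noteq> 1"
    by (rule tendsto_imp_eventually_ne) simp
  moreover have "\<forall>\<^sub>F t in at_right 0. \<exists>h. True \<and> kernel_curve d a b t h"
    by (intro eventually_ex_kernel_curve d) (use d(6) in auto)
  ultimately show ?thesis
    by eventually_elim (use kernel_curve.rational_case case1 in blast)
qed

lemma eventually_algebraic:
  assumes d: "\<And>v. 0 \<le> d v" "d (1, -1) > 0" "d (-1, 1) > 0" "d (1, 1) > 0"
    and case2: "a = 2" "b = 2" "d (1, 0) = 0" "d (0, 1) = 0"
  shows "\<forall>\<^sub>F t in at_right 0. algebraic_deg2 (Qgf S5 d a b t) 4 \<and>
    (\<exists>r>0. \<forall>x y. norm x < r \<and> norm y < r \<longrightarrow>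
      Qgf S5 d a b t x 0 = 1 / csqrt (1 - x^2 * cr ((4 * d (1,1) * d (1,-1) * t^2) /
        (1 - 4 * d (1,-1) * d (-1,1) * t^2))) \<and>
      Qgf S5 d a b t 0 y = 1 / csqrt (1 - y^2 * cr ((4 * d (1,1) * d (-1,1) * t^2) /
        (1 - 4 * d (1,-1) * d (-1,1) * t^2))))"
proof -
  have "\<forall>\<^sub>F t in at_right 0. \<exists>h. True \<and> kernel_curve d a b t h"
    by (intro eventually_ex_kernel_curve d) (use d(4) case2 in auto)
  thus ?thesis by eventually_elim (use kernel_curve.algebraic_case case2 in blast)
qed

lemma step_set_cases:
  assumes "S \<in> {S1, S2, S3, S4, S5}"
  shows "S \<subseteq> S5" "(1, -1) \<in> S" "(-1, 1) \<in> S" "(1, 1) \<in> S \<longleftrightarrow> S \<notin> {S1, S2}" "(0, 1) \<in> S \<longleftrightarrow> S \<noteq> S3"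
    "S = S3 \<Longrightarrow> (1, 0) \<notin> S"
proof -
  have "(1, 1) \<notin> S1" "(1, 1) \<notin> S2" "(1, 1) \<in> S3" "(1, 1) \<in> S4" "(1, 1) \<in> S5"
    by (simp_all add: S1_def S2_def S3_def S4_def S5_def)
  thus "(1, 1) \<in> S \<longleftrightarrow> S \<notin> {S1, S2}" using assms by blast
  have "(0, 1) \<in> S1" "(0, 1) \<in> S2" "(0, 1) \<notin> S3" "(0, 1) \<in> S4" "(0, 1) \<in> S5"
    by (simp_all add: S1_def S2_def S3_def S4_def S5_def)
  thus "(0, 1) \<in> S \<longleftrightarrow> S \<noteq> S3" using assms by blast
qed (use assms in \<open>auto simp: S1_def S2_def S3_def S4_def S5_def\<close>)

lemma eventually_at_right_0_cases:
  assumes "C1 \<Longrightarrow> \<forall>\<^sub>F t in at_right (0::real). P1 t" "C2 \<Longrightarrow> \<forall>\<^sub>F t in at_right 0. P2 t"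
    "C3 \<Longrightarrow> \<forall>\<^sub>F t in at_right 0. P3 t"
  shows "\<exists>\<epsilon>>0. \<forall>t. 0 < t \<and> t < \<epsilon> \<and> R t \<longrightarrow> (C1 \<longrightarrow> P1 t) \<and> (C2 \<longrightarrow> P2 t) \<and> (C3 \<longrightarrow> P3 t)"
proof -
  have "\<forall>\<^sub>F t in at_right 0. (C1 \<longrightarrow> P1 t) \<and> (C2 \<longrightarrow> P2 t) \<and> (C3 \<longrightarrow> P3 t)"
    using assms by (intro eventually_conj) auto
  thus ?thesis unfolding eventually_at_right[OF zero_less_one] by blast
qed

theorem theorem5p8:
  fixes S :: "(int \<times> int) set" and d :: "int \<times> int \<Rightarrow> real" and a b :: real
  assumes "S \<in> {S1, S2, S3, S4, S5}"
    and "\<forall>v\<in>S. d v > 0"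
    and "\<forall>v. v \<notin> S \<longrightarrow> d v = 0"
    and "a > 0" and "b > 0"
  shows "\<exists>\<epsilon>>0. \<forall>t. 0 < t \<and> t < \<epsilon> \<and>
      transcendental_over [d (1,-1), d (-1,1), d (1,0), d (0,1), d (1,1), a, b] t \<longrightarrow>
    ((S \<in> {S1, S2} \<and> a + b = a * b) \<longrightarrow>
        is_rational2 (Qgf S d a b t) \<and>
        (\<exists>r>0. \<forall>x y. norm x < r \<and> norm y < r \<longrightarrow>
           Qgf S d a b t x 0 = 1 / (1 - x * complex_of_real
              ((a * d (1,0) * t + a * b * d (1,-1) * d (0,1) * t^2) /
               (1 - a * b * d (1,-1) * d (-1,1) * t^2))) \<and>
           Qgf S d a b t 0 y = 1 / (1 - y * complex_of_real
              ((b * d (0,1) * t + a * b * d (-1,1) * d (1,0) * t^2) /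
               (1 - a * b * d (1,-1) * d (-1,1) * t^2))))) \<and>
    ((S = S3 \<and> a = 2 \<and> b = 2) \<longrightarrow>
        algebraic_deg2 (Qgf S d a b t) 4 \<and>
        (\<exists>r>0. \<forall>x y. norm x < r \<and> norm y < r \<longrightarrow>
           Qgf S d a b t x 0 = 1 / csqrt (1 - x^2 * complex_of_real
              ((4 * d (1,1) * d (1,-1) * t^2) / (1 - 4 * d (1,-1) * d (-1,1) * t^2))) \<and>
           Qgf S d a b t 0 y = 1 / csqrt (1 - y^2 * complex_of_real
              ((4 * d (1,1) * d (-1,1) * t^2) / (1 - 4 * d (1,-1) * d (-1,1) * t^2))))) \<and>
    ((\<not> (S \<in> {S1, S2} \<and> a + b = a * b) \<and> \<not> (S = S3 \<and> a = 2 \<and> b = 2)) \<longrightarrow>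
        \<not> x_D_algebraic (Qgf S d a b t) \<and> \<not> y_D_algebraic (Qgf S d a b t))"
proof -
  note S = step_set_cases[OF assms(1)]
  have d: "0 \<le> d v" for v using assms(2,3) by (metis less_le order_refl)
  have pos: "d (1, -1) > 0" "d (-1, 1) > 0" using assms(2) S(2,3) by auto
  have d11: "S \<in> {S1, S2} \<Longrightarrow> d (1, 1) = 0" "S \<notin> {S1, S2} \<Longrightarrow> d (1, 1) > 0" using assms(2,3) S(4) by blast+
  have d01: "S \<noteq> S3 \<Longrightarrow> d (0, 1) > 0" "S = S3 \<Longrightarrow> d (0, 1) = 0" using assms(2,3) S(5) by blast+
  have d10: "S = S3 \<Longrightarrow> d (1, 0) = 0" using assms(3) S(6) by blast
  have disjoint: "S \<in> {S1, S2} \<Longrightarrow> S \<noteq> S3" using S(4) by (auto simp: S3_def)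
  show ?thesis
    unfolding Qgf_S5[OF S(1) assms(3)]
  proof (rule eventually_at_right_0_cases, goal_cases rational algebraic transcendental)
    case rational
    thus ?case using d11(1) d01(1) disjoint by (intro eventually_rational[OF d assms(4,5) pos]) blast+
  next
    case algebraic
    thus ?case using d11(2) d01(2) d10 disjoint by (intro eventually_algebraic[OF d pos]) blast+
  next
    case transcendental
    hence "d (1, 1) > 0 \<and> \<not> (a = 2 \<and> b = 2 \<and> d (1, 0) = 0 \<and> d (0, 1) = 0) \<or>
        d (1, 1) = 0 \<and> d (0, 1) > 0 \<and> a + b \<noteq> a * b"
      using d11 d01(1) disjoint less_irrefl by metis
    thus ?case by (rule small_t_not_D_algebraic[OF d assms(4,5) pos])
  qed
qed

end
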